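(* Let $u(\cdot)$ be a given admissible control policy for the SDE $$d\mathbf{x}=f(\mathbf{x}(t),t)\,dt+g(\mathbf{x}(t),t)\,u(\mathbf{x}(t),t)\,dt+\sigma(\mathbf{x}(t),t)\,d\mathbf{w},\qquad \mathbf{x}(t_0)=x_0,$$ and let $\mathcal{X}_s,\mathcal{Q},\partial\mathcal{Q},\overline{\mathcal{Q}}$, the exit time $\mathbf{t}_f$ and the function $\widetilde\phi$ be as defined in the context. Let $$P_{fail}=P\left(\bigvee_{t\in[t_0,T]}\mathbf{x}(t)\notin\mathcal{X}_s\right)=\mathbb{E}_{x_0,t_0}\left[\mathbf{1}_{\mathbf{x}(\mathbf{t}_f)\in\partial\mathcal{X}_s}\right]$$ be the probability of failure of this system under the policy $u(\cdot)$. Suppose there exists a continuous function $J:\overline{\mathcal{Q}}\to\mathbb{R}$ that is continuously differentiable in $t$ and twice continuously differentiable in $x$ in the domain $\mathcal{Q}$, and that solves the PDE $$\begin{cases}-\partial_tJ=(f+gu)^T\partial_xJ+\tfrac12\mathrm{Tr}\left(\sigma\sigma^T\partial_x^2J\right), & (x,t)\in\mathcal{Q},\\ J(x,t)=\widetilde\phi(x), & (x,t)\in\partial\mathcal{Q}.\end{cases}$$ Then $$P_{fail}=J(x_0,t_0).$$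
   Context: Setting. Fix times $t_0<T$. The state is $\mathbf{x}(t)\in\mathbb{R}^n$, $u(\mathbf{x}(t),t)\in\mathbb{R}^m$ is the control input, $\mathbf{w}$ is a $k$-dimensional standard Wiener process on a probability space $(\Omega,\mathcal{F},P)$, and $f(x,t)\in\mathbb{R}^n$, $g(x,t)\in\mathbb{R}^{n\times m}$, $\sigma(x,t)\in\mathbb{R}^{n\times k}$. The initial state $\mathbf{x}(t_0)=x_0$ is fixed, with $(x_0,t_0)\in\overline{\mathcal{Q}}$. Standing assumption: the coefficients of the SDE are sufficiently regular that the SDE has a unique strong solution. A policy $u(\cdot)$ is admissible if it is measurable with respect to the $\sigma$-algebra adapted to $\mathbf{x}(t)$. Domains. $\mathcal{X}_s\subseteq\mathbb{R}^n$ is a bounded open set (the safe region), $\partial\mathcal{X}_s$ its boundary, $\overline{\mathcal{X}_s}=\mathcal{X}_s\cup\partial\mathcal{X}_s$. Set $\mathcal{Q}=\mathcal{X}_s\times[t_0,T)$, $\partial\mathcal{Q}=(\partial\mathcal{X}_s\times[t_0,T])\cup(\mathcal{X}_s\times\{T\})$, and $\overline{\mathcal{Q}}=\mathcal{Q}\cup\partial\mathcal{Q}=\overline{\mathcal{X}_s}\times[t_0,T]$. Exit time. $\mathbf{t}_f=T$ if $\mathbf{x}(t)\in\mathcal{X}_s$ for all $t\in[t_0,T]$, and $\mathbf{t}_f=\inf\{t\in[t_0,T]:\mathbf{x}(t)\notin\mathcal{X}_s\}$ otherwise. Boundary data. $\widetilde\phi:\overline{\mathcal{X}_s}\to\mathbb{R}$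 is $\widetilde\phi(x)=\mathbf{1}_{x\in\partial\mathcal{X}_s}$. (Convention: when regularity of $\widetilde\phi$ is needed, $\widetilde\phi$ is understood to be approximated with the help of a smooth bump function $B$ on $\mathcal{X}_s$, i.e. $\widetilde\phi(x)\approx 1-B(x)$.) Notation. The symbol $\bigvee_{t\in[t_0,T]}$ is logical OR: the event that $\mathbf{x}(t)\notin\mathcal{X}_s$ for some $t\in[t_0,T]$. $\mathbb{E}_{x_0,t_0}[\cdot]$ is expectation over trajectories of the SDE started at state $x_0$ at time $t_0$ under $P$. $\partial_x$ is the gradient (column vector), $\partial_x^2$ the Hessian matrix, $\mathrm{Tr}$ the trace. In the PDE the arguments $(x,t)$ of $f,g,u,\sigma,J$ are suppressed.
   Formalization: No continuous J attains the indicator data (1 and 0 clash at ∂X_s×{T}), so the literal claim is kept but vacuous; the content is stated for data 1−B_j with smooth bump functions B_j→1 pointwise on X_s: the solutions satisfy J_j(x_0,t_0)→P_fail. *)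

theory Defs
  imports "HOL-Probability.Probability"
begin

definition natural_filtration ::
  "'a measure \<Rightarrow> real \<Rightarrow> (real \<Rightarrow> 'a \<Rightarrow> 'b::topological_space) \<Rightarrow> real \<Rightarrow> 'a measure" where
  "natural_filtration M t0 X t =
     sigma (space M) {X s -` A \<inter> space M | s A. s \<in> {t0..t} \<and> A \<in> sets borel}"

definition augmented_filtration ::
  "'a measure \<Rightarrow> real \<Rightarrow> (real \<Rightarrow> 'a \<Rightarrow> 'b::topological_space) \<Rightarrow> real \<Rightarrow> 'a measure" where
  "augmented_filtration M t0 X t =
     sigma (space M) (sets (natural_filtration M t0 X t) \<union> null_sets M)"

text \<open>Only the increments of the Wiener process enter the equation, so its clock is started at the
  initial time \<open>t0\<close>.\<close>

definition standard_wiener ::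
  "'a measure \<Rightarrow> real \<Rightarrow> real \<Rightarrow> (real \<Rightarrow> 'a \<Rightarrow> real ^ 'k) \<Rightarrow> bool" where
  "standard_wiener M t0 T w \<longleftrightarrow>
     (\<forall>t\<in>{t0..T}. w t \<in> borel_measurable M) \<and>
     (AE \<omega> in M. w t0 \<omega> = 0) \<and>
     (AE \<omega> in M. continuous_on {t0..T} (\<lambda>t. w t \<omega>)) \<and>
     (\<forall>s t. t0 \<le> s \<and> s < t \<and> t \<le> T \<longrightarrow>
        prob_space.indep_set M
          (sets (natural_filtration M t0 w s))
          (sets (vimage_algebra (space M) (\<lambda>\<omega>. w t \<omega> - w s \<omega>) borel)) \<and>
        prob_space.indep_vars M (\<lambda>_. borel) (\<lambda>i \<omega>. w t \<omega> $ i - w s \<omega> $ i) (UNIV :: 'k set) \<and>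
        (\<forall>i. distributed M lborel (\<lambda>\<omega>. w t \<omega> $ i - w s \<omega> $ i)
               (normal_density 0 (sqrt (t - s)))))"

definition progressively_measurable ::
  "(real \<Rightarrow> 'a measure) \<Rightarrow> real \<Rightarrow> real \<Rightarrow> (real \<Rightarrow> 'a \<Rightarrow> 'b::topological_space) \<Rightarrow> bool" where
  "progressively_measurable F t0 T H \<longleftrightarrow>
     (\<forall>t\<in>{t0..T}. (\<lambda>(s, \<omega>). H s \<omega>)
        \<in> borel_measurable (restrict_space borel {t0..t} \<Otimes>\<^sub>M F t))"

definition simple_process ::
  "(real \<Rightarrow> 'a measure) \<Rightarrow> real \<Rightarrow> real \<Rightarrow> nat \<Rightarrow> (nat \<Rightarrow> real) \<Rightarrow>
   (nat \<Rightarrow> 'a \<Rightarrow> real ^ 'k ^ 'n) \<Rightarrow> bool" where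
  "simple_process F t0 T N p \<xi> \<longleftrightarrow>
     p 0 = t0 \<and> p N = T \<and>
     (\<forall>i<N. p i < p (Suc i) \<and> \<xi> i \<in> borel_measurable (F (p i)) \<and>
            (\<exists>C. \<forall>\<omega>\<in>space (F (p i)). norm (\<xi> i \<omega>) \<le> C))"

definition simple_value ::
  "nat \<Rightarrow> (nat \<Rightarrow> real) \<Rightarrow> (nat \<Rightarrow> 'a \<Rightarrow> real ^ 'k ^ 'n) \<Rightarrow> real \<Rightarrow> 'a \<Rightarrow> real ^ 'k ^ 'n" where
  "simple_value N p \<xi> t \<omega> = (\<Sum>i<N. indicator {p i<..p (Suc i)} t *\<^sub>R \<xi> i \<omega>)"

definition simple_integral ::
  "(real \<Rightarrow> 'a \<Rightarrow> real ^ 'k) \<Rightarrow> nat \<Rightarrow> (nat \<Rightarrow> real) \<Rightarrow> (nat \<Rightarrow> 'a \<Rightarrow> real ^ 'k ^ 'n) \<Rightarrow>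
   real \<Rightarrow> 'a \<Rightarrow> real ^ 'n" where
  "simple_integral w N p \<xi> t \<omega> =
     (\<Sum>i<N. \<xi> i \<omega> *v (w (min t (p (Suc i))) \<omega> - w (min t (p i)) \<omega>))"

definition vanishes_in_probability :: "'a measure \<Rightarrow> (nat \<Rightarrow> 'a \<Rightarrow> ennreal) \<Rightarrow> bool" where
  "vanishes_in_probability M e \<longleftrightarrow>
     (\<forall>\<epsilon>>0. (\<lambda>j. measure M {\<omega> \<in> space M. \<epsilon> < e j \<omega>}) \<longlonglongrightarrow> 0)"

text \<open>The Ito integral of integrands that are only almost surely square integrable in time: limit
  in probability of the integrals of simple processes, with continuous paths. The process \<open>I\<close> is
  determined up to indistinguishability. The norm on matrices is the Frobenius norm.\<close>

definition has_ito_integral ::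
  "'a measure \<Rightarrow> (real \<Rightarrow> 'a measure) \<Rightarrow> (real \<Rightarrow> 'a \<Rightarrow> real ^ 'k) \<Rightarrow> real \<Rightarrow> real \<Rightarrow>
   (real \<Rightarrow> 'a \<Rightarrow> real ^ 'k ^ 'n) \<Rightarrow> (real \<Rightarrow> 'a \<Rightarrow> real ^ 'n) \<Rightarrow> bool" where
  "has_ito_integral M F w t0 T H I \<longleftrightarrow>
     progressively_measurable F t0 T H \<and>
     (AE \<omega> in M. (\<integral>\<^sup>+t\<in>{t0..T}. ennreal ((norm (H t \<omega>))\<^sup>2) \<partial>lborel) < \<infinity>) \<and>
     (\<forall>t\<in>{t0..T}. I t \<in> borel_measurable (F t)) \<and>
     (AE \<omega> in M. continuous_on {t0..T} (\<lambda>t. I t \<omega>)) \<and>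
     (\<exists>N p \<xi>.
        (\<forall>j. simple_process F t0 T (N j) (p j) (\<xi> j)) \<and>
        vanishes_in_probability M (\<lambda>j \<omega>.
          \<integral>\<^sup>+t\<in>{t0..T}. ennreal ((norm (simple_value (N j) (p j) (\<xi> j) t \<omega> - H t \<omega>))\<^sup>2) \<partial>lborel) \<and>
        (\<forall>t\<in>{t0..T}. vanishes_in_probability M (\<lambda>j \<omega>.
          ennreal (norm (simple_integral w (N j) (p j) (\<xi> j) t \<omega> - I t \<omega>)))))"

definition strong_solution ::
  "'a measure \<Rightarrow> (real \<Rightarrow> 'a \<Rightarrow> real ^ 'k) \<Rightarrow> real \<Rightarrow> real \<Rightarrow>
   (real ^ 'n \<Rightarrow> real \<Rightarrow> real ^ 'n) \<Rightarrow> (real ^ 'n \<Rightarrow> real \<Rightarrow> real ^ 'k ^ 'n) \<Rightarrow>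
   real ^ 'n \<Rightarrow> (real \<Rightarrow> 'a \<Rightarrow> real ^ 'n) \<Rightarrow> bool" where
  "strong_solution M w t0 T b \<sigma> x0 x \<longleftrightarrow>
     (let F = augmented_filtration M t0 w in
       (\<forall>t\<in>{t0..T}. x t \<in> borel_measurable (F t)) \<and>
       (\<forall>\<omega>\<in>space M. continuous_on {t0..T} (\<lambda>t. x t \<omega>)) \<and>
       (AE \<omega> in M. x t0 \<omega> = x0) \<and>
       progressively_measurable F t0 T (\<lambda>t \<omega>. b (x t \<omega>) t) \<and>
       (AE \<omega> in M. set_integrable lborel {t0..T} (\<lambda>t. b (x t \<omega>) t)) \<and>
       (\<exists>I. has_ito_integral M F w t0 T (\<lambda>t \<omega>. \<sigma> (x t \<omega>) t) I \<and>
            (AE \<omega> in M. \<forall>t\<in>{t0..T}.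
               x t \<omega> = x0 + (LINT s:{t0..t}|lborel. b (x s \<omega>) s) + I t \<omega>)))"

definition unique_strong_solution ::
  "'a measure \<Rightarrow> (real \<Rightarrow> 'a \<Rightarrow> real ^ 'k) \<Rightarrow> real \<Rightarrow> real \<Rightarrow>
   (real ^ 'n \<Rightarrow> real \<Rightarrow> real ^ 'n) \<Rightarrow> (real ^ 'n \<Rightarrow> real \<Rightarrow> real ^ 'k ^ 'n) \<Rightarrow>
   real ^ 'n \<Rightarrow> (real \<Rightarrow> 'a \<Rightarrow> real ^ 'n) \<Rightarrow> bool" where
  "unique_strong_solution M w t0 T b \<sigma> x0 x \<longleftrightarrow>
     strong_solution M w t0 T b \<sigma> x0 x \<and>
     (\<forall>y. strong_solution M w t0 T b \<sigma> x0 y \<longrightarrow> (AE \<omega> in M. \<forall>t\<in>{t0..T}. y t \<omega> = x t \<omega>))"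

definition closed_loop_drift ::
  "(real ^ 'n \<Rightarrow> real \<Rightarrow> real ^ 'n) \<Rightarrow> (real ^ 'n \<Rightarrow> real \<Rightarrow> real ^ 'm ^ 'n) \<Rightarrow>
   (real ^ 'n \<Rightarrow> real \<Rightarrow> real ^ 'm) \<Rightarrow> real ^ 'n \<Rightarrow> real \<Rightarrow> real ^ 'n" where
  "closed_loop_drift f g u x t = f x t + g x t *v u x t"

definition admissible ::
  "'a measure \<Rightarrow> real \<Rightarrow> real \<Rightarrow> (real \<Rightarrow> 'a \<Rightarrow> real ^ 'n) \<Rightarrow>
   (real ^ 'n \<Rightarrow> real \<Rightarrow> real ^ 'm) \<Rightarrow> bool" where
  "admissible M t0 T x u \<longleftrightarrow>
     (\<forall>t\<in>{t0..T}. (\<lambda>\<omega>. u (x t \<omega>) t) \<in> borel_measurable (natural_filtration M t0 x t))"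

definition cylinder :: "(real ^ 'n) set \<Rightarrow> real \<Rightarrow> real \<Rightarrow> ((real ^ 'n) \<times> real) set" where
  "cylinder Xs t0 T = Xs \<times> {t0..<T}"

definition cylinder_boundary :: "(real ^ 'n) set \<Rightarrow> real \<Rightarrow> real \<Rightarrow> ((real ^ 'n) \<times> real) set" where
  "cylinder_boundary Xs t0 T = frontier Xs \<times> {t0..<T} \<union> Xs \<times> {T}"

definition closed_cylinder :: "(real ^ 'n) set \<Rightarrow> real \<Rightarrow> real \<Rightarrow> ((real ^ 'n) \<times> real) set" where
  "closed_cylinder Xs t0 T = closure Xs \<times> {t0..T}"

definition exit_time ::
  "(real ^ 'n) set \<Rightarrow> real \<Rightarrow> real \<Rightarrow> (real \<Rightarrow> 'a \<Rightarrow> real ^ 'n) \<Rightarrow> 'a \<Rightarrow> real" where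
  "exit_time Xs t0 T x \<omega> =
     (if \<forall>t\<in>{t0..T}. x t \<omega> \<in> Xs then T else Inf {t \<in> {t0..T}. x t \<omega> \<notin> Xs})"

definition failure_probability ::
  "'a measure \<Rightarrow> (real ^ 'n) set \<Rightarrow> real \<Rightarrow> real \<Rightarrow> (real \<Rightarrow> 'a \<Rightarrow> real ^ 'n) \<Rightarrow> real" where
  "failure_probability M Xs t0 T x = measure M {\<omega> \<in> space M. \<exists>t\<in>{t0..T}. x t \<omega> \<notin> Xs}"

definition boundary_data :: "(real ^ 'n) set \<Rightarrow> real ^ 'n \<Rightarrow> real" where
  "boundary_data Xs x = indicator (frontier Xs) x"

primrec C_times :: "nat \<Rightarrow> (real ^ 'n \<Rightarrow> real) \<Rightarrow> bool" where
  "C_times 0 h \<longleftrightarrow> continuous_on UNIV h"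
| "C_times (Suc k) h \<longleftrightarrow> (\<exists>D. (\<forall>x. GDERIV h x :> D x) \<and> (\<forall>i. C_times k (\<lambda>x. D x $ i)))"

definition bump_function :: "(real ^ 'n) set \<Rightarrow> (real ^ 'n \<Rightarrow> real) \<Rightarrow> bool" where
  "bump_function Xs B \<longleftrightarrow>
     (\<forall>k. C_times k B) \<and> (\<forall>x. 0 \<le> B x \<and> B x \<le> 1) \<and>
     compact (closure {x. B x \<noteq> 0}) \<and> closure {x. B x \<noteq> 0} \<subseteq> Xs"

text \<open>No continuous function on the closed cylinder attains the discontinuous boundary data exactly
  (near \<open>frontier Xs \<times> {T}\<close> it would have to be close to both 0 and 1), so where regularity is
  needed the data are read as approximated by \<open>1 - B\<close> with \<open>B\<close> a smooth bump function. In the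
  following, \<open>1 - B j\<close> tends to \<open>boundary_data Xs\<close> pointwise on \<open>closure Xs\<close>.\<close>

definition bump_approximation :: "(real ^ 'n) set \<Rightarrow> (nat \<Rightarrow> real ^ 'n \<Rightarrow> real) \<Rightarrow> bool" where
  "bump_approximation Xs B \<longleftrightarrow>
     (\<forall>j. bump_function Xs (B j)) \<and> (\<forall>x\<in>Xs. (\<lambda>j. B j x) \<longlonglongrightarrow> 1)"

text \<open>The derivatives are unique on the cylinder: \<open>Xs\<close> is open in the theorem, and the time derivative is
  one-sided at \<open>t0\<close>.\<close>

definition C21_on_cylinder ::
  "(real ^ 'n) set \<Rightarrow> real \<Rightarrow> real \<Rightarrow> ((real ^ 'n) \<times> real \<Rightarrow> real) \<Rightarrow>
   ((real ^ 'n) \<times> real \<Rightarrow> real) \<Rightarrow> ((real ^ 'n) \<times> real \<Rightarrow> real ^ 'n) \<Rightarrow>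
   ((real ^ 'n) \<times> real \<Rightarrow> real ^ 'n ^ 'n) \<Rightarrow> bool" where
  "C21_on_cylinder Xs t0 T J J_t J_x J_xx \<longleftrightarrow>
     (\<forall>(x, t) \<in> cylinder Xs t0 T.
        ((\<lambda>s. J (x, s)) has_real_derivative J_t (x, t)) (at t within {t0..<T}) \<and>
        GDERIV (\<lambda>y. J (y, t)) x :> J_x (x, t) \<and>
        ((\<lambda>y. J_x (y, t)) has_derivative (\<lambda>h. J_xx (x, t) *v h)) (at x)) \<and>
     continuous_on (cylinder Xs t0 T) J_t \<and>
     continuous_on (cylinder Xs t0 T) J_x \<and>
     continuous_on (cylinder Xs t0 T) J_xx"

definition solves_bvp ::
  "(real ^ 'n \<Rightarrow> real \<Rightarrow> real ^ 'n) \<Rightarrow> (real ^ 'n \<Rightarrow> real \<Rightarrow> real ^ 'm ^ 'n) \<Rightarrow>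
   (real ^ 'n \<Rightarrow> real \<Rightarrow> real ^ 'm) \<Rightarrow> (real ^ 'n \<Rightarrow> real \<Rightarrow> real ^ 'k ^ 'n) \<Rightarrow>
   (real ^ 'n) set \<Rightarrow> real \<Rightarrow> real \<Rightarrow> (real ^ 'n \<Rightarrow> real) \<Rightarrow>
   ((real ^ 'n) \<times> real \<Rightarrow> real) \<Rightarrow> bool" where
  "solves_bvp f g u \<sigma> Xs t0 T \<phi> J \<longleftrightarrow>
     continuous_on (closed_cylinder Xs t0 T) J \<and>
     (\<exists>J_t J_x J_xx. C21_on_cylinder Xs t0 T J J_t J_x J_xx \<and>
        (\<forall>(x, t) \<in> cylinder Xs t0 T.
           - J_t (x, t) = (f x t + g x t *v u x t) \<bullet> J_x (x, t)
             + 1 / 2 * trace (\<sigma> x t ** transpose (\<sigma> x t) ** J_xx (x, t)))) \<and>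
     (\<forall>(x, t) \<in> cylinder_boundary Xs t0 T. J (x, t) = \<phi> x)"

end

theory Submission
  imports Defs
begin

text \<open>Dynkin's formula at the exit time \<open>\<tau>\<close> gives \<open>J j (x0, t0) = E (J j (x \<tau>, \<tau>)) = E (1 - B j (x \<tau>))\<close>, and
  dominated convergence in \<open>j\<close> turns the right-hand side into the probability that \<open>x \<tau>\<close> lies outside \<open>Xs\<close>.
  The indicator datum itself admits no continuous solution, so that the statement about it holds vacuously.

  Ito's formula is replaced by a first-moment version for compactly supported test
  functions. While the integrand is a fixed matrix, a second-order Taylor expansion shows that the mean of
  \<open>F (x t) t\<close> minus its compensator changes by at most \<open>e * h + C e * h\<^sup>2\<close> over a time step \<open>h\<close>, for every
  \<open>e > 0\<close>, hence not at all; simple integrands are a concatenation of such pieces and general ones a limit in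
  probability. Drift and diffusion are only almost surely integrable in time, so everything is discounted by
  \<open>exp (- l * \<integral> (norm b + (norm \<sigma>)\<^sup>2))\<close>, which makes the compensator bounded; at the end \<open>l\<close> tends to 0.
  As \<open>J\<close> is smooth in the open cylinder only, it is multiplied by plateau functions built from partial sums
  of the bump functions, and the horizon is taken slightly before \<open>T\<close>.\<close>

section \<open>Elementary estimates\<close>

text \<open>The martingale property is only ever used in the form
  \<open>expectation (indicator A * increment) = 0\<close> for events \<open>A\<close> of the past.
  This needs no conditional expectations, passes to limits by dominated convergence, and is exactly
  what stopping on a time grid consumes. The drift is merely measurable in time, so neither the mean
  of the test function nor that of its compensator need have a derivative at a prescribed time; only
  their difference does, which is why its increments are estimated as a whole. The generator is at
  most a constant times one plus the discount rate, and a rate discounted by its own integral has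
  total mass at most 1. The resulting bound involves \<open>l\<close>, but neither the size of the
  coefficients nor the index of an approximation. It replaces the usual localisation by stopping
  times, under which the simple approximants would have to be stopped too. As \<open>l\<close> tends
  to 0 this bound blows up; domination then comes from the PDE, which leaves only the killing term
  of the generator before the exit time.\<close>

lemma constant_of_small_increments:
  fixes \<Psi> :: "real \<Rightarrow> real"
  assumes "a \<le> b"
    and small: "\<And>e. e > 0 \<Longrightarrow> \<exists>C. \<forall>s t. a \<le> s \<and> s \<le> t \<and> t \<le> b \<longrightarrow> \<bar>\<Psi> t - \<Psi> s\<bar> \<le> (e + C * (t - s)) * (t - s)"
  shows "\<Psi> b = \<Psi> a"
proof -
  have "(\<Psi> has_field_derivative 0) (at x within {a..b})" if x: "x \<in> {a..b}" for x
  proof -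
    have "((\<lambda>y. (\<Psi> y - \<Psi> x) / (y - x)) \<longlongrightarrow> 0) (at x within {a..b})"
    proof (rule tendstoI)
      fix e :: real assume e: "e > 0"
      then obtain C where C: "\<And>s t. a \<le> s \<Longrightarrow> s \<le> t \<Longrightarrow> t \<le> b \<Longrightarrow> \<bar>\<Psi> t - \<Psi> s\<bar> \<le> (e/2 + C * (t - s)) * (t - s)"
        using small[of "e/2"] by auto
      \<comment> \<open>Within this radius the part of the factor that involves \<open>C\<close>
        stays below \<open>e/2\<close>. The constant may depend on \<open>e\<close>, because only
        the limit of the difference quotient matters.\<close>
      define d where "d = e / (2 * (\<bar>C\<bar> + 1))"
      have d: "d > 0" using e by (simp add: d_def)
      have "dist ((\<Psi> y - \<Psi> x) / (y - x)) 0 < e" if y: "y \<in> {a..b}" "y \<noteq> x" "dist y x < d" for y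
      proof -
        have "\<bar>\<Psi> y - \<Psi> x\<bar> \<le> (e/2 + C * \<bar>y - x\<bar>) * \<bar>y - x\<bar>"
          using C[of x y] C[of y x] x y by (cases "x \<le> y") (auto simp: abs_minus_commute)
        also have "\<dots> < e * \<bar>y - x\<bar>"
        proof (rule mult_strict_right_mono)
          have "C * \<bar>y - x\<bar> \<le> (\<bar>C\<bar>+1) * \<bar>y - x\<bar>" by (intro mult_right_mono) auto
          also have "\<dots> < (\<bar>C\<bar> + 1) * d" using y by (intro mult_strict_left_mono) (auto simp: dist_real_def)
          also have "\<dots> = e / 2" by (simp add: d_def field_simps)
          finally show "e/2 + C * \<bar>y - x\<bar> < e" by simp
        qed (use y in auto)
        finally show ?thesis using y by (simp add: divide_simps)
      qed
      then show "\<forall>\<^sub>F y in at x within {a..b}. dist ((\<Psi> y - \<Psi> x) / (y - x)) 0 < e"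
        using d unfolding eventually_at by auto
    qed
    then show ?thesis by (simp add: has_field_derivative_iff)
  qed
  then obtain c where "\<And>x. x \<in> {a..b} \<Longrightarrow> \<Psi> x = c"
    using has_field_derivative_zero_constant[of "{a..b}" \<Psi>] by auto
  then show ?thesis using assms(1) by auto
qed

lemma set_integral_combine:
  fixes f :: "real \<Rightarrow> 'b::{banach, second_countable_topology}"
  assumes "a \<le> b" "b \<le> c" "set_integrable lborel {a..c} f"
  shows "(LINT r:{a..c}|lborel. f r) = (LINT r:{a..b}|lborel. f r) + (LINT r:{b..c}|lborel. f r)"
proof -
  have "(LINT r:{a..c}|lborel. f r) = (LINT r:{a..b} \<union> {b..c}|lborel. f r)"
    using assms by (simp add: ivl_disj_un_two_touch)
  also have "\<dots> = (LINT r:{a..b}|lborel. f r) + (LINT r:{b..c}|lborel. f r)"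
  proof (rule set_integral_Un_AE)
    show "AE x in lborel. \<not> (x \<in> {a..b} \<and> x \<in> {b..c})"
      using AE_lborel_singleton[of b] by eventually_elim auto
  qed (use assms in \<open>auto intro: set_integrable_subset\<close>)
  finally show ?thesis .
qed

section \<open>Frobenius estimates and a Taylor formula\<close>

lemma norm_matrix_vector_mult_le:
  fixes A :: "real ^ 'k ^ 'n"
  shows "norm (A *v v) \<le> norm A * norm v"
proof (rule power2_le_imp_le)
  have "(norm (A *v v))\<^sup>2 = (\<Sum>i\<in>UNIV. (A $ i \<bullet> v)\<^sup>2)"
    unfolding power2_norm_eq_inner inner_vec_def[of "A *v v"]
    by (simp add: matrix_vector_mul_component power2_eq_square)
  also have "\<dots> \<le> (\<Sum>i\<in>UNIV. (norm (A $ i))\<^sup>2 * (norm v)\<^sup>2)"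
    by (intro sum_mono) (metis Cauchy_Schwarz_ineq power2_norm_eq_inner)
  also have "\<dots> = (norm A * norm v)\<^sup>2"
    by (simp add: power_mult_distrib power2_norm_eq_inner inner_vec_def[of A A] sum_distrib_right)
  finally show "(norm (A *v v))\<^sup>2 \<le> (norm A * norm v)\<^sup>2" .
qed simp

lemma norm_matrix_transpose_mult_le:
  fixes A B :: "real ^ 'k ^ 'n"
  shows "norm (A ** transpose B) \<le> norm A * norm B"
proof (rule power2_le_imp_le)
  have "(norm (A ** transpose B))\<^sup>2 = (\<Sum>i\<in>UNIV. \<Sum>j\<in>UNIV. (A $ i \<bullet> B $ j)\<^sup>2)"
    unfolding power2_norm_eq_inner
    by (simp add: inner_vec_def matrix_matrix_mult_def transpose_def power2_eq_square)
  also have "\<dots> \<le> (\<Sum>i\<in>UNIV. \<Sum>j\<in>UNIV. (norm (A $ i))\<^sup>2 * (norm (B $ j))\<^sup>2)"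
    by (intro sum_mono) (metis Cauchy_Schwarz_ineq power2_norm_eq_inner)
  also have "\<dots> = (norm A * norm B)\<^sup>2"
    unfolding power_mult_distrib power2_norm_eq_inner inner_vec_def[of A A] inner_vec_def[of B B]
    by (simp add: sum_product)
  finally show "(norm (A ** transpose B))\<^sup>2 \<le> (norm A * norm B)\<^sup>2" .
qed simp

text \<open>Telescoping: in each term only one factor has to be small. This turns mean-square
  convergence of diffusion coefficients into L1 convergence of covariances.\<close>

lemma norm_self_transpose_diff_le:
  fixes A B :: "real ^ 'k ^ 'n"
  shows "norm (A ** transpose A - B ** transpose B) \<le> norm (A - B) * (norm A + norm B)"
proof -
  have "A ** transpose A - B ** transpose B = (A - B) ** transpose A + B ** transpose (A - B)"
    by (simp add: matrix_matrix_mult_def transpose_def vec_eq_iff sum_subtractf[symmetric] sum.distrib[symmetric] algebra_simps)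
  also have "norm \<dots> \<le> norm (A - B) * norm A + norm B * norm (A - B)"
    by (rule order_trans[OF norm_triangle_ineq]) (intro add_mono norm_matrix_transpose_mult_le)
  finally show ?thesis by (simp add: algebra_simps)
qed

text \<open>The trace transposes one factor, which the symmetry of \<open>A ** transpose A\<close>
  undoes; \<open>X\<close> itself may be asymmetric. The second-order term of the PDE thereby
  becomes an inner product with the Hessian.\<close>

lemma trace_mult_eq_inner:
  fixes A :: "real ^ 'k ^ 'n" and X :: "real ^ 'n ^ 'n"
  shows "trace (A ** transpose A ** X) = (A ** transpose A) \<bullet> X"
proof -
  define S where "S = A ** transpose A"
  have sym: "S $ i $ j = S $ j $ i" for i j
    by (simp add: S_def matrix_matrix_mult_def transpose_def mult.commute)
  have "trace (S ** X) = (\<Sum>i\<in>UNIV. \<Sum>j\<in>UNIV. S $ i $ j * X $ j $ i)"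
    by (simp add: trace_def matrix_matrix_mult_def)
  also have "\<dots> = (\<Sum>j\<in>UNIV. \<Sum>i\<in>UNIV. S $ j $ i * X $ j $ i)"
    by (subst sum.swap) (simp add: sym)
  also have "\<dots> = S \<bullet> X" by (simp add: inner_vec_def)
  finally show ?thesis by (simp add: S_def)
qed

text \<open>Maclaurin's formula of order 2 along the segment from \<open>x\<close> to
  \<open>x + v\<close>. The remainder keeps the Hessian at an intermediate point, so that a modulus
  of continuity can compare it with the Hessian at \<open>x\<close>.\<close>

lemma second_order_taylor:
  fixes h :: "real ^ 'n \<Rightarrow> real"
  assumes 1: "\<And>y. GDERIV h y :> D y"
    and 2: "\<And>y. (D has_derivative (\<lambda>v. D2 y *v v)) (at y)"
  obtains \<theta> where "0 < \<theta>" "\<theta> < 1"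
    "h (x + v) = h x + D x \<bullet> v + 1/2 * (v \<bullet> (D2 (x + \<theta> *\<^sub>R v) *v v))"
proof -
  define g where "g = (\<lambda>\<theta>::real. h (x + \<theta> *\<^sub>R v))"
  define diff where "diff = (\<lambda>m::nat. if m = 0 then g else if m = 1 then (\<lambda>\<theta>. D (x + \<theta> *\<^sub>R v) \<bullet> v) else (\<lambda>\<theta>. v \<bullet> (D2 (x + \<theta> *\<^sub>R v) *v v)))"
  have line: "((\<lambda>\<theta>::real. x + \<theta> *\<^sub>R v) has_derivative (\<lambda>s. s *\<^sub>R v)) (at \<theta>)" for \<theta>
    by (auto intro!: derivative_eq_intros)
  have g1: "(g has_real_derivative D (x + \<theta> *\<^sub>R v) \<bullet> v) (at \<theta>)" for \<theta>
  proof -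
    have "((\<lambda>\<theta>. h (x + \<theta> *\<^sub>R v)) has_derivative (\<lambda>s. (s *\<^sub>R v) \<bullet> D (x + \<theta> *\<^sub>R v))) (at \<theta>)"
      using has_derivative_compose[OF line 1[of "x + \<theta> *\<^sub>R v", unfolded gderiv_def]] by simp
    then show ?thesis unfolding g_def has_field_derivative_def
      by (rule has_derivative_eq_rhs) (auto simp: fun_eq_iff inner_commute)
  qed
  have g2: "((\<lambda>\<theta>. D (x + \<theta> *\<^sub>R v) \<bullet> v) has_real_derivative v \<bullet> (D2 (x + \<theta> *\<^sub>R v) *v v)) (at \<theta>)" for \<theta>
  proof -
    have "((\<lambda>\<theta>. D (x + \<theta> *\<^sub>R v)) has_derivative (\<lambda>s. D2 (x + \<theta> *\<^sub>R v) *v (s *\<^sub>R v))) (at \<theta>)"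
      using has_derivative_compose[OF line 2[of "x + \<theta> *\<^sub>R v"]] by simp
    from has_derivative_inner_left[OF this, of v] show ?thesis unfolding has_field_derivative_def
      by (rule has_derivative_eq_rhs) (auto simp: fun_eq_iff inner_commute matrix_vector_mult_scaleR)
  qed
  have "\<exists>t. 0 < t \<and> t < 1 \<and> g 1 = (\<Sum>m<2. diff m 0 / fact m * 1 ^ m) + diff 2 t / fact 2 * 1 ^ 2"
  proof (rule Maclaurin)
    have "m = 0 \<or> m = 1" if "m < 2" for m :: nat using that by auto
    then show "\<forall>m t. m < 2 \<and> 0 \<le> t \<and> t \<le> 1 \<longrightarrow> ((diff m) has_real_derivative diff (Suc m) t) (at t)"
      using g1 g2 by (auto simp: diff_def)
  qed (auto simp: diff_def)
  then obtain t where t: "0 < t" "t < 1" "g 1 = (\<Sum>m<2. diff m 0 / fact m * 1 ^ m) + diff 2 t / fact 2 * 1 ^ 2"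
    by blast
  show ?thesis by (rule that[OF t(1,2)]) (use t(3) in \<open>simp add: diff_def g_def numeral_2_eq_2\<close>)
qed

lemma exp_neg_quadratic_bound:
  fixes a :: real assumes "0 \<le> a" shows "\<bar>exp (- a) - 1 + a\<bar> \<le> a\<^sup>2"
proof -
  have "1 - a \<le> exp (- a)" using exp_ge_add_one_self[of "-a"] by simp
  moreover have "exp (- a) \<le> 1 / (1 + a)"
    using exp_ge_add_one_self[of a] assms by (simp add: exp_minus divide_simps)
  moreover have "1 / (1 + a) \<le> 1 - a + a\<^sup>2"
    using assms by (simp add: divide_simps) (simp add: algebra_simps power2_eq_square power3_eq_cube)
  ultimately show ?thesis by (simp add: abs_le_iff)
qed

section \<open>Integrals over time intervals and discounting\<close>

lemma norm_integral_le:
  fixes f :: "'x \<Rightarrow> 'b::{banach, second_countable_topology}"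
  assumes "integrable N f" "integrable N g" "\<And>x. x \<in> space N \<Longrightarrow> norm (f x) \<le> g x"
  shows "norm (\<integral>x. f x \<partial>N) \<le> (\<integral>x. g x \<partial>N)"
  by (rule order_trans[OF integral_norm_bound integral_mono]) (use assms in auto)

lemma set_integral_Icc_same:
  fixes f :: "real \<Rightarrow> 'b::{banach, second_countable_topology}"
  shows "(LINT r:{a..a}|lborel. f r) = 0"
  unfolding set_lebesgue_integral_def
  by (rule integral_eq_zero_AE) (use AE_lborel_singleton[of a] in eventually_elim, auto)

lemma set_integrable_bounded:
  fixes h :: "real \<Rightarrow> 'b::{banach, second_countable_topology}"
  assumes "set_borel_measurable lborel {a..b} h" "\<And>r. r \<in> {a..b} \<Longrightarrow> norm (h r) \<le> B"
  shows "set_integrable lborel {a..b} h"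
  unfolding set_integrable_def
proof (rule integrableI_bounded_set[where A = "{a..b}" and B = B])
  show "AE x in lborel. x \<in> {a..b} \<longrightarrow> norm (indicator {a..b} x *\<^sub>R h x) \<le> B"
    using assms(2) by (auto simp: indicator_def)
  show "emeasure lborel {a..b} < \<infinity>" using emeasure_lborel_Icc_eq[of a b] by (simp add: less_top)
qed (use assms in \<open>auto simp: set_borel_measurable_def indicator_def\<close>)

lemma set_integrable_Icc_const:
  fixes k :: "'b::{banach, second_countable_topology}"
  shows "set_integrable lborel {a..b::real} (\<lambda>_. k)"
  by (rule set_integrable_bounded[where B = "norm k"]) (auto simp: set_borel_measurable_def)

lemma set_integral_norm_le:
  fixes h :: "real \<Rightarrow> 'b::{banach, second_countable_topology}"
  assumes "set_integrable lborel {a..b} h" "set_integrable lborel {a..b} f"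
    and "\<And>r. r \<in> {a..b} \<Longrightarrow> norm (h r) \<le> f r"
  shows "norm (LINT r:{a..b}|lborel. h r) \<le> (LINT r:{a..b}|lborel. f r)"
  unfolding set_lebesgue_integral_def
  by (rule norm_integral_le)
     (use assms in \<open>auto simp: set_integrable_def indicator_def\<close>)

lemma set_integral_norm_le_const:
  fixes h :: "real \<Rightarrow> 'b::{banach, second_countable_topology}"
  assumes "set_borel_measurable lborel {a..b} h" "a \<le> b"
    and "\<And>r. r \<in> {a..b} \<Longrightarrow> norm (h r) \<le> B"
  shows "norm (LINT r:{a..b}|lborel. h r) \<le> B * (b - a)"
proof -
  have "norm (LINT r:{a..b}|lborel. h r) \<le> (LINT r:{a..b}|lborel. B)"
    by (rule set_integral_norm_le) (use assms set_integrable_bounded[OF assms(1,3)] in \<open>auto simp: set_integrable_def\<close>)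
  also have "\<dots> = B * (b - a)" using assms(2) by (simp add: set_lebesgue_integral_def)
  finally show ?thesis .
qed

lemma continuous_on_indefinite_set_integral:
  fixes f :: "real \<Rightarrow> 'e::euclidean_space"
  assumes "set_integrable lborel {a..b} f"
  shows "continuous_on {a..b} (\<lambda>r. LINT u:{a..r}|lborel. f u)"
proof -
  have "continuous_on {a..b} (\<lambda>r. integral {a..r} f)"
    using set_borel_integral_eq_integral(1)[OF assms] by (rule indefinite_integral_continuous_1)
  moreover have "(LINT u:{a..r}|lborel. f u) = integral {a..r} f" if "r \<in> {a..b}" for r
    using set_borel_integral_eq_integral(2)[OF set_integrable_subset[OF assms, of "{a..r}"]] that by auto
  ultimately show ?thesis by (subst continuous_on_cong[OF refl]) auto
qed

lemma set_integral_nonneg_real: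
  fixes f :: "real \<Rightarrow> real"
  assumes "\<And>r. r \<in> A \<Longrightarrow> 0 \<le> f r" shows "0 \<le> (LINT r:A|lborel. f r)"
  unfolding set_lebesgue_integral_def by (rule integral_nonneg_AE) (use assms in \<open>auto simp: indicator_def\<close>)

lemma set_integral_mono_nonneg:
  fixes f :: "real \<Rightarrow> real"
  assumes "set_integrable lborel {a..b} f" "\<And>r. r \<in> {a..b} \<Longrightarrow> 0 \<le> f r" "a \<le> s" "s \<le> t" "t \<le> b"
  shows "(LINT r:{a..s}|lborel. f r) \<le> (LINT r:{a..t}|lborel. f r)"
proof -
  have "(LINT r:{a..t}|lborel. f r) = (LINT r:{a..s}|lborel. f r) + (LINT r:{s..t}|lborel. f r)"
    by (rule set_integral_combine) (use assms in \<open>auto intro: set_integrable_subset\<close>)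
  moreover have "0 \<le> (LINT r:{s..t}|lborel. f r)"
    using assms by (intro set_integral_nonneg_real) auto
  ultimately show ?thesis by simp
qed

text \<open>With \<open>C\<close> the integral of \<open>c\<close>, the integrand is formally the
  derivative of \<open>- exp (- C)\<close>, so the total is \<open>1 - exp (- C b)\<close>. As
  \<open>c\<close> is only measurable, \<open>C\<close> need not be differentiable everywhere; that
  integral plus exponential is constant is read off from its increments instead.\<close>

lemma discounted_total_le_bounded:
  fixes c :: "real \<Rightarrow> real"
  assumes [measurable]: "c \<in> borel_measurable borel" and c: "\<And>r. 0 \<le> c r" "\<And>r. c r \<le> m" and "a \<le> b"
  shows "(LINT r:{a..b}|lborel. c r * exp (- (LINT u:{a..r}|lborel. c u))) \<le> 1"
proof -
  define C where "C r = (LINT u:{a..r}|lborel. c u)" for r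
  define h where "h r = c r * exp (- C r)" for r
  define \<Gamma> where "\<Gamma> t = (LINT r:{a..t}|lborel. h r) + exp (- C t)" for t
  have m: "0 \<le> m" using c[of 0] by simp
  have ic: "set_integrable lborel {s..t} c" for s t
    by (rule set_integrable_bounded[where B = m]) (use c in \<open>auto simp: set_borel_measurable_def\<close>)
  have Ccont: "continuous_on {a..b} C"
    unfolding C_def by (rule continuous_on_indefinite_set_integral[OF ic])
  have C0: "0 \<le> C r" for r unfolding C_def by (rule set_integral_nonneg_real) (simp add: c)
  have "(\<lambda>r. indicator {a..b} r *\<^sub>R exp (- C r)) \<in> borel_measurable borel"
    by (intro borel_measurable_continuous_on_indicator continuous_intros Ccont) auto
  from borel_measurable_times[OF assms(1) this] have mh: "set_borel_measurable lborel {a..b} h"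
    unfolding h_def set_borel_measurable_def by (simp add: ac_simps)
  have ih: "set_integrable lborel {s..t} h" if "a \<le> s" "t \<le> b" for s t
    by (rule set_integrable_subset[OF set_integrable_bounded[OF mh, where B = m]])
       (use that c C0 m in \<open>auto simp: h_def intro: mult_mono[of _ m _ 1, simplified]\<close>)
  \<comment> \<open>One \<open>m\<^sup>2\<close> comes from freezing the discount at
    \<open>s\<close> over the step, the other from the quadratic remainder of the exponential. The
    slack \<open>e\<close> is added at the end to fit the shape of the criterion.\<close>
  have "\<bar>\<Gamma> t - \<Gamma> s\<bar> \<le> (e + 2 * m\<^sup>2 * (t - s)) * (t - s)" if st: "a \<le> s" "s \<le> t" "t \<le> b" and e: "0 < e" for s t e
  proof -
    define d where "d = (LINT r:{s..t}|lborel. c r)"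
    have Cst: "C t = C s + d" unfolding C_def d_def by (rule set_integral_combine) (use st ic in auto)
    have Csr: "C s \<le> C r" "C r \<le> C s + m * (t - s)" if "r \<in> {s..t}" for r
    proof -
      have "C r = C s + (LINT r:{s..r}|lborel. c r)"
        unfolding C_def d_def by (rule set_integral_combine) (use st that ic in auto)
      moreover have "norm (LINT r:{s..r}|lborel. c r) \<le> m * (r - s)"
        by (rule set_integral_norm_le_const) (use that c in \<open>auto simp: set_borel_measurable_def\<close>)
      moreover have "0 \<le> (LINT r:{s..r}|lborel. c r)"
        by (rule set_integral_nonneg_real) (simp add: c)
      moreover have "m * (r - s) \<le> m * (t - s)" using that m by (intro mult_left_mono) auto
      ultimately show "C s \<le> C r" "C r \<le> C s + m * (t - s)" by auto
    qed
    have d: "0 \<le> d" "d \<le> m * (t - s)" using Csr[of t] st Cst by auto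
    have "(LINT r:{a..t}|lborel. h r) = (LINT r:{a..s}|lborel. h r) + (LINT r:{s..t}|lborel. h r)"
      by (rule set_integral_combine) (use st ih in auto)
    \<comment> \<open>The increment of the exponential is split into its linear part, which matches
      the integral with frozen discount, and a remainder of order \<open>d\<^sup>2\<close>.\<close>
    then have "\<Gamma> t - \<Gamma> s = (LINT r:{s..t}|lborel. h r) - d * exp (- C s) + exp (- C s) * (exp (- d) - 1 + d)"
      by (simp add: \<Gamma>_def Cst exp_add[symmetric] algebra_simps)
    also have "(LINT r:{s..t}|lborel. h r) - d * exp (- C s) = (LINT r:{s..t}|lborel. h r - c r * exp (- C s))"
      unfolding d_def by (subst set_integral_diff) (use st ih ic in auto)
    also have "\<bar>(LINT r:{s..t}|lborel. h r - c r * exp (- C s)) + exp (- C s) * (exp (- d) - 1 + d)\<bar> \<le> m\<^sup>2 * (t-s) * (t - s) + 1 * (m * (t - s))\<^sup>2"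
    proof (rule order_trans[OF abs_triangle_ineq], rule add_mono)
      show "\<bar>LINT r:{s..t}|lborel. h r - c r * exp (- C s)\<bar> \<le> m\<^sup>2 * (t-s) * (t - s)"
        unfolding real_norm_def[symmetric]
      proof (rule set_integral_norm_le_const)
        show "set_borel_measurable lborel {s..t} (\<lambda>r. h r - c r * exp (- C s))"
          using set_integral_diff(1)[OF ih[OF st(1,3)] set_integrable_mult_left[OF ic, where a = "exp (- C s)"]]
          by (simp add: set_integrable_def set_borel_measurable_def)
        fix r assume r: "r \<in> {s..t}"
        have "\<bar>exp (- C r) - exp (- C s)\<bar> \<le> C r - C s"
        proof -
          have "exp (- C s) - exp (- C r) = exp (- C s) * (1 - exp (- (C r - C s)))"
            by (simp add: right_diff_distrib exp_add[symmetric])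
          also have "\<dots> \<le> 1 * (C r - C s)"
          proof (rule mult_mono)
            show "1 - exp (- (C r - C s)) \<le> C r - C s" using exp_ge_add_one_self[of "-(C r - C s)"] by linarith
          qed (use C0[of s] Csr[OF r] in auto)
          finally show ?thesis using Csr[OF r] by simp
        qed
        then have "\<bar>c r * (exp (- C r) - exp (- C s))\<bar> \<le> m * (m * (t - s))"
          unfolding abs_mult using Csr[OF r] c[of r] m by (intro mult_mono) auto
        then show "norm (h r - c r * exp (- C s)) \<le> m\<^sup>2 * (t - s)"
          by (simp add: h_def right_diff_distrib power2_eq_square algebra_simps)
      qed (use st in auto)
      have "\<bar>exp (- d) - 1 + d\<bar> \<le> d\<^sup>2" by (rule exp_neg_quadratic_bound[OF d(1)])
      also have "\<dots> \<le> (m * (t - s))\<^sup>2" using d by (intro power_mono) auto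
      finally show "\<bar>exp (- C s) * (exp (- d) - 1 + d)\<bar> \<le> 1 * (m * (t - s))\<^sup>2"
        unfolding abs_mult using C0[of s] by (intro mult_mono) auto
    qed
    also have "\<dots> = (2 * m\<^sup>2 * (t - s)) * (t - s)" by (simp add: power2_eq_square algebra_simps)
    also have "\<dots> \<le> (e + 2 * m\<^sup>2 * (t - s)) * (t - s)" using st e by (intro mult_right_mono) auto
    finally show ?thesis .
  qed
  then have "\<Gamma> b = \<Gamma> a"
    by (intro constant_of_small_increments[OF \<open>a \<le> b\<close>]) blast
  moreover have "\<Gamma> a = 1"
    unfolding \<Gamma>_def C_def set_integral_Icc_same by simp
  ultimately show ?thesis by (simp add: \<Gamma>_def h_def C_def) (smt (verit) exp_gt_zero)
qed

text \<open>The bounded case applied to the truncations \<open>min (c r) n\<close>, followed by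
  dominated convergence. The truncated rate is kept together with the discount of the full
  \<open>c\<close>, which is smaller than its own, so that one majorant serves every
  \<open>n\<close>.\<close>

lemma
  fixes c :: "real \<Rightarrow> real"
  assumes c: "set_integrable lborel {a..b} c" "\<And>r. 0 \<le> c r" and "a \<le> b"
    and m[measurable]: "c \<in> borel_measurable borel"
  shows discounted_total_integrable: "set_integrable lborel {a..b} (\<lambda>r. c r * exp (- (LINT u:{a..r}|lborel. c u)))"
    and discounted_total_le: "(LINT r:{a..b}|lborel. c r * exp (- (LINT u:{a..r}|lborel. c u))) \<le> 1"
proof -
  define C where "C r = (LINT u:{a..r}|lborel. c u)" for r
  define k where "k n r = min (c r) (real n)" for n r
  have Ccont: "continuous_on {a..b} C"
    unfolding C_def by (rule continuous_on_indefinite_set_integral[OF c(1)])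
  have C0: "0 \<le> C r" for r unfolding C_def by (rule set_integral_nonneg_real) (simp add: c)
  have mE: "(\<lambda>r. indicator {a..b} r *\<^sub>R exp (- C r)) \<in> borel_measurable borel"
    by (intro borel_measurable_continuous_on_indicator continuous_intros Ccont) auto
  have mk[measurable]: "k n \<in> borel_measurable borel" for n unfolding k_def by measurable
  have k0: "0 \<le> k n r" "k n r \<le> c r" "k n r \<le> real n" for n r using c(2) by (auto simp: k_def)
  have int: "set_integrable lborel {a..b} (\<lambda>r. f r * exp (- C r))"
    if [measurable]: "f \<in> borel_measurable borel" and f: "\<And>r. 0 \<le> f r" "\<And>r. f r \<le> c r" for f
  proof (rule set_integrable_bound[OF c(1)])
    show "set_borel_measurable lborel {a..b} (\<lambda>r. f r * exp (- C r))"
      unfolding set_borel_measurable_def using borel_measurable_times[OF that(1) mE]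
      by (simp add: ac_simps)
    have "f r * exp (- C r) \<le> c r * 1" for r using f[of r] C0 c(2)[of r] by (intro mult_mono) auto
    then show "AE r in lborel. r \<in> {a..b} \<longrightarrow> norm (f r * exp (- C r)) \<le> norm (c r)"
      using f(1) c(2) by simp
  qed
  have le: "(LINT r:{a..b}|lborel. k n r * exp (- C r)) \<le> 1" for n
  proof -
    define Cn where "Cn r = (LINT u:{a..r}|lborel. k n u)" for r
    have ik: "set_integrable lborel {a..r} (k n)" for r
      by (rule set_integrable_bounded[where B = "real n"]) (use k0[of n] in \<open>auto simp: set_borel_measurable_def\<close>)
    have "continuous_on {a..b} Cn" unfolding Cn_def by (rule continuous_on_indefinite_set_integral[OF ik])
    then have mEn: "(\<lambda>r. indicator {a..b} r *\<^sub>R exp (- Cn r)) \<in> borel_measurable borel"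
      by (intro borel_measurable_continuous_on_indicator continuous_intros) auto
    have Cn0: "0 \<le> Cn r" for r unfolding Cn_def by (rule set_integral_nonneg_real) (simp add: k0)
    have "(LINT r:{a..b}|lborel. k n r * exp (- C r)) \<le> (LINT r:{a..b}|lborel. k n r * exp (- Cn r))"
    proof (rule set_integral_mono)
      show "set_integrable lborel {a..b} (\<lambda>r. k n r * exp (- C r))" by (rule int) (simp_all add: k0)
      show "set_integrable lborel {a..b} (\<lambda>r. k n r * exp (- Cn r))"
      proof (rule set_integrable_bounded[where B = "real n"])
        show "set_borel_measurable lborel {a..b} (\<lambda>r. k n r * exp (- Cn r))"
          unfolding set_borel_measurable_def using borel_measurable_times[OF mk[of n] mEn]
          by (simp add: ac_simps)
        show "norm (k n r * exp (- Cn r)) \<le> real n" for r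
          using k0[of n r] Cn0[of r] mult_mono[of "k n r" n "exp (- Cn r)" 1] by auto
      qed
      fix r assume r: "r \<in> {a..b}"
      have "Cn r \<le> C r" unfolding Cn_def C_def
        by (rule set_integral_mono[OF ik set_integrable_subset[OF c(1)]]) (use r k0 in auto)
      then show "k n r * exp (- C r) \<le> k n r * exp (- Cn r)" using k0 by (intro mult_left_mono) auto
    qed
    also have "\<dots> \<le> 1" unfolding Cn_def using k0 assms by (intro discounted_total_le_bounded[where m = n]) auto
    finally show ?thesis .
  qed
  show "set_integrable lborel {a..b} (\<lambda>r. c r * exp (- (LINT u:{a..r}|lborel. c u)))"
    using int[of c] c m unfolding C_def by simp
  have "(\<lambda>n. LINT r:{a..b}|lborel. k n r * exp (- C r)) \<longlonglongrightarrow> (LINT r:{a..b}|lborel. c r * exp (- C r))"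
    unfolding set_lebesgue_integral_def
  proof (rule integral_dominated_convergence[where w = "\<lambda>r. indicator {a..b} r *\<^sub>R (c r * exp (- C r))"])
    have "(\<lambda>n. k n r) \<longlonglongrightarrow> c r" for r
    proof (rule tendsto_eventually)
      have "eventually (\<lambda>n. c r \<le> real n) sequentially"
        using filterlim_real_sequentially by (simp add: filterlim_at_top)
      then show "\<forall>\<^sub>F n in sequentially. k n r = c r" by eventually_elim (simp add: k_def)
    qed
    then show "AE r in lborel. (\<lambda>n. indicator {a..b} r *\<^sub>R (k n r * exp (- C r))) \<longlonglongrightarrow> indicator {a..b} r *\<^sub>R (c r * exp (- C r))"
      by (intro AE_I2 tendsto_intros)
    show "AE r in lborel. norm (indicator {a..b} r *\<^sub>R (k n r * exp (- C r))) \<le> indicator {a..b} r *\<^sub>R (c r * exp (- C r))" for n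
      using k0 by (auto simp: indicator_def intro!: mult_right_mono)
  qed (use int[of c] int[of "k n" for n] c m k0 in \<open>auto simp: set_integrable_def intro: borel_measurable_integrable\<close>)
  from LIMSEQ_le_const2[OF this, of 1] le show "(LINT r:{a..b}|lborel. c r * exp (- (LINT u:{a..r}|lborel. c u))) \<le> 1"
    unfolding C_def by blast
qed

text \<open>One factor converges in L1, the other only almost everywhere but boundedly. The
  integrand splits into \<open>q \<bullet> G j\<close>, dominated by \<open>K * norm q\<close>, and
  \<open>(Q j - q) \<bullet> G j\<close>, whose integral is at most \<open>K\<close> times the L1
  distance.\<close>

lemma inner_integral_tendsto:
  fixes q g :: "'x \<Rightarrow> 'e::euclidean_space"
  assumes q: "\<And>j. integrable N (Q j)" "integrable N q"
    and g: "\<And>j. G j \<in> borel_measurable N" "g \<in> borel_measurable N"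
    and lim: "AE x in N. (\<lambda>j. G j x) \<longlonglongrightarrow> g x" and bd: "\<And>j x. x \<in> space N \<Longrightarrow> norm (G j x) \<le> K"
    and L1: "(\<lambda>j. \<integral>x. norm (Q j x - q x) \<partial>N) \<longlonglongrightarrow> 0"
  shows "(\<lambda>j. \<integral>x. Q j x \<bullet> G j x \<partial>N) \<longlonglongrightarrow> (\<integral>x. q x \<bullet> g x \<partial>N)"
proof -
  note [measurable] = g borel_measurable_integrable[OF q(2)] borel_measurable_integrable[OF q(1)]
  have inn: "\<bar>u \<bullet> v\<bar> \<le> K * norm u" if "norm v \<le> K" for u v :: 'e
    using order_trans[OF Cauchy_Schwarz_ineq2[of u v] mult_left_mono[OF that norm_ge_zero]] by (simp add: mult.commute)
  have i1: "integrable N (\<lambda>x. u x \<bullet> G j x)" if "integrable N u" for u j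
    by (rule Bochner_Integration.integrable_bound[of N "\<lambda>x. K * norm (u x)"])
       (use that bd inn in \<open>auto intro!: AE_I2 order_trans[OF inn]\<close>)
  have "(\<lambda>j. \<integral>x. q x \<bullet> G j x \<partial>N) \<longlonglongrightarrow> (\<integral>x. q x \<bullet> g x \<partial>N)"
  proof (rule integral_dominated_convergence[where w = "\<lambda>x. K * norm (q x)"])
    show "AE x in N. (\<lambda>j. q x \<bullet> G j x) \<longlonglongrightarrow> q x \<bullet> g x" using lim by eventually_elim (intro tendsto_intros)
  qed (use q bd inn in \<open>auto\<close>)
  moreover have "(\<lambda>j. \<integral>x. (Q j x - q x) \<bullet> G j x \<partial>N) \<longlonglongrightarrow> 0"
  proof (rule Lim_null_comparison)
    show "(\<lambda>j. K * (\<integral>x. norm (Q j x - q x) \<partial>N)) \<longlonglongrightarrow> 0" using tendsto_mult_right_zero[OF L1] .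
    have "norm (\<integral>x. (Q j x - q x) \<bullet> G j x \<partial>N) \<le> (\<integral>x. K * norm (Q j x - q x) \<partial>N)" for j
      by (rule norm_integral_le) (use q bd inn i1 in auto)
    then show "\<forall>\<^sub>F j in sequentially. norm (\<integral>x. (Q j x - q x) \<bullet> G j x \<partial>N) \<le> K * (\<integral>x. norm (Q j x - q x) \<partial>N)"
      by simp
  qed
  ultimately have "(\<lambda>j. (\<integral>x. q x \<bullet> G j x \<partial>N) + (\<integral>x. (Q j x - q x) \<bullet> G j x \<partial>N)) \<longlonglongrightarrow> (\<integral>x. q x \<bullet> g x \<partial>N) + 0"
    by (rule tendsto_add)
  moreover have "(\<integral>x. q x \<bullet> G j x \<partial>N) + (\<integral>x. (Q j x - q x) \<bullet> G j x \<partial>N) = (\<integral>x. Q j x \<bullet> G j x \<partial>N)" for j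
    by (subst Bochner_Integration.integral_add[symmetric]) (use q i1 in \<open>auto simp: inner_diff_left\<close>)
  ultimately show ?thesis by simp
qed

section \<open>Second-order expansion of a test function along a path\<close>

text \<open>Paired with the derivatives \<open>(Ft, Fx, Fxx, F)\<close>, the coefficients below give the generator with drift \<open>\<beta>\<close>,
  covariance \<open>S\<close> and killing rate \<open>\<gamma>\<close> applied to \<open>F\<close>.\<close>

definition coef :: "real ^ 'n \<Rightarrow> real ^ 'n ^ 'n \<Rightarrow> real \<Rightarrow> real \<times> (real ^ 'n) \<times> (real ^ 'n ^ 'n) \<times> real" where
  "coef \<beta> S \<gamma> = (1, \<beta>, (1/2) *\<^sub>R S, - \<gamma>)"

lemma norm_coef_diff_le: "norm (coef \<beta> S \<gamma> - coef \<beta>' S' \<gamma>') \<le> norm (\<beta> - \<beta>') + norm (S - S') + \<bar>\<gamma> - \<gamma>'\<bar>"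
proof -
  have "norm (coef \<beta> S \<gamma> - coef \<beta>' S' \<gamma>') = norm (0::real, \<beta> - \<beta>', (1/2) *\<^sub>R (S - S'), - (\<gamma> - \<gamma>'))"
    by (simp add: coef_def scaleR_diff_right)
  also have "\<dots> \<le> norm (\<beta> - \<beta>') + (norm ((1/2) *\<^sub>R (S - S')) + norm (- (\<gamma> - \<gamma>')))"
    by (rule order_trans[OF norm_Pair_le], simp, rule order_trans[OF norm_Pair_le], simp, rule order_trans[OF norm_Pair_le], simp)
  also have "\<dots> \<le> norm (\<beta> - \<beta>') + norm (S - S') + \<bar>\<gamma> - \<gamma>'\<bar>" by (simp add: abs_minus_commute)
  finally show ?thesis .
qed

lemma norm_coef_le:
  fixes \<beta> :: "real ^ 'n"
  shows "norm (coef \<beta> S \<gamma>) \<le> 1 + norm \<beta> + norm S + \<bar>\<gamma>\<bar>"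
proof -
  have "norm (coef 0 0 0 :: real \<times> (real ^ 'n) \<times> (real ^ 'n ^ 'n) \<times> real) = 1"
    by (simp add: coef_def norm_Pair)
  then show ?thesis
    using norm_coef_diff_le[of \<beta> S \<gamma> 0 0 0] norm_triangle_sub[of "coef \<beta> S \<gamma>" "coef 0 0 0"] by simp
qed

text \<open>Bundling the derivatives into one \<open>jet\<close> lets a single bound and a single
  modulus serve all of them. The modulus is linear in the squared distance and in time, because both
  have means of order \<open>t - s\<close> along a path with bounded coefficients; the slack
  \<open>e\<close> is the price for functions that are merely uniformly continuous. Time derivatives
  are taken within the interval, hence one-sided at its ends.\<close>

locale test_function =
  fixes t0 T1 :: real
    and F :: "real ^ 'n \<Rightarrow> real \<Rightarrow> real" and Ft :: "real ^ 'n \<Rightarrow> real \<Rightarrow> real"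
    and Fx :: "real ^ 'n \<Rightarrow> real \<Rightarrow> real ^ 'n" and Fxx :: "real ^ 'n \<Rightarrow> real \<Rightarrow> real ^ 'n ^ 'n"
    and K :: real
  fixes jet :: "real ^ 'n \<Rightarrow> real \<Rightarrow> real \<times> (real ^ 'n) \<times> (real ^ 'n ^ 'n) \<times> real"
  defines "jet y r \<equiv> (Ft y r, Fx y r, Fxx y r, F y r)"
  assumes deriv_t: "t \<in> {t0..T1} \<Longrightarrow> ((\<lambda>r. F y r) has_real_derivative Ft y t) (at t within {t0..T1})"
    and deriv_x: "t \<in> {t0..T1} \<Longrightarrow> GDERIV (\<lambda>z. F z t) y :> Fx y t"
    and deriv_xx: "t \<in> {t0..T1} \<Longrightarrow> ((\<lambda>z. Fx z t) has_derivative (\<lambda>v. Fxx y t *v v)) (at y)"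
    and jet_bounded: "t \<in> {t0..T1} \<Longrightarrow> norm (jet y t) \<le> K"
    and jet_modulus: "e > 0 \<Longrightarrow> \<exists>C\<ge>0. \<forall>y z. \<forall>r\<in>{t0..T1}. \<forall>s\<in>{t0..T1}.
           norm (jet y r - jet z s) \<le> e + C * ((norm (y - z))\<^sup>2 + \<bar>r - s\<bar>)"
begin

lemma jet_components_le:
  "\<bar>Ft y r - Ft z s\<bar> \<le> norm (jet y r - jet z s)" "norm (Fx y r - Fx z s) \<le> norm (jet y r - jet z s)"
  "norm (Fxx y r - Fxx z s) \<le> norm (jet y r - jet z s)" "\<bar>F y r - F z s\<bar> \<le> norm (jet y r - jet z s)"
  "norm (Fxx y r) \<le> norm (jet y r)" "norm (Fx y r) \<le> norm (jet y r)" "\<bar>F y r\<bar> \<le> norm (jet y r)"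
  unfolding jet_def
  by (auto simp: norm_Pair real_le_rsqrt power2_norm_eq_inner intro!: real_le_rsqrt)

lemma K_nonneg: "t0 \<le> T1 \<Longrightarrow> 0 \<le> K"
  using order_trans[OF norm_ge_zero jet_bounded[of t0 0]] by simp

lemma continuous_on_jet: "continuous_on (UNIV \<times> {t0..T1}) (\<lambda>(y, r). jet y r)"
  unfolding continuous_on_iff
proof (clarify)
  fix y r and e :: real assume r: "r \<in> {t0..T1}" and e: "0 < e"
  from jet_modulus[of "e/2"] e obtain C where C: "C \<ge> 0"
    "\<And>y z r s. r \<in> {t0..T1} \<Longrightarrow> s \<in> {t0..T1} \<Longrightarrow> norm (jet y r - jet z s) \<le> e/2 + C * ((norm (y - z))\<^sup>2 + \<bar>r - s\<bar>)"
    by (metis half_gt_zero)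
  \<comment> \<open>The cap 1 makes the square of a distance below \<open>d\<close> again at most
    \<open>d\<close>.\<close>
  define d where "d = min 1 (e / (8 * (C + 1)))"
  have d: "0 < d" "d \<le> 1" "C * (2 * d) < e / 2"
  proof -
    show "0 < d" "d \<le> 1" using e C by (auto simp: d_def)
    have "C * (2 * d) \<le> C * (2 * (e / (8 * (C + 1))))" using C by (intro mult_left_mono) (auto simp: d_def)
    also have "\<dots> \<le> e / 4" using C(1) e by (simp add: field_simps)
    finally show "C * (2 * d) < e / 2" using e by simp
  qed
  have "dist (jet z s) (jet y r) < e" if "s \<in> {t0..T1}" "dist (z, s) (y, r) < d" for z s
  proof -
    have 1: "norm (z - y) < d" "\<bar>s - r\<bar> < d"
      using that(2) dist_fst_le[of "(z,s)" "(y,r)"] dist_snd_le[of "(z,s)" "(y,r)"]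
      by (auto simp: dist_norm)
    have "(norm (z - y))\<^sup>2 \<le> d"
    proof -
      have "(norm (z - y))\<^sup>2 \<le> d\<^sup>2" using 1(1) by (intro power_mono) auto
      also have "\<dots> \<le> d" using d by (simp add: power2_eq_square mult_left_le)
      finally show ?thesis .
    qed
    then have "C * ((norm (z - y))\<^sup>2 + \<bar>s - r\<bar>) \<le> C * (2 * d)"
      using 1 C by (intro mult_left_mono) auto
    then show ?thesis using C(2)[OF that(1) r, of z y] d by (simp add: dist_norm)
  qed
  then show "\<exists>d>0. \<forall>x'\<in>UNIV \<times> {t0..T1}. dist x' (y, r) < d \<longrightarrow> dist (case x' of (y, r) \<Rightarrow> jet y r) (jet y r) < e"
    using d(1) by auto
qed

lemma continuous_on_jet_path:
  assumes "continuous_on S y" "S \<subseteq> {t0..T1}"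
  shows "continuous_on S (\<lambda>r. jet (y r) r)"
proof -
  have "continuous_on S (\<lambda>r. (\<lambda>(y, r). jet y r) (y r, r))"
    by (rule continuous_on_compose2[OF continuous_on_jet]) (use assms in \<open>auto intro!: continuous_intros\<close>)
  then show ?thesis by simp
qed

text \<open>Second-order expansion over one time step with the diffusion matrix frozen at
  \<open>\<xi>\<close>, for a single path and with explicit constants. The subtracted term with
  factor \<open>z\<close> is the one that has mean zero for a Wiener increment. The error is
  arranged in two scales: \<open>\<delta> + D\<close>, of mean order \<open>t - s\<close> and
  multiplied by the arbitrarily small \<open>e\<close>, and
  \<open>\<delta>\<^sup>2 + D\<^sup>2 + Q\<close>, of mean order \<open>(t - s)\<^sup>2\<close>,
  whose factor may depend on \<open>e\<close>. The number \<open>z\<close> stands for the discount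
  accumulated before \<open>s\<close>.\<close>

lemma ito_increment_explicit:
  fixes \<xi> :: "real ^ 'k ^ 'n" and b :: "real \<Rightarrow> real ^ 'n" and y :: "real \<Rightarrow> real ^ 'n"
  defines "jmp \<equiv> \<lambda>W s t. \<xi> *v (W t - W s)"
  assumes st: "t0 \<le> s" "s \<le> t" "t \<le> T1" and e: "e > 0" and C1: "C1 \<ge> 0"
    and mod: "\<And>y z r s. r \<in> {t0..T1} \<Longrightarrow> s \<in> {t0..T1} \<Longrightarrow> norm (jet y r - jet z s) \<le> e + C1 * ((norm (y - z))\<^sup>2 + \<bar>r - s\<bar>)"
    and [measurable]: "b \<in> borel_measurable borel" "c \<in> borel_measurable borel"
    and bd: "\<And>r. norm (b r) \<le> m" "\<And>r. 0 \<le> c r" "\<And>r. c r \<le> m" "norm \<xi> \<le> m"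
    and W: "continuous_on UNIV W" and yc: "continuous_on {s..t} y" and z: "0 \<le> z" "z \<le> 1"
    and y: "\<And>r. r \<in> {s..t} \<Longrightarrow> y r = y s + (LINT u:{s..r}|lborel. b u) + \<xi> *v (W r - W s)"
  defines "\<delta> \<equiv> t - s" and "D \<equiv> (norm (W t - W s))\<^sup>2" and "Q \<equiv> (LINT r:{s..t}|lborel. (norm (W r - W s))\<^sup>2)"
    and "L \<equiv> T1 - t0" and "S \<equiv> \<xi> ** transpose \<xi>" and "v \<equiv> \<xi> *v (W t - W s)"
    and "C2 \<equiv> C1 * (2 * m\<^sup>2 * (T1 - t0) + 2 * m\<^sup>2 + 1)"
  shows "\<bar>F (y t) t * (z * exp (- (LINT u:{s..t}|lborel. c u))) - F (y s) s * z
      - (LINT r:{s..t}|lborel. coef (b r) S (c r) \<bullet> ((z * exp (- (LINT u:{s..r}|lborel. c u))) *\<^sub>R jet (y r) r))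
      - z * (Fx (y s) s \<bullet> v + 1/2 * (v \<bullet> (Fxx (y s) s *v v) - \<delta> * (S \<bullet> Fxx (y s) s)))\<bar>
    \<le> (1 + 2 * m + m\<^sup>2 + m + 1 + m\<^sup>2 * (L + 1) + K * m\<^sup>2) * (e * (\<delta> + D))
      + ((1 + 2 * m + m\<^sup>2) * (C2 + m * K) + (K * m\<^sup>2 + 2 * m * C2) + 2 * C2 + 4 * C1 * m^4 * (L\<^sup>2 + 1) + K * m\<^sup>2 * (1 + 1 / e)) * (\<delta>\<^sup>2 + D\<^sup>2 + Q)"
proof -
  define \<beta> where "\<beta> = (LINT u:{s..t}|lborel. b u)"
  define \<Gamma> where "\<Gamma> = (LINT u:{s..t}|lborel. c u)"
  define Z where "Z r = z * exp (- (LINT u:{s..r}|lborel. c u))" for r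
  define a where "a = jet (y s) s"
  \<comment> \<open>\<open>E\<close> and \<open>R\<close> are the two scales of the error; each of
    the five estimates below ends in a multiple of \<open>e * E\<close> plus a multiple of
    \<open>R\<close>, or is an exact evaluation.\<close>
  define E where "E = \<delta> + D"
  define R where "R = \<delta>\<^sup>2 + D\<^sup>2 + Q"
  have m0: "0 \<le> m" using bd(2,3)[of 0] by simp
  have K0: "0 \<le> K" using K_nonneg st by simp
  have \<delta>: "0 \<le> \<delta>" "\<delta> \<le> L" using st by (auto simp: \<delta>_def L_def)
  have L0: "0 \<le> L" using \<delta> by simp
  have D0: "0 \<le> D" by (simp add: D_def)
  have Q0: "0 \<le> Q" unfolding Q_def by (rule set_integral_nonneg_real) simp
  have C20: "0 \<le> C2" unfolding C2_def using C1 L0 by (simp add: L_def)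
  have R: "0 \<le> R" "\<delta>\<^sup>2 \<le> R" "D\<^sup>2 \<le> R" "\<delta>\<^sup>2 + D\<^sup>2 \<le> R" "\<delta>\<^sup>2 + Q \<le> R" using Q0 by (auto simp: R_def)
  have E: "0 \<le> E" "\<delta> \<le> E" "D \<le> E" using \<delta> D0 by (auto simp: E_def)
  have \<delta>D: "\<delta> * D \<le> R"
    using sum_squares_bound[of \<delta> D] R(4) \<delta> D0 mult_nonneg_nonneg[of \<delta> D] by linarith
  have ib: "set_integrable lborel {u..u'} b" for u u'
    by (rule set_integrable_bounded[where B = m]) (use bd in \<open>auto simp: set_borel_measurable_def\<close>)
  have ic: "set_integrable lborel {u..u'} c" for u u'
    by (rule set_integrable_bounded[where B = m]) (use bd in \<open>auto simp: set_borel_measurable_def\<close>)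
  have c_le: "0 \<le> (LINT u:{s..r}|lborel. c u)" "(LINT u:{s..r}|lborel. c u) \<le> m * (r - s)" if "s \<le> r" for r
  proof -
    show "0 \<le> (LINT u:{s..r}|lborel. c u)" by (rule set_integral_nonneg_real) (simp add: bd)
    have "norm (LINT u:{s..r}|lborel. c u) \<le> m * (r - s)"
      by (rule set_integral_norm_le_const) (use bd that in \<open>auto simp: set_borel_measurable_def\<close>)
    then show "(LINT u:{s..r}|lborel. c u) \<le> m * (r - s)" by simp
  qed
  have \<Gamma>: "0 \<le> \<Gamma>" "\<Gamma> \<le> m * \<delta>" using c_le[OF st(2)] by (auto simp: \<Gamma>_def \<delta>_def)
  have b_le: "norm (LINT u:{s..r}|lborel. b u) \<le> m * (r - s)" if "s \<le> r" for r
    by (rule set_integral_norm_le_const) (use bd that in \<open>auto simp: set_borel_measurable_def\<close>)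
  have \<beta>: "norm \<beta> \<le> m * \<delta>" using b_le[OF st(2)] by (auto simp: \<beta>_def \<delta>_def)
  have v: "norm v \<le> m * norm (W t - W s)"
    unfolding v_def using norm_matrix_vector_mult_le[of \<xi> "W t - W s"] bd(4)
    by (meson order_trans mult_right_mono norm_ge_zero)
  have yd: "(norm (y r - y s))\<^sup>2 \<le> 2 * m\<^sup>2 * \<delta>\<^sup>2 + 2 * m\<^sup>2 * (norm (W r - W s))\<^sup>2" if r: "r \<in> {s..t}" for r
  proof -
    have "norm (y r - y s) \<le> norm (LINT u:{s..r}|lborel. b u) + norm (\<xi> *v (W r - W s))"
    proof -
      have "y r - y s = (LINT u:{s..r}|lborel. b u) + \<xi> *v (W r - W s)" by (subst y[OF r]) simp
      then show ?thesis by (simp only: norm_triangle_ineq)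
    qed
    also have "\<dots> \<le> m * \<delta> + m * norm (W r - W s)"
    proof (rule add_mono)
      show "norm (LINT u:{s..r}|lborel. b u) \<le> m * \<delta>"
        using b_le[of r] r m0 mult_left_mono[of "r - s" \<delta> m] by (auto simp: \<delta>_def)
      show "norm (\<xi> *v (W r - W s)) \<le> m * norm (W r - W s)"
        using norm_matrix_vector_mult_le[of \<xi> "W r - W s"] bd(4) by (meson order_trans mult_right_mono norm_ge_zero)
    qed
    finally have "(norm (y r - y s))\<^sup>2 \<le> (m * \<delta> + m * norm (W r - W s))\<^sup>2" by (rule power_mono) simp
    also have "\<dots> \<le> 2 * (m * \<delta>)\<^sup>2 + 2 * (m * norm (W r - W s))\<^sup>2"
      using sum_squares_bound[of "m * \<delta>" "m * norm (W r - W s)"] by (simp add: power2_sum)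
    finally show ?thesis by (simp add: power_mult_distrib)
  qed
  \<comment> \<open>Position and time vary independently, since the time increment below is taken
    with the position held at its value at \<open>t\<close>. The length \<open>L\<close> enters by
    bounding one factor of \<open>\<delta>\<^sup>2\<close>.\<close>
  have jd: "norm (jet (y r) u - a) \<le> e + C2 * (\<delta> + (norm (W r - W s))\<^sup>2)" if r: "r \<in> {s..t}" "u \<in> {s..t}" for r u
  proof -
    have "norm (jet (y r) u - a) \<le> e + C1 * ((norm (y r - y s))\<^sup>2 + \<bar>u - s\<bar>)"
      unfolding a_def by (rule mod) (use r st in auto)
    also have "(norm (y r - y s))\<^sup>2 + \<bar>u - s\<bar> \<le> (2 * m\<^sup>2 * L + 2 * m\<^sup>2 + 1) * (\<delta> + (norm (W r - W s))\<^sup>2)"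
    proof -
      have "2 * m\<^sup>2 * \<delta>\<^sup>2 \<le> 2 * m\<^sup>2 * L * \<delta>"
        using mult_mono[of \<delta> L \<delta> \<delta>] \<delta> m0 by (simp add: power2_eq_square mult_left_mono mult.assoc)
      moreover have "\<bar>u - s\<bar> \<le> \<delta>" using r by (auto simp: \<delta>_def)
      moreover have "0 \<le> 2 * m\<^sup>2 * L * (norm (W r - W s))\<^sup>2" "0 \<le> 2 * m\<^sup>2 * \<delta>" using L0 \<delta> by auto
      ultimately show ?thesis using yd[OF r(1)] zero_le_power2[of "norm (W r - W s)"]
        by (simp only: ring_distribs)
    qed
    finally show ?thesis using C1 by (simp add: C2_def L_def mult.assoc mult_left_mono)
  qed
  have ta: "norm a \<le> K" unfolding a_def using jet_bounded st by auto
  have comp: "\<bar>F (y s) s\<bar> \<le> K" "norm (Fxx (y s) s) \<le> K" "\<bar>F (y t) t\<bar> \<le> K"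
    using jet_bounded[of s "y s"] jet_bounded[of t "y t"] jet_components_le(5,7)[of "y s" s] jet_components_le(7)[of "y t" t] st
    by auto
  have Zr: "0 \<le> Z r" "Z r \<le> 1" "\<bar>Z r - z\<bar> \<le> m * \<delta>" if r: "r \<in> {s..t}" for r
  proof -
    have c: "0 \<le> (LINT u:{s..r}|lborel. c u)" "(LINT u:{s..r}|lborel. c u) \<le> m * \<delta>"
      using c_le[of r] r m0 mult_left_mono[of "r - s" \<delta> m] by (auto simp: \<delta>_def)
    show "0 \<le> Z r" using z by (simp add: Z_def)
    show "Z r \<le> 1" unfolding Z_def using z c by (intro mult_le_one) auto
    have "\<bar>Z r - z\<bar> = z * (1 - exp (- (LINT u:{s..r}|lborel. c u)))"
      using z c mult_left_mono[of "exp (- (LINT u:{s..r}|lborel. c u))" 1 z] by (simp add: Z_def right_diff_distrib)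
    also have "\<dots> \<le> 1 * (LINT u:{s..r}|lborel. c u)"
      using z c exp_ge_add_one_self[of "-(LINT u:{s..r}|lborel. c u)"] by (intro mult_mono) auto
    finally show "\<bar>Z r - z\<bar> \<le> m * \<delta>" using c by simp
  qed
  have S_le: "norm S \<le> m\<^sup>2"
    using norm_matrix_transpose_mult_le[of \<xi> \<xi>] bd(4) mult_mono[of "norm \<xi>" m "norm \<xi>" m] m0
    by (simp add: S_def power2_eq_square)
  have q_le: "norm (coef (b r) S (c r)) \<le> 1 + 2 * m + m\<^sup>2" for r
    using norm_coef_le[of "b r" S "c r"] bd(1,2,3)[of r] S_le by simp
  have cont: "continuous_on {s..t} (\<lambda>r. Z r *\<^sub>R jet (y r) r)"
    unfolding Z_def using st
    by (intro continuous_intros continuous_on_indefinite_set_integral ic continuous_on_jet_path yc) auto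
  have mcoef: "(\<lambda>r. coef (b r) S (c r)) \<in> borel_measurable borel" unfolding coef_def by measurable
  have mj: "(\<lambda>r. indicator {s..t} r *\<^sub>R (Z r *\<^sub>R jet (y r) r)) \<in> borel_measurable borel"
    by (intro borel_measurable_continuous_on_indicator cont) auto
  have i1: "set_integrable lborel {s..t} (\<lambda>r. coef (b r) S (c r) \<bullet> (Z r *\<^sub>R jet (y r) r))"
  proof (rule set_integrable_bounded[where B = "(1 + 2 * m + m\<^sup>2) * K"])
    show "set_borel_measurable lborel {s..t} (\<lambda>r. coef (b r) S (c r) \<bullet> (Z r *\<^sub>R jet (y r) r))"
      using borel_measurable_inner[OF mcoef mj] by (simp add: set_borel_measurable_def mult.assoc)
    fix r assume r: "r \<in> {s..t}"
    have "norm (Z r *\<^sub>R jet (y r) r) \<le> 1 * K"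
      using Zr[OF r] jet_bounded[of r "y r"] r st by (simp only: norm_scaleR, intro mult_mono) auto
    then show "norm (coef (b r) S (c r) \<bullet> (Z r *\<^sub>R jet (y r) r)) \<le> (1 + 2 * m + m\<^sup>2) * K"
      using order_trans[OF Cauchy_Schwarz_ineq2 mult_mono[OF q_le]] m0 by (simp del: inner_scaleR_right norm_scaleR)
  qed
  have i2: "set_integrable lborel {s..t} (\<lambda>r. coef (b r) S (c r))"
    by (rule set_integrable_bounded[OF _ q_le]) (use mcoef in \<open>simp add: set_borel_measurable_def\<close>)
  have i3: "set_integrable lborel {s..t} (\<lambda>r. coef (b r) S (c r) \<bullet> (z *\<^sub>R a))"
    using i2 unfolding set_integrable_def by (simp add: inner_scaleR_left[symmetric] del: inner_scaleR_left inner_scaleR_right)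
  define M1 where "M1 = 1 + 2 * m + m\<^sup>2"
  have M1: "0 \<le> M1" using m0 by (simp add: M1_def)
  \<comment> \<open>Freezing at \<open>s\<close>: the discounted jet under the compensator integral
    is replaced by \<open>z *\<^sub>R a\<close>.\<close>
  have I: "\<bar>(LINT r:{s..t}|lborel. coef (b r) S (c r) \<bullet> (Z r *\<^sub>R jet (y r) r))
         - (LINT r:{s..t}|lborel. coef (b r) S (c r) \<bullet> (z *\<^sub>R a))\<bar> \<le> M1 * (e * E) + M1 * (C2 + m * K) * R"
  proof -
    have Wm: "continuous_on {s..t} (\<lambda>r. (norm (W r - W s))\<^sup>2)"
      by (intro continuous_intros continuous_on_subset[OF W]) auto
    have i4: "set_integrable lborel {s..t} (\<lambda>r. (norm (W r - W s))\<^sup>2)"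
      using borel_integrable_compact[OF _ Wm] by (simp add: set_integrable_def)
    have i5: "set_integrable lborel {s..t} (\<lambda>r. M1 * (e + (C2 + m * K) * \<delta>))"
      by (rule set_integrable_Icc_const)
    have i6: "set_integrable lborel {s..t} (\<lambda>r. M1 * C2 * (norm (W r - W s))\<^sup>2)"
      using i4 by (rule set_integrable_mult_right)
    have "(LINT r:{s..t}|lborel. coef (b r) S (c r) \<bullet> (Z r *\<^sub>R jet (y r) r))
         - (LINT r:{s..t}|lborel. coef (b r) S (c r) \<bullet> (z *\<^sub>R a)) =
       (LINT r:{s..t}|lborel. coef (b r) S (c r) \<bullet> (Z r *\<^sub>R jet (y r) r) - coef (b r) S (c r) \<bullet> (z *\<^sub>R a))"
      by (rule set_integral_diff(2)[OF i1 i3, symmetric])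
    also have "norm \<dots> \<le> (LINT r:{s..t}|lborel. M1 * (e + (C2 + m * K) * \<delta>) + M1 * C2 * (norm (W r - W s))\<^sup>2)"
    proof (rule set_integral_norm_le[OF set_integral_diff(1)[OF i1 i3] set_integral_add(1)[OF i5 i6]])
      fix r assume r: "r \<in> {s..t}"
      have "norm (Z r *\<^sub>R jet (y r) r - z *\<^sub>R a) = norm (Z r *\<^sub>R (jet (y r) r - a) + (Z r - z) *\<^sub>R a)"
        by (simp add: algebra_simps)
      also have "\<dots> \<le> \<bar>Z r\<bar> * norm (jet (y r) r - a) + \<bar>Z r - z\<bar> * norm a"
        by (metis norm_scaleR norm_triangle_ineq)
      also have "\<dots> \<le> 1 * (e + C2 * (\<delta> + (norm (W r - W s))\<^sup>2)) + (m * \<delta>) * K"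
        using Zr[OF r] jd[OF r r] ta m0 \<delta> by (intro add_mono mult_mono) auto
      finally have *: "norm (Z r *\<^sub>R jet (y r) r - z *\<^sub>R a) \<le> (e + (C2 + m * K) * \<delta>) + C2 * (norm (W r - W s))\<^sup>2"
        by (simp add: algebra_simps)
      have "norm (coef (b r) S (c r) \<bullet> (Z r *\<^sub>R jet (y r) r) - coef (b r) S (c r) \<bullet> (z *\<^sub>R a))
          = \<bar>coef (b r) S (c r) \<bullet> (Z r *\<^sub>R jet (y r) r - z *\<^sub>R a)\<bar>" by (simp only: inner_diff_right real_norm_def)
      also have "\<dots> \<le> M1 * norm (Z r *\<^sub>R jet (y r) r - z *\<^sub>R a)"
        using order_trans[OF Cauchy_Schwarz_ineq2 mult_right_mono[OF q_le]] by (simp add: M1_def)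
      also have "\<dots> \<le> M1 * ((e + (C2 + m * K) * \<delta>) + C2 * (norm (W r - W s))\<^sup>2)"
        by (rule mult_left_mono[OF * M1])
      finally show "norm (coef (b r) S (c r) \<bullet> (Z r *\<^sub>R jet (y r) r) - coef (b r) S (c r) \<bullet> (z *\<^sub>R a))
        \<le> M1 * (e + (C2 + m * K) * \<delta>) + M1 * C2 * (norm (W r - W s))\<^sup>2" by (simp add: algebra_simps)
    qed
    also have "\<dots> = M1 * (e + (C2 + m * K) * \<delta>) * \<delta> + M1 * C2 * Q"
      by (subst set_integral_add(2)[OF i5 i6]) (use st in \<open>simp add: Q_def set_integral_const \<delta>_def\<close>)
    also have "\<dots> \<le> M1 * (e * E) + M1 * (C2 + m * K) * R"
    proof -
      have "M1 * (e * \<delta>) \<le> M1 * (e * E)" using M1 e E by (intro mult_left_mono) auto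
      moreover have "M1 * (C2 + m * K) * (\<delta>\<^sup>2 + Q) \<le> M1 * (C2 + m * K) * R"
        using M1 C20 m0 K0 R by (intro mult_left_mono) auto
      moreover have "0 \<le> M1 * (m * K) * Q" using M1 m0 K0 Q0 by auto
      ultimately show ?thesis by (simp add: power2_eq_square algebra_simps)
    qed
    finally show ?thesis by simp
  qed
  have Ia: "(LINT r:{s..t}|lborel. coef (b r) S (c r) \<bullet> (z *\<^sub>R a))
      = z * (\<delta> * Ft (y s) s + \<beta> \<bullet> Fx (y s) s + 1/2 * \<delta> * (S \<bullet> Fxx (y s) s) - \<Gamma> * F (y s) s)"
  proof -
    have 1: "set_integrable lborel {s..t} (\<lambda>r. Ft (y s) s + 1/2 * (S \<bullet> Fxx (y s) s))" by (rule set_integrable_Icc_const)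
    have 2: "set_integrable lborel {s..t} (\<lambda>r. b r \<bullet> Fx (y s) s)"
      using ib[of s t] unfolding set_integrable_def by (simp add: inner_scaleR_left[symmetric] del: inner_scaleR_left)
    have 3: "set_integrable lborel {s..t} (\<lambda>r. c r * F (y s) s)" using ic by simp
    have "(LINT r:{s..t}|lborel. coef (b r) S (c r) \<bullet> (z *\<^sub>R a))
      = z * (LINT r:{s..t}|lborel. (Ft (y s) s + 1/2 * (S \<bullet> Fxx (y s) s)) + b r \<bullet> Fx (y s) s - c r * F (y s) s)"
      unfolding set_integral_mult_right[symmetric]
      by (intro arg_cong[where f = "set_lebesgue_integral lborel {s..t}"]) (auto simp: coef_def a_def jet_def fun_eq_iff algebra_simps)
    also have "(LINT r:{s..t}|lborel. (Ft (y s) s + 1/2 * (S \<bullet> Fxx (y s) s)) + b r \<bullet> Fx (y s) s - c r * F (y s) s)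
       = \<delta> * (Ft (y s) s + 1/2 * (S \<bullet> Fxx (y s) s)) + \<beta> \<bullet> Fx (y s) s - \<Gamma> * F (y s) s"
    proof -
      have "(LINT r:{s..t}|lborel. b r \<bullet> Fx (y s) s) = \<beta> \<bullet> Fx (y s) s"
        using ib[of s t] unfolding \<beta>_def set_lebesgue_integral_def set_integrable_def
        by (subst integral_inner_left[symmetric]) auto
      then show ?thesis
        using st by (subst set_integral_diff(2)[OF set_integral_add(1)[OF 1 2] 3], subst set_integral_add(2)[OF 1 2])
          (simp add: set_integral_const \<Gamma>_def \<delta>_def)
    qed
    finally show ?thesis by (simp add: algebra_simps)
  qed
  \<comment> \<open>The loss of discount over the step cancels the killing term to first order,
    leaving the remainder of the exponential and the oscillation of \<open>F\<close>.\<close>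
  have II: "\<bar>(Z t - z) * F (y t) t + z * \<Gamma> * F (y s) s\<bar> \<le> m * (e * E) + (K * m\<^sup>2 + 2 * m * C2) * R"
  proof -
    have "(Z t - z) * F (y t) t + z * \<Gamma> * F (y s) s
        = z * ((exp (- \<Gamma>) - 1 + \<Gamma>) * F (y t) t - \<Gamma> * (F (y t) t - F (y s) s))"
      by (simp add: Z_def \<Gamma>_def algebra_simps)
    also have "\<bar>\<dots>\<bar> \<le> 1 * (\<bar>exp (- \<Gamma>) - 1 + \<Gamma>\<bar> * \<bar>F (y t) t\<bar> + \<Gamma> * \<bar>F (y t) t - F (y s) s\<bar>)"
      unfolding abs_mult using z \<Gamma>(1)
      by (intro mult_mono order_trans[OF abs_triangle_ineq4]) (auto simp: abs_mult)
    also have "\<dots> \<le> (m * \<delta>)\<^sup>2 * K + (m * \<delta>) * (e + C2 * (\<delta> + D))"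
    proof -
      have "\<bar>exp (- \<Gamma>) - 1 + \<Gamma>\<bar> \<le> (m * \<delta>)\<^sup>2"
        using exp_neg_quadratic_bound[OF \<Gamma>(1)] power_mono[OF \<Gamma>(2,1), of 2] by linarith
      moreover have "\<bar>F (y t) t - F (y s) s\<bar> \<le> e + C2 * (\<delta> + D)"
        using jd[of t t] st jet_components_le(4)[of "y t" t "y s" s] by (auto simp: a_def D_def)
      ultimately show ?thesis unfolding mult_1 using comp \<Gamma> K0 m0 \<delta> by (intro add_mono mult_mono) auto
    qed
    also have "\<dots> = m * (e * \<delta>) + ((K * m\<^sup>2 + m * C2) * \<delta>\<^sup>2 + m * C2 * (\<delta> * D))"
      by (simp add: power2_eq_square algebra_simps)
    also have "\<dots> \<le> m * (e * E) + ((K * m\<^sup>2 + m * C2) * R + m * C2 * R)"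
      using m0 e E K0 C20 R \<delta>D by (intro add_mono mult_left_mono) auto
    finally show ?thesis by (simp add: algebra_simps)
  qed
  \<comment> \<open>Increment in time with the position held at its final value; the mean value
    theorem needs \<open>s < t\<close>.\<close>
  have III: "\<bar>F (y t) t - F (y t) s - \<delta> * Ft (y s) s\<bar> \<le> e * E + 2 * C2 * R"
  proof (cases "s = t")
    case True then show ?thesis using e E C20 R(1) by (simp add: \<delta>_def)
  next
    case False
    then have "s < t" using st by simp
    have "\<exists>u\<in>{s<..<t}. F (y t) t - F (y t) s = (t - s) * Ft (y t) u"
    proof -
      have "\<exists>u\<in>{s<..<t}. F (y t) t - F (y t) s = (\<lambda>h. Ft (y t) u * h) (t - s)"
      proof (rule mvt_simple[OF \<open>s < t\<close>])
        fix u assume "s \<le> u" "u \<le> t"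
        then have "((\<lambda>r. F (y t) r) has_real_derivative Ft (y t) u) (at u within {s..t})"
          using deriv_t[of u "y t"] st by (auto intro: DERIV_subset)
        then show "(F (y t) has_derivative (\<lambda>h. Ft (y t) u * h)) (at u within {s..t})"
          by (simp add: has_field_derivative_def)
      qed
      then show ?thesis by (simp add: mult.commute)
    qed
    then obtain u where u: "u \<in> {s<..<t}" "F (y t) t - F (y t) s = \<delta> * Ft (y t) u" unfolding \<delta>_def by blast
    have "\<bar>Ft (y t) u - Ft (y s) s\<bar> \<le> e + C2 * (\<delta> + D)"
      using jd[of t u] u st jet_components_le(1)[of "y t" u "y s" s] by (auto simp: a_def D_def)
    then have "\<bar>\<delta> * (Ft (y t) u - Ft (y s) s)\<bar> \<le> \<delta> * (e + C2 * (\<delta> + D))"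
      unfolding abs_mult using \<delta> by (intro mult_mono) auto
    also have "\<dots> = e * \<delta> + (C2 * \<delta>\<^sup>2 + C2 * (\<delta> * D))" by (simp add: power2_eq_square algebra_simps)
    also have "\<dots> \<le> e * E + (C2 * R + C2 * R)"
      using e E C20 R \<delta>D by (intro add_mono mult_left_mono) auto
    finally show ?thesis using u(2) by (simp add: algebra_simps)
  qed
  define \<Delta> where "\<Delta> = y t - y s"
  have \<Delta>: "\<Delta> = \<beta> + v" using y[of t] st by (simp add: \<Delta>_def \<beta>_def v_def)
  have \<Delta>2: "(norm \<Delta>)\<^sup>2 \<le> 2 * m\<^sup>2 * \<delta>\<^sup>2 + 2 * m\<^sup>2 * D" using yd[of t] st by (simp add: \<Delta>_def D_def)
  \<comment> \<open>Increment in space at the initial time, by Taylor's formula with the full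
    displacement \<open>\<Delta>\<close>.\<close>
  have IV: "\<bar>F (y t) s - F (y s) s - Fx (y s) s \<bullet> \<Delta> - 1/2 * (\<Delta> \<bullet> (Fxx (y s) s *v \<Delta>))\<bar>
      \<le> m\<^sup>2 * (L + 1) * (e * E) + 4 * C1 * m^4 * (L\<^sup>2 + 1) * R"
  proof -
    have s: "s \<in> {t0..T1}" using st by auto
    obtain \<theta> where \<theta>: "0 < \<theta>" "\<theta> < 1" "F (y s + \<Delta>) s = F (y s) s + Fx (y s) s \<bullet> \<Delta> + 1/2 * (\<Delta> \<bullet> (Fxx (y s + \<theta> *\<^sub>R \<Delta>) s *v \<Delta>))"
      using second_order_taylor[OF deriv_x[OF s] deriv_xx[OF s]] by blast
    have "F (y t) s - F (y s) s - Fx (y s) s \<bullet> \<Delta> - 1/2 * (\<Delta> \<bullet> (Fxx (y s) s *v \<Delta>))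
       = 1/2 * (\<Delta> \<bullet> ((Fxx (y s + \<theta> *\<^sub>R \<Delta>) s - Fxx (y s) s) *v \<Delta>))"
      using \<theta>(3) by (simp add: \<Delta>_def matrix_vector_mult_diff_rdistrib inner_diff_right)
    also have "\<bar>\<dots>\<bar> \<le> 1/2 * (norm \<Delta> * (norm (Fxx (y s + \<theta> *\<^sub>R \<Delta>) s - Fxx (y s) s) * norm \<Delta>))"
      unfolding abs_mult
      by (intro mult_mono order_trans[OF Cauchy_Schwarz_ineq2] norm_matrix_vector_mult_le) auto
    also have "\<dots> = 1/2 * ((norm \<Delta>)\<^sup>2 * norm (Fxx (y s + \<theta> *\<^sub>R \<Delta>) s - Fxx (y s) s))"
      by (simp add: power2_eq_square)
    also have "\<dots> \<le> 1/2 * ((norm \<Delta>)\<^sup>2 * (e + C1 * (norm \<Delta>)\<^sup>2))"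
    proof -
      have "norm (Fxx (y s + \<theta> *\<^sub>R \<Delta>) s - Fxx (y s) s) \<le> e + C1 * ((norm (\<theta> *\<^sub>R \<Delta>))\<^sup>2 + 0)"
        using mod[OF s s, of "y s + \<theta> *\<^sub>R \<Delta>" "y s"] jet_components_le(3)[of "y s + \<theta> *\<^sub>R \<Delta>" s "y s" s] by simp
      also have "\<dots> \<le> e + C1 * (norm \<Delta>)\<^sup>2"
      proof -
        have "norm (\<theta> *\<^sub>R \<Delta>) \<le> norm \<Delta>" using \<theta> mult_left_le_one_le[of "norm \<Delta>" \<theta>] by simp
        then have "(norm (\<theta> *\<^sub>R \<Delta>))\<^sup>2 \<le> (norm \<Delta>)\<^sup>2" by (intro power_mono) auto
        then show ?thesis using C1 by (simp add: mult_left_mono)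
      qed
      finally show ?thesis by (intro mult_left_mono) auto
    qed
    also have "\<dots> = 1/2 * e * (norm \<Delta>)\<^sup>2 + 1/2 * C1 * ((norm \<Delta>)\<^sup>2)\<^sup>2" by (simp add: power2_eq_square algebra_simps)
    also have "\<dots> \<le> 1/2 * e * (2 * m\<^sup>2 * (L + 1) * E) + 1/2 * C1 * (8 * m^4 * (L\<^sup>2 + 1) * R)"
    proof (intro add_mono mult_left_mono)
      have "2 * m\<^sup>2 * \<delta>\<^sup>2 \<le> 2 * m\<^sup>2 * (L * E)"
        using mult_mono[of \<delta> L \<delta> E] \<delta> E L0 by (intro mult_left_mono) (auto simp: power2_eq_square)
      moreover have "2 * m\<^sup>2 * D \<le> 2 * m\<^sup>2 * E" using E by (intro mult_left_mono) auto
      ultimately show "(norm \<Delta>)\<^sup>2 \<le> 2 * m\<^sup>2 * (L + 1) * E" using \<Delta>2 by (simp add: algebra_simps)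
      have "((norm \<Delta>)\<^sup>2)\<^sup>2 \<le> (2 * m\<^sup>2 * \<delta>\<^sup>2 + 2 * m\<^sup>2 * D)\<^sup>2" by (rule power_mono[OF \<Delta>2]) simp
      also have "\<dots> \<le> 2 * (2 * m\<^sup>2 * \<delta>\<^sup>2)\<^sup>2 + 2 * (2 * m\<^sup>2 * D)\<^sup>2"
        using sum_squares_bound[of "2 * m\<^sup>2 * \<delta>\<^sup>2" "2 * m\<^sup>2 * D"] by (simp add: power2_sum)
      also have "\<dots> = 8 * m^4 * (\<delta>\<^sup>2 * \<delta>\<^sup>2) + 8 * m^4 * D\<^sup>2" by (simp add: power2_eq_square power4_eq_xxxx)
      also have "\<dots> \<le> 8 * m^4 * (L\<^sup>2 * R) + 8 * m^4 * R"
        using R \<delta> L0 by (intro add_mono mult_left_mono mult_mono power_mono) auto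
      finally show "((norm \<Delta>)\<^sup>2)\<^sup>2 \<le> 8 * m^4 * (L\<^sup>2 + 1) * R" by (simp add: algebra_simps)
    qed (use e C1 in auto)
    finally show ?thesis by (simp add: algebra_simps)
  qed
  \<comment> \<open>The drift is removed from the quadratic term. The cross term is
    \<open>\<delta>\<close> times the unsquared Wiener increment and thus only of order 3/2;
    splitting it with weight \<open>e\<close> fits it into the two scales and produces the factor
    \<open>1/e\<close>.\<close>
  have V: "\<bar>1/2 * (\<Delta> \<bullet> (Fxx (y s) s *v \<Delta>)) - 1/2 * (v \<bullet> (Fxx (y s) s *v v))\<bar> \<le> K * m\<^sup>2 * (e * E) + K * m\<^sup>2 * (1 + 1/e) * R"
  proof -
    define nW where "nW = norm (W t - W s)"
    define X where "X = Fxx (y s) s"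
    have X: "\<bar>u \<bullet> (X *v u')\<bar> \<le> K * (norm u * norm u')" for u u'
    proof -
      have "\<bar>u \<bullet> (X *v u')\<bar> \<le> norm u * (norm X * norm u')"
        by (rule order_trans[OF Cauchy_Schwarz_ineq2 mult_left_mono[OF norm_matrix_vector_mult_le]]) simp
      also have "\<dots> \<le> norm u * (K * norm u')" using comp(2) by (intro mult_mono) (auto simp: X_def K0)
      finally show ?thesis by (simp add: ac_simps)
    qed
    have "\<Delta> \<bullet> (X *v \<Delta>) - v \<bullet> (X *v v) = \<beta> \<bullet> (X *v \<beta>) + \<beta> \<bullet> (X *v v) + v \<bullet> (X *v \<beta>)"
      by (simp add: \<Delta> matrix_vector_right_distrib inner_add_left inner_add_right)
    also have "\<bar>\<dots>\<bar> \<le> K * (norm \<beta> * norm \<beta>) + K * (norm \<beta> * norm v) + K * (norm v * norm \<beta>)"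
      using X[of \<beta> \<beta>] X[of \<beta> v] X[of v \<beta>] by linarith
    also have "\<dots> \<le> K * ((m * \<delta>) * (m * \<delta>)) + K * ((m * \<delta>) * (m * nW)) + K * ((m * nW) * (m * \<delta>))"
      using \<beta> v K0 m0 \<delta> by (intro add_mono mult_left_mono mult_mono) (auto simp: nW_def)
    also have "\<dots> = K * m\<^sup>2 * \<delta>\<^sup>2 + 2 * (K * m\<^sup>2) * (\<delta> * nW)" by (simp add: power2_eq_square algebra_simps)
    also have "\<dots> \<le> 2 * (K * m\<^sup>2) * R + 2 * (K * m\<^sup>2) * (e * E + 1/e * R)"
    proof (rule add_mono)
      show "K * m\<^sup>2 * \<delta>\<^sup>2 \<le> 2 * (K * m\<^sup>2) * R"
      proof -
        have "K * m\<^sup>2 * \<delta>\<^sup>2 \<le> K * m\<^sup>2 * R" using R K0 by (intro mult_left_mono) auto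
        moreover have "0 \<le> K * m\<^sup>2 * R" using R K0 by simp
        ultimately show ?thesis by linarith
      qed
      have "nW \<le> e + D / e"
      proof -
        have "0 \<le> e * nW" using e by (simp add: nW_def)
        then have "e * nW \<le> e\<^sup>2 + D" using sum_squares_bound[of e nW] unfolding D_def nW_def by linarith
        then show ?thesis using e by (simp add: field_simps power2_eq_square)
      qed
      then have "\<delta> * nW \<le> \<delta> * (e + D / e)" using \<delta> by (intro mult_left_mono) auto
      also have "\<dots> = e * \<delta> + 1/e * (\<delta> * D)" by (simp add: algebra_simps)
      also have "\<dots> \<le> e * E + 1/e * R" using e E \<delta>D by (intro add_mono mult_left_mono) auto
      finally show "2 * (K * m\<^sup>2) * (\<delta> * nW) \<le> 2 * (K * m\<^sup>2) * (e * E + 1/e * R)"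
        using K0 by (intro mult_left_mono) auto
    qed
    finally have *: "\<bar>\<Delta> \<bullet> (X *v \<Delta>) - v \<bullet> (X *v v)\<bar> \<le> 2 * (K * m\<^sup>2) * R + 2 * (K * m\<^sup>2) * (e * E + 1/e * R)" .
    have "\<bar>1/2 * (\<Delta> \<bullet> (X *v \<Delta>)) - 1/2 * (v \<bullet> (X *v v))\<bar> = 1/2 * \<bar>\<Delta> \<bullet> (X *v \<Delta>) - v \<bullet> (X *v v)\<bar>"
      by (simp add: abs_if)
    also have "\<dots> \<le> 1/2 * (2 * (K * m\<^sup>2) * R + 2 * (K * m\<^sup>2) * (e * E + 1/e * R))"
      using * by (intro mult_left_mono) auto
    also have "\<dots> = K * m\<^sup>2 * (e * E) + K * m\<^sup>2 * (1 + 1/e) * R" by (simp add: algebra_simps)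
    finally show ?thesis by (simp add: X_def)
  qed
  define X1 where "X1 = (LINT r:{s..t}|lborel. coef (b r) S (c r) \<bullet> (Z r *\<^sub>R jet (y r) r))"
  define X2 where "X2 = F (y t) t - F (y t) s - \<delta> * Ft (y s) s"
  define X3 where "X3 = F (y t) s - F (y s) s - Fx (y s) s \<bullet> \<Delta> - 1/2 * (\<Delta> \<bullet> (Fxx (y s) s *v \<Delta>))"
  define X4 where "X4 = 1/2 * (\<Delta> \<bullet> (Fxx (y s) s *v \<Delta>)) - 1/2 * (v \<bullet> (Fxx (y s) s *v v))"
  \<comment> \<open>Exact decomposition: frozen compensator, change of discount, increments in time
    and in space, and the correction of the quadratic term. The terms linear in
    \<open>\<beta>\<close> and \<open>\<Gamma>\<close> cancel here.\<close>
  have "F (y t) t * Z t - F (y s) s * z - X1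
      - z * (Fx (y s) s \<bullet> v + 1/2 * (v \<bullet> (Fxx (y s) s *v v) - \<delta> * (S \<bullet> Fxx (y s) s)))
    = - (X1 - (LINT r:{s..t}|lborel. coef (b r) S (c r) \<bullet> (z *\<^sub>R a)))
      + ((Z t - z) * F (y t) t + z * \<Gamma> * F (y s) s) + z * (X2 + X3 + X4)"
    unfolding Ia X2_def X3_def X4_def \<Delta> inner_add_right inner_commute[of \<beta>] by (simp add: algebra_simps)
  also have "\<bar>\<dots>\<bar> \<le> \<bar>X1 - (LINT r:{s..t}|lborel. coef (b r) S (c r) \<bullet> (z *\<^sub>R a))\<bar>
      + \<bar>(Z t - z) * F (y t) t + z * \<Gamma> * F (y s) s\<bar> + (\<bar>X2\<bar> + \<bar>X3\<bar> + \<bar>X4\<bar>)"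
  proof -
    have "\<bar>z * (X2 + X3 + X4)\<bar> \<le> 1 * (\<bar>X2\<bar> + \<bar>X3\<bar> + \<bar>X4\<bar>)"
      unfolding abs_mult using z by (intro mult_mono) auto
    moreover have "\<bar>- p + q + r\<bar> \<le> \<bar>p\<bar> + \<bar>q\<bar> + u" if "\<bar>r\<bar> \<le> u" for p q r u :: real
      using that by linarith
    ultimately show ?thesis by (simp only: mult_1)
  qed
  also have "\<dots> \<le> (M1 * (e * E) + M1 * (C2 + m * K) * R) + (m * (e * E) + (K * m\<^sup>2 + 2 * m * C2) * R)
      + ((e * E + 2 * C2 * R) + (m\<^sup>2 * (L + 1) * (e * E) + 4 * C1 * m^4 * (L\<^sup>2 + 1) * R) + (K * m\<^sup>2 * (e * E) + K * m\<^sup>2 * (1 + 1/e) * R))"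
    using I II III IV V unfolding X1_def X2_def X3_def X4_def by (intro add_mono)
  also have "\<dots> = (M1 + m + 1 + m\<^sup>2 * (L + 1) + K * m\<^sup>2) * (e * E)
      + (M1 * (C2 + m * K) + (K * m\<^sup>2 + 2 * m * C2) + 2 * C2 + 4 * C1 * m^4 * (L\<^sup>2 + 1) + K * m\<^sup>2 * (1 + 1 / e)) * R"
    by (simp only: ring_distribs mult_1 add_ac)
  finally show ?thesis unfolding X1_def Z_def E_def R_def M1_def .
qed

end

section \<open>Wiener processes adapted to a filtration\<close>

text \<open>The outcome comes first, as Fubini's theorem for
  \<open>M \<Otimes>\<^sub>M lborel\<close> expects, and time ranges over the whole line; processes
  given on an interval are clamped to it.\<close>

definition jointly_measurable :: "'a measure \<Rightarrow> (real \<Rightarrow> 'a \<Rightarrow> 'b::topological_space) \<Rightarrow> bool" where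
  "jointly_measurable N X \<longleftrightarrow> (\<lambda>z. X (snd z) (fst z)) \<in> borel_measurable (N \<Otimes>\<^sub>M borel)"

lemma jointly_measurable_section:
  "jointly_measurable N X \<Longrightarrow> \<omega> \<in> space N \<Longrightarrow> (\<lambda>r. X r \<omega>) \<in> borel_measurable borel"
  unfolding jointly_measurable_def by (drule measurable_compose[OF measurable_Pair1', rotated]) simp_all

lemma jointly_measurable_compose:
  "jointly_measurable N X \<Longrightarrow> f \<in> borel_measurable borel \<Longrightarrow> jointly_measurable N (\<lambda>r \<omega>. f (X r \<omega>))"
  unfolding jointly_measurable_def by (rule measurable_compose)

lemma jointly_measurable_subalgebra:
  assumes "subalgebra M N" "jointly_measurable N X" shows "jointly_measurable M X"
proof -
  have "(\<lambda>\<omega>. \<omega>) \<in> measurable M N" using assms(1) by (auto simp: subalgebra_def measurable_def)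
  then have "(\<lambda>z. (fst z, snd z)) \<in> measurable (M \<Otimes>\<^sub>M borel) (N \<Otimes>\<^sub>M borel)" by measurable
  from measurable_compose[OF this assms(2)[unfolded jointly_measurable_def]]
  show ?thesis by (simp add: jointly_measurable_def)
qed

lemma measurable_set_integral:
  fixes X :: "real \<Rightarrow> 'a \<Rightarrow> 'b::{banach, second_countable_topology}"
  assumes "jointly_measurable N X"
  shows "(\<lambda>\<omega>. LINT r:{a..b}|lborel. X r \<omega>) \<in> borel_measurable N"
  unfolding set_lebesgue_integral_def
proof (rule lborel.borel_measurable_lebesgue_integral)
  have "(\<lambda>z. indicator {a..b} (snd z) *\<^sub>R X (snd z) (fst z)) \<in> borel_measurable (N \<Otimes>\<^sub>M borel)"
    by (intro borel_measurable_scaleR assms[unfolded jointly_measurable_def]) measurable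
  then show "(\<lambda>(\<omega>, r). indicator {a..b} r *\<^sub>R X r \<omega>) \<in> borel_measurable (N \<Otimes>\<^sub>M lborel)"
    by (simp add: case_prod_beta' measurable_cong_sets[OF sets_pair_measure_cong[OF refl sets_lborel]])
qed

text \<open>A process with continuous paths is the pointwise limit of its evaluations on finer and finer grids.\<close>

lemma jointly_measurable_continuous:
  fixes X :: "real \<Rightarrow> 'a \<Rightarrow> 'b::metric_space"
  assumes X: "\<And>r. X r \<in> borel_measurable N" and c: "\<And>\<omega>. \<omega> \<in> space N \<Longrightarrow> continuous_on UNIV (\<lambda>r. X r \<omega>)"
  shows "jointly_measurable N X"
  unfolding jointly_measurable_def
proof (rule borel_measurable_LIMSEQ_metric)
  define gr where "gr n r = real_of_int \<lfloor>r * real (Suc n)\<rfloor> / real (Suc n)" for n r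
  show "(\<lambda>z. X (gr n (snd z)) (fst z)) \<in> borel_measurable (N \<Otimes>\<^sub>M borel)" for n
  proof -
    \<comment> \<open>The floor takes countably many values, and for each fixed value only one time
      of the process is involved.\<close>
    have "(\<lambda>z. (\<lambda>i z. X (real_of_int i / real (Suc n)) (fst z)) \<lfloor>snd z * real (Suc n)\<rfloor> z) \<in> borel_measurable (N \<Otimes>\<^sub>M borel)"
      by (rule measurable_compose_countable) (use X in measurable)
    then show ?thesis by (simp add: gr_def)
  qed
  fix z assume z: "z \<in> space (N \<Otimes>\<^sub>M (borel :: real measure))"
  have "(\<lambda>n. gr n r) \<longlonglongrightarrow> r" for r
  proof (rule LIMSEQ_I)
    fix e :: real assume "0 < e"
    then obtain n0 where n0: "inverse (real (Suc n0)) < e" using reals_Archimedean by blast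
    have "norm (gr n r - r) < e" if "n \<ge> n0" for n
    proof -
      have "\<bar>gr n r - r\<bar> = \<bar>real_of_int \<lfloor>r * real (Suc n)\<rfloor> - r * real (Suc n)\<bar> / real (Suc n)"
        by (simp add: gr_def field_simps abs_divide[symmetric] del: of_nat_Suc)
      also have "\<dots> \<le> 1 / real (Suc n)"
        by (intro divide_right_mono) (linarith, simp)
      also have "\<dots> \<le> inverse (real (Suc n0))" using that by (simp add: inverse_eq_divide frac_le)
      finally show ?thesis using n0 by simp
    qed
    then show "\<exists>no. \<forall>n\<ge>no. norm (gr n r - r) < e" by blast
  qed
  moreover have "fst z \<in> space N" using z by (auto simp: space_pair_measure)
  ultimately show "(\<lambda>n. X (gr n (snd z)) (fst z)) \<longlonglongrightarrow> X (snd z) (fst z)"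
    using continuous_on_tendsto_compose[OF c, of "fst z" "\<lambda>n. gr n (snd z)" "snd z" sequentially] by simp
qed

lemma borel_measurable_vec_component:
  "X \<in> borel_measurable N \<Longrightarrow> (\<lambda>\<omega>. (X \<omega> :: 'b::real_normed_vector ^ 'n) $ i) \<in> borel_measurable N"
  by (rule measurable_compose[of X N borel "\<lambda>v. v $ i"])
     (auto intro!: borel_measurable_continuous_onI continuous_intros)

lemma continuous_on_self_transpose: "continuous_on UNIV (\<lambda>A :: real ^ 'k ^ 'n. A ** transpose A)"
  unfolding matrix_matrix_mult_def transpose_def by (intro continuous_intros)

lemma borel_measurable_self_transpose[measurable]:
  "(\<lambda>A :: real ^ 'k ^ 'n. A ** transpose A) \<in> borel_measurable borel"
  by (intro borel_measurable_continuous_onI continuous_on_self_transpose)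

lemma continuous_on_matrix_vector: "continuous_on UNIV (\<lambda>z :: (real ^ 'k ^ 'n) \<times> (real ^ 'k). fst z *v snd z)"
  unfolding matrix_vector_mult_def by (intro continuous_intros)

lemma borel_measurable_matrix_vector:
  assumes "X \<in> borel_measurable N" "Y \<in> borel_measurable N"
  shows "(\<lambda>\<omega>. (X \<omega> :: real ^ 'k ^ 'n) *v Y \<omega>) \<in> borel_measurable N"
proof -
  have "(\<lambda>\<omega>. (\<lambda>z. fst z *v snd z) (X \<omega>, Y \<omega>)) \<in> borel_measurable N"
    by (rule borel_measurable_continuous_on[OF continuous_on_matrix_vector]) (use assms in measurable)
  then show ?thesis by simp
qed

lemma borel_measurable_coef:
  assumes "b \<in> borel_measurable N" "S \<in> borel_measurable N" "c \<in> borel_measurable N"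
  shows "(\<lambda>z. coef (b z) (S z) (c z)) \<in> borel_measurable N"
  unfolding coef_def using assms by measurable

text \<open>Independence of the increments from the past is stated through bounded weights
  \<open>Y\<close> measurable at time \<open>s\<close>, and only in its consequences for the
  expansion: mean, covariance, and a fourth moment of order \<open>(t - s)\<^sup>2\<close>. Paths
  are continuous for every outcome and on the whole line, which a modification will provide.\<close>

locale wiener_filtration = prob_space M
  for M :: "'a measure" +
  fixes Fl :: "real \<Rightarrow> 'a measure" and t0 T :: real and w :: "real \<Rightarrow> 'a \<Rightarrow> real ^ 'k" and Cw :: real
  assumes t0_less_T: "t0 < T"
    and subalg: "t \<in> {t0..T} \<Longrightarrow> subalgebra M (Fl t)"
    and filtration_mono: "t0 \<le> s \<Longrightarrow> s \<le> t \<Longrightarrow> t \<le> T \<Longrightarrow> sets (Fl s) \<subseteq> sets (Fl t)"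
    and w_measurable: "w r \<in> borel_measurable M"
    and w_adapted: "t \<in> {t0..T} \<Longrightarrow> w t \<in> borel_measurable (Fl t)"
    and w_continuous: "\<omega> \<in> space M \<Longrightarrow> continuous_on UNIV (\<lambda>r. w r \<omega>)"
    and w_mean: "t0 \<le> s \<Longrightarrow> s < t \<Longrightarrow> t \<le> T \<Longrightarrow> Y \<in> borel_measurable (Fl s) \<Longrightarrow>
       (\<And>\<omega>. \<omega> \<in> space M \<Longrightarrow> \<bar>Y \<omega>\<bar> \<le> B) \<Longrightarrow> expectation (\<lambda>\<omega>. Y \<omega> * (w t \<omega> - w s \<omega>) $ i) = 0"
    and w_covariance: "t0 \<le> s \<Longrightarrow> s < t \<Longrightarrow> t \<le> T \<Longrightarrow> Y \<in> borel_measurable (Fl s) \<Longrightarrow>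
       (\<And>\<omega>. \<omega> \<in> space M \<Longrightarrow> \<bar>Y \<omega>\<bar> \<le> B) \<Longrightarrow>
       expectation (\<lambda>\<omega>. Y \<omega> * ((w t \<omega> - w s \<omega>) $ i * (w t \<omega> - w s \<omega>) $ j)) = (if i = j then (t - s) * expectation Y else 0)"
    and w_fourth_integrable: "t0 \<le> s \<Longrightarrow> s < t \<Longrightarrow> t \<le> T \<Longrightarrow> integrable M (\<lambda>\<omega>. ((norm (w t \<omega> - w s \<omega>))\<^sup>2)\<^sup>2)"
    and w_fourth: "t0 \<le> s \<Longrightarrow> s < t \<Longrightarrow> t \<le> T \<Longrightarrow> expectation (\<lambda>\<omega>. ((norm (w t \<omega> - w s \<omega>))\<^sup>2)\<^sup>2) \<le> Cw * (t - s)\<^sup>2"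
begin

lemma space_filtration: "t \<in> {t0..T} \<Longrightarrow> space (Fl t) = space M"
  using subalg unfolding subalgebra_def by blast

lemma sets_filtration: "t \<in> {t0..T} \<Longrightarrow> A \<in> sets (Fl t) \<Longrightarrow> A \<in> sets M"
  using subalg unfolding subalgebra_def by blast

lemma measurable_filtration_M: "t \<in> {t0..T} \<Longrightarrow> X \<in> measurable (Fl t) N \<Longrightarrow> X \<in> measurable M N"
  using measurable_from_subalg[OF subalg] .

lemma measurable_filtration_mono:
  assumes "t0 \<le> s" "s \<le> t" "t \<le> T" "X \<in> measurable (Fl s) N" shows "X \<in> measurable (Fl t) N"
proof (rule measurable_from_subalg[OF _ assms(4)])
  show "subalgebra (Fl t) (Fl s)"
    using filtration_mono[OF assms(1-3)] space_filtration[of s] space_filtration[of t] assms by (auto simp: subalgebra_def)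
qed

lemma integrable_bounded:
  fixes X :: "'a \<Rightarrow> real"
  assumes "X \<in> borel_measurable M" "\<And>\<omega>. \<omega> \<in> space M \<Longrightarrow> \<bar>X \<omega>\<bar> \<le> B" shows "integrable M X"
  by (rule integrable_const_bound[of _ B]) (use assms in auto)

text \<open>The sign condition on \<open>B\<close> covers random variables that are not integrable,
  whose expectation is 0 by convention.\<close>

lemma abs_expectation_le:
  fixes X :: "'a \<Rightarrow> real"
  assumes "\<And>\<omega>. \<omega> \<in> space M \<Longrightarrow> \<bar>X \<omega>\<bar> \<le> B" "0 \<le> B" shows "\<bar>expectation X\<bar> \<le> B"
proof (cases "integrable M X")
  case True
  have "norm (expectation X) \<le> expectation (\<lambda>_. B)" by (rule norm_integral_le[OF True]) (use assms in auto)
  then show ?thesis by (simp add: prob_space)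
qed (use assms in \<open>simp add: not_integrable_integral_eq\<close>)

lemma w_increment_measurable: "(\<lambda>\<omega>. w t \<omega> - w s \<omega>) \<in> borel_measurable M"
  using w_measurable by measurable

text \<open>The fourth moment is the integrability that the locale provides, so integrands are
  compared with it; the polynomials that occur have degree at most 2.\<close>

lemma w_integrable_growth:
  assumes st: "t0 \<le> s" "s < t" "t \<le> T" and "p \<in> borel_measurable borel" "\<And>v. \<bar>p v\<bar> \<le> 1 + ((norm v)\<^sup>2)\<^sup>2"
    and "Y \<in> borel_measurable M" "\<And>\<omega>. \<omega> \<in> space M \<Longrightarrow> \<bar>Y \<omega>\<bar> \<le> B"
  shows "integrable M (\<lambda>\<omega>. Y \<omega> * (p (w t \<omega> - w s \<omega>) :: real))"
proof (rule Bochner_Integration.integrable_bound)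
  show "integrable M (\<lambda>\<omega>. B * (1 + ((norm (w t \<omega> - w s \<omega>))\<^sup>2)\<^sup>2))"
    using w_fourth_integrable[OF st] by simp
  show "(\<lambda>\<omega>. Y \<omega> * p (w t \<omega> - w s \<omega>)) \<in> borel_measurable M"
    by (intro borel_measurable_times assms measurable_compose[OF w_increment_measurable])
  show "AE \<omega> in M. norm (Y \<omega> * p (w t \<omega> - w s \<omega>)) \<le> norm (B * (1 + ((norm (w t \<omega> - w s \<omega>))\<^sup>2)\<^sup>2))"
  proof (rule AE_I2)
    fix \<omega> assume "\<omega> \<in> space M"
    then have Y: "\<bar>Y \<omega>\<bar> \<le> B" using assms by auto
    then have "\<bar>Y \<omega>\<bar> * \<bar>p (w t \<omega> - w s \<omega>)\<bar> \<le> B * (1 + ((norm (w t \<omega> - w s \<omega>))\<^sup>2)\<^sup>2)"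
      by (intro mult_mono assms(5)) auto
    then show "norm (Y \<omega> * p (w t \<omega> - w s \<omega>)) \<le> norm (B * (1 + ((norm (w t \<omega> - w s \<omega>))\<^sup>2)\<^sup>2))"
      using abs_ge_self order_trans by (fastforce simp: abs_mult)
  qed
qed

lemma abs_component_le_growth: "\<bar>v $ i\<bar> \<le> 1 + ((norm (v :: real ^ 'k))\<^sup>2)\<^sup>2"
  "\<bar>v $ i * v $ j\<bar> \<le> 1 + ((norm (v :: real ^ 'k))\<^sup>2)\<^sup>2" "(norm v)\<^sup>2 \<le> 1 + ((norm (v :: real ^ 'k))\<^sup>2)\<^sup>2"
proof -
  have a: "a \<le> 1 + a\<^sup>2" for a :: real
  proof (cases "a \<le> 1")
    case True then show ?thesis using zero_le_power2[of a] by linarith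
  next
    case False
    then have "a * 1 \<le> a * a" by (intro mult_left_mono) auto
    then show ?thesis by (simp add: power2_eq_square)
  qed
  show sq: "(norm v)\<^sup>2 \<le> 1 + ((norm v)\<^sup>2)\<^sup>2" by (rule a)
  show "\<bar>v $ i * v $ j\<bar> \<le> 1 + ((norm v)\<^sup>2)\<^sup>2"
    using sq mult_mono[OF component_le_norm_cart[of v i] component_le_norm_cart[of v j]] by (simp add: abs_mult power2_eq_square)
  show "\<bar>v $ i\<bar> \<le> 1 + ((norm v)\<^sup>2)\<^sup>2"
  proof (cases "norm v \<le> 1")
    case True then show ?thesis using component_le_norm_cart[of v i] zero_le_power2[of "(norm v)\<^sup>2"] by linarith
  next
    case False
    then have "norm v \<le> (norm v)\<^sup>2" using mult_left_mono[of 1 "norm v" "norm v"] by (simp add: power2_eq_square)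
    then show ?thesis using component_le_norm_cart[of v i] sq by linarith
  qed
qed

lemma w_second:
  assumes st: "t0 \<le> s" "s < t" "t \<le> T"
  shows "integrable M (\<lambda>\<omega>. (norm (w t \<omega> - w s \<omega>))\<^sup>2)"
    and "expectation (\<lambda>\<omega>. (norm (w t \<omega> - w s \<omega>))\<^sup>2) = real CARD('k) * (t - s)"
proof -
  have i: "integrable M (\<lambda>\<omega>. 1 * ((w t \<omega> - w s \<omega>) $ i * (w t \<omega> - w s \<omega>) $ i))" for i
  proof (rule w_integrable_growth[OF st, of "\<lambda>v. v $ i * v $ i" "\<lambda>_. 1" 1])
    show "(\<lambda>v :: real ^ 'k. v $ i * v $ i) \<in> borel_measurable borel"
      by (intro borel_measurable_times borel_measurable_vec_component) simp_all
  qed (rule abs_component_le_growth(2), simp_all)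
  have e: "expectation (\<lambda>\<omega>. 1 * ((w t \<omega> - w s \<omega>) $ i * (w t \<omega> - w s \<omega>) $ i)) = t - s" for i
    using w_covariance[OF st, of "\<lambda>_. 1" 1 i i] by (simp add: prob_space)
  have n: "(norm (w t \<omega> - w s \<omega>))\<^sup>2 = (\<Sum>i\<in>UNIV. 1 * ((w t \<omega> - w s \<omega>) $ i * (w t \<omega> - w s \<omega>) $ i))" for \<omega>
    unfolding power2_norm_eq_inner inner_vec_def by simp
  show "integrable M (\<lambda>\<omega>. (norm (w t \<omega> - w s \<omega>))\<^sup>2)" unfolding n by (intro Bochner_Integration.integrable_sum i)
  show "expectation (\<lambda>\<omega>. (norm (w t \<omega> - w s \<omega>))\<^sup>2) = real CARD('k) * (t - s)"
    unfolding n using i e by (subst Bochner_Integration.integral_sum) auto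
qed

text \<open>The mean of the remainder \<open>Q\<close> of the expansion, by Tonelli's theorem.
  Bounding \<open>r - s\<close> by \<open>t - s\<close> inside loses a factor 2, which is harmless
  since only the order counts.\<close>

lemma w_second_integral:
  assumes st: "t0 \<le> s" "s < t" "t \<le> T"
  shows "integrable M (\<lambda>\<omega>. LINT r:{s..t}|lborel. (norm (w r \<omega> - w s \<omega>))\<^sup>2)"
    and "expectation (\<lambda>\<omega>. LINT r:{s..t}|lborel. (norm (w r \<omega> - w s \<omega>))\<^sup>2) \<le> real CARD('k) * (t - s)\<^sup>2"
proof -
  interpret P: pair_sigma_finite M lborel ..
  define h where "h z = indicator {s..t} (snd z) *\<^sub>R (norm (w (snd z) (fst z) - w s (fst z)))\<^sup>2" for z
  have "jointly_measurable M w" using w_measurable w_continuous by (rule jointly_measurable_continuous)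
  then have [measurable]: "(\<lambda>z. w (snd z) (fst z)) \<in> borel_measurable (M \<Otimes>\<^sub>M borel)" by (simp add: jointly_measurable_def)
  have [measurable]: "w s \<in> borel_measurable M" by (rule w_measurable)
  have "h \<in> borel_measurable (M \<Otimes>\<^sub>M borel)" unfolding h_def by measurable
  then have mh[measurable]: "h \<in> borel_measurable (M \<Otimes>\<^sub>M lborel)"
    by (simp add: measurable_cong_sets[OF sets_pair_measure_cong[OF refl sets_lborel]])
  have e: "expectation (\<lambda>\<omega>. (norm (w r \<omega> - w s \<omega>))\<^sup>2) \<le> real CARD('k) * (t - s)"
       "integrable M (\<lambda>\<omega>. (norm (w r \<omega> - w s \<omega>))\<^sup>2)" if "r \<in> {s..t}" for r
  proof -
    \<comment> \<open>The moment facts require \<open>s < r\<close>; at \<open>r = s\<close> the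
      increment is zero.\<close>
    have rs: "r = s \<or> s < r" using that by auto
    then show "expectation (\<lambda>\<omega>. (norm (w r \<omega> - w s \<omega>))\<^sup>2) \<le> real CARD('k) * (t - s)"
      using w_second(2)[of s r] that st by (auto intro!: mult_left_mono)
    show "integrable M (\<lambda>\<omega>. (norm (w r \<omega> - w s \<omega>))\<^sup>2)"
      using rs w_second(1)[of s r] that st by auto
  qed
  have nn: "(\<integral>\<^sup>+z. ennreal (h z) \<partial>(M \<Otimes>\<^sub>M lborel)) \<le> ennreal (real CARD('k) * (t - s)\<^sup>2)"
  proof -
    have "(\<integral>\<^sup>+z. ennreal (h z) \<partial>(M \<Otimes>\<^sub>M lborel)) = (\<integral>\<^sup>+r. (\<integral>\<^sup>+\<omega>. ennreal (h (\<omega>, r)) \<partial>M) \<partial>lborel)"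
      by (subst P.nn_integral_snd[symmetric]) auto
    also have "\<dots> \<le> (\<integral>\<^sup>+r. ennreal (real CARD('k) * (t - s)) * indicator {s..t} r \<partial>lborel)"
    proof (rule nn_integral_mono)
      fix r :: real
      show "(\<integral>\<^sup>+\<omega>. ennreal (h (\<omega>, r)) \<partial>M) \<le> ennreal (real CARD('k) * (t - s)) * indicator {s..t} r"
      proof (cases "r \<in> {s..t}")
        case True
        then show ?thesis using e[OF True] by (simp add: h_def nn_integral_eq_integral ennreal_leI)
      qed (simp add: h_def)
    qed
    also have "\<dots> = ennreal (real CARD('k) * (t - s)\<^sup>2)"
      using st by (simp add: nn_integral_cmult ennreal_mult[symmetric] power2_eq_square)
    finally show ?thesis .
  qed
  have hn: "0 \<le> h z" for z by (simp add: h_def)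
  have ih: "integrable (M \<Otimes>\<^sub>M lborel) h"
    by (rule integrableI_nonneg) (use nn hn in \<open>auto intro: order_le_less_trans\<close>)
  have eq: "(LINT r:{s..t}|lborel. (norm (w r \<omega> - w s \<omega>))\<^sup>2) = (\<integral>r. h (\<omega>, r) \<partial>lborel)" for \<omega>
    by (simp add: set_lebesgue_integral_def h_def)
  show "integrable M (\<lambda>\<omega>. LINT r:{s..t}|lborel. (norm (w r \<omega> - w s \<omega>))\<^sup>2)"
    unfolding eq by (rule P.integrable_fst'[OF ih])
  have "ennreal (integral\<^sup>L (M \<Otimes>\<^sub>M lborel) h) = (\<integral>\<^sup>+z. ennreal (h z) \<partial>(M \<Otimes>\<^sub>M lborel))"
    by (rule nn_integral_eq_integral[OF ih, symmetric]) (simp add: hn)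
  then have "integral\<^sup>L (M \<Otimes>\<^sub>M lborel) h \<le> real CARD('k) * (t - s)\<^sup>2"
    using nn ennreal_le_iff[of "real CARD('k) * (t - s)\<^sup>2" "integral\<^sup>L (M \<Otimes>\<^sub>M lborel) h"] by simp
  then show "expectation (\<lambda>\<omega>. LINT r:{s..t}|lborel. (norm (w r \<omega> - w s \<omega>))\<^sup>2) \<le> real CARD('k) * (t - s)\<^sup>2"
    unfolding eq by (simp add: P.integral_fst'[OF ih])
qed

end

section \<open>Discounted test functions and their compensators\<close>

definition discount :: "real \<Rightarrow> (real \<Rightarrow> real) \<Rightarrow> real \<Rightarrow> real" where
  "discount t0 c r = exp (- (LINT u:{t0..r}|lborel. c u))"

lemma jointly_measurable_discount:
  assumes "jointly_measurable N c"
  shows "jointly_measurable N (\<lambda>r \<omega>. discount t0 (\<lambda>u. c u \<omega>) r)"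
proof -
  have [measurable]: "(\<lambda>z. c (snd z) (fst z)) \<in> borel_measurable (N \<Otimes>\<^sub>M borel)" using assms by (simp add: jointly_measurable_def)
  have "(\<lambda>z. \<integral>u. indicator {t0..snd z} u *\<^sub>R c u (fst z) \<partial>lborel) \<in> borel_measurable (N \<Otimes>\<^sub>M borel)"
  proof (rule lborel.borel_measurable_lebesgue_integral)
    have "(\<lambda>q. c (snd q) (fst (fst q))) \<in> borel_measurable ((N \<Otimes>\<^sub>M (borel :: real measure)) \<Otimes>\<^sub>M borel)"
      using measurable_compose[of "\<lambda>q. (fst (fst q), snd q)" "(N \<Otimes>\<^sub>M (borel :: real measure)) \<Otimes>\<^sub>M borel" "N \<Otimes>\<^sub>M borel" "\<lambda>z. c (snd z) (fst z)" borel]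
      by simp
    \<comment> \<open>The indicator becomes a condition on the triple, since the upper limit of
      integration moves with the time argument.\<close>
    moreover have "(\<lambda>q. if t0 \<le> snd q \<and> snd q \<le> snd (fst q) then 1 else 0 :: real) \<in> borel_measurable ((N \<Otimes>\<^sub>M (borel :: real measure)) \<Otimes>\<^sub>M borel)"
      by measurable
    ultimately have "(\<lambda>q. (if t0 \<le> snd q \<and> snd q \<le> snd (fst q) then 1 else 0) *\<^sub>R c (snd q) (fst (fst q))) \<in> borel_measurable ((N \<Otimes>\<^sub>M (borel :: real measure)) \<Otimes>\<^sub>M borel)"
      by (rule borel_measurable_scaleR[rotated])
    then show "(\<lambda>(z, u). indicator {t0..snd z} u *\<^sub>R c u (fst z)) \<in> borel_measurable ((N \<Otimes>\<^sub>M borel) \<Otimes>\<^sub>M lborel)"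
      by (simp add: case_prod_beta' indicator_def of_bool_def measurable_cong_sets[OF sets_pair_measure_cong[OF refl sets_lborel]])
  qed
  from measurable_compose[OF this, of "\<lambda>x. exp (- x)" borel]
  show ?thesis unfolding jointly_measurable_def discount_def set_lebesgue_integral_def by simp
qed

context test_function
begin

definition generator_rate :: "(real \<Rightarrow> real ^ 'n) \<Rightarrow> (real \<Rightarrow> real ^ 'n ^ 'n) \<Rightarrow> (real \<Rightarrow> real) \<Rightarrow> (real \<Rightarrow> real ^ 'n) \<Rightarrow> real \<Rightarrow> real" where
  "generator_rate b S c y r = coef (b r) (S r) (c r) \<bullet> (discount t0 c r *\<^sub>R jet (y r) r)"

text \<open>The deviation of the discounted test function along a path from its compensator; its mean is to be
  shown to vanish.\<close>

definition gap :: "(real \<Rightarrow> real ^ 'n) \<Rightarrow> (real \<Rightarrow> real ^ 'n ^ 'n) \<Rightarrow> (real \<Rightarrow> real) \<Rightarrow> (real \<Rightarrow> real ^ 'n) \<Rightarrow> real \<Rightarrow> real \<Rightarrow> real" where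
  "gap b S c y s t = F (y t) t * discount t0 c t - F (y s) s * discount t0 c s
     - (LINT r:{s..t}|lborel. generator_rate b S c y r)"

lemma gap_combine:
  assumes "s \<le> t" "t \<le> u" "set_integrable lborel {s..u} (generator_rate b S c y)"
  shows "gap b S c y s u = gap b S c y s t + gap b S c y t u"
  unfolding gap_def using set_integral_combine[OF assms] by simp

text \<open>The jet is continuous only on the closed time interval, hence the indicator: continuity
  on a closed set makes the extension by zero Borel.\<close>

lemma jointly_measurable_jet:
  assumes "jointly_measurable N y"
  shows "(\<lambda>z. indicator {t0..T1} (snd z) *\<^sub>R jet (y (snd z) (fst z)) (snd z)) \<in> borel_measurable (N \<Otimes>\<^sub>M borel)"
proof -
  have "(\<lambda>p. indicator (UNIV \<times> {t0..T1}) p *\<^sub>R (\<lambda>(y, r). jet y r) p) \<in> borel_measurable borel"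
    by (intro borel_measurable_continuous_on_indicator continuous_on_jet) (auto intro!: borel_closed closed_Times)
  moreover have "(\<lambda>z. (y (snd z) (fst z), snd z)) \<in> borel_measurable (N \<Otimes>\<^sub>M borel)"
    using assms unfolding jointly_measurable_def by measurable
  ultimately have "(\<lambda>z. (\<lambda>p. indicator (UNIV \<times> {t0..T1}) p *\<^sub>R (\<lambda>(y, r). jet y r) p) (y (snd z) (fst z), snd z)) \<in> borel_measurable (N \<Otimes>\<^sub>M borel)"
    by (rule measurable_compose[rotated])
  then show ?thesis by (simp add: indicator_def)
qed

lemma jointly_measurable_generator_rate:
  assumes "jointly_measurable N b" "jointly_measurable N S" "jointly_measurable N c" "jointly_measurable N y"
  shows "jointly_measurable N (\<lambda>r \<omega>. indicator {t0..T1} r * generator_rate (\<lambda>r. b r \<omega>) (\<lambda>r. S r \<omega>) (\<lambda>r. c r \<omega>) (\<lambda>r. y r \<omega>) r)"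
proof -
  have "(\<lambda>z. coef (b (snd z) (fst z)) (S (snd z) (fst z)) (c (snd z) (fst z)) \<bullet>
     (discount t0 (\<lambda>r. c r (fst z)) (snd z) *\<^sub>R (indicator {t0..T1} (snd z) *\<^sub>R jet (y (snd z) (fst z)) (snd z)))) \<in> borel_measurable (N \<Otimes>\<^sub>M borel)"
    using assms jointly_measurable_discount[OF assms(3), of t0] unfolding jointly_measurable_def
    by (intro borel_measurable_inner borel_measurable_coef borel_measurable_scaleR jointly_measurable_jet)
       (auto simp: jointly_measurable_def)
  then show ?thesis by (simp add: jointly_measurable_def generator_rate_def ac_simps)
qed

lemma jet_section_measurable: "t \<in> {t0..T1} \<Longrightarrow> (\<lambda>y. jet y t) \<in> borel_measurable borel"
proof (rule borel_measurable_continuous_onI)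
  assume t: "t \<in> {t0..T1}"
  have "continuous_on UNIV (\<lambda>y :: real ^ 'n. (\<lambda>(y, r). jet y r) (y, t))"
    by (rule continuous_on_compose2[OF continuous_on_jet]) (use t in \<open>auto intro!: continuous_intros\<close>)
  then show "continuous_on UNIV (\<lambda>y. jet y t)" by simp
qed

lemma components_measurable:
  assumes "t \<in> {t0..T1}" "X \<in> borel_measurable N"
  shows "(\<lambda>\<omega>. F (X \<omega>) t) \<in> borel_measurable N" "(\<lambda>\<omega>. Fx (X \<omega>) t) \<in> borel_measurable N"
    "(\<lambda>\<omega>. Fxx (X \<omega>) t) \<in> borel_measurable N"
proof -
  have j: "(\<lambda>\<omega>. jet (X \<omega>) t) \<in> borel_measurable N"
    by (rule measurable_compose[OF assms(2) jet_section_measurable[OF assms(1)]])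
  have e: "F y t = snd (snd (snd (jet y t)))" "Fx y t = fst (snd (jet y t))" "Fxx y t = fst (snd (snd (jet y t)))" for y
    by (simp_all add: jet_def)
  have c: "continuous_on UNIV f \<Longrightarrow> (\<lambda>\<omega>. f (jet (X \<omega>) t)) \<in> borel_measurable N" for f :: "_ \<Rightarrow> 'd::real_normed_vector"
    using borel_measurable_continuous_on[OF _ j] .
  show "(\<lambda>\<omega>. F (X \<omega>) t) \<in> borel_measurable N" "(\<lambda>\<omega>. Fx (X \<omega>) t) \<in> borel_measurable N"
    "(\<lambda>\<omega>. Fxx (X \<omega>) t) \<in> borel_measurable N"
    unfolding e by (rule c, intro continuous_intros)+
qed

lemma gap_measurable:
  assumes st: "t0 \<le> s" "s \<le> t" "t \<le> T1"
    and "jointly_measurable N b" "jointly_measurable N S" "jointly_measurable N c" "jointly_measurable N y"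
  shows "(\<lambda>\<omega>. gap (\<lambda>r. b r \<omega>) (\<lambda>r. S r \<omega>) (\<lambda>r. c r \<omega>) (\<lambda>r. y r \<omega>) s t) \<in> borel_measurable N"
proof -
  have sec: "(\<lambda>\<omega>. X r \<omega>) \<in> borel_measurable N" if "jointly_measurable N X" for X :: "real \<Rightarrow> 'a \<Rightarrow> 'd::topological_space" and r
  proof -
    have "(\<lambda>\<omega>. (\<omega>, r)) \<in> measurable N (N \<Otimes>\<^sub>M borel)" by measurable
    from measurable_compose[OF this that[unfolded jointly_measurable_def]] show ?thesis by simp
  qed
  have "(\<lambda>\<omega>. F (y r \<omega>) r * discount t0 (\<lambda>u. c u \<omega>) r) \<in> borel_measurable N" if "r \<in> {t0..T1}" for r
    using components_measurable(1)[OF that sec[OF assms(7)], of r] sec[OF jointly_measurable_discount[OF assms(6), of t0], of r]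
    by measurable
  moreover have "(\<lambda>\<omega>. LINT r:{s..t}|lborel. generator_rate (\<lambda>r. b r \<omega>) (\<lambda>r. S r \<omega>) (\<lambda>r. c r \<omega>) (\<lambda>r. y r \<omega>) r) \<in> borel_measurable N"
  proof -
    have "(LINT r:{s..t}|lborel. generator_rate (\<lambda>r. b r \<omega>) (\<lambda>r. S r \<omega>) (\<lambda>r. c r \<omega>) (\<lambda>r. y r \<omega>) r)
      = (LINT r:{s..t}|lborel. indicator {t0..T1} r * generator_rate (\<lambda>r. b r \<omega>) (\<lambda>r. S r \<omega>) (\<lambda>r. c r \<omega>) (\<lambda>r. y r \<omega>) r)" for \<omega>
      by (rule set_lebesgue_integral_cong) (use st in auto)
    then show ?thesis using measurable_set_integral[OF jointly_measurable_generator_rate[OF assms(4-7)]] by simp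
  qed
  ultimately show ?thesis unfolding gap_def using st by (intro borel_measurable_diff) auto
qed

end

locale ito_setting = test_function t0 T1 F Ft Fx Fxx K jet + wiener_filtration M Fl t0 T w Cw
  for t0 T1 T :: real and F :: "real ^ 'n \<Rightarrow> real \<Rightarrow> real" and Ft Fx Fxx K jet
    and M :: "'a measure" and Fl and w :: "real \<Rightarrow> 'a \<Rightarrow> real ^ 'k" and Cw +
  assumes horizon: "t0 \<le> T1" "T1 \<le> T"
begin

lemma generator_rate_integrable:
  assumes "b \<in> borel_measurable borel" "S \<in> borel_measurable borel" "c \<in> borel_measurable borel" "continuous_on UNIV y"
    and bd: "\<And>r. norm (b r) \<le> m" "\<And>r. norm (S r) \<le> m'" "\<And>r. 0 \<le> c r" "\<And>r. c r \<le> m" and st: "t0 \<le> s" "t \<le> T1"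
  shows "set_integrable lborel {s..t} (generator_rate b S c y)"
    and "r \<in> {s..t} \<Longrightarrow> \<bar>generator_rate b S c y r\<bar> \<le> (1 + 2 * m + m') * K"
proof -
  have m: "0 \<le> m" "0 \<le> m'" using order_trans[OF norm_ge_zero bd(1)] order_trans[OF norm_ge_zero bd(2)] by auto
  have Z: "0 \<le> discount t0 c r" "discount t0 c r \<le> 1" for r
    by (auto simp: discount_def intro!: set_integral_nonneg_real bd)
  show le: "\<bar>generator_rate b S c y r\<bar> \<le> (1 + 2 * m + m') * K" if "r \<in> {s..t}" for r
  proof -
    have "\<bar>generator_rate b S c y r\<bar> \<le> norm (coef (b r) (S r) (c r)) * norm (discount t0 c r *\<^sub>R jet (y r) r)"
      unfolding generator_rate_def by (rule Cauchy_Schwarz_ineq2)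
    also have "\<dots> \<le> (1 + 2 * m + m') * (1 * K)"
    proof (rule mult_mono)
      show "norm (coef (b r) (S r) (c r)) \<le> 1 + 2 * m + m'"
        using norm_coef_le[of "b r" "S r" "c r"] bd(1,2,3,4)[of r] by simp
      have "\<bar>discount t0 c r\<bar> * norm (jet (y r) r) \<le> 1 * K"
        using Z[of r] jet_bounded[of r "y r"] that st by (intro mult_mono) auto
      then show "norm (discount t0 c r *\<^sub>R jet (y r) r) \<le> 1 * K" by simp
    qed (use m in auto)
    finally show ?thesis by simp
  qed
  show "set_integrable lborel {s..t} (generator_rate b S c y)"
  proof (rule set_integrable_bounded[OF _ le[unfolded real_norm_def[symmetric]]])
    have ic: "set_integrable lborel {t0..T1} c"
      by (rule set_integrable_bounded[where B = m]) (use bd assms(3) in \<open>auto simp: set_borel_measurable_def\<close>)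
    have "continuous_on {t0..T1} (\<lambda>r. discount t0 c r *\<^sub>R jet (y r) r)"
      unfolding discount_def
      by (intro continuous_intros continuous_on_indefinite_set_integral ic continuous_on_jet_path continuous_on_subset[OF assms(4)]) auto
    then have "continuous_on {s..t} (\<lambda>r. discount t0 c r *\<^sub>R jet (y r) r)"
      by (rule continuous_on_subset) (use st in auto)
    then have "(\<lambda>r. indicator {s..t} r *\<^sub>R (discount t0 c r *\<^sub>R jet (y r) r)) \<in> borel_measurable borel"
      by (intro borel_measurable_continuous_on_indicator) auto
    from borel_measurable_inner[OF borel_measurable_coef[OF assms(1-3)] this]
    show "set_borel_measurable lborel {s..t} (generator_rate b S c y)"
      by (simp add: set_borel_measurable_def generator_rate_def ac_simps)
  qed
qed

lemma gap_bounded: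
  assumes "b \<in> borel_measurable borel" "S \<in> borel_measurable borel" "c \<in> borel_measurable borel" "continuous_on UNIV y"
    and bd: "\<And>r. norm (b r) \<le> m" "\<And>r. norm (S r) \<le> m'" "\<And>r. 0 \<le> c r" "\<And>r. c r \<le> m" and st: "t0 \<le> s" "s \<le> t" "t \<le> T1"
  shows "\<bar>gap b S c y s t\<bar> \<le> 2 * K + (1 + 2 * m + m') * K * (T1 - t0)"
proof -
  have m: "0 \<le> m" "0 \<le> m'" using order_trans[OF norm_ge_zero bd(1)] order_trans[OF norm_ge_zero bd(2)] by auto
  have K0: "0 \<le> K" using K_nonneg horizon by simp
  have Z: "\<bar>F (y r) r * discount t0 c r\<bar> \<le> K" if "r \<in> {t0..T1}" for r
  proof -
    have "\<bar>F (y r) r\<bar> * \<bar>discount t0 c r\<bar> \<le> K * 1"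
      using order_trans[OF jet_components_le(7) jet_bounded[OF that]] K0
      by (intro mult_mono) (auto simp: discount_def intro!: set_integral_nonneg_real bd)
    then show ?thesis by (simp add: abs_mult)
  qed
  have "norm (LINT r:{s..t}|lborel. generator_rate b S c y r) \<le> ((1 + 2 * m + m') * K) * (t - s)"
    by (rule set_integral_norm_le_const)
       (use generator_rate_integrable[OF assms(1-4), OF bd st(1,3)] st in \<open>auto simp: set_integrable_def set_borel_measurable_def\<close>)
  also have "\<dots> \<le> ((1 + 2 * m + m') * K) * (T1 - t0)" using st m K0 by (intro mult_left_mono) auto
  finally show ?thesis using Z[of s] Z[of t] st unfolding gap_def by auto
qed

text \<open>In coordinates this is a polynomial of degree 2 in the Wiener increment with bounded
  coefficients from the past. The linear part and the off-diagonal products have mean zero; the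
  diagonal products give \<open>t - s\<close> times the sum that the subtracted term consists
  of.\<close>

lemma mean_zero_increment:
  fixes \<xi> :: "'a \<Rightarrow> real ^ 'k ^ 'n"
  assumes st: "t0 \<le> s" "s < t" "t \<le> T"
    and [measurable]: "X \<in> borel_measurable (Fl s)" "D \<in> borel_measurable (Fl s)" "DD \<in> borel_measurable (Fl s)" "\<xi> \<in> borel_measurable (Fl s)"
    and bd: "\<And>\<omega>. \<omega> \<in> space M \<Longrightarrow> \<bar>X \<omega>\<bar> \<le> 1" "\<And>\<omega>. \<omega> \<in> space M \<Longrightarrow> norm (D \<omega>) \<le> B"
      "\<And>\<omega>. \<omega> \<in> space M \<Longrightarrow> norm (DD \<omega>) \<le> B" "\<And>\<omega>. \<omega> \<in> space M \<Longrightarrow> norm (\<xi> \<omega>) \<le> B"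
  defines "v \<equiv> \<lambda>\<omega>. \<xi> \<omega> *v (w t \<omega> - w s \<omega>)"
  defines "R \<equiv> \<lambda>\<omega>. X \<omega> * (D \<omega> \<bullet> v \<omega> + 1/2 * (v \<omega> \<bullet> (DD \<omega> *v v \<omega>) - (t - s) * ((\<xi> \<omega> ** transpose (\<xi> \<omega>)) \<bullet> DD \<omega>)))"
  shows "integrable M R" "expectation R = 0"
proof -
  have s: "s \<in> {t0..T}" using st by auto
  define W where "W \<omega> = w t \<omega> - w s \<omega>" for \<omega>
  \<comment> \<open>\<open>P a\<close> is the coefficient of \<open>W \<omega> $ a\<close> and
    \<open>Q a c\<close> that of \<open>W \<omega> $ a * W \<omega> $ c\<close>, an entry of
    transposed \<open>\<xi>\<close> times \<open>DD\<close> times \<open>\<xi>\<close>; both carry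
    the weight \<open>X\<close>.\<close>
  define P where "P a \<omega> = X \<omega> * (\<Sum>i\<in>UNIV. D \<omega> $ i * \<xi> \<omega> $ i $ a)" for a \<omega>
  define Q where "Q a c \<omega> = X \<omega> * (\<Sum>i\<in>UNIV. \<Sum>j\<in>UNIV. \<xi> \<omega> $ i $ a * DD \<omega> $ i $ j * \<xi> \<omega> $ j $ c)" for a c \<omega>
  have B0: "0 \<le> B"
  proof -
    obtain \<omega> where "\<omega> \<in> space M" using not_empty by blast
    then show ?thesis using order_trans[OF norm_ge_zero bd(2)] by blast
  qed
  have mD: "(\<lambda>\<omega>. D \<omega> $ i) \<in> borel_measurable (Fl s)" for i by (rule borel_measurable_vec_component) measurable
  have mX: "(\<lambda>\<omega>. \<xi> \<omega> $ i $ a) \<in> borel_measurable (Fl s)" for i a by (intro borel_measurable_vec_component) measurable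
  have mDD: "(\<lambda>\<omega>. DD \<omega> $ i $ j) \<in> borel_measurable (Fl s)" for i j by (intro borel_measurable_vec_component) measurable
  have mP: "P a \<in> borel_measurable (Fl s)" for a unfolding P_def using mD mX by measurable
  have mQ: "Q a c \<in> borel_measurable (Fl s)" for a c unfolding Q_def using mX mDD by measurable
  have entry: "\<bar>A $ i $ j\<bar> \<le> norm A" for A :: "real ^ 'x ^ 'y" and i j
    using component_le_norm_cart[of "A $ i" j] Finite_Cartesian_Product.norm_nth_le[of A i] by linarith
  have eD: "\<bar>D \<omega> $ i\<bar> \<le> B" and eX: "\<bar>\<xi> \<omega> $ i $ a\<bar> \<le> B" and eDD: "\<bar>DD \<omega> $ i $ j\<bar> \<le> B"
    if "\<omega> \<in> space M" for \<omega> i j a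
    using order_trans[OF component_le_norm_cart bd(2)[OF that]] order_trans[OF entry bd(4)[OF that]]
      order_trans[OF entry bd(3)[OF that]] by auto
  have bP: "\<bar>P a \<omega>\<bar> \<le> 1 * (\<Sum>i\<in>(UNIV::'n set). B * B)" if "\<omega> \<in> space M" for a \<omega>
    unfolding P_def abs_mult
  proof (rule mult_mono)
    show "\<bar>\<Sum>i\<in>UNIV. D \<omega> $ i * \<xi> \<omega> $ i $ a\<bar> \<le> (\<Sum>i\<in>(UNIV::'n set). B * B)"
      by (rule order_trans[OF sum_abs], rule sum_mono, unfold abs_mult, rule mult_mono)
         (simp_all add: eD eX that B0)
  qed (use bd that in auto)
  have bQ: "\<bar>Q a c \<omega>\<bar> \<le> 1 * (\<Sum>i\<in>(UNIV::'n set). \<Sum>j\<in>(UNIV::'n set). B * B * B)" if "\<omega> \<in> space M" for a c \<omega>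
    unfolding Q_def abs_mult
  proof (rule mult_mono)
    show "\<bar>\<Sum>i\<in>UNIV. \<Sum>j\<in>UNIV. \<xi> \<omega> $ i $ a * DD \<omega> $ i $ j * \<xi> \<omega> $ j $ c\<bar> \<le> (\<Sum>i\<in>(UNIV::'n set). \<Sum>j\<in>(UNIV::'n set). B * B * B)"
      by (rule order_trans[OF sum_abs], rule sum_mono, rule order_trans[OF sum_abs], rule sum_mono, unfold abs_mult, intro mult_mono)
         (simp_all add: eDD eX that B0)
  qed (use bd that in auto)
  have iP: "integrable M (\<lambda>\<omega>. P a \<omega> * W \<omega> $ a)" for a
    unfolding W_def
    by (rule w_integrable_growth[OF st, of "\<lambda>v. v $ a" "P a"])
       (use bP abs_component_le_growth(1) measurable_filtration_M[OF s mP] in \<open>auto intro!: borel_measurable_vec_component\<close>)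
  have iQ: "integrable M (\<lambda>\<omega>. Q a c \<omega> * (W \<omega> $ a * W \<omega> $ c))" for a c
    unfolding W_def
  proof (rule w_integrable_growth[OF st, of "\<lambda>v. v $ a * v $ c" "Q a c"])
    show "(\<lambda>v :: real ^ 'k. v $ a * v $ c) \<in> borel_measurable borel"
      by (intro borel_measurable_times borel_measurable_vec_component) simp_all
  qed (rule abs_component_le_growth(2) measurable_filtration_M[OF s mQ] bQ; assumption?)+
  have iQ0: "integrable M (Q a c)" for a c
    by (rule integrable_bounded[OF measurable_filtration_M[OF s mQ] bQ])
  have R: "R \<omega> = (\<Sum>a\<in>UNIV. P a \<omega> * W \<omega> $ a)
      + 1/2 * ((\<Sum>a\<in>UNIV. \<Sum>c\<in>UNIV. Q a c \<omega> * (W \<omega> $ a * W \<omega> $ c)) - (t - s) * (\<Sum>a\<in>UNIV. Q a a \<omega>))" for \<omega>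
  proof -
    have 1: "D \<omega> \<bullet> v \<omega> = (\<Sum>a\<in>UNIV. (\<Sum>i\<in>UNIV. D \<omega> $ i * \<xi> \<omega> $ i $ a) * W \<omega> $ a)"
      unfolding v_def W_def inner_vec_def matrix_vector_mult_def
      by (simp add: sum_distrib_left sum_distrib_right mult.assoc) (rule sum.swap)
    have "v \<omega> \<bullet> (DD \<omega> *v v \<omega>) = (\<Sum>i\<in>UNIV. (\<Sum>a\<in>UNIV. \<xi> \<omega> $ i $ a * W \<omega> $ a) * (\<Sum>j\<in>UNIV. DD \<omega> $ i $ j * (\<Sum>c\<in>UNIV. \<xi> \<omega> $ j $ c * W \<omega> $ c)))"
      unfolding v_def W_def inner_vec_def matrix_vector_mult_def by simp
    also have "\<dots> = (\<Sum>i\<in>UNIV. \<Sum>a\<in>UNIV. \<Sum>j\<in>UNIV. \<Sum>c\<in>UNIV. \<xi> \<omega> $ i $ a * DD \<omega> $ i $ j * \<xi> \<omega> $ j $ c * (W \<omega> $ a * W \<omega> $ c))"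
      unfolding sum_product unfolding sum_distrib_left by (intro sum.cong refl) (simp add: mult_ac)
    also have "\<dots> = (\<Sum>a\<in>UNIV. \<Sum>i\<in>UNIV. \<Sum>c\<in>UNIV. \<Sum>j\<in>UNIV. \<xi> \<omega> $ i $ a * DD \<omega> $ i $ j * \<xi> \<omega> $ j $ c * (W \<omega> $ a * W \<omega> $ c))"
      by (subst sum.swap) (intro sum.cong refl sum.swap)
    also have "\<dots> = (\<Sum>a\<in>UNIV. \<Sum>c\<in>UNIV. \<Sum>i\<in>UNIV. \<Sum>j\<in>UNIV. \<xi> \<omega> $ i $ a * DD \<omega> $ i $ j * \<xi> \<omega> $ j $ c * (W \<omega> $ a * W \<omega> $ c))"
      by (intro sum.cong refl sum.swap)
    finally have 2: "v \<omega> \<bullet> (DD \<omega> *v v \<omega>) = \<dots>" .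
    have "(\<xi> \<omega> ** transpose (\<xi> \<omega>)) \<bullet> DD \<omega> = (\<Sum>i\<in>UNIV. \<Sum>j\<in>UNIV. \<Sum>a\<in>UNIV. \<xi> \<omega> $ i $ a * DD \<omega> $ i $ j * \<xi> \<omega> $ j $ a)"
      unfolding inner_vec_def matrix_matrix_mult_def transpose_def
      by (simp add: sum_distrib_right) (intro sum.cong refl, simp add: mult_ac)
    also have "\<dots> = (\<Sum>i\<in>UNIV. \<Sum>a\<in>UNIV. \<Sum>j\<in>UNIV. \<xi> \<omega> $ i $ a * DD \<omega> $ i $ j * \<xi> \<omega> $ j $ a)"
      by (intro sum.cong refl sum.swap)
    also have "\<dots> = (\<Sum>a\<in>UNIV. \<Sum>i\<in>UNIV. \<Sum>j\<in>UNIV. \<xi> \<omega> $ i $ a * DD \<omega> $ i $ j * \<xi> \<omega> $ j $ a)" by (rule sum.swap)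
    finally have 3: "(\<xi> \<omega> ** transpose (\<xi> \<omega>)) \<bullet> DD \<omega> = \<dots>" .
    show ?thesis unfolding R_def 1 2 3 P_def Q_def
      unfolding sum_distrib_right ring_distribs sum_distrib_left
      by (intro arg_cong2[where f = "(+)"] arg_cong2[where f = "(-)"] sum.cong refl) (simp_all add: mult_ac)
  qed
  have R': "R = (\<lambda>\<omega>. (\<Sum>a\<in>UNIV. P a \<omega> * W \<omega> $ a)
      + 1/2 * ((\<Sum>a\<in>UNIV. \<Sum>c\<in>UNIV. Q a c \<omega> * (W \<omega> $ a * W \<omega> $ c)) - (t - s) * (\<Sum>a\<in>UNIV. Q a a \<omega>)))"
    using R by blast
  show "integrable M R" unfolding R'
    by (intro Bochner_Integration.integrable_add Bochner_Integration.integrable_diff integrable_mult_right Bochner_Integration.integrable_sum iP iQ iQ0)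
  have eP: "expectation (\<lambda>\<omega>. P a \<omega> * W \<omega> $ a) = 0" for a
    unfolding W_def by (rule w_mean[OF st mP bP])
  have eQ: "expectation (\<lambda>\<omega>. Q a c \<omega> * (W \<omega> $ a * W \<omega> $ c)) = (if a = c then (t - s) * expectation (Q a c) else 0)" for a c
    unfolding W_def by (rule w_covariance[OF st mQ bQ])
  have "expectation R = (\<Sum>a\<in>UNIV. expectation (\<lambda>\<omega>. P a \<omega> * W \<omega> $ a))
      + 1/2 * ((\<Sum>a\<in>UNIV. \<Sum>c\<in>UNIV. expectation (\<lambda>\<omega>. Q a c \<omega> * (W \<omega> $ a * W \<omega> $ c))) - (t - s) * (\<Sum>a\<in>UNIV. expectation (Q a a)))"
    unfolding R' using iP iQ iQ0
    by (simp add: Bochner_Integration.integral_add Bochner_Integration.integral_diff Bochner_Integration.integral_sum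
        Bochner_Integration.integrable_sum Bochner_Integration.integrable_diff)
  also have "\<dots> = 0" unfolding eP eQ by (simp add: sum.delta sum_distrib_left)
  finally show "expectation R = 0" .
qed

end

section \<open>Ito's formula in mean for a frozen integrand\<close>

lemma discount_split:
  assumes "t0 \<le> s" "s \<le> r" "set_integrable lborel {t0..r} c"
  shows "discount t0 c r = discount t0 c s * exp (- (LINT u:{s..r}|lborel. c u))"
  unfolding discount_def using set_integral_combine[OF assms] by (simp add: exp_add[symmetric])

context ito_setting
begin

text \<open>As a function of the right end, the mean of the gap weighted by \<open>A\<close> has
  increments controlled by the expansion, hence is constant, and it vanishes at \<open>u\<close>.
  The event is taken from time \<open>u\<close>, so that it belongs to the past of every
  intermediate \<open>s\<close>.\<close>

lemma gap_mean_zero_piece: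
  fixes \<xi> :: "'a \<Rightarrow> real ^ 'k ^ 'n" and b :: "real \<Rightarrow> 'a \<Rightarrow> real ^ 'n"
  assumes uv: "t0 \<le> u" "u \<le> v" "v \<le> T1"
    and jm: "jointly_measurable M b" "jointly_measurable M c" "jointly_measurable M y"
    and bd: "\<And>r \<omega>. \<omega> \<in> space M \<Longrightarrow> norm (b r \<omega>) \<le> m" "\<And>r \<omega>. \<omega> \<in> space M \<Longrightarrow> 0 \<le> c r \<omega>"
      "\<And>r \<omega>. \<omega> \<in> space M \<Longrightarrow> c r \<omega> \<le> m" "\<And>\<omega>. \<omega> \<in> space M \<Longrightarrow> norm (\<xi> \<omega>) \<le> m"
    and ad: "\<And>r. r \<in> {t0..T1} \<Longrightarrow> y r \<in> borel_measurable (Fl r)"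
      "\<And>r. r \<in> {t0..T1} \<Longrightarrow> (\<lambda>\<omega>. discount t0 (\<lambda>r. c r \<omega>) r) \<in> borel_measurable (Fl r)"
    and y_cont: "\<And>\<omega>. \<omega> \<in> space M \<Longrightarrow> continuous_on UNIV (\<lambda>r. y r \<omega>)"
    and \<xi>: "\<xi> \<in> borel_measurable (Fl u)"
    and y_eq: "\<And>r \<omega>. \<omega> \<in> space M \<Longrightarrow> r \<in> {u..v} \<Longrightarrow>
       y r \<omega> = y u \<omega> + (LINT q:{u..r}|lborel. b q \<omega>) + \<xi> \<omega> *v (w r \<omega> - w u \<omega>)"
    and A: "A \<in> sets (Fl u)"
  defines "G \<equiv> \<lambda>s t \<omega>. gap (\<lambda>r. b r \<omega>) (\<lambda>r. \<xi> \<omega> ** transpose (\<xi> \<omega>)) (\<lambda>r. c r \<omega>) (\<lambda>r. y r \<omega>) s t"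
  shows "expectation (\<lambda>\<omega>. indicator A \<omega> * G u v \<omega>) = 0"
proof -
  define \<Psi> where "\<Psi> t = expectation (\<lambda>\<omega>. indicator A \<omega> * G u t \<omega>)" for t
  have m0: "0 \<le> m"
  proof -
    obtain \<omega> where "\<omega> \<in> space M" using not_empty by blast
    then show ?thesis using order_trans[OF norm_ge_zero bd(1)] by blast
  qed
  have K0: "0 \<le> K" using K_nonneg horizon by simp
  have uT: "u \<in> {t0..T}" using uv horizon by auto
  have \<xi>M: "\<xi> \<in> borel_measurable M" by (rule measurable_filtration_M[OF uT \<xi>])
  have AM: "A \<in> sets M" by (rule sets_filtration[OF uT A])
  have jS: "jointly_measurable M (\<lambda>r \<omega>. \<xi> \<omega> ** transpose (\<xi> \<omega>))"
    unfolding jointly_measurable_def using \<xi>M by measurable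
  have secb: "(\<lambda>r. b r \<omega>) \<in> borel_measurable borel" and secc: "(\<lambda>r. c r \<omega>) \<in> borel_measurable borel"
    if "\<omega> \<in> space M" for \<omega>
    using jointly_measurable_section[OF jm(1) that] jointly_measurable_section[OF jm(2) that] by auto
  have S_le: "norm (\<xi> \<omega> ** transpose (\<xi> \<omega>)) \<le> m * m" if "\<omega> \<in> space M" for \<omega>
    using order_trans[OF norm_matrix_transpose_mult_le mult_mono[OF bd(4)[OF that] bd(4)[OF that] m0 norm_ge_zero]] .
  define BG where "BG = 2 * K + (1 + 2 * m + m * m) * K * (T1 - t0)"
  have G_bd: "\<bar>G s t \<omega>\<bar> \<le> BG" if "\<omega> \<in> space M" "t0 \<le> s" "s \<le> t" "t \<le> T1" for s t \<omega>
    unfolding G_def BG_def using that bd S_le secb secc y_cont by (intro gap_bounded) auto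
  have G_meas: "G s t \<in> borel_measurable M" if "t0 \<le> s" "s \<le> t" "t \<le> T1" for s t
    unfolding G_def by (rule gap_measurable[OF that jm(1) jS jm(2,3)])
  have iG: "integrable M (\<lambda>\<omega>. indicator A \<omega> * G s t \<omega>)" if "t0 \<le> s" "s \<le> t" "t \<le> T1" for s t
  proof (rule integrable_bounded[where B = BG])
    show "(\<lambda>\<omega>. indicator A \<omega> * G s t \<omega>) \<in> borel_measurable M" using G_meas[OF that] AM by measurable
    show "\<bar>indicator A \<omega> * G s t \<omega>\<bar> \<le> BG" if "\<omega> \<in> space M" for \<omega>
      using G_bd[OF that \<open>t0 \<le> s\<close> \<open>s \<le> t\<close> \<open>t \<le> T1\<close>] by (auto simp: indicator_def intro: order_trans[OF abs_ge_zero])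
  qed
  have ic: "set_integrable lborel {p..q} (\<lambda>r. c r \<omega>)" if "\<omega> \<in> space M" for p q \<omega>
    by (rule set_integrable_bounded[where B = m]) (use bd(2,3)[OF that] secc[OF that] in \<open>auto simp: set_borel_measurable_def\<close>)
  have ib: "set_integrable lborel {p..q} (\<lambda>r. b r \<omega>)" if "\<omega> \<in> space M" for p q \<omega>
    by (rule set_integrable_bounded[where B = m]) (use bd(1)[OF that] secb[OF that] in \<open>auto simp: set_borel_measurable_def\<close>)
  have Z01: "0 \<le> discount t0 (\<lambda>r. c r \<omega>) s" "discount t0 (\<lambda>r. c r \<omega>) s \<le> 1" if "\<omega> \<in> space M" for s \<omega>
    by (auto simp: discount_def intro!: set_integral_nonneg_real bd that)
  define k where "k = real CARD('k)"
  define L where "L = T1 - t0"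
  define A0 where "A0 = 1 + 2 * m + m\<^sup>2 + m + 1 + m\<^sup>2 * (L + 1) + K * m\<^sup>2"
  have L0: "0 \<le> L" using horizon by (simp add: L_def)
  have A0: "1 \<le> A0"
    using m0 K0 L0 mult_nonneg_nonneg[OF zero_le_power2[of m], of "L + 1"] mult_nonneg_nonneg[OF K0 zero_le_power2[of m]]
    by (auto simp: A0_def)
  have small: "\<exists>C. \<forall>s t. u \<le> s \<and> s \<le> t \<and> t \<le> v \<longrightarrow> \<bar>\<Psi> t - \<Psi> s\<bar> \<le> (e' + C * (t - s)) * (t - s)" if e': "0 < e'" for e'
  proof -
    \<comment> \<open>\<open>A0\<close> multiplies the first scale in the expansion and
      \<open>1 + k\<close> is the mean of \<open>(t - s) + D\<close> per unit of time, so the first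
      scale contributes exactly \<open>e'\<close>.\<close>
    define e where "e = e' / (A0 * (1 + k))"
    have e: "0 < e" using e' A0 by (auto simp: e_def k_def intro!: divide_pos_pos mult_pos_pos)
    obtain C1 where C1: "0 \<le> C1" "\<And>y z r s. r \<in> {t0..T1} \<Longrightarrow> s \<in> {t0..T1} \<Longrightarrow> norm (jet y r - jet z s) \<le> e + C1 * ((norm (y - z))\<^sup>2 + \<bar>r - s\<bar>)"
      using jet_modulus[OF e] by blast
    \<comment> \<open>The factor of the second scale in the expansion, with its constant
      \<open>C2\<close> written out.\<close>
    define C0 where "C0 = (1 + 2 * m + m\<^sup>2) * (C1 * (2 * m\<^sup>2 * (T1 - t0) + 2 * m\<^sup>2 + 1) + m * K) + (K * m\<^sup>2 + 2 * m * (C1 * (2 * m\<^sup>2 * (T1 - t0) + 2 * m\<^sup>2 + 1))) + 2 * (C1 * (2 * m\<^sup>2 * (T1 - t0) + 2 * m\<^sup>2 + 1)) + 4 * C1 * m^4 * (L\<^sup>2 + 1) + K * m\<^sup>2 * (1 + 1 / e)"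
    have C0: "0 \<le> C0" unfolding C0_def using m0 K0 C1(1) e horizon L0
      by (intro add_nonneg_nonneg mult_nonneg_nonneg) auto
    have main: "\<bar>\<Psi> t - \<Psi> s\<bar> \<le> (e' + (C0 * (1 + Cw + k)) * (t - s)) * (t - s)" if st: "u \<le> s" "s < t" "t \<le> v" for s t
    proof -
      have sT: "s \<in> {t0..T}" "s \<in> {t0..T1}" using st uv horizon by auto
      have stT: "t0 \<le> s" "s < t" "t \<le> T" using st uv horizon by auto
      have As: "A \<in> sets (Fl s)" using filtration_mono[of u s] A st uv horizon by auto
      have \<xi>s: "\<xi> \<in> borel_measurable (Fl s)" by (rule measurable_filtration_mono[OF _ _ _ \<xi>]) (use st uv horizon in auto)
      \<comment> \<open>The discount up to \<open>s\<close> is known at \<open>s\<close> and joins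
        the event as a weight bounded by 1.\<close>
      define X where "X \<omega> = indicator A \<omega> * discount t0 (\<lambda>r. c r \<omega>) s" for \<omega>
      define vv where "vv \<omega> = \<xi> \<omega> *v (w t \<omega> - w s \<omega>)" for \<omega>
      define R where "R \<omega> = X \<omega> * (Fx (y s \<omega>) s \<bullet> vv \<omega> + 1/2 * (vv \<omega> \<bullet> (Fxx (y s \<omega>) s *v vv \<omega>) - (t - s) * ((\<xi> \<omega> ** transpose (\<xi> \<omega>)) \<bullet> Fxx (y s \<omega>) s)))" for \<omega>
      have R: "integrable M R" "expectation R = 0"
      proof -
        have mX: "X \<in> borel_measurable (Fl s)"
          unfolding X_def by (intro borel_measurable_times borel_measurable_indicator As ad(2)[OF sT(2)])
        have bX: "\<bar>X \<omega>\<bar> \<le> 1" if "\<omega> \<in> space M" for \<omega>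
          using Z01[OF that, of s] by (simp add: X_def indicator_def)
        have bF: "norm (Fx (y s \<omega>) s) \<le> max K m" "norm (Fxx (y s \<omega>) s) \<le> max K m" for \<omega>
          using order_trans[OF jet_components_le(6) jet_bounded[OF sT(2)]] order_trans[OF jet_components_le(5) jet_bounded[OF sT(2)]]
          by (auto simp: le_max_iff_disj)
        have b\<xi>: "norm (\<xi> \<omega>) \<le> max K m" if "\<omega> \<in> space M" for \<omega> using bd(4)[OF that] by simp
        note mc = components_measurable(2,3)[OF sT(2) ad(1)[OF sT(2)]]
        show "integrable M R" unfolding R_def vv_def
          by (rule mean_zero_increment(1)[where X = X and D = "\<lambda>\<omega>. Fx (y s \<omega>) s" and DD = "\<lambda>\<omega>. Fxx (y s \<omega>) s" and \<xi> = \<xi> and B = "max K m"])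
             (use stT mX mc \<xi>s bX bF b\<xi> in blast)+
        show "expectation R = 0" unfolding R_def vv_def
          by (rule mean_zero_increment(2)[where X = X and D = "\<lambda>\<omega>. Fx (y s \<omega>) s" and DD = "\<lambda>\<omega>. Fxx (y s \<omega>) s" and \<xi> = \<xi> and B = "max K m"])
             (use stT mX mc \<xi>s bX bF b\<xi> in blast)+
      qed
      define D where "D \<omega> = (norm (w t \<omega> - w s \<omega>))\<^sup>2" for \<omega>
      define Q where "Q \<omega> = (LINT r:{s..t}|lborel. (norm (w r \<omega> - w s \<omega>))\<^sup>2)" for \<omega>
      have bound: "\<bar>indicator A \<omega> * G s t \<omega> - R \<omega>\<bar> \<le> A0 * (e * ((t - s) + D \<omega>)) + C0 * ((t - s)\<^sup>2 + (D \<omega>)\<^sup>2 + Q \<omega>)"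
        if \<omega>: "\<omega> \<in> space M" for \<omega>
      proof -
        define z where "z = discount t0 (\<lambda>r. c r \<omega>) s"
        have Zs: "discount t0 (\<lambda>r. c r \<omega>) r = z * exp (- (LINT u:{s..r}|lborel. c u \<omega>))" if "s \<le> r" for r
          unfolding z_def by (rule discount_split[OF _ that ic[OF \<omega>]]) (use stT in auto)
        have yst: "y r \<omega> = y s \<omega> + (LINT q:{s..r}|lborel. b q \<omega>) + \<xi> \<omega> *v (w r \<omega> - w s \<omega>)" if r: "r \<in> {s..t}" for r
        proof -
          have "(LINT q:{u..r}|lborel. b q \<omega>) = (LINT q:{u..s}|lborel. b q \<omega>) + (LINT q:{s..r}|lborel. b q \<omega>)"
            by (rule set_integral_combine) (use st r ib[OF \<omega>] in auto)
          then show ?thesis using y_eq[OF \<omega>, of r] y_eq[OF \<omega>, of s] st r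
            by (simp add: matrix_vector_mult_diff_distrib)
        qed
        have "\<bar>F (y t \<omega>) t * (z * exp (- (LINT u:{s..t}|lborel. c u \<omega>))) - F (y s \<omega>) s * z
          - (LINT r:{s..t}|lborel. coef (b r \<omega>) (\<xi> \<omega> ** transpose (\<xi> \<omega>)) (c r \<omega>) \<bullet> ((z * exp (- (LINT u:{s..r}|lborel. c u \<omega>))) *\<^sub>R jet (y r \<omega>) r))
          - z * (Fx (y s \<omega>) s \<bullet> vv \<omega> + 1/2 * (vv \<omega> \<bullet> (Fxx (y s \<omega>) s *v vv \<omega>) - (t - s) * ((\<xi> \<omega> ** transpose (\<xi> \<omega>)) \<bullet> Fxx (y s \<omega>) s)))\<bar>
          \<le> A0 * (e * ((t - s) + D \<omega>)) + C0 * ((t - s)\<^sup>2 + (D \<omega>)\<^sup>2 + Q \<omega>)"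
          unfolding A0_def C0_def L_def D_def Q_def vv_def
        proof (rule ito_increment_explicit[where b = "\<lambda>r. b r \<omega>" and c = "\<lambda>r. c r \<omega>" and y = "\<lambda>r. y r \<omega>"
              and W = "\<lambda>r. w r \<omega>" and \<xi> = "\<xi> \<omega>" and s = s and t = t and z = z and m = m and e = e and ?C1.0 = C1])
          show "continuous_on {s..t} (\<lambda>r. y r \<omega>)" by (rule continuous_on_subset[OF y_cont[OF \<omega>]]) simp
          show "0 \<le> z" "z \<le> 1" using Z01[OF \<omega>] by (auto simp: z_def)
          show "t0 \<le> s" "s \<le> t" "t \<le> T1" using stT st uv by auto
          show "norm (jet p q - jet p' q') \<le> e + C1 * ((norm (p - p'))\<^sup>2 + \<bar>q - q'\<bar>)"
            if "q \<in> {t0..T1}" "q' \<in> {t0..T1}" for p p' q q' by (rule C1(2)[OF that])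
          show "y r \<omega> = y s \<omega> + (LINT u:{s..r}|lborel. b u \<omega>) + \<xi> \<omega> *v (w r \<omega> - w s \<omega>)" if "r \<in> {s..t}" for r
            by (rule yst[OF that])
        qed (rule e C1(1) secb[OF \<omega>] secc[OF \<omega>] bd(1)[OF \<omega>] bd(2)[OF \<omega>] bd(3)[OF \<omega>] bd(4)[OF \<omega>] w_continuous[OF \<omega>])+
        also have "F (y t \<omega>) t * (z * exp (- (LINT u:{s..t}|lborel. c u \<omega>))) - F (y s \<omega>) s * z
          - (LINT r:{s..t}|lborel. coef (b r \<omega>) (\<xi> \<omega> ** transpose (\<xi> \<omega>)) (c r \<omega>) \<bullet> ((z * exp (- (LINT u:{s..r}|lborel. c u \<omega>))) *\<^sub>R jet (y r \<omega>) r))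
          = G s t \<omega>"
        proof -
          have "(LINT r:{s..t}|lborel. coef (b r \<omega>) (\<xi> \<omega> ** transpose (\<xi> \<omega>)) (c r \<omega>) \<bullet> ((z * exp (- (LINT u:{s..r}|lborel. c u \<omega>))) *\<^sub>R jet (y r \<omega>) r))
            = (LINT r:{s..t}|lborel. generator_rate (\<lambda>r. b r \<omega>) (\<lambda>r. \<xi> \<omega> ** transpose (\<xi> \<omega>)) (\<lambda>r. c r \<omega>) (\<lambda>r. y r \<omega>) r)"
            by (rule set_lebesgue_integral_cong) (auto simp: generator_rate_def Zs)
          then show ?thesis using st by (simp add: G_def gap_def Zs[of t] z_def[symmetric])
        qed
        finally have *: "\<bar>G s t \<omega> - z * (Fx (y s \<omega>) s \<bullet> vv \<omega> + 1/2 * (vv \<omega> \<bullet> (Fxx (y s \<omega>) s *v vv \<omega>) - (t - s) * ((\<xi> \<omega> ** transpose (\<xi> \<omega>)) \<bullet> Fxx (y s \<omega>) s)))\<bar>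
          \<le> A0 * (e * ((t - s) + D \<omega>)) + C0 * ((t - s)\<^sup>2 + (D \<omega>)\<^sup>2 + Q \<omega>)" .
        show ?thesis
        proof (cases "\<omega> \<in> A")
          case True then show ?thesis using * by (simp add: R_def X_def z_def)
        next
          case False then show ?thesis using order_trans[OF abs_ge_zero *] by (simp add: R_def X_def)
        qed
      qed
      have iD: "integrable M D" "expectation D = k * (t - s)"
        unfolding D_def k_def using w_second[OF stT] by auto
      have iD2: "integrable M (\<lambda>\<omega>. (D \<omega>)\<^sup>2)" "expectation (\<lambda>\<omega>. (D \<omega>)\<^sup>2) \<le> Cw * (t - s)\<^sup>2"
        unfolding D_def using w_fourth_integrable[OF stT] w_fourth[OF stT] by auto
      have iQ: "integrable M Q" "expectation Q \<le> k * (t - s)\<^sup>2"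
        unfolding Q_def k_def using w_second_integral[OF stT] by auto
      have "\<Psi> t - \<Psi> s = expectation (\<lambda>\<omega>. indicator A \<omega> * G s t \<omega>)"
      proof -
        have "indicator A \<omega> * G u t \<omega> = indicator A \<omega> * G u s \<omega> + indicator A \<omega> * G s t \<omega>" if "\<omega> \<in> space M" for \<omega>
          unfolding G_def using that st uv bd S_le secb secc y_cont
          by (subst gap_combine[of u s t]) (auto simp: distrib_left intro!: generator_rate_integrable(1)[of _ _ _ _ m "m * m"])
        then have "\<Psi> t = expectation (\<lambda>\<omega>. indicator A \<omega> * G u s \<omega> + indicator A \<omega> * G s t \<omega>)"
          unfolding \<Psi>_def by (intro Bochner_Integration.integral_cong) auto
        also have "\<dots> = \<Psi> s + expectation (\<lambda>\<omega>. indicator A \<omega> * G s t \<omega>)"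
          unfolding \<Psi>_def by (rule Bochner_Integration.integral_add) (use st uv in \<open>auto intro!: iG\<close>)
        finally show ?thesis by simp
      qed
      also have "\<dots> = expectation (\<lambda>\<omega>. indicator A \<omega> * G s t \<omega> - R \<omega>)"
        using R iG[of s t] st uv by (subst Bochner_Integration.integral_diff) auto
      also have "norm \<dots> \<le> expectation (\<lambda>\<omega>. A0 * (e * ((t - s) + D \<omega>)) + C0 * ((t - s)\<^sup>2 + (D \<omega>)\<^sup>2 + Q \<omega>))"
        by (rule norm_integral_le) (use R iG[of s t] st uv iD iD2 iQ bound in auto)
      also have "\<dots> = A0 * (e * ((t - s) + expectation D)) + C0 * ((t - s)\<^sup>2 + expectation (\<lambda>\<omega>. (D \<omega>)\<^sup>2) + expectation Q)"
        using iD(1) iD2(1) iQ(1) by (simp add: prob_space)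
      also have "\<dots> \<le> A0 * (e * ((t - s) + k * (t - s))) + C0 * ((t - s)\<^sup>2 + Cw * (t - s)\<^sup>2 + k * (t - s)\<^sup>2)"
        using iD(2) iD2(2) iQ(2) C0 e A0 by (intro add_mono mult_left_mono) auto
      also have "\<dots> = (A0 * (1 + k) * e + (C0 * (1 + Cw + k)) * (t - s)) * (t - s)"
        by (simp add: power2_eq_square algebra_simps)
      also have "A0 * (1 + k) * e = e'" using A0 by (simp add: e_def k_def add_nonneg_eq_0_iff)
      finally show ?thesis by simp
    qed
    have "\<bar>\<Psi> t - \<Psi> s\<bar> \<le> (e' + (C0 * (1 + Cw + k)) * (t - s)) * (t - s)" if "u \<le> s \<and> s \<le> t \<and> t \<le> v" for s t
      using main[of s t] that by (cases "s = t") auto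
    then show ?thesis by blast
  qed
  have "\<Psi> v = \<Psi> u" by (rule constant_of_small_increments[OF uv(2) small])
  moreover have "\<Psi> u = 0" unfolding \<Psi>_def G_def gap_def set_integral_Icc_same by simp
  ultimately show ?thesis by (simp add: \<Psi>_def)
qed

end

section \<open>Simple integrands\<close>

lemma simple_process_mono:
  assumes "simple_process Fl t0 T N p \<xi>" "i \<le> j" "j \<le> N"
  shows "p i \<le> p j"
  using assms(2,3)
proof (induction j rule: dec_induct)
  case (step n)
  then have "p n < p (Suc n)" using assms(1) by (auto simp: simple_process_def)
  then show ?case using step by auto
qed simp

lemma continuous_on_simple_integral:
  assumes "continuous_on UNIV (\<lambda>r. w r \<omega>)"
  shows "continuous_on UNIV (\<lambda>r. simple_integral w N p \<xi> r \<omega>)"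
proof -
  have "continuous_on UNIV (\<lambda>r. w (min r q) \<omega>)" for q
    by (rule continuous_on_compose2[OF assms]) (auto intro!: continuous_intros)
  then have "continuous_on UNIV (\<lambda>r. (\<lambda>z. fst z *v snd z) (\<xi> i \<omega>, w (min r (p (Suc i))) \<omega> - w (min r (p i)) \<omega>))" for i
    by (intro continuous_on_compose2[OF continuous_on_matrix_vector]) (auto intro!: continuous_intros)
  then show ?thesis unfolding simple_integral_def by (intro continuous_on_sum) simp
qed

text \<open>Within one interval of the partition a single summand moves: earlier ones are complete,
  and in later ones both minima equal the current time.\<close>

lemma simple_integral_increment:
  assumes sp: "simple_process Fl t0 T N p \<xi>" and i: "i < N" and u: "p i \<le> u" "u \<le> r" "r \<le> p (Suc i)"
  shows "simple_integral w N p \<xi> r \<omega> = simple_integral w N p \<xi> u \<omega> + \<xi> i \<omega> *v (w r \<omega> - w u \<omega>)"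
proof -
  have "\<xi> l \<omega> *v (w (min r (p (Suc l))) \<omega> - w (min r (p l)) \<omega>)
      = \<xi> l \<omega> *v (w (min u (p (Suc l))) \<omega> - w (min u (p l)) \<omega>) + (if l = i then \<xi> i \<omega> *v (w r \<omega> - w u \<omega>) else 0)"
    if l: "l < N" for l
  proof -
    consider "l < i" | "l = i" | "i < l" by linarith
    then show ?thesis
    proof cases
      case 1
      then have "p (Suc l) \<le> p i" "p l \<le> p (Suc l)" using simple_process_mono[OF sp] l i by auto
      then show ?thesis using 1 u by (simp add: min_absorb2)
    next
      case 2 then show ?thesis using u by (simp add: min_absorb1 min_absorb2 matrix_vector_mult_diff_distrib)
    next
      case 3
      then have "p (Suc i) \<le> p l" "p l \<le> p (Suc l)" using simple_process_mono[OF sp] l i by auto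
      then show ?thesis using 3 u by (simp add: min_absorb1)
    qed
  qed
  then have "simple_integral w N p \<xi> r \<omega> = (\<Sum>l<N. \<xi> l \<omega> *v (w (min u (p (Suc l))) \<omega> - w (min u (p l)) \<omega>) + (if l = i then \<xi> i \<omega> *v (w r \<omega> - w u \<omega>) else 0))"
    unfolding simple_integral_def by (intro sum.cong) auto
  also have "\<dots> = simple_integral w N p \<xi> u \<omega> + \<xi> i \<omega> *v (w r \<omega> - w u \<omega>)"
    using i by (simp add: sum.distrib simple_integral_def)
  finally show ?thesis .
qed

lemma simple_value_piece:
  assumes sp: "simple_process Fl t0 T N p \<xi>" and i: "i < N" and r: "p i < r" "r \<le> p (Suc i)"
  shows "simple_value N p \<xi> r \<omega> = \<xi> i \<omega>"
proof -
  have "indicator {p l<..p (Suc l)} r *\<^sub>R \<xi> l \<omega> = (if l = i then \<xi> i \<omega> else 0)" if l: "l < N" for l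
  proof -
    consider "l < i" | "l = i" | "i < l" by linarith
    then show ?thesis
    proof cases
      case 1 then have "p (Suc l) \<le> p i" using simple_process_mono[OF sp] l i by auto
      then show ?thesis using 1 r by (simp add: indicator_def)
    next
      case 2 then show ?thesis using r by (simp add: indicator_def)
    next
      case 3 then have "p (Suc i) \<le> p l" using simple_process_mono[OF sp] l i by auto
      then show ?thesis using 3 r by (simp add: indicator_def)
    qed
  qed
  then have "simple_value N p \<xi> r \<omega> = (\<Sum>l<N. if l = i then \<xi> i \<omega> else 0)"
    unfolding simple_value_def by (intro sum.cong) auto
  then show ?thesis using i by simp
qed

text \<open>The left end \<open>s\<close> is a Lebesgue null set. It has to be exempt because at a
  partition point a simple value still belongs to the preceding interval.\<close>

lemma (in test_function) gap_cong:
  assumes "\<And>r. s < r \<Longrightarrow> r \<le> t \<Longrightarrow> S r = S' r"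
  shows "gap b S c y s t = gap b S' c y s t"
proof -
  have half: "(LINT r:{s..t}|lborel. f r) = (LINT r:{s<..t}|lborel. f r)" for f :: "real \<Rightarrow> real"
    by (rule set_integral_discrete_difference[of "{s}"]) auto
  have "(LINT r:{s<..t}|lborel. generator_rate b S c y r) = (LINT r:{s<..t}|lborel. generator_rate b S' c y r)"
    by (rule set_lebesgue_integral_cong) (auto simp: generator_rate_def assms)
  then show ?thesis by (simp add: gap_def half)
qed

context ito_setting
begin

lemma simple_process_cutpoint: "simple_process Fl t0 T N p \<xi> \<Longrightarrow> i \<le> N \<Longrightarrow> p i \<in> {t0..T}"
  using simple_process_mono[of Fl t0 T N p \<xi> 0 i] simple_process_mono[of Fl t0 T N p \<xi> i N]
  by (auto simp: simple_process_def)

lemma simple_process_bounded: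
  assumes "simple_process Fl t0 T N p (\<xi> :: nat \<Rightarrow> 'a \<Rightarrow> real ^ 'k ^ 'n)"
  obtains B where "0 \<le> B" "\<And>i \<omega>. i < N \<Longrightarrow> \<omega> \<in> space M \<Longrightarrow> norm (\<xi> i \<omega>) \<le> B"
    "\<And>r \<omega>. \<omega> \<in> space M \<Longrightarrow> norm (simple_value N p \<xi> r \<omega>) \<le> B"
proof -
  have "\<exists>C. \<forall>\<omega>\<in>space M. norm (\<xi> i \<omega>) \<le> C" if "i < N" for i
  proof -
    have "space (Fl (p i)) = space M"
      by (rule space_filtration[OF simple_process_cutpoint[OF assms]]) (use that in simp)
    moreover have "\<exists>C. \<forall>\<omega>\<in>space (Fl (p i)). norm (\<xi> i \<omega>) \<le> C"
      using assms that unfolding simple_process_def by blast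
    ultimately show ?thesis by simp
  qed
  then obtain C where C: "\<And>i \<omega>. i < N \<Longrightarrow> \<omega> \<in> space M \<Longrightarrow> norm (\<xi> i \<omega>) \<le> C i" by metis
  have C0: "norm (\<xi> i \<omega>) \<le> \<bar>C i\<bar>" if "i < N" "\<omega> \<in> space M" for i \<omega> using C[OF that] by linarith
  show thesis
  proof (rule that[of "\<Sum>i<N. \<bar>C i\<bar>"])
    show "0 \<le> (\<Sum>i<N. \<bar>C i\<bar>)" by (rule sum_nonneg) simp
    show "norm (\<xi> i \<omega>) \<le> (\<Sum>i<N. \<bar>C i\<bar>)" if "i < N" "\<omega> \<in> space M" for i \<omega>
      by (rule order_trans[OF C0[OF that]], rule member_le_sum) (use that in auto)
    show "norm (simple_value N p \<xi> r \<omega>) \<le> (\<Sum>i<N. \<bar>C i\<bar>)" if "\<omega> \<in> space M" for r \<omega>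
      unfolding simple_value_def
    proof (rule sum_norm_le)
      fix i assume "i \<in> {..<N}"
      then show "norm (indicator {p i<..p (Suc i)} r *\<^sub>R \<xi> i \<omega>) \<le> \<bar>C i\<bar>"
        using C0[of i \<omega>] that by (auto simp: indicator_def)
    qed
  qed
qed

lemma simple_process_measurable:
  assumes "simple_process Fl t0 T N p (\<xi> :: nat \<Rightarrow> 'a \<Rightarrow> real ^ 'k ^ 'n)" "i < N"
  shows "\<xi> i \<in> borel_measurable M"
  using assms measurable_filtration_M[OF simple_process_cutpoint[OF assms(1), of i]] by (auto simp: simple_process_def)

lemma simple_value_measurable:
  assumes "simple_process Fl t0 T N p (\<xi> :: nat \<Rightarrow> 'a \<Rightarrow> real ^ 'k ^ 'n)"
  shows "jointly_measurable M (simple_value N p \<xi>)"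
  unfolding jointly_measurable_def simple_value_def
proof (rule borel_measurable_sum)
  fix i assume "i \<in> {..<N}"
  then have "\<xi> i \<in> borel_measurable M" using simple_process_measurable[OF assms] by auto
  then have "(\<lambda>z. \<xi> i (fst z)) \<in> borel_measurable (M \<Otimes>\<^sub>M (borel :: real measure))" by measurable
  then show "(\<lambda>z. indicator {p i<..p (Suc i)} (snd z) *\<^sub>R \<xi> i (fst z)) \<in> borel_measurable (M \<Otimes>\<^sub>M (borel :: real measure))"
    by (intro borel_measurable_scaleR) measurable
qed

lemma simple_integral_measurable:
  assumes "simple_process Fl t0 T N p (\<xi> :: nat \<Rightarrow> 'a \<Rightarrow> real ^ 'k ^ 'n)"
  shows "simple_integral w N p \<xi> r \<in> borel_measurable M"
    and "r \<in> {t0..T} \<Longrightarrow> simple_integral w N p \<xi> r \<in> borel_measurable (Fl r)"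
proof -
  have "(\<lambda>\<omega>. \<Sum>i<N. \<xi> i \<omega> *v (w (min r (p (Suc i))) \<omega> - w (min r (p i)) \<omega>)) \<in> borel_measurable M"
    by (intro borel_measurable_sum borel_measurable_matrix_vector borel_measurable_diff w_measurable simple_process_measurable[OF assms]) auto
  then show "simple_integral w N p \<xi> r \<in> borel_measurable M" by (simp add: simple_integral_def[abs_def])
  assume r: "r \<in> {t0..T}"
  have "(\<lambda>\<omega>. \<xi> i \<omega> *v (w (min r (p (Suc i))) \<omega> - w (min r (p i)) \<omega>)) \<in> borel_measurable (Fl r)" if "i \<in> {..<N}" for i
  proof (cases "p i \<le> r")
    case True
    have pi: "p i \<in> {t0..T}" "p (Suc i) \<in> {t0..T}" using simple_process_cutpoint[OF assms] that by auto
    have wm: "w q \<in> borel_measurable (Fl r)" if "q \<in> {t0..r}" for q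
      by (rule measurable_filtration_mono[of q]) (use that r w_adapted in auto)
    have "\<xi> i \<in> borel_measurable (Fl (p i))" using assms that by (auto simp: simple_process_def)
    then have "\<xi> i \<in> borel_measurable (Fl r)"
      by (rule measurable_filtration_mono[rotated 3]) (use pi r True in auto)
    then show ?thesis
      by (intro borel_measurable_matrix_vector borel_measurable_diff wm) (use pi r in auto)
  next
    \<comment> \<open>The piece has not begun: both minima equal \<open>r\<close>, so
      \<open>\<xi> i\<close>, known to be measurable only at the later time \<open>p i\<close>,
      drops out.\<close>
    case False
    moreover have "p i < p (Suc i)" using assms that by (auto simp: simple_process_def)
    ultimately show ?thesis by (simp add: min_absorb1)
  qed
  then show "simple_integral w N p \<xi> r \<in> borel_measurable (Fl r)"
    unfolding simple_integral_def[abs_def] by (rule borel_measurable_sum)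
qed

text \<open>On each interval of the partition the integrand is frozen, and an arbitrary interval is
  cut at the partition points. Time is clamped in the drift integral so that \<open>y\<close> is a
  continuous path on the whole line.\<close>

lemma gap_mean_zero_simple:
  fixes \<xi> :: "nat \<Rightarrow> 'a \<Rightarrow> real ^ 'k ^ 'n" and b :: "real \<Rightarrow> 'a \<Rightarrow> real ^ 'n" and x0 :: "real ^ 'n"
  assumes sp: "simple_process Fl t0 T N p \<xi>"
    and jm: "jointly_measurable M b" "jointly_measurable M c"
    and bd: "\<And>r \<omega>. \<omega> \<in> space M \<Longrightarrow> norm (b r \<omega>) \<le> m" "\<And>r \<omega>. \<omega> \<in> space M \<Longrightarrow> 0 \<le> c r \<omega>"
      "\<And>r \<omega>. \<omega> \<in> space M \<Longrightarrow> c r \<omega> \<le> m"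
    and ad: "\<And>r. r \<in> {t0..T} \<Longrightarrow> (\<lambda>\<omega>. LINT q:{t0..r}|lborel. b q \<omega>) \<in> borel_measurable (Fl r)"
      "\<And>r. r \<in> {t0..T} \<Longrightarrow> (\<lambda>\<omega>. discount t0 (\<lambda>r. c r \<omega>) r) \<in> borel_measurable (Fl r)"
  defines "y \<equiv> \<lambda>r \<omega>. x0 + (LINT q:{t0..max t0 (min T r)}|lborel. b q \<omega>) + simple_integral w N p \<xi> r \<omega>"
  assumes st: "t0 \<le> s" "s \<le> t" "t \<le> T1" and A: "A \<in> sets (Fl s)"
  defines "G \<equiv> \<lambda>s t \<omega>. gap (\<lambda>r. b r \<omega>) (\<lambda>r. simple_value N p \<xi> r \<omega> ** transpose (simple_value N p \<xi> r \<omega>)) (\<lambda>r. c r \<omega>) (\<lambda>r. y r \<omega>) s t"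
  shows "\<And>\<omega>. \<omega> \<in> space M \<Longrightarrow> continuous_on UNIV (\<lambda>r. y r \<omega>)"
    and "y r \<in> borel_measurable M"
    and "expectation (\<lambda>\<omega>. indicator A \<omega> * G s t \<omega>) = 0"
proof -
  obtain B where B: "0 \<le> B" "\<And>i \<omega>. i < N \<Longrightarrow> \<omega> \<in> space M \<Longrightarrow> norm (\<xi> i \<omega>) \<le> B"
    "\<And>r \<omega>. \<omega> \<in> space M \<Longrightarrow> norm (simple_value N p \<xi> r \<omega>) \<le> B"
    using simple_process_bounded[OF sp] by blast
  have secb: "(\<lambda>r. b r \<omega>) \<in> borel_measurable borel" and secc: "(\<lambda>r. c r \<omega>) \<in> borel_measurable borel"
    if "\<omega> \<in> space M" for \<omega>
    using jointly_measurable_section[OF jm(1) that] jointly_measurable_section[OF jm(2) that] by auto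
  have ib: "set_integrable lborel {u..q} (\<lambda>r. b r \<omega>)" if "\<omega> \<in> space M" for u q \<omega>
    by (rule set_integrable_bounded[where B = m]) (use bd(1)[OF that] secb[OF that] in \<open>auto simp: set_borel_measurable_def\<close>)
  show yc: "continuous_on UNIV (\<lambda>r. y r \<omega>)" if "\<omega> \<in> space M" for \<omega>
  proof -
    have "continuous_on UNIV (\<lambda>r. LINT q:{t0..max t0 (min T r)}|lborel. b q \<omega>)"
      by (rule continuous_on_compose2[OF continuous_on_indefinite_set_integral[OF ib[OF that], of t0 T]])
         (use t0_less_T in \<open>auto intro!: continuous_intros\<close>)
    then show ?thesis unfolding y_def
      by (intro continuous_intros continuous_on_simple_integral w_continuous[OF that])
  qed
  show yM: "y r \<in> borel_measurable M" for r
    unfolding y_def by (intro borel_measurable_add measurable_set_integral jm simple_integral_measurable[OF sp]) simp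
  have yj: "jointly_measurable M y" by (rule jointly_measurable_continuous[OF yM yc])
  have yF: "y r \<in> borel_measurable (Fl r)" if "r \<in> {t0..T}" for r
  proof -
    have "(\<lambda>\<omega>. x0 + (LINT q:{t0..r}|lborel. b q \<omega>) + simple_integral w N p \<xi> r \<omega>) \<in> borel_measurable (Fl r)"
      by (intro borel_measurable_add ad(1)[OF that] simple_integral_measurable(2)[OF sp that]) simp
    then show ?thesis unfolding y_def using that by simp
  qed
  define S where "S r \<omega> = simple_value N p \<xi> r \<omega> ** transpose (simple_value N p \<xi> r \<omega>)" for r \<omega>
  have jS: "jointly_measurable M S"
    unfolding S_def by (rule jointly_measurable_compose[OF simple_value_measurable[OF sp] borel_measurable_self_transpose])
  have S_le: "norm (S r \<omega>) \<le> B * B" if "\<omega> \<in> space M" for r \<omega>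
    unfolding S_def using order_trans[OF norm_matrix_transpose_mult_le mult_mono[OF B(3)[OF that] B(3)[OF that] B(1) norm_ge_zero]] .
  have secS: "(\<lambda>r. S r \<omega>) \<in> borel_measurable borel" if "\<omega> \<in> space M" for \<omega>
    using jointly_measurable_section[OF jS that] .
  have G: "G s t \<omega> = gap (\<lambda>r. b r \<omega>) (\<lambda>r. S r \<omega>) (\<lambda>r. c r \<omega>) (\<lambda>r. y r \<omega>) s t" for s t \<omega>
    by (simp add: G_def S_def)
  define BG where "BG = 2 * K + (1 + 2 * m + B * B) * K * (T1 - t0)"
  have G_bd: "\<bar>G s t \<omega>\<bar> \<le> BG" if "\<omega> \<in> space M" "t0 \<le> s" "s \<le> t" "t \<le> T1" for s t \<omega>
    unfolding G BG_def
    by (rule gap_bounded[OF secb[OF that(1)] secS[OF that(1)] secc[OF that(1)] yc[OF that(1)] bd(1)[OF that(1)] S_le[OF that(1)] bd(2,3)[OF that(1)] that(2-4)])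
  have iG: "integrable M (\<lambda>\<omega>. indicator A \<omega> * G s t \<omega>)" if A: "A \<in> sets M" and st: "t0 \<le> s" "s \<le> t" "t \<le> T1" for s t A
  proof (rule integrable_bounded[where B = BG])
    have "G s t \<in> borel_measurable M" unfolding G by (rule gap_measurable[OF st jm(1) jS jm(2) yj])
    then show "(\<lambda>\<omega>. indicator A \<omega> * G s t \<omega>) \<in> borel_measurable M"
      by (intro borel_measurable_times borel_measurable_indicator A)
    show "\<bar>indicator A \<omega> * G s t \<omega>\<bar> \<le> BG" if "\<omega> \<in> space M" for \<omega>
      using G_bd[OF that st] by (auto simp: indicator_def intro: order_trans[OF abs_ge_zero])
  qed
  have piece: "expectation (\<lambda>\<omega>. indicator A \<omega> * G s t \<omega>) = 0"
    if i: "i < N" and st: "p i \<le> s" "s \<le> t" "t \<le> p (Suc i)" "t \<le> T1" and A: "A \<in> sets (Fl s)" for i s t A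
  proof -
    have pi: "p i \<in> {t0..T}" "p (Suc i) \<in> {t0..T}" using simple_process_cutpoint[OF sp] i by auto
    have s: "t0 \<le> s" "s \<le> T" using st pi by auto
    have xi: "\<xi> i \<in> borel_measurable (Fl (p i))" using sp i by (auto simp: simple_process_def)
    have xs: "\<xi> i \<in> borel_measurable (Fl s)" by (rule measurable_filtration_mono[OF _ st(1) s(2) xi]) (use pi in auto)
    have eq: "G s t \<omega> = gap (\<lambda>r. b r \<omega>) (\<lambda>r. \<xi> i \<omega> ** transpose (\<xi> i \<omega>)) (\<lambda>r. c r \<omega>) (\<lambda>r. y r \<omega>) s t" for \<omega>
      unfolding G S_def by (rule gap_cong) (use simple_value_piece[OF sp i] st in auto)
    have "expectation (\<lambda>\<omega>. indicator A \<omega> * gap (\<lambda>r. b r \<omega>) (\<lambda>r. \<xi> i \<omega> ** transpose (\<xi> i \<omega>)) (\<lambda>r. c r \<omega>) (\<lambda>r. y r \<omega>) s t) = 0"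
    proof (rule gap_mean_zero_piece[where b = b and c = c and y = y and \<xi> = "\<xi> i" and m = "max m B" and u = s and v = t and A = A])
      show "y r \<in> borel_measurable (Fl r)" if "r \<in> {t0..T1}" for r using yF that horizon by auto
      show "(\<lambda>\<omega>. discount t0 (\<lambda>r. c r \<omega>) r) \<in> borel_measurable (Fl r)" if "r \<in> {t0..T1}" for r using ad(2) that horizon by auto
      show "y r \<omega> = y s \<omega> + (LINT q:{s..r}|lborel. b q \<omega>) + \<xi> i \<omega> *v (w r \<omega> - w s \<omega>)" if "\<omega> \<in> space M" "r \<in> {s..t}" for r \<omega>
      proof -
        have "simple_integral w N p \<xi> r \<omega> = simple_integral w N p \<xi> s \<omega> + \<xi> i \<omega> *v (w r \<omega> - w s \<omega>)"
          by (rule simple_integral_increment[OF sp i]) (use st that in auto)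
        moreover have "(LINT q:{t0..r}|lborel. b q \<omega>) = (LINT q:{t0..s}|lborel. b q \<omega>) + (LINT q:{s..r}|lborel. b q \<omega>)"
          by (rule set_integral_combine) (use s that ib in auto)
        moreover have "max t0 (min T r) = r" "max t0 (min T s) = s" using that st s horizon by auto
        ultimately show ?thesis by (simp add: y_def)
      qed
      show "norm (b r \<omega>) \<le> max m B" "c r \<omega> \<le> max m B" "norm (\<xi> i \<omega>) \<le> max m B" if "\<omega> \<in> space M" for r \<omega>
        using bd(1,3)[OF that, of r] B(2)[OF i that] by auto
    qed (rule s st jm yj bd xs A yc; assumption?)+
    then show ?thesis by (simp add: eq)
  qed
  \<comment> \<open>\<open>s\<close>, \<open>t\<close> and \<open>A\<close> are quantified because
    cutting at \<open>p i\<close> changes the right end in the induction hypothesis; the remaining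
    piece uses the same event at the later time \<open>p i\<close>.\<close>
  have "\<forall>s t A. t0 \<le> s \<longrightarrow> s \<le> t \<longrightarrow> t \<le> T1 \<longrightarrow> t \<le> p i \<longrightarrow> A \<in> sets (Fl s) \<longrightarrow> expectation (\<lambda>\<omega>. indicator A \<omega> * G s t \<omega>) = 0"
    if "i \<le> N" for i
    using that
  proof (induction i)
    case 0
    have "p 0 = t0" using sp by (simp add: simple_process_def)
    moreover have "G r r \<omega> = 0" for r \<omega> unfolding G_def gap_def set_integral_Icc_same by simp
    ultimately have "expectation (\<lambda>\<omega>. indicator A \<omega> * G s t \<omega>) = 0" if "t0 \<le> s" "s \<le> t" "t \<le> p 0" for s t A
    proof -
      have "s = t" using that \<open>p 0 = t0\<close> by linarith
      then show ?thesis using \<open>\<And>r \<omega>. G r r \<omega> = 0\<close> by simp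
    qed
    then show ?case by blast
  next
    case (Suc i)
    show ?case
    proof (intro allI impI)
      fix s t A assume st: "t0 \<le> s" "s \<le> t" "t \<le> T1" "t \<le> p (Suc i)" and A: "A \<in> sets (Fl s)"
      have iN: "i < N" using Suc by simp
      consider "t \<le> p i" | "p i \<le> s" | "s < p i" "p i < t" by linarith
      then show "expectation (\<lambda>\<omega>. indicator A \<omega> * G s t \<omega>) = 0"
      proof cases
        case 1 then show ?thesis using Suc st A by simp
      next
        case 2 show ?thesis by (rule piece[OF iN 2 st(2,4,3) A])
      next
        case 3
        have AM: "A \<in> sets M" using sets_filtration[OF _ A] st horizon by auto
        have Ai: "A \<in> sets (Fl (p i))" using filtration_mono[of s "p i"] A st 3 horizon by auto
        have "G s t \<omega> = G s (p i) \<omega> + G (p i) t \<omega>" if "\<omega> \<in> space M" for \<omega>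
          unfolding G by (rule gap_combine)
            (use 3 st generator_rate_integrable(1)[OF secb[OF that] secS[OF that] secc[OF that] yc[OF that] bd(1)[OF that] S_le[OF that] bd(2,3)[OF that]] in auto)
        then have "expectation (\<lambda>\<omega>. indicator A \<omega> * G s t \<omega>) = expectation (\<lambda>\<omega>. indicator A \<omega> * G s (p i) \<omega> + indicator A \<omega> * G (p i) t \<omega>)"
          by (intro Bochner_Integration.integral_cong) (auto simp: distrib_left)
        also have "\<dots> = expectation (\<lambda>\<omega>. indicator A \<omega> * G s (p i) \<omega>) + expectation (\<lambda>\<omega>. indicator A \<omega> * G (p i) t \<omega>)"
          by (rule Bochner_Integration.integral_add) (use 3 st AM in \<open>auto intro!: iG\<close>)
        also have "\<dots> = 0" using Suc.IH iN 3 st A piece[OF iN _ _ st(4,3) Ai] by simp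
        finally show ?thesis .
      qed
    qed
  qed
  from this[of N] show "expectation (\<lambda>\<omega>. indicator A \<omega> * G s t \<omega>) = 0"
    using st A horizon sp by (auto simp: simple_process_def)
qed

end

section \<open>Limits of simple integrands\<close>

text \<open>Young's inequality with a free weight: the product is at most
  \<open>1 + 1/\<kappa>\<close> times the squared error plus \<open>\<kappa>\<close> times the fixed
  square of \<open>\<eta>\<close>. It will control differences of covariances as well as of squared
  norms.\<close>

lemma L2_product_tendsto:
  fixes \<eta> :: "'x \<Rightarrow> 'b::{banach, second_countable_topology}"
  assumes [measurable]: "\<And>j. \<eta>j j \<in> borel_measurable N" "\<eta> \<in> borel_measurable N"
    and i: "integrable N (\<lambda>x. (norm (\<eta> x))\<^sup>2)" "\<And>j. integrable N (\<lambda>x. (norm (\<eta>j j x - \<eta> x))\<^sup>2)"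
    and lim: "(\<lambda>j. \<integral>x. (norm (\<eta>j j x - \<eta> x))\<^sup>2 \<partial>N) \<longlonglongrightarrow> 0"
  shows "integrable N (\<lambda>x. norm (\<eta>j j x - \<eta> x) * (norm (\<eta>j j x) + norm (\<eta> x)))"
    and "(\<lambda>j. \<integral>x. norm (\<eta>j j x - \<eta> x) * (norm (\<eta>j j x) + norm (\<eta> x)) \<partial>N) \<longlonglongrightarrow> 0"
proof -
  have le: "norm (\<eta>j j x - \<eta> x) * (norm (\<eta>j j x) + norm (\<eta> x)) \<le> (1 + 1/\<kappa>) * (norm (\<eta>j j x - \<eta> x))\<^sup>2 + \<kappa> * (norm (\<eta> x))\<^sup>2"
    if "\<kappa> > 0" for j x \<kappa>
  proof -
    define u v where "u = norm (\<eta>j j x - \<eta> x)" and "v = norm (\<eta> x)"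
    have "norm (\<eta>j j x) \<le> u + v" unfolding u_def v_def by (metis add.commute norm_triangle_sub)
    then have "u * (norm (\<eta>j j x) + v) \<le> u * (u + 2 * v)" by (intro mult_left_mono) (auto simp: u_def)
    moreover have "2 * (u * v) \<le> 1/\<kappa> * u\<^sup>2 + \<kappa> * v\<^sup>2"
    proof -
      have "0 \<le> (u - \<kappa> * v)\<^sup>2 / \<kappa>" using that by simp
      also have "\<dots> = 1/\<kappa> * u\<^sup>2 + \<kappa> * v\<^sup>2 - 2 * (u * v)" using that by (simp add: field_simps power2_eq_square)
      finally show ?thesis by simp
    qed
    ultimately show ?thesis unfolding u_def[symmetric] v_def[symmetric] by (simp add: algebra_simps power2_eq_square)
  qed
  have nn: "0 \<le> norm (\<eta>j j x - \<eta> x) * (norm (\<eta>j j x) + norm (\<eta> x))" for j x by simp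
  show int: "integrable N (\<lambda>x. norm (\<eta>j j x - \<eta> x) * (norm (\<eta>j j x) + norm (\<eta> x)))" for j
    by (rule Bochner_Integration.integrable_bound[of N "\<lambda>x. (1 + 1/1) * (norm (\<eta>j j x - \<eta> x))\<^sup>2 + 1 * (norm (\<eta> x))\<^sup>2"])
       (use i in \<open>auto intro!: AE_I2 order_trans[OF le[of 1]] simp: abs_mult\<close>)
  define V where "V = (\<integral>x. (norm (\<eta> x))\<^sup>2 \<partial>N)"
  have V0: "0 \<le> V" by (simp add: V_def)
  show "(\<lambda>j. \<integral>x. norm (\<eta>j j x - \<eta> x) * (norm (\<eta>j j x) + norm (\<eta> x)) \<partial>N) \<longlonglongrightarrow> 0"
  proof (rule tendstoI)
    fix e :: real assume e: "0 < e"
    \<comment> \<open>Makes the fixed part at most \<open>e/2\<close>; the summand 1 guards against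
      \<open>V = 0\<close>.\<close>
    define \<kappa> where "\<kappa> = e / (2 * (V + 1))"
    have \<kappa>: "0 < \<kappa>" "\<kappa> * V \<le> e / 2" using e V0 by (auto simp: \<kappa>_def field_simps)
    have "(\<lambda>j. (1 + 1/\<kappa>) * (\<integral>x. (norm (\<eta>j j x - \<eta> x))\<^sup>2 \<partial>N)) \<longlonglongrightarrow> 0"
      using tendsto_mult_right_zero[OF lim] .
    then have "\<forall>\<^sub>F j in sequentially. (1 + 1/\<kappa>) * (\<integral>x. (norm (\<eta>j j x - \<eta> x))\<^sup>2 \<partial>N) < e / 2"
      by (rule order_tendstoD(2)) (use e in simp)
    then show "\<forall>\<^sub>F j in sequentially. dist (\<integral>x. norm (\<eta>j j x - \<eta> x) * (norm (\<eta>j j x) + norm (\<eta> x)) \<partial>N) 0 < e"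
    proof eventually_elim
      case (elim j)
      have "(\<integral>x. norm (\<eta>j j x - \<eta> x) * (norm (\<eta>j j x) + norm (\<eta> x)) \<partial>N)
          \<le> (\<integral>x. (1 + 1/\<kappa>) * (norm (\<eta>j j x - \<eta> x))\<^sup>2 + \<kappa> * (norm (\<eta> x))\<^sup>2 \<partial>N)"
        by (rule integral_mono[OF int _ le[OF \<kappa>(1)]]) (use i in auto)
      also have "\<dots> = (1 + 1/\<kappa>) * (\<integral>x. (norm (\<eta>j j x - \<eta> x))\<^sup>2 \<partial>N) + \<kappa> * V"
        using i by (simp add: V_def)
      also have "\<dots> < e" using elim \<kappa>(2) by linarith
      finally show ?case using integral_nonneg_AE[of "\<lambda>x. norm (\<eta>j j x - \<eta> x) * (norm (\<eta>j j x) + norm (\<eta> x))" N] nn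
        by (simp add: dist_real_def)
    qed
  qed
qed

lemma set_integral_L1_tendsto:
  fixes f :: "real \<Rightarrow> 'b::{banach, second_countable_topology}"
  assumes f: "\<And>j. set_integrable lborel {a..b} (fj j)" "set_integrable lborel {a..b} f"
    and L1: "(\<lambda>j. LINT r:{a..b}|lborel. norm (fj j r - f r)) \<longlonglongrightarrow> 0" and ab: "a \<le> u" "v \<le> b"
  shows "(\<lambda>j. LINT r:{u..v}|lborel. fj j r) \<longlonglongrightarrow> (LINT r:{u..v}|lborel. f r)"
proof (rule LIM_zero_cancel, rule Lim_null_comparison[OF _ L1], rule always_eventually, rule allI)
  fix j
  have sub: "set_integrable lborel {u..v} (fj j)" "set_integrable lborel {u..v} f"
    using set_integrable_subset[OF f(1)] set_integrable_subset[OF f(2)] ab by auto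
  have d: "set_integrable lborel {a..b} (\<lambda>r. norm (fj j r - f r))"
    using integrable_norm[OF set_integral_diff(1)[OF f(1) f(2), unfolded set_integrable_def]]
    by (simp add: set_integrable_def)
  have "(LINT r:{u..v}|lborel. fj j r) - (LINT r:{u..v}|lborel. f r) = (LINT r:{u..v}|lborel. fj j r - f r)"
    using set_integral_diff(2)[OF sub] by simp
  also have "norm \<dots> \<le> (LINT r:{u..v}|lborel. norm (fj j r - f r))"
    by (rule set_integral_norm_le) (use set_integral_diff(1)[OF sub] set_integrable_subset[OF d, of "{u..v}"] ab in auto)
  also have "\<dots> \<le> (LINT r:{a..b}|lborel. norm (fj j r - f r))"
    unfolding set_lebesgue_integral_def
    by (rule integral_mono) (use set_integrable_subset[OF d, of "{u..v}"] d ab in \<open>auto simp: set_integrable_def indicator_def\<close>)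
  finally show "norm ((LINT r:{u..v}|lborel. fj j r) - (LINT r:{u..v}|lborel. f r)) \<le> (LINT r:{a..b}|lborel. norm (fj j r - f r))" .
qed

lemma tendsto_of_min_one:
  fixes a :: "nat \<Rightarrow> real"
  assumes "(\<lambda>j. min 1 (a j)) \<longlonglongrightarrow> 0" "\<And>j. 0 \<le> a j" shows "a \<longlonglongrightarrow> 0"
proof (rule tendstoI)
  fix e :: real assume "0 < e"
  then have "\<forall>\<^sub>F j in sequentially. min 1 (a j) < min 1 e"
    by (intro order_tendstoD(2)[OF assms(1)]) simp
  then show "\<forall>\<^sub>F j in sequentially. dist (a j) 0 < e"
    by eventually_elim (use assms(2) in \<open>auto simp: min_def split: if_splits\<close>)
qed

text \<open>Truncation at 1 turns convergence in probability into convergence in mean, also for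
  infinite values. Means can be added, integrated over time, and yield almost surely convergent
  subsequences.\<close>

lemma (in prob_space) vanishes_in_probability_expectation:
  assumes [measurable]: "\<And>j. e j \<in> borel_measurable M" and v: "vanishes_in_probability M e"
  shows "(\<lambda>j. expectation (\<lambda>\<omega>. enn2real (min 1 (e j \<omega>)))) \<longlonglongrightarrow> 0"
proof (rule tendstoI)
  fix d :: real assume d: "0 < d"
  define A where "A j = {\<omega> \<in> space M. ennreal (d/2) < e j \<omega>}" for j
  have A[measurable]: "A j \<in> sets M" for j unfolding A_def by measurable
  have "(\<lambda>j. measure M (A j)) \<longlonglongrightarrow> 0"
    using v d unfolding vanishes_in_probability_def A_def by (auto simp: ennreal_zero_less_divide)
  then have "\<forall>\<^sub>F j in sequentially. measure M (A j) < d / 2"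
    by (rule order_tendstoD(2)) (use d in simp)
  then show "\<forall>\<^sub>F j in sequentially. dist (expectation (\<lambda>\<omega>. enn2real (min 1 (e j \<omega>)))) 0 < d"
  proof eventually_elim
    case (elim j)
    have b: "enn2real (min 1 x) \<le> 1" for x :: ennreal
      by (rule enn2real_leI) (auto simp: min_def)
    have i1: "integrable M (\<lambda>\<omega>. enn2real (min 1 (e j \<omega>)))"
      by (rule integrable_const_bound[of _ 1]) (use b in auto)
    have i2: "integrable M (\<lambda>\<omega>. d/2 + indicator (A j) \<omega>)"
      using A by (intro Bochner_Integration.integrable_add integrable_const) (auto simp: emeasure_eq_measure)
    have "expectation (\<lambda>\<omega>. enn2real (min 1 (e j \<omega>))) \<le> expectation (\<lambda>\<omega>. d/2 + indicator (A j) \<omega>)"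
    proof (rule integral_mono[OF i1 i2])
      fix \<omega> assume w: "\<omega> \<in> space M"
      show "enn2real (min 1 (e j \<omega>)) \<le> d/2 + indicator (A j) \<omega>"
      proof (cases "\<omega> \<in> A j")
        case True then show ?thesis using b[of "e j \<omega>"] d by simp
      next
        case False
        then have "min 1 (e j \<omega>) \<le> ennreal (d/2)" using w by (auto simp: A_def not_less min_le_iff_disj)
        then have "enn2real (min 1 (e j \<omega>)) \<le> enn2real (ennreal (d/2))" by (rule enn2real_mono) simp
        then show ?thesis using d False by simp
      qed
    qed
    also have "\<dots> = d/2 + measure M (A j)"
      using A by (subst Bochner_Integration.integral_add) (auto simp: emeasure_eq_measure prob_space)
    finally show ?case using elim by (simp add: dist_real_def)
  qed
qed

context test_function
begin

text \<open>A statement about one fixed outcome. The coefficients converge in L1 and the discounted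
  jets boundedly almost everywhere; at the two ends, where \<open>F\<close> is evaluated,
  convergence of the paths is required separately.\<close>

lemma gap_tendsto:
  assumes st: "t0 \<le> s" "s \<le> t" "t \<le> T1"
    and [measurable]: "\<And>j. bj j \<in> borel_measurable borel" "\<And>j. Sj j \<in> borel_measurable borel" "\<And>j. cj j \<in> borel_measurable borel"
      "b \<in> borel_measurable borel" "S \<in> borel_measurable borel" "c \<in> borel_measurable borel"
    and ij: "\<And>j. set_integrable lborel {t0..T1} (bj j)" "\<And>j. set_integrable lborel {t0..T1} (Sj j)" "\<And>j. set_integrable lborel {t0..T1} (cj j)"
    and i: "set_integrable lborel {t0..T1} b" "set_integrable lborel {t0..T1} S" "set_integrable lborel {t0..T1} c"
    and c0: "\<And>j r. 0 \<le> cj j r" "\<And>r. 0 \<le> c r"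
    and L1: "(\<lambda>j. LINT r:{t0..T1}|lborel. norm (bj j r - b r)) \<longlonglongrightarrow> 0" "(\<lambda>j. LINT r:{t0..T1}|lborel. norm (Sj j r - S r)) \<longlonglongrightarrow> 0"
      "(\<lambda>j. LINT r:{t0..T1}|lborel. norm (cj j r - c r)) \<longlonglongrightarrow> 0"
    and y: "\<And>j. continuous_on UNIV (yj j)" "continuous_on UNIV y"
    and lim: "AE r in lborel. r \<in> {t0..T1} \<longrightarrow> (\<lambda>j. yj j r) \<longlonglongrightarrow> y r" "(\<lambda>j. yj j s) \<longlonglongrightarrow> y s" "(\<lambda>j. yj j t) \<longlonglongrightarrow> y t"
  shows "(\<lambda>j. gap (bj j) (Sj j) (cj j) (yj j) s t) \<longlonglongrightarrow> gap b S c y s t"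
proof -
  have Z: "(\<lambda>j. discount t0 (cj j) r) \<longlonglongrightarrow> discount t0 c r" if "r \<in> {t0..T1}" for r
    unfolding discount_def
    by (intro tendsto_intros set_integral_L1_tendsto[OF ij(3) i(3) L1(3)]) (use that in auto)
  have J: "(\<lambda>j. jet (yj j r) r) \<longlonglongrightarrow> jet (y r) r" if "r \<in> {t0..T1}" "(\<lambda>j. yj j r) \<longlonglongrightarrow> y r" for r
  proof -
    have "continuous_on UNIV (\<lambda>z. jet z r)"
    proof -
      have "continuous_on UNIV (\<lambda>z :: real ^ 'n. (\<lambda>(y, r). jet y r) (z, r))"
        by (rule continuous_on_compose2[OF continuous_on_jet]) (use that in \<open>auto intro!: continuous_intros\<close>)
      then show ?thesis by simp
    qed
    from continuous_on_tendsto_compose[OF this that(2)] show ?thesis by simp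
  qed
  have FZ: "(\<lambda>j. F (yj j r) r * discount t0 (cj j) r) \<longlonglongrightarrow> F (y r) r * discount t0 c r" if "r \<in> {t0..T1}" "(\<lambda>j. yj j r) \<longlonglongrightarrow> y r" for r
  proof -
    have "(\<lambda>j. snd (snd (snd (jet (yj j r) r)))) \<longlonglongrightarrow> snd (snd (snd (jet (y r) r)))" by (intro tendsto_snd J that)
    then have "(\<lambda>j. F (yj j r) r) \<longlonglongrightarrow> F (y r) r" by (simp add: jet_def)
    then show ?thesis by (intro tendsto_mult Z that)
  qed
  define Q where "Q j r = indicator {s..t} r *\<^sub>R coef (bj j r) (Sj j r) (cj j r)" for j r
  define q where "q r = indicator {s..t} r *\<^sub>R coef (b r) (S r) (c r)" for r
  define G where "G j r = indicator {s..t} r *\<^sub>R (discount t0 (cj j) r *\<^sub>R jet (yj j r) r)" for j r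
  define g where "g r = indicator {s..t} r *\<^sub>R (discount t0 c r *\<^sub>R jet (y r) r)" for r
  have coef_int: "integrable lborel (\<lambda>r. indicator {s..t} r *\<^sub>R coef (b r) (S r) (c r))"
    if [measurable]: "b \<in> borel_measurable borel" "S \<in> borel_measurable borel" "c \<in> borel_measurable borel"
    and int: "set_integrable lborel {t0..T1} b" "set_integrable lborel {t0..T1} S" "set_integrable lborel {t0..T1} c"
    for b :: "real \<Rightarrow> real ^ 'n" and S c
  proof (rule Bochner_Integration.integrable_bound)
    have n: "set_integrable lborel {t0..T1} (\<lambda>r. norm (h r))" if "set_integrable lborel {t0..T1} h" for h :: "real \<Rightarrow> 'z::{banach, second_countable_topology}"
      using integrable_norm[OF that[unfolded set_integrable_def]] by (simp add: set_integrable_def)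
    have "set_integrable lborel {t0..T1} (\<lambda>r. 1 + norm (b r) + norm (S r) + norm (c r))"
      by (intro set_integral_add(1) set_integrable_Icc_const n int)
    then have "set_integrable lborel {s..t} (\<lambda>r. 1 + norm (b r) + norm (S r) + norm (c r))"
      by (rule set_integrable_subset) (use st in auto)
    then show "integrable lborel (\<lambda>r. indicator {s..t} r *\<^sub>R (1 + norm (b r) + norm (S r) + norm (c r)))"
      by (simp add: set_integrable_def)
    show "(\<lambda>r. indicator {s..t} r *\<^sub>R coef (b r) (S r) (c r)) \<in> borel_measurable lborel"
      using borel_measurable_coef[OF that(1-3)] by measurable
    show "AE r in lborel. norm (indicator {s..t} r *\<^sub>R coef (b r) (S r) (c r)) \<le> norm (indicator {s..t} r *\<^sub>R (1 + norm (b r) + norm (S r) + norm (c r)))"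
      using norm_coef_le by (intro AE_I2) (auto simp: indicator_def)
  qed
  have G_meas: "(\<lambda>r. indicator {s..t} r *\<^sub>R (discount t0 c r *\<^sub>R jet (y r) r)) \<in> borel_measurable borel"
    if "set_integrable lborel {t0..T1} c" "continuous_on UNIV y" for c y
  proof -
    have "continuous_on {t0..T1} (\<lambda>r. discount t0 c r *\<^sub>R jet (y r) r)"
      unfolding discount_def
      by (intro continuous_intros continuous_on_indefinite_set_integral that continuous_on_jet_path continuous_on_subset[OF that(2)]) auto
    then have "continuous_on {s..t} (\<lambda>r. discount t0 c r *\<^sub>R jet (y r) r)"
      by (rule continuous_on_subset) (use st in auto)
    then show ?thesis by (intro borel_measurable_continuous_on_indicator) auto
  qed
  have rate: "(LINT r:{s..t}|lborel. generator_rate (bj j) (Sj j) (cj j) (yj j) r) = (\<integral>r. Q j r \<bullet> G j r \<partial>lborel)" for j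
    unfolding set_lebesgue_integral_def Q_def G_def generator_rate_def
    by (intro Bochner_Integration.integral_cong refl) (auto simp: indicator_def)
  have rate': "(LINT r:{s..t}|lborel. generator_rate b S c y r) = (\<integral>r. q r \<bullet> g r \<partial>lborel)"
    unfolding set_lebesgue_integral_def q_def g_def generator_rate_def
    by (intro Bochner_Integration.integral_cong refl) (auto simp: indicator_def)
  have "(\<lambda>j. \<integral>r. Q j r \<bullet> G j r \<partial>lborel) \<longlonglongrightarrow> (\<integral>r. q r \<bullet> g r \<partial>lborel)"
  proof (rule inner_integral_tendsto[where K = K])
    show iQ: "integrable lborel (Q j)" for j unfolding Q_def by (rule coef_int) (use ij in auto)
    show iq: "integrable lborel q" unfolding q_def by (rule coef_int) (use i in auto)
    show "G j \<in> borel_measurable lborel" for j unfolding G_def[abs_def] using G_meas[OF ij(3) y(1)] by simp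
    show "g \<in> borel_measurable lborel" unfolding g_def[abs_def] using G_meas[OF i(3) y(2)] by simp
    show "AE r in lborel. (\<lambda>j. G j r) \<longlonglongrightarrow> g r"
      using lim(1)
    proof eventually_elim
      case (elim r)
      show ?case
      proof (cases "r \<in> {s..t}")
        case True
        then have "r \<in> {t0..T1}" using st by auto
        then show ?thesis unfolding G_def g_def using elim by (intro tendsto_scaleR tendsto_const Z J) auto
      qed (simp add: G_def g_def)
    qed
    show "norm (G j r) \<le> K" for j r
    proof (cases "r \<in> {s..t}")
      case True
      then have r: "r \<in> {t0..T1}" using st by auto
      have "\<bar>discount t0 (cj j) r\<bar> * norm (jet (yj j r) r) \<le> 1 * K"
        using jet_bounded[OF r] by (intro mult_mono) (auto simp: discount_def intro!: set_integral_nonneg_real c0)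
      then show ?thesis using True by (simp add: G_def)
    qed (use K_nonneg st in \<open>simp add: G_def\<close>)
    have n: "set_integrable lborel {t0..T1} (\<lambda>r. norm (h j r - h' r))" if "\<And>j. set_integrable lborel {t0..T1} (h j)" "set_integrable lborel {t0..T1} h'"
      for h and h' :: "real \<Rightarrow> 'z::{banach, second_countable_topology}" and j :: nat
      using integrable_norm[OF set_integral_diff(1)[OF that(1) that(2), unfolded set_integrable_def]]
      by (simp add: set_integrable_def)
    define B where "B j = (LINT r:{t0..T1}|lborel. norm (bj j r - b r) + norm (Sj j r - S r) + norm (cj j r - c r))" for j
    have iB: "set_integrable lborel {t0..T1} (\<lambda>r. norm (bj j r - b r) + norm (Sj j r - S r) + norm (cj j r - c r))" for j
      by (intro set_integral_add(1) n ij i)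
    have "B j = (LINT r:{t0..T1}|lborel. norm (bj j r - b r)) + (LINT r:{t0..T1}|lborel. norm (Sj j r - S r)) + (LINT r:{t0..T1}|lborel. norm (cj j r - c r))" for j
      unfolding B_def
      by (subst set_integral_add(2), intro set_integral_add(1) n ij i, intro n ij i, subst set_integral_add(2), (intro n ij i)+, simp)
    then have "B = (\<lambda>j. (LINT r:{t0..T1}|lborel. norm (bj j r - b r)) + (LINT r:{t0..T1}|lborel. norm (Sj j r - S r)) + (LINT r:{t0..T1}|lborel. norm (cj j r - c r)))" by blast
    then have B0: "B \<longlonglongrightarrow> 0" using tendsto_add[OF tendsto_add[OF L1(1,2)] L1(3)] by simp
    show "(\<lambda>j. \<integral>r. norm (Q j r - q r) \<partial>lborel) \<longlonglongrightarrow> 0"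
    proof (rule Lim_null_comparison[OF _ B0], rule always_eventually, rule allI)
      fix j
      have "norm (\<integral>r. norm (Q j r - q r) \<partial>lborel) = (\<integral>r. norm (Q j r - q r) \<partial>lborel)"
        by simp
      also have "\<dots> \<le> B j" unfolding B_def set_lebesgue_integral_def
      proof (rule integral_mono)
        show "integrable lborel (\<lambda>r. norm (Q j r - q r))" using iQ iq by simp
        show "integrable lborel (\<lambda>r. indicator {t0..T1} r *\<^sub>R (norm (bj j r - b r) + norm (Sj j r - S r) + norm (cj j r - c r)))"
          using iB by (simp add: set_integrable_def)
        show "norm (Q j r - q r) \<le> indicator {t0..T1} r *\<^sub>R (norm (bj j r - b r) + norm (Sj j r - S r) + norm (cj j r - c r))" for r
          using norm_coef_diff_le[of "bj j r" "Sj j r" "cj j r" "b r" "S r" "c r"] st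
          by (auto simp: Q_def q_def indicator_def)
      qed
      finally show "norm (\<integral>r. norm (Q j r - q r) \<partial>lborel) \<le> B j" .
    qed
  qed
  then show ?thesis unfolding gap_def rate rate'
    by (intro tendsto_diff FZ lim) (use st in auto)
qed

text \<open>If the discount rate dominates the coefficients, the compensator is bounded no matter
  how large they are, because \<open>c\<close> discounted by its own integral has total at most 1.
  This provides the majorant for limits in the coefficients.\<close>

lemma gap_bounded_discounted:
  assumes st: "t0 \<le> s" "s \<le> t" "t \<le> T1"
    and [measurable]: "b \<in> borel_measurable borel" "S \<in> borel_measurable borel" "c \<in> borel_measurable borel"
    and c: "set_integrable lborel {t0..T1} c" "\<And>r. 0 \<le> c r"
    and dom: "\<And>r. norm (b r) + norm (S r) \<le> \<kappa> * c r" and \<kappa>: "0 \<le> \<kappa>" and y: "continuous_on UNIV y"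
  shows "set_integrable lborel {t0..T1} (generator_rate b S c y)"
    and "\<bar>gap b S c y s t\<bar> \<le> 2 * K + (K * (T1 - t0) + K * (\<kappa> + 1))"
proof -
  have K0: "0 \<le> K" using K_nonneg st by simp
  have Z: "0 \<le> discount t0 c r" "discount t0 c r \<le> 1" for r
    by (auto simp: discount_def intro!: set_integral_nonneg_real c)
  have tT: "t0 \<le> T1" using st by simp
  have icZ: "set_integrable lborel {t0..T1} (\<lambda>r. c r * discount t0 c r)"
    and lcZ: "(LINT r:{t0..T1}|lborel. c r * discount t0 c r) \<le> 1"
    using discounted_total_integrable[OF c tT] discounted_total_le[OF c tT] unfolding discount_def by auto
  \<comment> \<open>The constant part comes from the time derivative, whose coefficient is 1; the
    factor \<open>\<kappa> + 1\<close> collects drift, covariance and killing.\<close>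
  define H where "H r = K + (K * (\<kappa> + 1)) * (c r * discount t0 c r)" for r
  have iH: "set_integrable lborel {t0..T1} H"
    unfolding H_def by (intro set_integral_add(1) set_integrable_Icc_const set_integrable_mult_right icZ)
  have le: "\<bar>generator_rate b S c y r\<bar> \<le> H r" if r: "r \<in> {t0..T1}" for r
  proof -
    have "\<bar>generator_rate b S c y r\<bar> \<le> norm (coef (b r) (S r) (c r)) * norm (discount t0 c r *\<^sub>R jet (y r) r)"
      unfolding generator_rate_def by (rule Cauchy_Schwarz_ineq2)
    also have "\<dots> \<le> (1 + (\<kappa> + 1) * c r) * (discount t0 c r * K)"
    proof (rule mult_mono)
      show "norm (coef (b r) (S r) (c r)) \<le> 1 + (\<kappa> + 1) * c r"
        using norm_coef_le[of "b r" "S r" "c r"] dom[of r] c(2)[of r] by (simp add: distrib_right)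
      show "norm (discount t0 c r *\<^sub>R jet (y r) r) \<le> discount t0 c r * K"
        using Z[of r] jet_bounded[OF r, of "y r"] by (simp add: mult_left_mono)
    qed (use c(2) \<kappa> in auto)
    also have "\<dots> = K * discount t0 c r + (K * (\<kappa> + 1)) * (c r * discount t0 c r)" by (simp add: algebra_simps)
    also have "\<dots> \<le> H r" unfolding H_def using Z[of r] K0 mult_left_mono[of "discount t0 c r" 1 K] by simp
    finally show ?thesis .
  qed
  show i: "set_integrable lborel {t0..T1} (generator_rate b S c y)"
  proof (rule set_integrable_bound[OF iH])
    have "continuous_on {t0..T1} (\<lambda>r. discount t0 c r *\<^sub>R jet (y r) r)"
      unfolding discount_def
      by (intro continuous_intros continuous_on_indefinite_set_integral c continuous_on_jet_path continuous_on_subset[OF y]) auto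
    then have "(\<lambda>r. indicator {t0..T1} r *\<^sub>R (discount t0 c r *\<^sub>R jet (y r) r)) \<in> borel_measurable borel"
      by (intro borel_measurable_continuous_on_indicator) auto
    from borel_measurable_inner[OF borel_measurable_coef[OF assms(4-6)] this]
    show "set_borel_measurable lborel {t0..T1} (generator_rate b S c y)"
      by (simp add: set_borel_measurable_def generator_rate_def ac_simps)
    show "AE r in lborel. r \<in> {t0..T1} \<longrightarrow> norm (generator_rate b S c y r) \<le> norm (H r)"
    proof (rule AE_I2, rule impI)
      fix r assume "r \<in> {t0..T1}"
      from order_trans[OF le[OF this] abs_ge_self] show "norm (generator_rate b S c y r) \<le> norm (H r)" by simp
    qed
  qed
  have H0: "0 \<le> H r" for r unfolding H_def using K0 \<kappa> Z[of r] c(2)[of r] by simp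
  have "norm (LINT r:{s..t}|lborel. generator_rate b S c y r) \<le> (LINT r:{s..t}|lborel. H r)"
    by (rule set_integral_norm_le) (use i iH le st in \<open>auto intro: set_integrable_subset\<close>)
  also have "\<dots> \<le> (LINT r:{t0..T1}|lborel. H r)"
    unfolding set_lebesgue_integral_def
    by (rule integral_mono) (use set_integrable_subset[OF iH, of "{s..t}"] iH st H0 in \<open>auto simp: set_integrable_def indicator_def\<close>)
  also have "\<dots> = K * (T1 - t0) + (K * (\<kappa> + 1)) * (LINT r:{t0..T1}|lborel. c r * discount t0 c r)"
    unfolding H_def using tT
    by (subst set_integral_add(2)[OF set_integrable_Icc_const set_integrable_mult_right[OF icZ]]) (simp add: set_integral_const)
  also have "\<dots> \<le> K * (T1 - t0) + (K * (\<kappa> + 1)) * 1" using lcZ K0 \<kappa> by (intro add_left_mono mult_left_mono) auto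
  finally have 1: "\<bar>LINT r:{s..t}|lborel. generator_rate b S c y r\<bar> \<le> K * (T1 - t0) + K * (\<kappa> + 1)" by simp
  have 2: "\<bar>F (y r) r * discount t0 c r\<bar> \<le> K" if "r \<in> {t0..T1}" for r
  proof -
    have "\<bar>F (y r) r\<bar> * \<bar>discount t0 c r\<bar> \<le> K * 1"
      using order_trans[OF jet_components_le(7) jet_bounded[OF that]] K0 Z[of r] by (intro mult_mono) auto
    then show ?thesis by (simp add: abs_mult)
  qed
  have "\<bar>p - q - g\<bar> \<le> 2 * K + B" if "\<bar>p\<bar> \<le> K" "\<bar>q\<bar> \<le> K" "\<bar>g\<bar> \<le> B" for p q g B :: real using that by linarith
  then show "\<bar>gap b S c y s t\<bar> \<le> 2 * K + (K * (T1 - t0) + K * (\<kappa> + 1))"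
    unfolding gap_def using 1 2[of s] 2[of t] st by simp
qed

end

section \<open>Progressive measurability and passage to general integrands\<close>

lemma jointly_measurable_add:
  fixes X Y :: "real \<Rightarrow> 'a \<Rightarrow> 'b::{second_countable_topology, real_normed_vector}"
  shows "jointly_measurable N X \<Longrightarrow> jointly_measurable N Y \<Longrightarrow> jointly_measurable N (\<lambda>r \<omega>. X r \<omega> + Y r \<omega>)"
  unfolding jointly_measurable_def by (rule borel_measurable_add)

context wiener_filtration
begin

text \<open>Progressive measurability for processes on the whole line: stopping the time argument at
  \<open>r\<close> replaces the restriction to \<open>{t0..r}\<close>.\<close>

definition progressive :: "(real \<Rightarrow> 'a \<Rightarrow> 'b::topological_space) \<Rightarrow> bool" where
  "progressive X \<longleftrightarrow> jointly_measurable M X \<and> (\<forall>r\<in>{t0..T}. jointly_measurable (Fl r) (\<lambda>q \<omega>. X (max t0 (min r q)) \<omega>))"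

lemma progressive_jointly_measurable: "progressive X \<Longrightarrow> jointly_measurable M X"
  by (simp add: progressive_def)

lemma progressive_compose: "progressive X \<Longrightarrow> f \<in> borel_measurable borel \<Longrightarrow> progressive (\<lambda>r \<omega>. f (X r \<omega>))"
  unfolding progressive_def using jointly_measurable_compose[of M X f]
    jointly_measurable_compose[of "Fl r" "\<lambda>q \<omega>. X (max t0 (min r q)) \<omega>" f for r] by blast

lemma progressive_add:
  fixes X Y :: "real \<Rightarrow> 'a \<Rightarrow> 'b::{second_countable_topology, real_normed_vector}"
  assumes "progressive X" "progressive Y" shows "progressive (\<lambda>r \<omega>. X r \<omega> + Y r \<omega>)"
  unfolding progressive_def
proof (intro conjI ballI)
  show "jointly_measurable M (\<lambda>r \<omega>. X r \<omega> + Y r \<omega>)"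
    using assms by (intro jointly_measurable_add) (auto simp: progressive_def)
  show "jointly_measurable (Fl r) (\<lambda>q \<omega>. X (max t0 (min r q)) \<omega> + Y (max t0 (min r q)) \<omega>)" if "r \<in> {t0..T}" for r
    by (rule jointly_measurable_add[of _ "\<lambda>q. X (max t0 (min r q))" "\<lambda>q. Y (max t0 (min r q))"])
       (use assms that in \<open>auto simp: progressive_def\<close>)
qed

lemma progressive_integral:
  fixes X :: "real \<Rightarrow> 'a \<Rightarrow> 'b::{banach, second_countable_topology}"
  assumes "progressive X" "r \<in> {t0..T}"
  shows "(\<lambda>\<omega>. LINT q:{t0..r}|lborel. X q \<omega>) \<in> borel_measurable (Fl r)"
proof -
  have "jointly_measurable (Fl r) (\<lambda>q \<omega>. X (max t0 (min r q)) \<omega>)" using assms by (auto simp: progressive_def)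
  from measurable_set_integral[OF this, of t0 r]
  have "(\<lambda>\<omega>. LINT q:{t0..r}|lborel. X (max t0 (min r q)) \<omega>) \<in> borel_measurable (Fl r)" .
  moreover have "(LINT q:{t0..r}|lborel. X (max t0 (min r q)) \<omega>) = (LINT q:{t0..r}|lborel. X q \<omega>)" for \<omega>
    by (rule set_lebesgue_integral_cong) (auto simp: max_def min_def)
  ultimately show ?thesis by simp
qed

end

context ito_setting
begin

lemma progressive_simple_value:
  assumes sp: "simple_process Fl t0 T N p (\<xi> :: nat \<Rightarrow> 'a \<Rightarrow> real ^ 'k ^ 'n)"
  shows "progressive (simple_value N p \<xi>)"
  unfolding progressive_def
proof (intro conjI ballI)
  show "jointly_measurable M (simple_value N p \<xi>)" by (rule simple_value_measurable[OF sp])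
  fix r assume r: "r \<in> {t0..T}"
  show "jointly_measurable (Fl r) (\<lambda>q. simple_value N p \<xi> (max t0 (min r q)))"
    unfolding jointly_measurable_def simple_value_def
  proof (rule borel_measurable_sum)
    fix i assume i: "i \<in> {..<N}"
    have pi: "p i \<in> {t0..T}" using simple_process_cutpoint[OF sp] i by auto
    show "(\<lambda>z. indicator {p i<..p (Suc i)} (max t0 (min r (snd z))) *\<^sub>R \<xi> i (fst z)) \<in> borel_measurable (Fl r \<Otimes>\<^sub>M (borel :: real measure))"
    proof (cases "p i < r")
      case True
      have "\<xi> i \<in> borel_measurable (Fl (p i))" using sp i by (auto simp: simple_process_def)
      then have xi: "\<xi> i \<in> borel_measurable (Fl r)"
        by (rule measurable_filtration_mono[rotated 3]) (use pi r True in auto)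
      show ?thesis
      proof (rule borel_measurable_scaleR)
        show "(\<lambda>z. indicator {p i<..p (Suc i)} (max t0 (min r (snd z))) :: real) \<in> borel_measurable (Fl r \<Otimes>\<^sub>M (borel :: real measure))"
          by measurable
        show "(\<lambda>z. \<xi> i (fst z)) \<in> borel_measurable (Fl r \<Otimes>\<^sub>M (borel :: real measure))"
          by (rule measurable_compose[OF measurable_fst xi])
      qed
    next
      \<comment> \<open>The clamped time never exceeds \<open>p i\<close>, so the summand vanishes
        identically.\<close>
      case False
      then have "\<not> p i < max t0 (min r q)" for q using pi by auto
      then show ?thesis by simp
    qed
  qed
qed

text \<open>The drift is truncated and the diffusion replaced by the given simple integrands; each
  approximating gap has mean zero. Its bound is independent of the index, so almost sure convergence
  along a subsequence suffices.\<close>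

lemma gap_mean_zero_limit:
  fixes b :: "real \<Rightarrow> 'a \<Rightarrow> real ^ 'n" and H :: "real \<Rightarrow> 'a \<Rightarrow> real ^ 'k ^ 'n"
  assumes b: "progressive b" and H: "progressive H"
    and ib: "AE \<omega> in M. set_integrable lborel {t0..T} (\<lambda>r. b r \<omega>)"
    and iH: "AE \<omega> in M. set_integrable lborel {t0..T} (\<lambda>r. (norm (H r \<omega>))\<^sup>2)"
    and x: "\<And>\<omega>. \<omega> \<in> space M \<Longrightarrow> continuous_on UNIV (\<lambda>r. x r \<omega>)" "\<And>r. x r \<in> borel_measurable M"
    and x_eq: "AE \<omega> in M. \<forall>t\<in>{t0..T}. x t \<omega> = x0 + (LINT r:{t0..t}|lborel. b r \<omega>) + I t \<omega>"
    and I: "\<And>t. t \<in> {t0..T} \<Longrightarrow> I t \<in> borel_measurable M"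
    and sp: "\<And>j. simple_process Fl t0 T (N j) (p j) (\<xi> j)"
    and H_lim: "vanishes_in_probability M (\<lambda>j \<omega>. \<integral>\<^sup>+t\<in>{t0..T}. ennreal ((norm (simple_value (N j) (p j) (\<xi> j) t \<omega> - H t \<omega>))\<^sup>2) \<partial>lborel)"
    and I_lim: "\<And>t. t \<in> {t0..T} \<Longrightarrow> vanishes_in_probability M (\<lambda>j \<omega>. ennreal (norm (simple_integral w (N j) (p j) (\<xi> j) t \<omega> - I t \<omega>)))"
    and l: "0 < l" and st: "t0 \<le> s" "s \<le> t" "t \<le> T1" and A: "A \<in> sets (Fl s)"
  defines "G \<equiv> \<lambda>\<omega>. gap (\<lambda>r. b r \<omega>) (\<lambda>r. H r \<omega> ** transpose (H r \<omega>)) (\<lambda>r. l * (norm (b r \<omega>) + (norm (H r \<omega>))\<^sup>2)) (\<lambda>r. x r \<omega>) s t"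
  shows "expectation (\<lambda>\<omega>. indicator A \<omega> * G \<omega>) = 0"
proof -
  \<comment> \<open>Large values are sent to 0; the error is at most \<open>norm v\<close> and
    vanishes from some index on.\<close>
  define tr where "tr j v = (if norm v \<le> real j then v else 0)" for j and v :: "real ^ 'n"
  have tr_m: "tr j \<in> borel_measurable borel" for j unfolding tr_def by measurable
  have tr_le: "norm (tr j v) \<le> real j" "norm (tr j v) \<le> norm v" "norm (tr j v - v) \<le> norm v" for j v by (auto simp: tr_def)
  have tr_lim: "(\<lambda>j. tr j v) \<longlonglongrightarrow> v" for v
  proof (rule tendsto_eventually)
    have "\<forall>\<^sub>F j in sequentially. norm v \<le> real j" using filterlim_real_sequentially by (simp add: filterlim_at_top)
    then show "\<forall>\<^sub>F j in sequentially. tr j v = v" by eventually_elim (simp add: tr_def)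
  qed
  define bt where "bt j r \<omega> = tr j (b r \<omega>)" for j r \<omega>
  define Hj where "Hj j r \<omega> = simple_value (N j) (p j) (\<xi> j) r \<omega>" for j r \<omega>
  \<comment> \<open>The rate is built from the approximating coefficients themselves, so that it
    dominates them with the same factor \<open>1/l\<close> for every \<open>j\<close>.\<close>
  define cj where "cj j r \<omega> = l * (norm (bt j r \<omega>) + (norm (Hj j r \<omega>))\<^sup>2)" for j r \<omega>
  define c where "c r \<omega> = l * (norm (b r \<omega>) + (norm (H r \<omega>))\<^sup>2)" for r \<omega>
  \<comment> \<open>The path is driven by the approximants too, as mean zero has been established
    only for such paths.\<close>
  define y where "y j r \<omega> = x0 + (LINT q:{t0..max t0 (min T r)}|lborel. bt j q \<omega>) + simple_integral w (N j) (p j) (\<xi> j) r \<omega>" for j r \<omega>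
  define Gj where "Gj j \<omega> = gap (\<lambda>r. bt j r \<omega>) (\<lambda>r. Hj j r \<omega> ** transpose (Hj j r \<omega>)) (\<lambda>r. cj j r \<omega>) (\<lambda>r. y j r \<omega>) s t" for j \<omega>
  have sT: "s \<in> {t0..T}" "t \<in> {t0..T}" using st horizon by auto
  have AM: "A \<in> sets M" by (rule sets_filtration[OF sT(1) A])
  have pbt: "progressive (bt j)" for j
  proof -
    have "bt j = (\<lambda>r \<omega>. tr j (b r \<omega>))" by (simp add: bt_def fun_eq_iff)
    then show ?thesis using progressive_compose[OF b tr_m] by simp
  qed
  have pHj: "progressive (Hj j)" for j
    unfolding Hj_def by (rule progressive_simple_value[OF sp])
  have pc: "progressive (\<lambda>r \<omega>. l * (norm (b' r \<omega>) + (norm (H' r \<omega>))\<^sup>2))" if "progressive b'" "progressive H'" for b' :: "real \<Rightarrow> 'a \<Rightarrow> real ^ 'n" and H' :: "real \<Rightarrow> 'a \<Rightarrow> real ^ 'k ^ 'n"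
    by (rule progressive_compose[where f = "\<lambda>v. l * v"], rule progressive_add,
        rule progressive_compose[OF that(1), of norm], simp, rule progressive_compose[OF that(2), of "\<lambda>v. (norm v)\<^sup>2"], simp_all)
  have pcj: "progressive (cj j)" for j unfolding cj_def by (rule pc[OF pbt pHj])
  have pcc: "progressive c" unfolding c_def by (rule pc[OF b H])
  note jb = progressive_jointly_measurable[OF b] and jH = progressive_jointly_measurable[OF H]
    and jbt = progressive_jointly_measurable[OF pbt] and jHj = progressive_jointly_measurable[OF pHj]
    and jcj = progressive_jointly_measurable[OF pcj] and jc = progressive_jointly_measurable[OF pcc]
  have jS: "jointly_measurable M (\<lambda>r \<omega>. H r \<omega> ** transpose (H r \<omega>))" "\<And>j. jointly_measurable M (\<lambda>r \<omega>. Hj j r \<omega> ** transpose (Hj j r \<omega>))"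
    using jointly_measurable_compose[OF jH borel_measurable_self_transpose] jointly_measurable_compose[OF jHj borel_measurable_self_transpose] by auto
  have jx: "jointly_measurable M x" by (rule jointly_measurable_continuous[OF x(2,1)])
  have Hj_bd: "\<exists>B. \<forall>r. \<forall>\<omega>\<in>space M. norm (Hj j r \<omega>) \<le> B" for j
    unfolding Hj_def by (rule simple_process_bounded[OF sp[of j]]) blast
  have c0: "0 \<le> cj j r \<omega>" "0 \<le> c r \<omega>" for j r \<omega> using l by (auto simp: cj_def c_def)
  have step: "continuous_on UNIV (\<lambda>r. y j r \<omega>)" "y j r \<in> borel_measurable M" "expectation (\<lambda>\<omega>. indicator A \<omega> * Gj j \<omega>) = 0"
    if "\<omega> \<in> space M" for j r \<omega>
  proof -
    obtain B where B: "\<And>r \<omega>. \<omega> \<in> space M \<Longrightarrow> norm (Hj j r \<omega>) \<le> B" using Hj_bd[of j] by blast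
    define m where "m = max (real j) (l * (real j + B\<^sup>2))"
    have m: "norm (bt j r \<omega>) \<le> m" "cj j r \<omega> \<le> m" if "\<omega> \<in> space M" for r \<omega>
    proof -
      show "norm (bt j r \<omega>) \<le> m" using tr_le(1)[of j "b r \<omega>"] by (simp add: m_def bt_def)
      have "cj j r \<omega> \<le> l * (real j + B\<^sup>2)"
        unfolding cj_def using l tr_le(1)[of j "b r \<omega>"] power_mono[OF B[OF that, of r] norm_ge_zero, of 2]
        by (intro mult_left_mono add_mono) (auto simp: bt_def)
      then show "cj j r \<omega> \<le> m" by (simp add: m_def)
    qed
    have d: "(\<lambda>\<omega>. discount t0 (\<lambda>r. cj j r \<omega>) r) \<in> borel_measurable (Fl r)" if "r \<in> {t0..T}" for r
      unfolding discount_def using measurable_compose[OF progressive_integral[OF pcj[of j] that], of "\<lambda>x. exp (- x)" borel] by simp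
    note simple = gap_mean_zero_simple[where N = "N j" and p = "p j" and \<xi> = "\<xi> j" and b = "bt j" and c = "cj j" and m = m
        and ?x0.0 = x0 and s = s and t = t and A = A]
    show "continuous_on UNIV (\<lambda>r. y j r \<omega>)" unfolding y_def
      by (rule simple(1); (rule sp jbt jcj m c0 progressive_integral[OF pbt] d st A that; assumption?))
    have "(\<lambda>\<omega>. y j r \<omega>) \<in> borel_measurable M" unfolding y_def
      by (rule simple(2); (rule sp jbt jcj m c0 progressive_integral[OF pbt] d st A; assumption?))
    then show "y j r \<in> borel_measurable M" .
    show "expectation (\<lambda>\<omega>. indicator A \<omega> * Gj j \<omega>) = 0" unfolding Gj_def Hj_def y_def
      by (rule simple(3); (rule sp jbt jcj m c0 progressive_integral[OF pbt] d st A; assumption?))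
  qed
  obtain \<omega>0 where \<omega>0: "\<omega>0 \<in> space M" using not_empty by blast
  note yc = step(1) and yM = step(2)[OF \<omega>0] and Gj0 = step(3)[OF \<omega>0]
  have jy: "jointly_measurable M (y j)" for j by (rule jointly_measurable_continuous[OF yM yc])
  have GjM: "Gj j \<in> borel_measurable M" for j
    unfolding Gj_def by (rule gap_measurable[OF st jbt jS(2) jcj jy])
  have GM: "G \<in> borel_measurable M"
    unfolding G_def using gap_measurable[OF st jb jS(1) jc jx] by (simp add: c_def)
  have T1T: "{t0..T1} \<subseteq> {t0..T}" using horizon by auto
  define BB where "BB = 2 * K + (K * (T1 - t0) + K * (1/l + 1))"
  have ibt: "set_integrable lborel {t0..T} (\<lambda>r. bt j r \<omega>)" and iHj: "set_integrable lborel {t0..T} (\<lambda>r. (norm (Hj j r \<omega>))\<^sup>2)"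
    and icj: "set_integrable lborel {t0..T} (\<lambda>r. cj j r \<omega>)" if w: "\<omega> \<in> space M" for j \<omega>
  proof -
    obtain B where B: "\<And>r. norm (Hj j r \<omega>) \<le> B" using Hj_bd[of j] w by blast
    show 1: "set_integrable lborel {t0..T} (\<lambda>r. bt j r \<omega>)"
      by (rule set_integrable_bounded[where B = "real j"])
         (use jointly_measurable_section[OF jbt w] tr_le(1) in \<open>auto simp: set_borel_measurable_def bt_def\<close>)
    have mH: "(\<lambda>r. Hj j r \<omega>) \<in> borel_measurable borel" by (rule jointly_measurable_section[OF jHj w])
    show 2: "set_integrable lborel {t0..T} (\<lambda>r. (norm (Hj j r \<omega>))\<^sup>2)"
      by (rule set_integrable_bounded[where B = "B\<^sup>2"])
         (use mH power_mono[OF B norm_ge_zero, where n = 2] in \<open>auto simp: set_borel_measurable_def\<close>)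
    show "set_integrable lborel {t0..T} (\<lambda>r. cj j r \<omega>)"
      unfolding cj_def
      using integrable_norm[OF 1[unfolded set_integrable_def]] 2
      by (intro set_integrable_mult_right set_integral_add(1)) (auto simp: set_integrable_def)
  qed
  have Gj_bd: "\<bar>Gj j \<omega>\<bar> \<le> BB" if w: "\<omega> \<in> space M" for j \<omega>
    unfolding Gj_def BB_def
  proof (rule gap_bounded_discounted(2)[OF st])
    show "(\<lambda>r. bt j r \<omega>) \<in> borel_measurable borel" "(\<lambda>r. Hj j r \<omega> ** transpose (Hj j r \<omega>)) \<in> borel_measurable borel" "(\<lambda>r. cj j r \<omega>) \<in> borel_measurable borel"
      using jointly_measurable_section[OF jbt w] jointly_measurable_section[OF jS(2) w] jointly_measurable_section[OF jcj w] by auto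
    show "set_integrable lborel {t0..T1} (\<lambda>r. cj j r \<omega>)" by (rule set_integrable_subset[OF icj[OF w] _ T1T]) simp
    show "norm (bt j r \<omega>) + norm (Hj j r \<omega> ** transpose (Hj j r \<omega>)) \<le> 1/l * cj j r \<omega>" for r
      using norm_matrix_transpose_mult_le[of "Hj j r \<omega>" "Hj j r \<omega>"] l by (simp add: cj_def power2_eq_square)
  qed (use l c0 yc[OF w] in auto)
  define e where "e j \<omega> = (\<integral>\<^sup>+t\<in>{t0..T}. ennreal ((norm (Hj j t \<omega> - H t \<omega>))\<^sup>2) \<partial>lborel)" for j \<omega>
  define d where "d j r \<omega> = min 1 (norm (y j r \<omega> - x r \<omega>))" for j r \<omega>
  have d01: "0 \<le> d j r \<omega>" "d j r \<omega> \<le> 1" for j r \<omega> by (auto simp: d_def)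
  have jd: "jointly_measurable M (d j)" for j
    unfolding d_def jointly_measurable_def
    using jy[of j, unfolded jointly_measurable_def] jx[unfolded jointly_measurable_def] by measurable
  have dM: "d j r \<in> borel_measurable M" for j r
    unfolding d_def[abs_def] using yM[of j r] x(2)[of r] by measurable
  have eM: "e j \<in> borel_measurable M" for j
  proof -
    have "(\<lambda>z. ennreal ((norm (Hj j (snd z) (fst z) - H (snd z) (fst z)))\<^sup>2) * indicator {t0..T} (snd z)) \<in> borel_measurable (M \<Otimes>\<^sub>M borel)"
      using jHj[of j, unfolded jointly_measurable_def] jH[unfolded jointly_measurable_def] by measurable
    then have "(\<lambda>(\<omega>, t). ennreal ((norm (Hj j t \<omega> - H t \<omega>))\<^sup>2) * indicator {t0..T} t) \<in> borel_measurable (M \<Otimes>\<^sub>M lborel)"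
      by (simp add: case_prod_beta' measurable_cong_sets[OF sets_pair_measure_cong[OF refl sets_lborel]])
    then show ?thesis unfolding e_def[abs_def] by (rule lborel.borel_measurable_nn_integral)
  qed
  have e_lim: "(\<lambda>j. expectation (\<lambda>\<omega>. enn2real (min 1 (e j \<omega>)))) \<longlonglongrightarrow> 0"
  proof (rule vanishes_in_probability_expectation[OF eM])
    show "vanishes_in_probability M e" using H_lim unfolding e_def Hj_def by simp
  qed
  have bt_L1: "(\<lambda>j. LINT r:{t0..T}|lborel. norm (bt j r \<omega> - b r \<omega>)) \<longlonglongrightarrow> 0"
    if w: "\<omega> \<in> space M" and int: "set_integrable lborel {t0..T} (\<lambda>r. b r \<omega>)" for \<omega>
  proof -
    have "(\<lambda>j. \<integral>r. indicator {t0..T} r *\<^sub>R norm (bt j r \<omega> - b r \<omega>) \<partial>lborel) \<longlonglongrightarrow> (\<integral>r. 0 \<partial>(lborel :: real measure))"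
    proof (rule integral_dominated_convergence[where w = "\<lambda>r. norm (indicator {t0..T} r *\<^sub>R b r \<omega>)"])
      show "integrable lborel (\<lambda>r. norm (indicator {t0..T} r *\<^sub>R b r \<omega>))"
        using integrable_norm[OF int[unfolded set_integrable_def]] .
      show "(\<lambda>r. indicator {t0..T} r *\<^sub>R norm (bt j r \<omega> - b r \<omega>)) \<in> borel_measurable lborel" for j
        using jointly_measurable_section[OF jbt[of j] w] jointly_measurable_section[OF jb w] by measurable
      have "(\<lambda>j. indicator {t0..T} r *\<^sub>R norm (bt j r \<omega> - b r \<omega>)) \<longlonglongrightarrow> indicator {t0..T} r *\<^sub>R norm (b r \<omega> - b r \<omega>)" for r
        unfolding bt_def by (intro tendsto_intros tr_lim)
      then show "AE r in lborel. (\<lambda>j. indicator {t0..T} r *\<^sub>R norm (bt j r \<omega> - b r \<omega>)) \<longlonglongrightarrow> 0" by simp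
      show "AE r in lborel. norm (indicator {t0..T} r *\<^sub>R norm (bt j r \<omega> - b r \<omega>)) \<le> norm (indicator {t0..T} r *\<^sub>R b r \<omega>)" for j
        using tr_le(3) by (auto simp: bt_def indicator_def)
    qed simp
    then show ?thesis by (simp add: set_lebesgue_integral_def)
  qed
  \<comment> \<open>At a fixed time the error of the path is at most that of the drift integral plus
    that of the Ito integral, and each vanishes in truncated mean.\<close>
  have d_lim: "(\<lambda>j. expectation (d j r)) \<longlonglongrightarrow> 0" if r: "r \<in> {t0..T}" for r
  proof (rule Lim_null_comparison)
    define f1 where "f1 j \<omega> = min 1 (norm ((LINT q:{t0..r}|lborel. bt j q \<omega>) - (LINT q:{t0..r}|lborel. b q \<omega>)))" for j \<omega>
    define f2 where "f2 j \<omega> = enn2real (min 1 (ennreal (norm (simple_integral w (N j) (p j) (\<xi> j) r \<omega> - I r \<omega>))))" for j \<omega>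
    have f1M: "f1 j \<in> borel_measurable M" for j
      unfolding f1_def[abs_def] using measurable_set_integral[OF jbt[of j], of t0 r] measurable_set_integral[OF jb, of t0 r] by measurable
    have f2M: "f2 j \<in> borel_measurable M" for j
      unfolding f2_def[abs_def] using simple_integral_measurable(1)[OF sp[of j], of r] I[OF r] by measurable
    have f2': "f2 j \<omega> = min 1 (norm (simple_integral w (N j) (p j) (\<xi> j) r \<omega> - I r \<omega>))" for j \<omega>
      unfolding f2_def by (cases "1 \<le> norm (simple_integral w (N j) (p j) (\<xi> j) r \<omega> - I r \<omega>)") (simp_all add: min_def)
    have i1: "integrable M (f1 j)" for j by (rule integrable_bounded[OF f1M, of _ 1]) (auto simp: f1_def)
    have i2: "integrable M (f2 j)" for j by (rule integrable_bounded[OF f2M, of _ 1]) (auto simp: f2')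
    have id: "integrable M (d j r)" for j by (rule integrable_bounded[OF dM, of _ _ 1]) (use d01 in auto)
    have l1: "(\<lambda>j. expectation (f1 j)) \<longlonglongrightarrow> 0"
    proof -
      have "(\<lambda>j. expectation (f1 j)) \<longlonglongrightarrow> expectation (\<lambda>_. 0)"
      proof (rule integral_dominated_convergence[where w = "\<lambda>_. 1"])
        show "AE \<omega> in M. (\<lambda>j. f1 j \<omega>) \<longlonglongrightarrow> 0"
          using ib AE_space
        proof eventually_elim
          case (elim \<omega>)
          have "(\<lambda>j. LINT q:{t0..r}|lborel. bt j q \<omega>) \<longlonglongrightarrow> (LINT q:{t0..r}|lborel. b q \<omega>)"
            by (rule set_integral_L1_tendsto[OF ibt elim(1) bt_L1]) (use elim r in auto)
          then have "(\<lambda>j. min 1 (norm ((LINT q:{t0..r}|lborel. bt j q \<omega>) - (LINT q:{t0..r}|lborel. b q \<omega>)))) \<longlonglongrightarrow> min 1 (norm ((LINT q:{t0..r}|lborel. b q \<omega>) - (LINT q:{t0..r}|lborel. b q \<omega>)))"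
            by (intro tendsto_intros)
          then show ?case by (simp add: f1_def)
        qed
      qed (use f1M in \<open>auto simp: f1_def\<close>)
      then show ?thesis by simp
    qed
    have l2: "(\<lambda>j. expectation (f2 j)) \<longlonglongrightarrow> 0"
      unfolding f2_def
      by (rule vanishes_in_probability_expectation[OF _ I_lim[OF r]])
         (use simple_integral_measurable(1)[OF sp, of _ r] I[OF r] in measurable)
    show "(\<lambda>j. expectation (f1 j) + expectation (f2 j)) \<longlonglongrightarrow> 0" using tendsto_add[OF l1 l2] by simp
    have "norm (expectation (d j r)) \<le> expectation (f1 j) + expectation (f2 j)" for j
    proof -
      have "norm (expectation (d j r)) = expectation (d j r)" using d01 by (auto intro!: integral_nonneg_AE)
      also have "\<dots> \<le> expectation (\<lambda>\<omega>. f1 j \<omega> + f2 j \<omega>)"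
      proof (rule integral_mono_AE[OF id Bochner_Integration.integrable_add[OF i1 i2]])
        show "AE \<omega> in M. d j r \<omega> \<le> f1 j \<omega> + f2 j \<omega>"
          using x_eq
        proof eventually_elim
          case (elim \<omega>)
          have mr: "max t0 (min T r) = r" using r by auto
          have "y j r \<omega> - x r \<omega> = ((LINT q:{t0..r}|lborel. bt j q \<omega>) - (LINT q:{t0..r}|lborel. b q \<omega>))
              + (simple_integral w (N j) (p j) (\<xi> j) r \<omega> - I r \<omega>)"
            using elim r by (simp add: y_def mr)
          then have "norm (y j r \<omega> - x r \<omega>) \<le> norm ((LINT q:{t0..r}|lborel. bt j q \<omega>) - (LINT q:{t0..r}|lborel. b q \<omega>))
              + norm (simple_integral w (N j) (p j) (\<xi> j) r \<omega> - I r \<omega>)"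
            by (metis norm_triangle_ineq)
          moreover have "min 1 u \<le> min 1 v + min 1 v'" if "u \<le> v + v'" "0 \<le> v" "0 \<le> v'" for u v v' :: real
            using that by (auto simp: min_def)
          ultimately show ?case unfolding d_def f1_def f2' by simp
        qed
      qed
      also have "\<dots> = expectation (f1 j) + expectation (f2 j)" by (rule Bochner_Integration.integral_add[OF i1 i2])
      finally show ?thesis .
    qed
    then show "\<forall>\<^sub>F j in sequentially. norm (expectation (d j r)) \<le> expectation (f1 j) + expectation (f2 j)" by simp
  qed
  interpret P: pair_sigma_finite M lborel ..
  \<comment> \<open>Convergence in probability at each time says nothing about whole paths.
    Integrating the truncated error over time and extracting a subsequence gives convergence at
    almost every time, which is what the compensator requires.\<close>
  define D where "D j z = indicator {t0..T} (snd z) *\<^sub>R d j (snd z) (fst z)" for j z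
  have DM: "D j \<in> borel_measurable (M \<Otimes>\<^sub>M lborel)" for j
  proof -
    have "(\<lambda>z. indicator {t0..T} (snd z) *\<^sub>R d j (snd z) (fst z)) \<in> borel_measurable (M \<Otimes>\<^sub>M borel)"
      using jd[of j, unfolded jointly_measurable_def] by measurable
    then show ?thesis
      by (simp add: D_def[abs_def] measurable_cong_sets[OF sets_pair_measure_cong[OF refl sets_lborel]])
  qed
  have D0: "0 \<le> D j z" for j z using d01 by (simp add: D_def)
  have iD: "integrable (M \<Otimes>\<^sub>M lborel) (D j)" for j
  proof (rule Bochner_Integration.integrable_bound[OF _ DM])
    show "integrable (M \<Otimes>\<^sub>M lborel) (indicator (space M \<times> {t0..T}) :: _ \<Rightarrow> real)"
      by (subst integrable_indicator_iff) (use t0_less_T in \<open>auto simp: lborel.emeasure_pair_measure_Times emeasure_space_1\<close>)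
    show "AE z in M \<Otimes>\<^sub>M lborel. norm (D j z) \<le> norm (indicator (space M \<times> {t0..T}) z :: real)"
      using d01 by (intro AE_I2) (auto simp: D_def indicator_def space_pair_measure)
  qed
  have D_lim: "(\<lambda>j. \<integral>z. norm (D j z) \<partial>(M \<Otimes>\<^sub>M lborel)) \<longlonglongrightarrow> 0"
  proof -
    have "(\<lambda>j. \<integral>r. (\<integral>\<omega>. D j (\<omega>, r) \<partial>M) \<partial>lborel) \<longlonglongrightarrow> (\<integral>r. 0 \<partial>(lborel :: real measure))"
    proof (rule integral_dominated_convergence[where w = "indicator {t0..T}"])
      have "(\<integral>\<omega>. D j (\<omega>, r) \<partial>M) = indicator {t0..T} r *\<^sub>R expectation (d j r)" for j r by (simp add: D_def)
      moreover have "(\<lambda>j. indicator {t0..T} r *\<^sub>R expectation (d j r)) \<longlonglongrightarrow> 0" for r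
        using d_lim[of r] by (cases "r \<in> {t0..T}") auto
      ultimately show "AE r in lborel. (\<lambda>j. \<integral>\<omega>. D j (\<omega>, r) \<partial>M) \<longlonglongrightarrow> 0" by simp
      show "AE r in lborel. norm (\<integral>\<omega>. D j (\<omega>, r) \<partial>M) \<le> indicator {t0..T} r" for j
      proof (rule AE_I2)
        fix r show "norm (\<integral>\<omega>. D j (\<omega>, r) \<partial>M) \<le> indicator {t0..T} r"
          unfolding real_norm_def by (rule abs_expectation_le) (use d01 in \<open>auto simp: D_def indicator_def\<close>)
      qed
      show "(\<lambda>r. \<integral>\<omega>. D j (\<omega>, r) \<partial>M) \<in> borel_measurable lborel" for j
        using P.integrable_snd[of "\<lambda>\<omega> r. D j (\<omega>, r)"] iD[of j] by (auto simp: case_prod_beta')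
      show "integrable lborel (indicator {t0..T} :: real \<Rightarrow> real)"
        using set_integrable_Icc_const[of t0 T "1 :: real"] by (simp add: set_integrable_def)
    qed simp
    moreover have "(\<integral>r. (\<integral>\<omega>. D j (\<omega>, r) \<partial>M) \<partial>lborel) = (\<integral>z. norm (D j z) \<partial>(M \<Otimes>\<^sub>M lborel))" for j
      using P.integral_snd[of "\<lambda>\<omega> r. D j (\<omega>, r)"] iD[of j] D0 by (simp add: case_prod_beta')
    ultimately show ?thesis by simp
  qed
  obtain \<phi>1 where \<phi>1: "strict_mono \<phi>1" "AE z in M \<Otimes>\<^sub>M lborel. (\<lambda>j. D (\<phi>1 j) z) \<longlonglongrightarrow> 0"
    using tendsto_L1_AE_subseq[OF iD D_lim] by blast
  \<comment> \<open>The second subsequence takes care of what almost every time does not cover: the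
    endpoints \<open>s\<close> and \<open>t\<close>, and the error of the integrand.\<close>
  define u where "u j \<omega> = enn2real (min 1 (e j \<omega>)) + d j s \<omega> + d j t \<omega>" for j \<omega>
  have b1: "enn2real (min 1 v) \<le> 1" for v :: ennreal by (rule enn2real_leI) (auto simp: min_def)
  have ie: "integrable M (\<lambda>\<omega>. enn2real (min 1 (e j \<omega>)))" for j
    by (rule integrable_bounded[of _ 1]) (use eM[of j] b1 in \<open>auto intro!: measurable_compose[OF _ borel_measurable_enn2real]\<close>)
  have idd: "integrable M (d j r)" for j r by (rule integrable_bounded[OF dM, of _ _ 1]) (use d01 in auto)
  have iu: "integrable M (u j)" for j unfolding u_def by (intro Bochner_Integration.integrable_add ie idd)
  have "(\<lambda>j. expectation (u j)) \<longlonglongrightarrow> 0"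
  proof -
    have "expectation (u j) = expectation (\<lambda>\<omega>. enn2real (min 1 (e j \<omega>))) + expectation (d j s) + expectation (d j t)" for j
      unfolding u_def using ie idd by simp
    then show ?thesis using tendsto_add[OF tendsto_add[OF e_lim d_lim[OF sT(1)]] d_lim[OF sT(2)]] by simp
  qed
  from LIMSEQ_subseq_LIMSEQ[OF this \<phi>1(1)] have "(\<lambda>j. expectation (u (\<phi>1 j))) \<longlonglongrightarrow> 0" by (simp add: o_def)
  moreover have "norm (u j \<omega>) = u j \<omega>" for j \<omega> using d01 by (simp add: u_def)
  ultimately have "(\<lambda>j. expectation (\<lambda>\<omega>. norm (u (\<phi>1 j) \<omega>))) \<longlonglongrightarrow> 0" by simp
  then obtain \<phi>2 where \<phi>2: "strict_mono \<phi>2" "AE \<omega> in M. (\<lambda>j. u (\<phi>1 (\<phi>2 j)) \<omega>) \<longlonglongrightarrow> 0"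
    using tendsto_L1_AE_subseq[of M "\<lambda>j. u (\<phi>1 j)"] iu by blast
  define \<phi> where "\<phi> = (\<lambda>j. \<phi>1 (\<phi>2 j))"
  have \<phi>: "strict_mono \<phi>" using strict_mono_o[OF \<phi>1(1) \<phi>2(1)] by (simp add: \<phi>_def o_def)
  have y_lim: "AE \<omega> in M. AE r in lborel. r \<in> {t0..T} \<longrightarrow> (\<lambda>j. y (\<phi> j) r \<omega>) \<longlonglongrightarrow> x r \<omega>"
  proof -
    have "AE \<omega> in M. AE r in lborel. (\<lambda>j. D (\<phi>1 j) (\<omega>, r)) \<longlonglongrightarrow> 0"
      using P.AE_pair[OF \<phi>1(2)] by simp
    then show ?thesis
    proof eventually_elim
      case (elim \<omega>)
      then show ?case
      proof eventually_elim
        case (elim r)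
        show ?case
        proof
          assume r: "r \<in> {t0..T}"
          have "(\<lambda>j. D (\<phi> j) (\<omega>, r)) \<longlonglongrightarrow> 0"
            using LIMSEQ_subseq_LIMSEQ[OF elim \<phi>2(1)] by (simp add: \<phi>_def o_def)
          then have "(\<lambda>j. min 1 (norm (y (\<phi> j) r \<omega> - x r \<omega>))) \<longlonglongrightarrow> 0" using r by (simp add: D_def d_def)
          then have "(\<lambda>j. norm (y (\<phi> j) r \<omega> - x r \<omega>)) \<longlonglongrightarrow> 0" by (rule tendsto_of_min_one) simp
          then show "(\<lambda>j. y (\<phi> j) r \<omega>) \<longlonglongrightarrow> x r \<omega>" using tendsto_norm_zero_iff LIM_zero_iff by blast
        qed
      qed
    qed
  qed
  have G_lim: "AE \<omega> in M. (\<lambda>j. Gj (\<phi> j) \<omega>) \<longlonglongrightarrow> G \<omega>"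
    using y_lim \<phi>2(2) ib iH AE_space
  proof eventually_elim
    case (elim \<omega>)
    note w = elim(5)
    have "(\<lambda>j. u (\<phi> j) \<omega>) \<longlonglongrightarrow> 0" using elim(2) by (simp add: \<phi>_def)
    then have u0: "(\<lambda>j. enn2real (min 1 (e (\<phi> j) \<omega>))) \<longlonglongrightarrow> 0" "(\<lambda>j. d (\<phi> j) s \<omega>) \<longlonglongrightarrow> 0" "(\<lambda>j. d (\<phi> j) t \<omega>) \<longlonglongrightarrow> 0"
      by (rule Lim_null_comparison[rotated], use d01 in \<open>auto simp: u_def intro!: always_eventually\<close>)+
    have pt: "(\<lambda>j. y (\<phi> j) r \<omega>) \<longlonglongrightarrow> x r \<omega>" if "(\<lambda>j. d (\<phi> j) r \<omega>) \<longlonglongrightarrow> 0" for r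
    proof -
      have "(\<lambda>j. norm (y (\<phi> j) r \<omega> - x r \<omega>)) \<longlonglongrightarrow> 0" by (rule tendsto_of_min_one) (use that in \<open>simp_all add: d_def\<close>)
      then show ?thesis using tendsto_norm_zero_iff LIM_zero_iff by blast
    qed
    have mH: "(\<lambda>r. H r \<omega>) \<in> borel_measurable borel" and mHj: "(\<lambda>r. Hj j r \<omega>) \<in> borel_measurable borel" for j
      using jointly_measurable_section[OF jH w] jointly_measurable_section[OF jHj w] by auto
    \<comment> \<open>Restricting the measure turns set integrals into plain ones, as the product
      estimate expects.\<close>
    define R where "R = restrict_space lborel {t0..T}"
    have mR: "f \<in> borel_measurable borel \<Longrightarrow> f \<in> borel_measurable R" for f :: "real \<Rightarrow> 'z::topological_space"
      unfolding R_def by (rule measurable_restrict_space1) simp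
    have iR: "integrable R f \<longleftrightarrow> set_integrable lborel {t0..T} f" and lR: "integral\<^sup>L R f = (LINT r:{t0..T}|lborel. f r)" for f :: "real \<Rightarrow> real"
      unfolding R_def by (simp_all add: integrable_restrict_space set_integrable_def integral_restrict_space set_lebesgue_integral_def)
    have diff2: "integrable R (\<lambda>r. (norm (Hj j r \<omega> - H r \<omega>))\<^sup>2)" for j
    proof (rule Bochner_Integration.integrable_bound)
      show "integrable R (\<lambda>r. 2 * (norm (Hj j r \<omega>))\<^sup>2 + 2 * (norm (H r \<omega>))\<^sup>2)"
        using iHj[OF w, of j] elim(4) by (simp add: iR[symmetric])
      show "(\<lambda>r. (norm (Hj j r \<omega> - H r \<omega>))\<^sup>2) \<in> borel_measurable R"
        using mR[OF mH] mR[OF mHj[of j]] by measurable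
      have "(norm (v - v'))\<^sup>2 \<le> 2 * (norm v)\<^sup>2 + 2 * (norm v')\<^sup>2" for v v' :: "real ^ 'k ^ 'n"
      proof -
        have "(norm (v - v'))\<^sup>2 \<le> (norm v + norm v')\<^sup>2" by (intro power_mono norm_triangle_ineq4) simp
        also have "\<dots> \<le> 2 * (norm v)\<^sup>2 + 2 * (norm v')\<^sup>2" using sum_squares_bound[of "norm v" "norm v'"] by (simp add: power2_sum)
        finally show ?thesis .
      qed
      then show "AE r in R. norm ((norm (Hj j r \<omega> - H r \<omega>))\<^sup>2) \<le> norm (2 * (norm (Hj j r \<omega>))\<^sup>2 + 2 * (norm (H r \<omega>))\<^sup>2)"
        by (intro AE_I2) (auto simp: abs_of_nonneg)
    qed
    have e_eq: "e j \<omega> = ennreal (\<integral>r. (norm (Hj j r \<omega> - H r \<omega>))\<^sup>2 \<partial>R)" for j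
    proof -
      have "e j \<omega> = (\<integral>\<^sup>+r. ennreal ((norm (Hj j r \<omega> - H r \<omega>))\<^sup>2) \<partial>R)"
        unfolding e_def R_def by (subst nn_integral_restrict_space) auto
      also have "\<dots> = ennreal (\<integral>r. (norm (Hj j r \<omega> - H r \<omega>))\<^sup>2 \<partial>R)" by (rule nn_integral_eq_integral[OF diff2]) simp
      finally show ?thesis .
    qed
    have "enn2real (min 1 (ennreal v)) = min 1 v" if "0 \<le> v" for v :: real
      using that by (cases "1 \<le> v") (simp_all add: min_def)
    then have "(\<lambda>j. min 1 (\<integral>r. (norm (Hj (\<phi> j) r \<omega> - H r \<omega>))\<^sup>2 \<partial>R)) \<longlonglongrightarrow> 0"
      using u0(1) by (simp add: e_eq)
    then have L2: "(\<lambda>j. \<integral>r. (norm (Hj (\<phi> j) r \<omega> - H r \<omega>))\<^sup>2 \<partial>R) \<longlonglongrightarrow> 0" by (rule tendsto_of_min_one) simp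
    \<comment> \<open>A common majorant for the errors of the covariance and of the squared norm in
      the rate.\<close>
    define q where "q j r = norm (Hj (\<phi> j) r \<omega> - H r \<omega>) * (norm (Hj (\<phi> j) r \<omega>) + norm (H r \<omega>))" for j r
    have iq: "integrable R (q j)" and lq: "(\<lambda>j. \<integral>r. q j r \<partial>R) \<longlonglongrightarrow> 0" for j
      unfolding q_def
      using L2_product_tendsto[of "\<lambda>j r. Hj (\<phi> j) r \<omega>" R "\<lambda>r. H r \<omega>", OF mR[OF mHj] mR[OF mH] _ diff2 L2] elim(4) by (simp_all add: iR)
    have sub: "set_integrable lborel {t0..T1} f" if "set_integrable lborel {t0..T} f" for f :: "real \<Rightarrow> 'z::{banach, second_countable_topology}"
      by (rule set_integrable_subset[OF that _ T1T]) simp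
    have nrm: "set_integrable lborel {t0..T} (\<lambda>r. norm (f r))" if "set_integrable lborel {t0..T} f" for f :: "real \<Rightarrow> 'z::{banach, second_countable_topology}"
      using integrable_norm[OF that[unfolded set_integrable_def]] by (simp add: set_integrable_def)
    have iS: "set_integrable lborel {t0..T} (\<lambda>r. h r ** transpose (h r))"
      if "h \<in> borel_measurable borel" "set_integrable lborel {t0..T} (\<lambda>r. (norm (h r))\<^sup>2)" for h :: "real \<Rightarrow> real ^ 'k ^ 'n"
    proof (rule set_integrable_bound[OF that(2)])
      show "set_borel_measurable lborel {t0..T} (\<lambda>r. h r ** transpose (h r))"
        using measurable_compose[OF that(1) borel_measurable_self_transpose] by (simp add: set_borel_measurable_def)
      show "AE r in lborel. r \<in> {t0..T} \<longrightarrow> norm (h r ** transpose (h r)) \<le> norm ((norm (h r))\<^sup>2)"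
        using norm_matrix_transpose_mult_le by (intro AE_I2) (auto simp: power2_eq_square)
    qed
    have ic: "set_integrable lborel {t0..T} (\<lambda>r. c r \<omega>)"
      unfolding c_def by (intro set_integrable_mult_right set_integral_add(1) nrm elim(3,4))
    \<comment> \<open>A squeeze that also passes from the interval up to \<open>T\<close> to the one
      up to \<open>T1\<close>.\<close>
    have dom: "(\<lambda>j. LINT r:{t0..T1}|lborel. norm (f j r)) \<longlonglongrightarrow> 0"
      if "\<And>j. set_integrable lborel {t0..T} (f j)" "\<And>j. set_integrable lborel {t0..T} (g j)" "\<And>j r. norm (f j r) \<le> g j r" "(\<lambda>j. LINT r:{t0..T}|lborel. g j r) \<longlonglongrightarrow> 0"
      for f :: "nat \<Rightarrow> real \<Rightarrow> 'z::{banach, second_countable_topology}" and g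
    proof (rule Lim_null_comparison[OF always_eventually that(4)], rule allI)
      fix j
      have "norm (LINT r:{t0..T1}|lborel. norm (f j r)) = (LINT r:{t0..T1}|lborel. norm (f j r))"
        by (simp add: set_integral_nonneg_real)
      also have "\<dots> \<le> (LINT r:{t0..T}|lborel. g j r)"
        unfolding set_lebesgue_integral_def
        by (rule integral_mono)
           (use sub[OF nrm[OF that(1)[of j]]] that(2)[of j] that(3)[of j] order_trans[OF norm_ge_zero that(3)[of j]] T1T in \<open>auto simp: set_integrable_def indicator_def\<close>)
      finally show "norm (LINT r:{t0..T1}|lborel. norm (f j r)) \<le> (LINT r:{t0..T}|lborel. g j r)" .
    qed
    have bL: "(\<lambda>j. LINT r:{t0..T}|lborel. norm (bt (\<phi> j) r \<omega> - b r \<omega>)) \<longlonglongrightarrow> 0"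
      using LIMSEQ_subseq_LIMSEQ[OF bt_L1[OF w elim(3)] \<phi>] by (simp add: o_def)
    have iqs: "set_integrable lborel {t0..T} (q j)" for j using iq by (simp add: iR)
    have lqs: "(\<lambda>j. LINT r:{t0..T}|lborel. q j r) \<longlonglongrightarrow> 0" using lq by (simp add: lR)
    have ibd: "set_integrable lborel {t0..T} (\<lambda>r. bt (\<phi> j) r \<omega> - b r \<omega>)" for j
      by (rule set_integral_diff(1)[OF ibt[OF w] elim(3)])
    show ?case unfolding Gj_def G_def c_def[symmetric]
    proof (rule gap_tendsto[OF st])
      show "(\<lambda>r. bt (\<phi> j) r \<omega>) \<in> borel_measurable borel" "(\<lambda>r. Hj (\<phi> j) r \<omega> ** transpose (Hj (\<phi> j) r \<omega>)) \<in> borel_measurable borel"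
        "(\<lambda>r. cj (\<phi> j) r \<omega>) \<in> borel_measurable borel" for j
        using jointly_measurable_section[OF jbt w] jointly_measurable_section[OF jS(2) w] jointly_measurable_section[OF jcj w] by auto
      show "(\<lambda>r. b r \<omega>) \<in> borel_measurable borel" "(\<lambda>r. H r \<omega> ** transpose (H r \<omega>)) \<in> borel_measurable borel" "(\<lambda>r. c r \<omega>) \<in> borel_measurable borel"
        using jointly_measurable_section[OF jb w] jointly_measurable_section[OF jS(1) w] jointly_measurable_section[OF jc w] by auto
      show "set_integrable lborel {t0..T1} (\<lambda>r. bt (\<phi> j) r \<omega>)" for j by (rule sub[OF ibt[OF w]])
      show "set_integrable lborel {t0..T1} (\<lambda>r. Hj (\<phi> j) r \<omega> ** transpose (Hj (\<phi> j) r \<omega>))" for j by (rule sub[OF iS[OF mHj iHj[OF w]]])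
      show "set_integrable lborel {t0..T1} (\<lambda>r. cj (\<phi> j) r \<omega>)" for j by (rule sub[OF icj[OF w]])
      show "set_integrable lborel {t0..T1} (\<lambda>r. b r \<omega>)" by (rule sub[OF elim(3)])
      show "set_integrable lborel {t0..T1} (\<lambda>r. H r \<omega> ** transpose (H r \<omega>))" by (rule sub[OF iS[OF mH elim(4)]])
      show "set_integrable lborel {t0..T1} (\<lambda>r. c r \<omega>)" by (rule sub[OF ic])
      show "(\<lambda>j. LINT r:{t0..T1}|lborel. norm (bt (\<phi> j) r \<omega> - b r \<omega>)) \<longlonglongrightarrow> 0"
        by (rule dom[OF ibd nrm[OF ibd] order_refl bL])
      show "(\<lambda>j. LINT r:{t0..T1}|lborel. norm (Hj (\<phi> j) r \<omega> ** transpose (Hj (\<phi> j) r \<omega>) - H r \<omega> ** transpose (H r \<omega>))) \<longlonglongrightarrow> 0"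
        by (rule dom[OF set_integral_diff(1)[OF iS[OF mHj iHj[OF w]] iS[OF mH elim(4)]] iqs _ lqs])
           (simp add: q_def norm_self_transpose_diff_le)
      show "(\<lambda>j. LINT r:{t0..T1}|lborel. norm (cj (\<phi> j) r \<omega> - c r \<omega>)) \<longlonglongrightarrow> 0"
      proof -
        have d1: "set_integrable lborel {t0..T} (\<lambda>r. cj (\<phi> j) r \<omega> - c r \<omega>)" for j by (rule set_integral_diff(1)[OF icj[OF w] ic])
        have d2: "set_integrable lborel {t0..T} (\<lambda>r. l * (norm (bt (\<phi> j) r \<omega> - b r \<omega>) + q j r))" for j
          by (intro set_integrable_mult_right set_integral_add(1) nrm ibd iqs)
        have d3: "norm (cj (\<phi> j) r \<omega> - c r \<omega>) \<le> l * (norm (bt (\<phi> j) r \<omega> - b r \<omega>) + q j r)" for j r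
        proof -
          define u1 u2 where "u1 = norm (Hj (\<phi> j) r \<omega>)" and "u2 = norm (H r \<omega>)"
          have "\<bar>norm (bt (\<phi> j) r \<omega>) - norm (b r \<omega>)\<bar> \<le> norm (bt (\<phi> j) r \<omega> - b r \<omega>)" by (rule norm_triangle_ineq3)
          moreover have "\<bar>u1\<^sup>2 - u2\<^sup>2\<bar> \<le> q j r"
          proof -
            have "\<bar>u1\<^sup>2 - u2\<^sup>2\<bar> = \<bar>u1 - u2\<bar> * (u1 + u2)"
            proof -
              have "u1\<^sup>2 - u2\<^sup>2 = (u1 - u2) * (u1 + u2)" by (simp add: power2_eq_square algebra_simps)
              then show ?thesis by (simp add: abs_mult u1_def u2_def)
            qed
            also have "\<dots> \<le> q j r" unfolding q_def u1_def u2_def by (intro mult_right_mono norm_triangle_ineq3) simp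
            finally show ?thesis .
          qed
          ultimately have "\<bar>(norm (bt (\<phi> j) r \<omega>) + u1\<^sup>2) - (norm (b r \<omega>) + u2\<^sup>2)\<bar> \<le> norm (bt (\<phi> j) r \<omega> - b r \<omega>) + q j r" by linarith
          then show ?thesis unfolding cj_def c_def real_norm_def right_diff_distrib[symmetric] abs_mult u1_def u2_def
            using l by (simp add: mult_left_mono)
        qed
        have d4: "(\<lambda>j. LINT r:{t0..T}|lborel. l * (norm (bt (\<phi> j) r \<omega> - b r \<omega>) + q j r)) \<longlonglongrightarrow> 0"
        proof -
          have eq: "(LINT r:{t0..T}|lborel. l * (norm (bt (\<phi> j) r \<omega> - b r \<omega>) + q j r))
            = l * ((LINT r:{t0..T}|lborel. norm (bt (\<phi> j) r \<omega> - b r \<omega>)) + (LINT r:{t0..T}|lborel. q j r))" for j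
            by (subst set_integral_mult_right, subst set_integral_add(2)[OF nrm[OF ibd] iqs]) simp
          show ?thesis unfolding eq using tendsto_mult_left[OF tendsto_add[OF bL lqs], of l] by simp
        qed
        show ?thesis by (rule dom[OF d1 d2 d3 d4])
      qed
      show "AE r in lborel. r \<in> {t0..T1} \<longrightarrow> (\<lambda>j. y (\<phi> j) r \<omega>) \<longlonglongrightarrow> x r \<omega>"
        using elim(1) by eventually_elim (use T1T in auto)
    qed (rule c0 yc[OF w] x(1)[OF w] pt[OF u0(2)] pt[OF u0(3)])+
  qed
  have "(\<lambda>j. expectation (\<lambda>\<omega>. indicator A \<omega> * Gj (\<phi> j) \<omega>)) \<longlonglongrightarrow> expectation (\<lambda>\<omega>. indicator A \<omega> * G \<omega>)"
  proof (rule integral_dominated_convergence[where w = "\<lambda>_. BB"])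
    show "(\<lambda>\<omega>. indicator A \<omega> * G \<omega>) \<in> borel_measurable M" "\<And>j. (\<lambda>\<omega>. indicator A \<omega> * Gj (\<phi> j) \<omega>) \<in> borel_measurable M"
      by (intro borel_measurable_times borel_measurable_indicator AM GM GjM)+
    show "AE \<omega> in M. (\<lambda>j. indicator A \<omega> * Gj (\<phi> j) \<omega>) \<longlonglongrightarrow> indicator A \<omega> * G \<omega>"
      using G_lim by eventually_elim (intro tendsto_intros)
    show "AE \<omega> in M. norm (indicator A \<omega> * Gj (\<phi> j) \<omega>) \<le> BB" for j
      using Gj_bd order_trans[OF abs_ge_zero Gj_bd] by (intro AE_I2) (auto simp: indicator_def)
  qed simp
  moreover have "expectation (\<lambda>\<omega>. indicator A \<omega> * Gj (\<phi> j) \<omega>) = 0" for j by (rule Gj0)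
  ultimately have "(\<lambda>j :: nat. 0 :: real) \<longlonglongrightarrow> expectation (\<lambda>\<omega>. indicator A \<omega> * G \<omega>)" by simp
  then show ?thesis by (simp add: LIMSEQ_const_iff)
qed

end

section \<open>Optional stopping at exit times\<close>

lemma exit_time_bounds:
  assumes "t0 \<le> T1" shows "t0 \<le> exit_time U t0 T1 x \<omega>" "exit_time U t0 T1 x \<omega> \<le> T1"
proof -
  have "t0 \<le> exit_time U t0 T1 x \<omega> \<and> exit_time U t0 T1 x \<omega> \<le> T1"
  proof (cases "\<forall>t\<in>{t0..T1}. x t \<omega> \<in> U")
    case True then show ?thesis using assms by (simp add: exit_time_def)
  next
    case False
    then obtain t where t: "t \<in> {t \<in> {t0..T1}. x t \<omega> \<notin> U}" by blast
    have "Inf {t \<in> {t0..T1}. x t \<omega> \<notin> U} \<le> t" by (rule cInf_lower[OF t]) (auto intro: bdd_belowI[of _ t0])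
    moreover have "t0 \<le> Inf {t \<in> {t0..T1}. x t \<omega> \<notin> U}" by (rule cInf_greatest) (use t in auto)
    ultimately show ?thesis using t False by (auto simp: exit_time_def)
  qed
  then show "t0 \<le> exit_time U t0 T1 x \<omega>" "exit_time U t0 T1 x \<omega> \<le> T1" by auto
qed

lemma exit_time_le:
  assumes "r \<in> {t0..T1}" "x r \<omega> \<notin> U" shows "exit_time U t0 T1 x \<omega> \<le> r"
proof -
  have "exit_time U t0 T1 x \<omega> = Inf {t \<in> {t0..T1}. x t \<omega> \<notin> U}" using assms by (auto simp: exit_time_def)
  also have "\<dots> \<le> r" by (rule cInf_lower) (use assms in \<open>auto intro: bdd_belowI[of _ t0]\<close>)
  finally show ?thesis .
qed

lemma before_exit_time:
  assumes "t0 \<le> r" "r < exit_time U t0 T1 x \<omega>" "t0 \<le> T1" shows "x r \<omega> \<in> U"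
  using exit_time_le[of r t0 T1 x \<omega> U] exit_time_bounds(2)[OF assms(3), of U x \<omega>] assms by (force simp: not_less)

lemma exit_time_ge:
  assumes "\<And>q. t0 \<le> q \<Longrightarrow> q \<le> r \<Longrightarrow> x q \<omega> \<in> U" "r \<le> T1" shows "r \<le> exit_time U t0 T1 x \<omega>"
proof (cases "\<forall>t\<in>{t0..T1}. x t \<omega> \<in> U")
  case True then show ?thesis using assms by (simp add: exit_time_def)
next
  case False
  then have "exit_time U t0 T1 x \<omega> = Inf {t \<in> {t0..T1}. x t \<omega> \<notin> U}" by (auto simp: exit_time_def)
  moreover have "r \<le> Inf {t \<in> {t0..T1}. x t \<omega> \<notin> U}"
  proof (rule cInf_greatest)
    show "{t \<in> {t0..T1}. x t \<omega> \<notin> U} \<noteq> {}" using False by blast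
    show "r \<le> q" if "q \<in> {t \<in> {t0..T1}. x t \<omega> \<notin> U}" for q
      using assms(1)[of q] that by (cases "q \<le> r") auto
  qed
  ultimately show ?thesis by simp
qed

lemma exit_time_attained:
  assumes "open U" "continuous_on {t0..T1} (\<lambda>t. x t \<omega>)" "\<exists>t\<in>{t0..T1}. x t \<omega> \<notin> U"
  shows "x (exit_time U t0 T1 x \<omega>) \<omega> \<notin> U"
proof -
  define E where "E = {t \<in> {t0..T1}. x t \<omega> \<notin> U}"
  have "closed E"
  proof -
    have "closed ({t0..T1} \<inter> (\<lambda>t. x t \<omega>) -` (- U))"
      using continuous_closed_preimage[OF assms(2), of "- U"] assms(1) by auto
    moreover have "{t0..T1} \<inter> (\<lambda>t. x t \<omega>) -` (- U) = E" by (auto simp: E_def)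
    ultimately show ?thesis by simp
  qed
  moreover have "E \<noteq> {}" "bdd_below E" using assms(3) by (auto simp: E_def intro: bdd_belowI[of _ t0])
  ultimately have "Inf E \<in> E" by (rule closed_contains_Inf[rotated 2])
  moreover have "exit_time U t0 T1 x \<omega> = Inf E" using assms(3) by (auto simp: exit_time_def E_def)
  ultimately show ?thesis by (auto simp: E_def)
qed

text \<open>By compactness, a path that stays in the open set keeps a positive distance from the complement,
  and this can be checked at countably many times.\<close>

lemma stays_in_open_measurable:
  fixes x :: "real \<Rightarrow> 'a \<Rightarrow> 'b::{heine_borel, real_normed_vector, second_countable_topology}"
  assumes U: "open U" and ts: "t0 \<le> s"
    and x: "\<And>r. r \<in> {t0..s} \<Longrightarrow> x r \<in> borel_measurable N"
    and xc: "\<And>\<omega>. \<omega> \<in> space N \<Longrightarrow> continuous_on {t0..s} (\<lambda>r. x r \<omega>)"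
  shows "{\<omega> \<in> space N. \<forall>r\<in>{t0..s}. x r \<omega> \<in> U} \<in> sets N"
\<comment> \<open>The distance to an empty complement is 0 by convention, so this case is treated
  apart.\<close>
proof (cases "U = UNIV")
  case True then show ?thesis by simp
next
  case False
  \<comment> \<open>Maps the line onto \<open>{t0..s}\<close>, so that rational parameters give
    countably many dense times, also when the interval is a point.\<close>
  define tm where "tm q = t0 + (s - t0) * max 0 (min 1 q)" for q
  have tm: "tm q \<in> {t0..s}" for q
  proof -
    have "(s - t0) * max 0 (min 1 q) \<le> (s - t0) * 1" using ts by (intro mult_left_mono) auto
    then show ?thesis using ts by (auto simp: tm_def intro: mult_nonneg_nonneg)
  qed
  have eq: "(\<forall>r\<in>{t0..s}. x r \<omega> \<in> U) \<longleftrightarrow> (\<exists>n::nat. \<forall>q\<in>\<rat>. 1 / real (Suc n) \<le> infdist (x (tm q) \<omega>) (- U))"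
    if w: "\<omega> \<in> space N" for \<omega>
  proof
    assume A: "\<forall>r\<in>{t0..s}. x r \<omega> \<in> U"
    define g where "g r = infdist (x r \<omega>) (- U)" for r
    have gc: "continuous_on {t0..s} g" unfolding g_def by (intro continuous_intros xc[OF w])
    obtain r0 where r0: "r0 \<in> {t0..s}" "\<And>r. r \<in> {t0..s} \<Longrightarrow> g r0 \<le> g r"
      using continuous_attains_inf[OF _ _ gc] ts by auto
    have "0 < g r0"
      unfolding g_def by (rule infdist_pos_not_in_closed) (use U A r0 False in auto)
    then obtain n where "inverse (real (Suc n)) < g r0" using reals_Archimedean by blast
    then have "\<forall>q\<in>\<rat>. 1 / real (Suc n) \<le> infdist (x (tm q) \<omega>) (- U)"
      using r0(2)[OF tm] unfolding g_def by (auto simp: inverse_eq_divide intro: order_trans[OF less_imp_le])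
    then show "\<exists>n::nat. \<forall>q\<in>\<rat>. 1 / real (Suc n) \<le> infdist (x (tm q) \<omega>) (- U)" by blast
  next
    assume "\<exists>n::nat. \<forall>q\<in>\<rat>. 1 / real (Suc n) \<le> infdist (x (tm q) \<omega>) (- U)"
    then obtain n :: nat where n: "\<And>q. q \<in> \<rat> \<Longrightarrow> 1 / real (Suc n) \<le> infdist (x (tm q) \<omega>) (- U)" by blast
    show "\<forall>r\<in>{t0..s}. x r \<omega> \<in> U"
    proof
      fix r assume r: "r \<in> {t0..s}"
      have hc: "continuous_on UNIV (\<lambda>q. infdist (x (tm q) \<omega>) (- U))"
        by (intro continuous_intros continuous_on_compose2[OF xc[OF w]]) (use tm in \<open>auto simp: tm_def intro!: continuous_intros\<close>)
      have "closed {q. 1 / real (Suc n) \<le> infdist (x (tm q) \<omega>) (- U)}"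
        by (rule closed_Collect_le[OF _ hc]) (intro continuous_intros)
      moreover have "\<rat> \<subseteq> {q. 1 / real (Suc n) \<le> infdist (x (tm q) \<omega>) (- U)}" using n by auto
      ultimately have "closure \<rat> \<subseteq> {q. 1 / real (Suc n) \<le> infdist (x (tm q) \<omega>) (- U)}" by (rule closure_minimal[rotated])
      then have all: "1 / real (Suc n) \<le> infdist (x (tm q) \<omega>) (- U)" for q using Rats_closure_real by auto
      obtain q where q: "tm q = r"
      proof (cases "s = t0")
        case True then show thesis using that[of 0] r by (simp add: tm_def)
      next
        case False
        then have "tm ((r - t0) / (s - t0)) = r" using r ts by (auto simp: tm_def field_simps max_def min_def)
        then show thesis by (rule that)
      qed
      show "x r \<omega> \<in> U"
      proof (rule ccontr)
        assume "x r \<omega> \<notin> U"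
        then have "infdist (x (tm q) \<omega>) (- U) = 0" using q by simp
        then show False using all[of q] by simp
      qed
    qed
  qed
  have "{\<omega> \<in> space N. \<forall>r\<in>{t0..s}. x r \<omega> \<in> U} = (\<Union>n::nat. \<Inter>q\<in>\<rat>. {\<omega> \<in> space N. 1 / real (Suc n) \<le> infdist (x (tm q) \<omega>) (- U)})"
    using eq Rats_0 by fastforce
  also have "\<dots> \<in> sets N"
  proof -
    define B where "B n q = {\<omega> \<in> space N. 1 / real (Suc n) \<le> infdist (x (tm q) \<omega>) (- U)}" for n q
    have "(\<lambda>\<omega>. infdist (x (tm q) \<omega>) (- U)) \<in> borel_measurable N" for q
      by (rule borel_measurable_continuous_on[OF _ x[OF tm]]) (intro continuous_intros)
    then have "B n q \<in> sets N" for n q unfolding B_def by measurable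
    then have "(\<Inter>q\<in>\<rat>. B n q) \<in> sets N" for n
      by (intro sets.countable_INT'[OF countable_rat]) (use Rats_0 in blast)+
    then have "(\<Union>n. \<Inter>q\<in>\<rat>. B n q) \<in> sets N" by (intro sets.countable_UN) blast
    then show ?thesis by (simp add: B_def)
  qed
  finally show ?thesis .
qed

context wiener_filtration
begin

context
  fixes U :: "(real ^ 'n) set" and x :: "real \<Rightarrow> 'a \<Rightarrow> real ^ 'n" and T1 :: real
  assumes U: "open U" and T1: "t0 \<le> T1" "T1 \<le> T"
    and x_adapted: "\<And>r. r \<in> {t0..T} \<Longrightarrow> x r \<in> borel_measurable (Fl r)"
    and x_cont: "\<And>\<omega>. \<omega> \<in> space M \<Longrightarrow> continuous_on UNIV (\<lambda>r. x r \<omega>)"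
begin

lemma stays_in_filtration:
  assumes "s \<in> {t0..T}" shows "{\<omega> \<in> space M. \<forall>r\<in>{t0..s}. x r \<omega> \<in> U} \<in> sets (Fl s)"
proof -
  have "{\<omega> \<in> space (Fl s). \<forall>r\<in>{t0..s}. x r \<omega> \<in> U} \<in> sets (Fl s)"
  proof (rule stays_in_open_measurable[OF U])
    show "x r \<in> borel_measurable (Fl s)" if "r \<in> {t0..s}" for r
      by (rule measurable_filtration_mono[of r]) (use that assms x_adapted in auto)
    show "continuous_on {t0..s} (\<lambda>r. x r \<omega>)" if "\<omega> \<in> space (Fl s)" for \<omega>
      using x_cont[of \<omega>] that space_filtration[OF assms] by (auto intro: continuous_on_subset)
  qed (use assms in auto)
  then show ?thesis by (simp add: space_filtration[OF assms])
qed

lemma exit_time_measurable: "exit_time U t0 T1 x \<in> borel_measurable M"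
proof (rule borel_measurable_iff_greater[THEN iffD2], rule allI)
  fix a
  \<comment> \<open>The exit time lies in \<open>{t0..T1}\<close>. For \<open>a\<close> in between,
    exceeding \<open>a\<close> means staying in \<open>U\<close> up to and including
    \<open>a\<close>, because the exit time is attained.\<close>
  consider "a < t0" | "T1 \<le> a" | "t0 \<le> a" "a < T1" by linarith
  then show "{\<omega> \<in> space M. a < exit_time U t0 T1 x \<omega>} \<in> sets M"
  proof cases
    case 1
    then have "{\<omega> \<in> space M. a < exit_time U t0 T1 x \<omega>} = space M"
      using less_le_trans[OF 1 exit_time_bounds(1)[where x = x, OF T1(1)]] by blast
    then show ?thesis by simp
  next
    case 2
    then have "\<not> a < exit_time U t0 T1 x \<omega>" for \<omega>
      using exit_time_bounds(2)[OF T1(1), of U x \<omega>] by linarith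
    then show ?thesis by simp
  next
    case 3
    have "a < exit_time U t0 T1 x \<omega> \<longleftrightarrow> (\<forall>r\<in>{t0..a}. x r \<omega> \<in> U)" if w: "\<omega> \<in> space M" for \<omega>
    proof
      assume a: "a < exit_time U t0 T1 x \<omega>"
      show "\<forall>r\<in>{t0..a}. x r \<omega> \<in> U"
      proof
        fix r assume "r \<in> {t0..a}"
        then have "t0 \<le> r" "r < exit_time U t0 T1 x \<omega>" using a by auto
        from before_exit_time[where x = x and \<omega> = \<omega>, OF this T1(1)] show "x r \<omega> \<in> U" .
      qed
    next
      assume *: "\<forall>r\<in>{t0..a}. x r \<omega> \<in> U"
      show "a < exit_time U t0 T1 x \<omega>"
      proof (cases "\<forall>t\<in>{t0..T1}. x t \<omega> \<in> U")
        case True then show ?thesis using 3 by (simp add: exit_time_def)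
      next
        case False
        have "continuous_on {t0..T1} (\<lambda>r. x r \<omega>)" by (rule continuous_on_subset[OF x_cont[OF w]]) simp
        from exit_time_attained[where x = x and \<omega> = \<omega>, OF U this] False have "x (exit_time U t0 T1 x \<omega>) \<omega> \<notin> U" by blast
        moreover have "t0 \<le> exit_time U t0 T1 x \<omega>" by (rule exit_time_bounds(1)[OF T1(1)])
        ultimately have "exit_time U t0 T1 x \<omega> \<notin> {t0..a}" using * by blast
        then show ?thesis using \<open>t0 \<le> exit_time U t0 T1 x \<omega>\<close> by simp
      qed
    qed
    then have "{\<omega> \<in> space M. a < exit_time U t0 T1 x \<omega>} = {\<omega> \<in> space M. \<forall>r\<in>{t0..a}. x r \<omega> \<in> U}" by blast
    moreover have aT: "a \<in> {t0..T}" using 3 T1 by auto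
    ultimately show ?thesis using sets_filtration[OF aT stays_in_filtration[OF aT]] by (simp only:)
  qed
qed

lemma exit_value_measurable:
  assumes "jointly_measurable M X"
  shows "(\<lambda>\<omega>. X (exit_time U t0 T1 x \<omega>) \<omega>) \<in> borel_measurable M"
proof -
  have "(\<lambda>\<omega>. (\<omega>, exit_time U t0 T1 x \<omega>)) \<in> measurable M (M \<Otimes>\<^sub>M borel)"
    by (intro measurable_Pair measurable_ident_sets refl exit_time_measurable)
  from measurable_compose[OF this assms[unfolded jointly_measurable_def]] show ?thesis by (simp only: fst_conv snd_conv)
qed

text \<open>The stopped value is the limit of the values at the first grid point at which the path has been
  seen outside \<open>U\<close>; the latter is a sum of increments weighted by past events.\<close>

lemma optional_stopping_exit_time:
  assumes X: "\<And>r. X r \<in> borel_measurable M" "\<And>\<omega>. \<omega> \<in> space M \<Longrightarrow> continuous_on UNIV (\<lambda>r. X r \<omega>)"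
    and bd: "\<And>r \<omega>. \<omega> \<in> space M \<Longrightarrow> \<bar>X r \<omega>\<bar> \<le> (B::real)"
    and inc: "\<And>s t A. t0 \<le> s \<Longrightarrow> s \<le> t \<Longrightarrow> t \<le> T1 \<Longrightarrow> A \<in> sets (Fl s) \<Longrightarrow> expectation (\<lambda>\<omega>. indicator A \<omega> * (X t \<omega> - X s \<omega>)) = 0"
  shows "expectation (\<lambda>\<omega>. X (exit_time U t0 T1 x \<omega>) \<omega> - X t0 \<omega>) = 0"
proof -
  define h where "h n = (T1 - t0) / real (Suc n)" for n
  define g where "g n k = t0 + real k * h n" for n k
  define E where "E s = {\<omega> \<in> space M. \<forall>r\<in>{t0..s}. x r \<omega> \<in> U}" for s
  \<comment> \<open>Each weight is an event known at the left grid point, so every summand has mean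
    zero.\<close>
  define Sm where "Sm n \<omega> = (\<Sum>k<Suc n. indicator (E (g n k)) \<omega> * (X (g n (Suc k)) \<omega> - X (g n k) \<omega>))" for n \<omega>
  have h0: "0 \<le> h n" for n using T1 by (simp add: h_def)
  have g0: "g n 0 = t0" "g n (Suc n) = T1" "g n (Suc k) = g n k + h n" for n k
  proof -
    show "g n 0 = t0" "g n (Suc k) = g n k + h n" by (simp_all add: g_def algebra_simps)
    show "g n (Suc n) = T1" by (simp add: g_def h_def del: of_nat_Suc)
  qed
  have gm: "g n k \<le> g n k'" if "k \<le> k'" for n k k'
    using that h0[of n] by (auto simp: g_def intro: mult_right_mono)
  have gr: "t0 \<le> g n k" "k \<le> Suc n \<Longrightarrow> g n k \<le> T1" for n k
    using gm[of 0 k n] gm[of k "Suc n" n] g0(1,2)[of n] by auto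
  have gT: "k \<le> Suc n \<Longrightarrow> g n k \<in> {t0..T}" for n k using gr(1)[of n k] gr(2)[of k n] T1 by auto
  have EM: "E (g n k) \<in> sets M" if "k \<le> Suc n" for n k
    unfolding E_def by (rule sets_filtration[OF gT[OF that] stays_in_filtration[OF gT[OF that]]])
  have SmE: "expectation (Sm n) = 0" for n
  proof -
    have i: "integrable M (\<lambda>\<omega>. indicator (E (g n k)) \<omega> * (X (g n (Suc k)) \<omega> - X (g n k) \<omega>))" if "k < Suc n" for k
    proof (rule integrable_bounded[where B = "B + B"])
      show "(\<lambda>\<omega>. indicator (E (g n k)) \<omega> * (X (g n (Suc k)) \<omega> - X (g n k) \<omega>)) \<in> borel_measurable M"
        using EM[of k n] X(1) that by (intro borel_measurable_times borel_measurable_indicator borel_measurable_diff) auto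
      show "\<bar>indicator (E (g n k)) \<omega> * (X (g n (Suc k)) \<omega> - X (g n k) \<omega>)\<bar> \<le> B + B" if "\<omega> \<in> space M" for \<omega>
        using bd[OF that, of "g n (Suc k)"] bd[OF that, of "g n k"] by (auto simp: indicator_def)
    qed
    have "expectation (Sm n) = (\<Sum>k<Suc n. expectation (\<lambda>\<omega>. indicator (E (g n k)) \<omega> * (X (g n (Suc k)) \<omega> - X (g n k) \<omega>)))"
      unfolding Sm_def by (rule Bochner_Integration.integral_sum) (use i in auto)
    also have "\<dots> = 0"
    proof (rule sum.neutral, rule ballI)
      fix k assume "k \<in> {..<Suc n}"
      then have k: "k \<le> Suc n" "Suc k \<le> Suc n" by auto
      show "expectation (\<lambda>\<omega>. indicator (E (g n k)) \<omega> * (X (g n (Suc k)) \<omega> - X (g n k) \<omega>)) = 0"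
      proof (rule inc)
        show "E (g n k) \<in> sets (Fl (g n k))" unfolding E_def by (rule stays_in_filtration[OF gT[OF k(1)]])
      qed (use gr(1)[of n k] gr(2)[OF k(2)] gm[of k "Suc k" n] in auto)
    qed
    finally show ?thesis .
  qed
  have near: "\<exists>\<sigma>. Sm n \<omega> = X \<sigma> \<omega> - X t0 \<omega> \<and> \<bar>\<sigma> - exit_time U t0 T1 x \<omega>\<bar> \<le> h n" if w: "\<omega> \<in> space M" for n \<omega>
  proof -
    \<comment> \<open>\<open>\<kappa>\<close> is the first grid index by which the path has left
      \<open>U\<close>, capped at the end of the grid. The weights are 1 below it and 0 from it on,
      so the sum telescopes.\<close>
    define P where "P k \<longleftrightarrow> k = Suc n \<or> \<omega> \<notin> E (g n k)" for k
    define \<kappa> where "\<kappa> = (LEAST k. P k)"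
    have P\<kappa>: "P \<kappa>" unfolding \<kappa>_def by (rule LeastI[of P "Suc n"]) (simp add: P_def)
    have \<kappa>n: "\<kappa> \<le> Suc n" unfolding \<kappa>_def by (rule Least_le) (simp add: P_def)
    have before: "\<omega> \<in> E (g n k)" if "k < \<kappa>" for k
      using not_less_Least[of k P] that by (auto simp: \<kappa>_def P_def)
    have after: "\<omega> \<notin> E (g n k)" if "\<kappa> \<le> k" "k < Suc n" for k
    proof -
      have "\<omega> \<notin> E (g n \<kappa>)" using P\<kappa> that by (simp add: P_def)
      moreover have "E (g n k) \<subseteq> E (g n \<kappa>)" using gm[OF that(1), of n] unfolding E_def by auto
      ultimately show ?thesis by blast
    qed
    have "Sm n \<omega> = (\<Sum>k<Suc n. if k < \<kappa> then X (g n (Suc k)) \<omega> - X (g n k) \<omega> else 0)"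
      unfolding Sm_def
    proof (rule sum.cong[OF refl])
      fix k assume k: "k \<in> {..<Suc n}"
      show "indicator (E (g n k)) \<omega> * (X (g n (Suc k)) \<omega> - X (g n k) \<omega>) = (if k < \<kappa> then X (g n (Suc k)) \<omega> - X (g n k) \<omega> else 0)"
        using before[of k] after[of k] k by (cases "k < \<kappa>") (simp_all add: not_less)
    qed
    also have "\<dots> = (\<Sum>k\<in>{..<Suc n} \<inter> {k. k < \<kappa>}. X (g n (Suc k)) \<omega> - X (g n k) \<omega>)"
      by (subst sum.inter_restrict) auto
    also have "{..<Suc n} \<inter> {k. k < \<kappa>} = {..<\<kappa>}" using \<kappa>n by auto
    also have "(\<Sum>k<\<kappa>. X (g n (Suc k)) \<omega> - X (g n k) \<omega>) = X (g n \<kappa>) \<omega> - X (g n 0) \<omega>"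
      by (rule sum_lessThan_telescope)
    finally have S: "Sm n \<omega> = X (g n \<kappa>) \<omega> - X t0 \<omega>" by (simp add: g0)
    have up: "exit_time U t0 T1 x \<omega> \<le> g n \<kappa>"
    proof (cases "\<kappa> = Suc n")
      case True then show ?thesis using exit_time_bounds(2)[OF T1(1), of U x \<omega>] g0 by simp
    next
      case False
      then have "\<omega> \<notin> E (g n \<kappa>)" using P\<kappa> by (simp add: P_def)
      then obtain r where r: "r \<in> {t0..g n \<kappa>}" "x r \<omega> \<notin> U" using w by (auto simp: E_def)
      have "exit_time U t0 T1 x \<omega> \<le> r" using gr(2)[OF \<kappa>n] r
        by (intro exit_time_le[where x = x and \<omega> = \<omega> and U = U]) auto
      then show ?thesis using r(1) by simp
    qed
    have low: "g n \<kappa> - h n \<le> exit_time U t0 T1 x \<omega>"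
    proof (cases \<kappa>)
      case 0
      then show ?thesis using exit_time_bounds(1)[OF T1(1), of U x \<omega>] g0(1)[of n] h0[of n] by simp
    next
      case (Suc k)
      have "g n k \<le> exit_time U t0 T1 x \<omega>"
      proof (rule exit_time_ge[where x = x and \<omega> = \<omega> and U = U])
        show "g n k \<le> T1" using gr(2)[of k n] Suc \<kappa>n by simp
        show "x q \<omega> \<in> U" if "t0 \<le> q" "q \<le> g n k" for q using before[of k] Suc that by (simp add: E_def)
      qed
      then show ?thesis using Suc g0(3)[of n k] by simp
    qed
    show ?thesis using S up low h0[of n] by (intro exI[of _ "g n \<kappa>"]) auto
  qed
  have hl: "h \<longlonglongrightarrow> 0"
    unfolding h_def using LIMSEQ_inverse_real_of_nat[THEN tendsto_mult_left, of "T1 - t0"] by (simp add: divide_inverse)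
  have "(\<lambda>n. expectation (Sm n)) \<longlonglongrightarrow> expectation (\<lambda>\<omega>. X (exit_time U t0 T1 x \<omega>) \<omega> - X t0 \<omega>)"
  proof (rule integral_dominated_convergence[where w = "\<lambda>_. B + B"])
    show "(\<lambda>\<omega>. X (exit_time U t0 T1 x \<omega>) \<omega> - X t0 \<omega>) \<in> borel_measurable M"
      by (rule borel_measurable_diff[OF exit_value_measurable[OF jointly_measurable_continuous[OF X]] X(1)])
    show "Sm n \<in> borel_measurable M" for n unfolding Sm_def[abs_def]
      by (intro borel_measurable_sum borel_measurable_times borel_measurable_indicator borel_measurable_diff X EM) auto
    show "AE \<omega> in M. norm (Sm n \<omega>) \<le> B + B" for n
    proof (rule AE_I2)
      fix \<omega> assume w: "\<omega> \<in> space M"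
      from near[OF w, of n] obtain \<sigma> where "Sm n \<omega> = X \<sigma> \<omega> - X t0 \<omega>" by blast
      then show "norm (Sm n \<omega>) \<le> B + B" using bd[OF w, of \<sigma>] bd[OF w, of t0] by auto
    qed
    show "AE \<omega> in M. (\<lambda>n. Sm n \<omega>) \<longlonglongrightarrow> X (exit_time U t0 T1 x \<omega>) \<omega> - X t0 \<omega>"
    proof (rule AE_I2)
      fix \<omega> assume w: "\<omega> \<in> space M"
      obtain \<sigma> where \<sigma>: "\<And>n. Sm n \<omega> = X (\<sigma> n) \<omega> - X t0 \<omega>" "\<And>n. \<bar>\<sigma> n - exit_time U t0 T1 x \<omega>\<bar> \<le> h n"
        using near[OF w] by metis
      have "(\<lambda>n. \<sigma> n - exit_time U t0 T1 x \<omega>) \<longlonglongrightarrow> 0"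
        by (rule Lim_null_comparison[OF _ hl]) (use \<sigma>(2) in auto)
      then have "\<sigma> \<longlonglongrightarrow> exit_time U t0 T1 x \<omega>" by (simp add: LIM_zero_iff)
      from continuous_on_tendsto_compose[OF X(2)[OF w] this]
      have "(\<lambda>n. X (\<sigma> n) \<omega>) \<longlonglongrightarrow> X (exit_time U t0 T1 x \<omega>) \<omega>" by simp
      then show "(\<lambda>n. Sm n \<omega>) \<longlonglongrightarrow> X (exit_time U t0 T1 x \<omega>) \<omega> - X t0 \<omega>"
        unfolding \<sigma>(1) by (intro tendsto_diff tendsto_const)
    qed
  qed simp
  then show ?thesis unfolding SmE by (simp add: LIMSEQ_const_iff)
qed

end

end

section \<open>Dynkin's formula\<close>

context ito_setting
begin

lemma continuous_on_F_path:
  assumes "continuous_on UNIV x" shows "continuous_on {t0..T1} (\<lambda>r. F (x r) r)"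
proof -
  have "continuous_on {t0..T1} (\<lambda>r. snd (snd (snd (jet (x r) r))))"
    by (intro continuous_on_snd continuous_on_jet_path continuous_on_subset[OF assms]) auto
  then show ?thesis by (simp add: jet_def)
qed

lemma F_bounded: "r \<in> {t0..T1} \<Longrightarrow> \<bar>F y r\<bar> \<le> K"
  using order_trans[OF jet_components_le(7) jet_bounded] by blast

lemma gap_continuous:
  assumes b: "b \<in> borel_measurable borel" "S \<in> borel_measurable borel" "c \<in> borel_measurable borel"
    and c: "set_integrable lborel {t0..T1} c" "\<And>r. 0 \<le> c r"
    and dom: "\<And>r. norm (b r) + norm (S r) \<le> \<kappa> * c r" "0 \<le> \<kappa>" and y: "continuous_on UNIV y"
  shows "continuous_on {t0..T1} (\<lambda>t. gap b S c y t0 t)"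
  unfolding gap_def
proof (intro continuous_on_diff continuous_on_mult continuous_on_const continuous_on_indefinite_set_integral continuous_on_F_path[OF y])
  show "continuous_on {t0..T1} (discount t0 c)"
    unfolding discount_def by (intro continuous_intros continuous_on_indefinite_set_integral c)
  show "set_integrable lborel {t0..T1} (generator_rate b S c y)"
    by (rule gap_bounded_discounted(1)[OF order_refl horizon(1) order_refl b c dom y])
qed

text \<open>Before \<open>\<tau>\<close> the equation removes every term of the generator except
  killing. What is left is at most \<open>K\<close> times the discounted total of the rate: the 1 in
  the minimum is uniform in the rate, the integral makes the bound vanish together with the
  rate.\<close>

lemma stopped_gap_harmonic:
  assumes b: "b \<in> borel_measurable borel" "S \<in> borel_measurable borel" "c \<in> borel_measurable borel"
    and c: "set_integrable lborel {t0..T1} c" "\<And>r. 0 \<le> c r" and y: "continuous_on UNIV y"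
    and \<tau>: "t0 \<le> \<tau>" "\<tau> \<le> T1"
    and pde: "\<And>r. t0 \<le> r \<Longrightarrow> r < \<tau> \<Longrightarrow> Ft (y r) r + b r \<bullet> Fx (y r) r + 1/2 * (S r \<bullet> Fxx (y r) r) = 0"
  shows "\<bar>gap b S c y t0 \<tau> - (F (y \<tau>) \<tau> * discount t0 c \<tau> - F (y t0) t0)\<bar> \<le> K * min 1 (LINT r:{t0..T1}|lborel. c r)"
proof -
  define h where "h r = - (F (y r) r * (c r * discount t0 c r))" for r
  have K0: "0 \<le> K" using K_nonneg horizon by simp
  have Z: "0 \<le> discount t0 c r" "discount t0 c r \<le> 1" for r
    by (auto simp: discount_def intro!: set_integral_nonneg_real c)
  have icZ: "set_integrable lborel {t0..T1} (\<lambda>r. c r * discount t0 c r)"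
    and lcZ: "(LINT r:{t0..T1}|lborel. c r * discount t0 c r) \<le> 1"
    using discounted_total_integrable[OF c horizon(1) b(3)] discounted_total_le[OF c horizon(1) b(3)] unfolding discount_def by auto
  have icZs: "set_integrable lborel {t0..\<tau>} (\<lambda>r. c r * discount t0 c r)"
    by (rule set_integrable_subset[OF icZ]) (use \<tau> in auto)
  have nn: "0 \<le> c r * discount t0 c r" for r using c(2) Z by simp
  \<comment> \<open>The equation is available strictly before \<open>\<tau>\<close>; the end point
    is a null set.\<close>
  have half: "(LINT r:{t0..\<tau>}|lborel. f r) = (LINT r:{t0..<\<tau>}|lborel. f r)" for f :: "real \<Rightarrow> real"
    by (rule set_integral_discrete_difference[of "{\<tau>}"]) auto
  have "(LINT r:{t0..<\<tau>}|lborel. generator_rate b S c y r) = (LINT r:{t0..<\<tau>}|lborel. h r)"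
  proof (rule set_lebesgue_integral_cong)
    show "\<forall>r. r \<in> {t0..<\<tau>} \<longrightarrow> generator_rate b S c y r = h r"
    proof (intro allI impI)
      fix r assume "r \<in> {t0..<\<tau>}"
      then have p: "Ft (y r) r + b r \<bullet> Fx (y r) r + 1/2 * (S r \<bullet> Fxx (y r) r) = 0" by (intro pde) auto
      have "generator_rate b S c y r = discount t0 c r * (Ft (y r) r + b r \<bullet> Fx (y r) r + 1/2 * (S r \<bullet> Fxx (y r) r)) + h r"
        by (simp add: generator_rate_def coef_def jet_def h_def algebra_simps)
      then show "generator_rate b S c y r = h r" unfolding p by simp
    qed
  qed simp
  then have eq: "(LINT r:{t0..\<tau>}|lborel. generator_rate b S c y r) = (LINT r:{t0..\<tau>}|lborel. h r)"
    by (simp only: half)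
  have h_le: "\<bar>h r\<bar> \<le> K * (c r * discount t0 c r)" if "r \<in> {t0..\<tau>}" for r
    using F_bounded[of r "y r"] that \<tau> nn[of r] mult_right_mono[of "\<bar>F (y r) r\<bar>" K "c r * discount t0 c r"]
    by (simp add: h_def abs_mult[of "F (y r) r"] abs_of_nonneg[OF nn])
  have iKcZ: "set_integrable lborel {t0..\<tau>} (\<lambda>r. K * (c r * discount t0 c r))" using icZs by (rule set_integrable_mult_right)
  have ih: "set_integrable lborel {t0..\<tau>} h"
  proof (rule set_integrable_bound[OF iKcZ])
    have "continuous_on {t0..\<tau>} (\<lambda>r. F (y r) r)"
      by (rule continuous_on_subset[OF continuous_on_F_path[OF y]]) (use \<tau> in auto)
    then have "(\<lambda>r. indicator {t0..\<tau>} r *\<^sub>R F (y r) r) \<in> borel_measurable borel"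
      by (intro borel_measurable_continuous_on_indicator) auto
    then have "(\<lambda>r. indicator {t0..\<tau>} r *\<^sub>R F (y r) r) \<in> borel_measurable lborel" by simp
    from borel_measurable_times[OF this borel_measurable_integrable[OF icZs[unfolded set_integrable_def]]]
    have "(\<lambda>r. - (indicator {t0..\<tau>} r *\<^sub>R F (y r) r * (indicator {t0..\<tau>} r *\<^sub>R (c r * discount t0 c r)))) \<in> borel_measurable lborel"
      by (rule borel_measurable_uminus)
    then show "set_borel_measurable lborel {t0..\<tau>} h"
      unfolding set_borel_measurable_def by (rule measurable_cong[THEN iffD1, rotated]) (simp add: h_def indicator_def)
    show "AE r in lborel. r \<in> {t0..\<tau>} \<longrightarrow> norm (h r) \<le> norm (K * (c r * discount t0 c r))"
      using order_trans[OF h_le abs_ge_self] by (intro AE_I2) (simp del: abs_mult)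
  qed
  have "norm (LINT r:{t0..\<tau>}|lborel. h r) \<le> (LINT r:{t0..\<tau>}|lborel. K * (c r * discount t0 c r))"
    by (rule set_integral_norm_le[OF ih iKcZ]) (use h_le in simp)
  also have "\<dots> = K * (LINT r:{t0..\<tau>}|lborel. c r * discount t0 c r)" by simp
  also have "\<dots> \<le> K * min 1 (LINT r:{t0..T1}|lborel. c r)"
  proof (rule mult_left_mono[OF _ K0])
    have 1: "(LINT r:{t0..\<tau>}|lborel. c r * discount t0 c r) \<le> (LINT r:{t0..T1}|lborel. c r * discount t0 c r)"
      by (rule set_integral_mono_nonneg[OF icZ nn]) (use \<tau> in auto)
    have 2: "(LINT r:{t0..T1}|lborel. c r * discount t0 c r) \<le> (LINT r:{t0..T1}|lborel. c r)"
    proof (rule set_integral_mono[OF icZ c(1)])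
      show "c r * discount t0 c r \<le> c r" for r using mult_left_mono[OF Z(2) c(2)] by simp
    qed
    show "(LINT r:{t0..\<tau>}|lborel. c r * discount t0 c r) \<le> min 1 (LINT r:{t0..T1}|lborel. c r)" using 1 2 lcZ by simp
  qed
  finally have fin: "\<bar>LINT r:{t0..\<tau>}|lborel. h r\<bar> \<le> K * min 1 (LINT r:{t0..T1}|lborel. c r)" by simp
  have "discount t0 c t0 = 1" unfolding discount_def set_integral_Icc_same by simp
  then have "gap b S c y t0 \<tau> - (F (y \<tau>) \<tau> * discount t0 c \<tau> - F (y t0) t0) = - (LINT r:{t0..\<tau>}|lborel. h r)"
    unfolding gap_def eq by simp
  then show ?thesis using fin by simp
qed

text \<open>For each \<open>l\<close> the stopped gap has mean zero. As \<open>l\<close> tends to 0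
  the discount tends to 1 and the killing term disappears, so the increment of \<open>F\<close> up
  to the exit time has mean zero.\<close>

lemma dynkin_exit_time:
  fixes b :: "real \<Rightarrow> 'a \<Rightarrow> real ^ 'n" and H :: "real \<Rightarrow> 'a \<Rightarrow> real ^ 'k ^ 'n"
  assumes b: "progressive b" and H: "progressive H"
    and ib: "AE \<omega> in M. set_integrable lborel {t0..T} (\<lambda>r. b r \<omega>)"
    and iH: "AE \<omega> in M. set_integrable lborel {t0..T} (\<lambda>r. (norm (H r \<omega>))\<^sup>2)"
    and x: "\<And>\<omega>. \<omega> \<in> space M \<Longrightarrow> continuous_on UNIV (\<lambda>r. x r \<omega>)" "\<And>r. x r \<in> borel_measurable M"
      "\<And>r. r \<in> {t0..T} \<Longrightarrow> x r \<in> borel_measurable (Fl r)"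
    and x_eq: "AE \<omega> in M. \<forall>t\<in>{t0..T}. x t \<omega> = x0 + (LINT r:{t0..t}|lborel. b r \<omega>) + I t \<omega>"
    and I: "\<And>t. t \<in> {t0..T} \<Longrightarrow> I t \<in> borel_measurable M"
    and sp: "\<And>j. simple_process Fl t0 T (N j) (p j) (\<xi> j)"
    and H_lim: "vanishes_in_probability M (\<lambda>j \<omega>. \<integral>\<^sup>+t\<in>{t0..T}. ennreal ((norm (simple_value (N j) (p j) (\<xi> j) t \<omega> - H t \<omega>))\<^sup>2) \<partial>lborel)"
    and I_lim: "\<And>t. t \<in> {t0..T} \<Longrightarrow> vanishes_in_probability M (\<lambda>j \<omega>. ennreal (norm (simple_integral w (N j) (p j) (\<xi> j) t \<omega> - I t \<omega>)))"
    and x0: "AE \<omega> in M. x t0 \<omega> = x0"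
    and U: "open U"
    and pde: "\<And>\<omega> r. \<omega> \<in> space M \<Longrightarrow> r \<in> {t0..T1} \<Longrightarrow> x r \<omega> \<in> U \<Longrightarrow>
        Ft (x r \<omega>) r + b r \<omega> \<bullet> Fx (x r \<omega>) r + 1/2 * ((H r \<omega> ** transpose (H r \<omega>)) \<bullet> Fxx (x r \<omega>) r) = 0"
  shows "expectation (\<lambda>\<omega>. F (x (exit_time U t0 T1 x \<omega>) \<omega>) (exit_time U t0 T1 x \<omega>)) = F x0 t0"
proof -
  define \<tau> where "\<tau> = exit_time U t0 T1 x"
  define a where "a r \<omega> = norm (b r \<omega>) + (norm (H r \<omega>))\<^sup>2" for r \<omega>
  define S where "S r \<omega> = H r \<omega> ** transpose (H r \<omega>)" for r \<omega>
  define G where "G l s t \<omega> = gap (\<lambda>r. b r \<omega>) (\<lambda>r. S r \<omega>) (\<lambda>r. l * a r \<omega>) (\<lambda>r. x r \<omega>) s t" for l s t \<omega>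
  define cl where "cl r = max t0 (min T1 r)" for r
  have K0: "0 \<le> K" using K_nonneg horizon by simp
  have \<tau>: "t0 \<le> \<tau> \<omega>" "\<tau> \<omega> \<le> T1" for \<omega> using exit_time_bounds[OF horizon(1)] by (auto simp: \<tau>_def)
  have cl: "cl r \<in> {t0..T1}" for r using horizon by (auto simp: cl_def)
  have cl_id: "r \<in> {t0..T1} \<Longrightarrow> cl r = r" for r by (auto simp: cl_def)
  note jb = progressive_jointly_measurable[OF b] and jH = progressive_jointly_measurable[OF H]
  have jS: "jointly_measurable M S" unfolding S_def by (rule jointly_measurable_compose[OF jH borel_measurable_self_transpose])
  have ja: "jointly_measurable M a" unfolding a_def
    by (rule jointly_measurable_add[OF jointly_measurable_compose[OF jb, of norm] jointly_measurable_compose[OF jH, of "\<lambda>v. (norm v)\<^sup>2"]]) simp_all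
  have jla: "jointly_measurable M (\<lambda>r \<omega>. l * a r \<omega>)" for l by (rule jointly_measurable_compose[OF ja]) simp
  have jx: "jointly_measurable M x" by (rule jointly_measurable_continuous[OF x(2,1)])
  have a0: "0 \<le> a r \<omega>" for r \<omega> by (simp add: a_def)
  have "AE \<omega> in M. set_integrable lborel {t0..T1} (\<lambda>r. a r \<omega>)"
    using ib iH
  proof eventually_elim
    case (elim \<omega>)
    have "set_integrable lborel {t0..T} (\<lambda>r. a r \<omega>)"
      unfolding a_def using integrable_norm[OF elim(1)[unfolded set_integrable_def]] elim(2)
      by (intro set_integral_add(1)) (auto simp: set_integrable_def)
    then show ?case by (rule set_integrable_subset) (use horizon in auto)
  qed
  \<comment> \<open>On a null set the rate may fail to be integrable. Setting the process to 0 there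
    makes it bounded and continuous for every outcome, as stopping requires.\<close>
  then obtain N0 where N0: "N0 \<in> null_sets M" "{\<omega> \<in> space M. \<not> set_integrable lborel {t0..T1} (\<lambda>r. a r \<omega>)} \<subseteq> N0"
    unfolding eventually_ae_filter by blast
  have N0M: "N0 \<in> sets M" using N0(1) by auto
  have good: "set_integrable lborel {t0..T1} (\<lambda>r. l * a r \<omega>)" if "\<omega> \<in> space M" "\<omega> \<notin> N0" for \<omega> l
    using N0(2) that by (intro set_integrable_mult_right) auto
  have AE_good: "AE \<omega> in M. \<omega> \<notin> N0" using AE_not_in[OF N0(1)] .
  note sb = jointly_measurable_section[OF jb] and sS = jointly_measurable_section[OF jS] and sa = jointly_measurable_section[OF jla]
  have dom: "norm (b r \<omega>) + norm (S r \<omega>) \<le> 1/l * (l * a r \<omega>)" if "0 < l" for l r \<omega>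
    using norm_matrix_transpose_mult_le[of "H r \<omega>" "H r \<omega>"] that by (simp add: a_def S_def power2_eq_square)
  define X where "X l r \<omega> = (if \<omega> \<in> N0 then 0 else G l t0 (cl r) \<omega>)" for l r \<omega>
  have X_zero: "expectation (\<lambda>\<omega>. X l (\<tau> \<omega>) \<omega>) = 0" and X_meas: "(\<lambda>\<omega>. X l (\<tau> \<omega>) \<omega>) \<in> borel_measurable M" if l: "0 < l" for l
  proof -
    have la0: "0 \<le> l * a r \<omega>" for r \<omega> using l a0 by simp
    have l1: "0 \<le> 1 / l" using l by simp
    define B where "B = 2 * K + (K * (T1 - t0) + K * (1/l + 1))"
    have B0: "0 \<le> B" using K0 l horizon by (auto simp: B_def intro!: add_nonneg_nonneg mult_nonneg_nonneg)
    have GM: "(\<lambda>\<omega>. G l s t \<omega>) \<in> borel_measurable M" if "t0 \<le> s" "s \<le> t" "t \<le> T1" for s t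
      unfolding G_def by (rule gap_measurable[OF that jb jS jla jx])
    have XM: "X l r \<in> borel_measurable M" for r
      unfolding X_def[abs_def]
      by (rule measurable_If_set) (use GM[of t0 "cl r"] cl[of r] N0M in \<open>auto simp: sets.Int_space_eq2\<close>)
    have G_bd: "\<bar>G l s t \<omega>\<bar> \<le> B" if w: "\<omega> \<in> space M" "\<omega> \<notin> N0" and st: "t0 \<le> s" "s \<le> t" "t \<le> T1" for s t \<omega>
      unfolding G_def B_def
      by (rule gap_bounded_discounted(2)[OF st sb[OF w(1)] sS[OF w(1)] sa[OF w(1)] good[OF w] la0 dom[OF l] l1 x(1)[OF w(1)]])
    have X_bd: "\<bar>X l r \<omega>\<bar> \<le> B" if "\<omega> \<in> space M" for r \<omega>
      using G_bd[OF that, of t0 "cl r"] cl[of r] B0 by (auto simp: X_def)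
    have Xc: "continuous_on UNIV (\<lambda>r. X l r \<omega>)" if w: "\<omega> \<in> space M" for \<omega>
    proof (cases "\<omega> \<in> N0")
      case True then show ?thesis by (simp add: X_def)
    next
      case False
      have "continuous_on {t0..T1} (\<lambda>t. G l t0 t \<omega>)"
        unfolding G_def by (rule gap_continuous[OF sb[OF w] sS[OF w] sa[OF w] good[OF w False] la0 dom[OF l] l1 x(1)[OF w]])
      then have "continuous_on UNIV (\<lambda>r. G l t0 (cl r) \<omega>)"
        by (rule continuous_on_compose2) (use cl in \<open>auto simp: cl_def intro!: continuous_intros\<close>)
      then show ?thesis using False by (simp add: X_def)
    qed
    have inc: "expectation (\<lambda>\<omega>. indicator A \<omega> * (X l t \<omega> - X l s \<omega>)) = 0"
      if st: "t0 \<le> s" "s \<le> t" "t \<le> T1" and A: "A \<in> sets (Fl s)" for s t A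
    proof -
      have AM: "A \<in> sets M" by (rule sets_filtration[OF _ A]) (use st horizon in auto)
      have "expectation (\<lambda>\<omega>. indicator A \<omega> * (X l t \<omega> - X l s \<omega>)) = expectation (\<lambda>\<omega>. indicator A \<omega> * G l s t \<omega>)"
      proof (rule integral_cong_AE)
        show "(\<lambda>\<omega>. indicator A \<omega> * (X l t \<omega> - X l s \<omega>)) \<in> borel_measurable M" "(\<lambda>\<omega>. indicator A \<omega> * G l s t \<omega>) \<in> borel_measurable M"
          by (intro borel_measurable_times borel_measurable_diff borel_measurable_indicator AM XM GM[OF st])+
        show "AE \<omega> in M. indicator A \<omega> * (X l t \<omega> - X l s \<omega>) = indicator A \<omega> * G l s t \<omega>"
          using AE_good AE_space
        proof eventually_elim
          case (elim \<omega>)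
          note w = elim(2,1)
          have "set_integrable lborel {t0..T1} (generator_rate (\<lambda>r. b r \<omega>) (\<lambda>r. S r \<omega>) (\<lambda>r. l * a r \<omega>) (\<lambda>r. x r \<omega>))"
            by (rule gap_bounded_discounted(1)[OF st sb[OF w(1)] sS[OF w(1)] sa[OF w(1)] good[OF w] la0 dom[OF l] l1 x(1)[OF w(1)]])
          then have "set_integrable lborel {t0..t} (generator_rate (\<lambda>r. b r \<omega>) (\<lambda>r. S r \<omega>) (\<lambda>r. l * a r \<omega>) (\<lambda>r. x r \<omega>))"
            by (rule set_integrable_subset) (use st in auto)
          from gap_combine[OF st(1,2) this] have "G l t0 t \<omega> = G l t0 s \<omega> + G l s t \<omega>" by (simp add: G_def)
          then show ?case using elim st by (simp add: X_def cl_id)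
        qed
      qed
      also have "\<dots> = 0"
        unfolding G_def S_def a_def by (rule gap_mean_zero_limit[OF b H ib iH x(1,2) x_eq I sp H_lim I_lim l st A])
      finally show ?thesis .
    qed
    have "G l t0 t0 \<omega> = 0" for \<omega> unfolding G_def gap_def set_integral_Icc_same by simp
    then have Xt0: "X l t0 \<omega> = 0" for \<omega> using horizon by (simp add: X_def cl_id)
    show "expectation (\<lambda>\<omega>. X l (\<tau> \<omega>) \<omega>) = 0"
      using optional_stopping_exit_time[OF U horizon x(3,1) XM Xc X_bd inc] unfolding Xt0 \<tau>_def diff_0_right .
    show "(\<lambda>\<omega>. X l (\<tau> \<omega>) \<omega>) \<in> borel_measurable M"
      unfolding \<tau>_def by (rule exit_value_measurable[OF U horizon x(3,1) jointly_measurable_continuous[OF XM Xc]])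
  qed
  define V where "V r \<omega> = F (x (cl r) \<omega>) (cl r)" for r \<omega>
  have VM: "V r \<in> borel_measurable M" for r
    unfolding V_def[abs_def] by (rule components_measurable(1)[OF cl x(2)])
  have Vc: "continuous_on UNIV (\<lambda>r. V r \<omega>)" if w: "\<omega> \<in> space M" for \<omega>
    unfolding V_def by (rule continuous_on_compose2[OF continuous_on_F_path[OF x(1)[OF w]]]) (use cl in \<open>auto simp: cl_def intro!: continuous_intros\<close>)
  have V\<tau>M: "(\<lambda>\<omega>. V (\<tau> \<omega>) \<omega>) \<in> borel_measurable M"
    unfolding \<tau>_def by (rule exit_value_measurable[OF U horizon x(3,1) jointly_measurable_continuous[OF VM Vc]])
  have V\<tau>: "V (\<tau> \<omega>) \<omega> = F (x (\<tau> \<omega>) \<omega>) (\<tau> \<omega>)" for \<omega> using \<tau> by (simp add: V_def cl_id)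
  have Vt0: "V t0 \<omega> = F (x t0 \<omega>) t0" for \<omega> using horizon by (simp add: V_def cl_id)
  have V_bd: "\<bar>V r \<omega>\<bar> \<le> K" for r \<omega> unfolding V_def by (rule F_bounded[OF cl])
  define ln where "ln n = 1 / real (Suc n)" for n
  have ln: "0 < ln n" "ln \<longlonglongrightarrow> 0" for n
    using LIMSEQ_inverse_real_of_nat by (auto simp: ln_def[abs_def] inverse_eq_divide)
  have near: "\<bar>X l (\<tau> \<omega>) \<omega> - (V (\<tau> \<omega>) \<omega> * exp (- (l * (LINT u:{t0..\<tau> \<omega>}|lborel. a u \<omega>))) - V t0 \<omega>)\<bar> \<le> K * min 1 (l * (LINT r:{t0..T1}|lborel. a r \<omega>))"
    if w: "\<omega> \<in> space M" "\<omega> \<notin> N0" and l: "0 < l" for \<omega> l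
  proof -
    have la0: "0 \<le> l * a r \<omega>" for r using l a0 by simp
    have "\<bar>G l t0 (\<tau> \<omega>) \<omega> - (F (x (\<tau> \<omega>) \<omega>) (\<tau> \<omega>) * discount t0 (\<lambda>r. l * a r \<omega>) (\<tau> \<omega>) - F (x t0 \<omega>) t0)\<bar> \<le> K * min 1 (LINT r:{t0..T1}|lborel. l * a r \<omega>)"
      unfolding G_def
    proof (rule stopped_gap_harmonic[OF sb[OF w(1)] sS[OF w(1)] sa[OF w(1)] good[OF w] la0 x(1)[OF w(1)] \<tau>])
      fix r assume r: "t0 \<le> r" "r < \<tau> \<omega>"
      have "x r \<omega> \<in> U" by (rule before_exit_time[OF r(1) _ horizon(1)]) (use r in \<open>simp add: \<tau>_def\<close>)
      then show "Ft (x r \<omega>) r + b r \<omega> \<bullet> Fx (x r \<omega>) r + 1 / 2 * (S r \<omega> \<bullet> Fxx (x r \<omega>) r) = 0"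
        unfolding S_def by (intro pde w(1)) (use r \<tau>(2)[of \<omega>] in auto)
    qed
    then show ?thesis using w(2) \<tau> by (simp add: X_def V\<tau> Vt0 discount_def cl_id)
  qed
  have "(\<lambda>n. expectation (\<lambda>\<omega>. X (ln n) (\<tau> \<omega>) \<omega>)) \<longlonglongrightarrow> expectation (\<lambda>\<omega>. V (\<tau> \<omega>) \<omega> - V t0 \<omega>)"
  \<comment> \<open>\<open>K\<close> for each of the two values of \<open>F\<close> and
    \<open>K\<close> for the killing term; unlike the bound on the gap, this does not grow as
    \<open>l\<close> tends to 0.\<close>
  proof (rule integral_dominated_convergence[where w = "\<lambda>_. 3 * K"])
    show "(\<lambda>\<omega>. V (\<tau> \<omega>) \<omega> - V t0 \<omega>) \<in> borel_measurable M" by (intro borel_measurable_diff V\<tau>M VM)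
    show "(\<lambda>\<omega>. X (ln n) (\<tau> \<omega>) \<omega>) \<in> borel_measurable M" for n by (rule X_meas[OF ln(1)])
    show "AE \<omega> in M. norm (X (ln n) (\<tau> \<omega>) \<omega>) \<le> 3 * K" for n
      using AE_good AE_space
    proof eventually_elim
      case (elim \<omega>)
      define z where "z = exp (- (ln n * (LINT u:{t0..\<tau> \<omega>}|lborel. a u \<omega>)))"
      have z: "0 \<le> z" "z \<le> 1" unfolding z_def using ln(1)[of n] a0 by (auto intro!: mult_nonneg_nonneg set_integral_nonneg_real)
      have 1: "\<bar>V (\<tau> \<omega>) \<omega> * z\<bar> \<le> K * 1" unfolding abs_mult using V_bd z K0 by (intro mult_mono) auto
      have 2: "K * min 1 (ln n * (LINT r:{t0..T1}|lborel. a r \<omega>)) \<le> K * 1" using K0 by (intro mult_left_mono) auto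
      have 3: "\<bar>X (ln n) (\<tau> \<omega>) \<omega> - (V (\<tau> \<omega>) \<omega> * z - V t0 \<omega>)\<bar> \<le> K * min 1 (ln n * (LINT r:{t0..T1}|lborel. a r \<omega>))"
        unfolding z_def by (rule near[OF elim(2,1) ln(1)])
      show ?case using 1 2 3 V_bd[of t0 \<omega>] by auto
    qed
    show "AE \<omega> in M. (\<lambda>n. X (ln n) (\<tau> \<omega>) \<omega>) \<longlonglongrightarrow> V (\<tau> \<omega>) \<omega> - V t0 \<omega>"
      using AE_good AE_space
    proof eventually_elim
      case (elim \<omega>)
      define Q where "Q = (LINT u:{t0..\<tau> \<omega>}|lborel. a u \<omega>)"
      define Q1 where "Q1 = (LINT u:{t0..T1}|lborel. a u \<omega>)"
      have "(\<lambda>n. K * min 1 (ln n * Q1)) \<longlonglongrightarrow> K * min 1 (0 * Q1)" by (intro tendsto_intros ln)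
      then have "(\<lambda>n. K * min 1 (ln n * Q1)) \<longlonglongrightarrow> 0" by simp
      then have "(\<lambda>n. X (ln n) (\<tau> \<omega>) \<omega> - (V (\<tau> \<omega>) \<omega> * exp (- (ln n * Q)) - V t0 \<omega>)) \<longlonglongrightarrow> 0"
        by (rule Lim_null_comparison[rotated]) (use near[OF elim(2,1) ln(1)] in \<open>simp add: Q_def Q1_def\<close>)
      moreover have "(\<lambda>n. V (\<tau> \<omega>) \<omega> * exp (- (ln n * Q)) - V t0 \<omega>) \<longlonglongrightarrow> V (\<tau> \<omega>) \<omega> * exp (- (0 * Q)) - V t0 \<omega>"
        by (intro tendsto_intros ln)
      ultimately have "(\<lambda>n. (X (ln n) (\<tau> \<omega>) \<omega> - (V (\<tau> \<omega>) \<omega> * exp (- (ln n * Q)) - V t0 \<omega>)) + (V (\<tau> \<omega>) \<omega> * exp (- (ln n * Q)) - V t0 \<omega>))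
         \<longlonglongrightarrow> 0 + (V (\<tau> \<omega>) \<omega> * exp (- (0 * Q)) - V t0 \<omega>)" by (rule tendsto_add)
      then show ?case by simp
    qed
  qed simp
  then have 0: "expectation (\<lambda>\<omega>. V (\<tau> \<omega>) \<omega> - V t0 \<omega>) = 0" by (simp add: X_zero[OF ln(1)] LIMSEQ_const_iff)
  have iV: "integrable M (\<lambda>\<omega>. V (\<tau> \<omega>) \<omega>)" "integrable M (V t0)"
    by (rule integrable_bounded[OF V\<tau>M V_bd], rule integrable_bounded[OF VM V_bd])
  have "expectation (\<lambda>\<omega>. V (\<tau> \<omega>) \<omega>) = expectation (V t0)"
    using 0 Bochner_Integration.integral_diff[OF iV] by simp
  also have "\<dots> = expectation (\<lambda>_. F x0 t0)"
    by (rule integral_cong_AE) (use x0 VM in \<open>auto simp: Vt0\<close>)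
  finally have "expectation (\<lambda>\<omega>. V (\<tau> \<omega>) \<omega>) = F x0 t0" by (simp add: prob_space)
  then show ?thesis unfolding V\<tau> unfolding \<tau>_def .
qed

end

section \<open>Cutoff test functions\<close>

text \<open>The matrix \<open>a\<close> times transposed \<open>b\<close>. It carries the mixed
  terms in the Hessian of a product and the square of the gradient in that of a composition.\<close>

definition outer_product :: "real ^ 'n \<Rightarrow> real ^ 'n \<Rightarrow> real ^ 'n ^ 'n" where
  "outer_product a b = (\<chi> i j. a $ i * b $ j)"

lemma outer_product_mult: "outer_product a b *v v = (b \<bullet> v) *\<^sub>R a"
  by (simp add: outer_product_def matrix_vector_mult_def vec_eq_iff inner_vec_def sum_distrib_left sum_distrib_right mult_ac)

lemma outer_product_zero [simp]: "outer_product 0 b = 0" "outer_product a 0 = 0"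
  by (simp_all add: outer_product_def vec_eq_iff)

lemma continuous_on_outer_product [continuous_intros]:
  "continuous_on A f \<Longrightarrow> continuous_on A g \<Longrightarrow> continuous_on A (\<lambda>x. outer_product (f x) (g x))"
  unfolding outer_product_def by (intro continuous_intros)

definition C2_function :: "(real ^ 'n \<Rightarrow> real) \<Rightarrow> (real ^ 'n \<Rightarrow> real ^ 'n) \<Rightarrow> (real ^ 'n \<Rightarrow> real ^ 'n ^ 'n) \<Rightarrow> bool" where
  "C2_function h D E \<longleftrightarrow> (\<forall>x. GDERIV h x :> D x) \<and> (\<forall>x. (D has_derivative (\<lambda>v. E x *v v)) (at x)) \<and>
     continuous_on UNIV h \<and> continuous_on UNIV D \<and> continuous_on UNIV E"

text \<open>The recursion yields a gradient for every component of \<open>D\<close>; these gradients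
  are the rows of the Hessian.\<close>

lemma C_times_imp_C2_function:
  assumes "C_times (Suc (Suc 0)) h" obtains D E where "C2_function h D E"
proof -
  from assms obtain D where D: "\<And>x. GDERIV h x :> D x" "\<And>i. C_times (Suc 0) (\<lambda>x. D x $ i)" by auto
  have "\<exists>E. (\<forall>x. GDERIV (\<lambda>x. D x $ i) x :> E x) \<and> (\<forall>j. continuous_on UNIV (\<lambda>x. E x $ j))" for i using D(2)[of i] by auto
  then obtain E where E: "\<And>i x. GDERIV (\<lambda>x. D x $ i) x :> E i x" "\<And>i j. continuous_on UNIV (\<lambda>x. E i x $ j)" by metis
  have Dd: "(D has_derivative (\<lambda>v. (\<chi> i. E i x) *v v)) (at x)" for x
  proof (subst has_derivative_componentwise_within, rule ballI)
    fix e :: "real ^ 'a" assume "e \<in> Basis"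
    then obtain i where e: "e = axis i 1" by (auto simp: Basis_vec_def)
    have "((\<lambda>x. D x $ i) has_derivative (\<lambda>v. v \<bullet> E i x)) (at x)" using E(1)[of i x] by (simp add: gderiv_def)
    moreover have "(\<lambda>v. ((\<chi> i. E i x) *v v) $ i) = (\<lambda>v. v \<bullet> E i x)"
      by (simp add: fun_eq_iff matrix_vector_mul_component inner_commute)
    ultimately show "((\<lambda>x. D x \<bullet> e) has_derivative (\<lambda>v. ((\<chi> i. E i x) *v v) \<bullet> e)) (at x)"
      unfolding e cart_eq_inner_axis[symmetric] by simp
  qed
  have hc: "continuous_on UNIV h"
    using D(1) by (auto simp: gderiv_def intro!: continuous_at_imp_continuous_on has_derivative_continuous)
  have Dc: "continuous_on UNIV D"
    using Dd by (intro continuous_at_imp_continuous_on ballI has_derivative_continuous)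
  have "continuous_on UNIV (\<lambda>x. \<chi> i. E i x)"
  proof (rule continuous_on_vec_lambda)
    fix i
    have "continuous_on UNIV (\<lambda>x. \<chi> j. E i x $ j)" by (rule continuous_on_vec_lambda[OF E(2)])
    then show "continuous_on UNIV (E i)" by simp
  qed
  then have "C2_function h D (\<lambda>x. \<chi> i. E i x)" using D Dd hc Dc by (simp add: C2_function_def)
  then show thesis by (rule that)
qed

lemma C2_function_sum:
  assumes "\<And>i. i < N \<Longrightarrow> C2_function (h i) (D i) (E i)"
  shows "C2_function (\<lambda>x. \<Sum>i<N. h i x) (\<lambda>x. \<Sum>i<N. D i x) (\<lambda>x. \<Sum>i<(N::nat). E i x)"
proof -
  have mv: "(\<Sum>i<N. E i x) *v v = (\<Sum>i<N. E i x *v v)" for x v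
    by (induction N) (simp_all add: matrix_vector_mult_add_rdistrib)
  show ?thesis unfolding C2_function_def gderiv_def mv inner_sum_right
    using assms by (auto simp: C2_function_def gderiv_def intro!: has_derivative_sum continuous_on_sum)
qed

lemma has_real_derivative_positive_part_power:
  "((\<lambda>s. (max 0 s) ^ Suc (Suc n)) has_real_derivative real (Suc (Suc n)) * (max 0 s) ^ Suc n) (at s)"
proof -
  consider "s < 0" | "s = 0" | "0 < s" by linarith
  then show ?thesis
  proof cases
    case 1
    have "((\<lambda>s. 0) has_real_derivative real (Suc (Suc n)) * (max 0 s) ^ Suc n) (at s)" using 1 by simp
    then show ?thesis
      by (rule has_field_derivative_transform_within_open[where S = "{..<0}"]) (use 1 in auto)
  next
    case 2
    have "(\<lambda>y. ((max 0 y) ^ Suc (Suc n) - 0) / (y - 0)) \<midarrow>0\<rightarrow> (0::real)"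
    proof (rule Lim_null_comparison)
      have "(\<lambda>y::real. (max 0 y) ^ Suc n) \<midarrow>0\<rightarrow> (max 0 0) ^ Suc n" by (intro tendsto_intros)
      then show "(\<lambda>y::real. (max 0 y) ^ Suc n) \<midarrow>0\<rightarrow> 0" by simp
      have "norm (((max 0 y) ^ Suc (Suc n) - 0) / (y - 0)) \<le> (max 0 y) ^ Suc n" for y :: real
        by (cases "0 < y") (auto simp: max_def)
      then show "\<forall>\<^sub>F y in at 0. norm (((max 0 y) ^ Suc (Suc n) - 0) / (y - 0)) \<le> (max 0 (y::real)) ^ Suc n" by simp
    qed
    then show ?thesis using 2 by (simp add: has_field_derivative_iff)
  next
    case 3
    have "((\<lambda>s. s ^ Suc (Suc n)) has_real_derivative real (Suc (Suc n)) * (max 0 s) ^ Suc n) (at s)"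
      using DERIV_pow[of "Suc (Suc n)" s] 3 by (simp add: max_def)
    then show ?thesis
      by (rule has_field_derivative_transform_within_open[where S = "{0<..}"]) (use 3 in auto)
  qed
qed

text \<open>The profile \<open>1 - (max 0 (1 - s)) ^ 3\<close> is 0 at 0 and constantly 1 from 1 on,
  so the composition keeps zeros of \<open>h\<close> and is flat wherever \<open>h\<close> is at
  least 1. The cube is the smallest natural power whose positive part is twice continuously
  differentiable.\<close>

lemma C2_function_plateau:
  assumes "C2_function h D E"
  shows "C2_function (\<lambda>x. 1 - (max 0 (1 - h x)) ^ 3) (\<lambda>x. (3 * (max 0 (1 - h x))\<^sup>2) *\<^sub>R D x)
    (\<lambda>x. (3 * (max 0 (1 - h x))\<^sup>2) *\<^sub>R E x - (6 * max 0 (1 - h x)) *\<^sub>R outer_product (D x) (D x))"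
proof -
  have h: "\<And>x. GDERIV h x :> D x" "\<And>x. (D has_derivative (\<lambda>v. E x *v v)) (at x)"
    and c: "continuous_on UNIV h" "continuous_on UNIV D" "continuous_on UNIV E"
    using assms by (auto simp: C2_function_def)
  have q: "GDERIV (\<lambda>x. 1 - h x) x :> - D x" for x
    using GDERIV_diff[OF GDERIV_const h(1)] by simp
  have p3: "((\<lambda>s. (max 0 s) ^ 3) has_real_derivative 3 * (max 0 s)\<^sup>2) (at s)" for s :: real
    using has_real_derivative_positive_part_power[of 1 s] by (simp add: numeral_3_eq_3 numeral_2_eq_2)
  have p2: "((\<lambda>s. 3 * (max 0 s)\<^sup>2) has_real_derivative 6 * max 0 s) (at s)" for s :: real
    using DERIV_cmult[OF has_real_derivative_positive_part_power[of 0 s], of 3] by (simp add: numeral_2_eq_2)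
  have g1: "GDERIV (\<lambda>x. 1 - (max 0 (1 - h x)) ^ 3) x :> (3 * (max 0 (1 - h x))\<^sup>2) *\<^sub>R D x" for x
    using GDERIV_diff[OF GDERIV_const GDERIV_DERIV_compose[OF q p3], of 1 x] by simp
  have g2: "((\<lambda>x. (3 * (max 0 (1 - h x))\<^sup>2) *\<^sub>R D x) has_derivative
     (\<lambda>v. ((3 * (max 0 (1 - h x))\<^sup>2) *\<^sub>R E x - (6 * max 0 (1 - h x)) *\<^sub>R outer_product (D x) (D x)) *v v)) (at x)" for x
  proof -
    have "((\<lambda>x. 3 * (max 0 (1 - h x))\<^sup>2) has_derivative (\<lambda>v. v \<bullet> ((6 * max 0 (1 - h x)) *\<^sub>R - D x))) (at x)"
      using GDERIV_DERIV_compose[OF q p2, of x] by (simp add: gderiv_def)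
    from has_derivative_scaleR[OF this h(2)[of x]] show ?thesis
      by (rule has_derivative_eq_rhs)
         (simp add: fun_eq_iff matrix_vector_mult_diff_rdistrib scaleR_matrix_vector_assoc[symmetric] outer_product_mult inner_commute)
  qed
  show ?thesis unfolding C2_function_def using g1 g2
    by (intro conjI allI continuous_intros c) auto
qed

lemma has_derivative_matrix_zero:
  fixes A :: "real ^ 'n ^ 'm"
  assumes "(\<lambda>v. A *v v) = (\<lambda>v. 0)" shows "A = 0"
  using assms by (simp add: matrix_eq fun_eq_iff)

lemma C2_function_zero_outside:
  assumes "C2_function h D E" "closed K" "\<And>x. x \<notin> K \<Longrightarrow> h x = 0" and x: "x \<notin> K"
  shows "D x = 0" "E x = 0"
proof -
  have D0: "D z = 0" if z: "z \<notin> K" for z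
  proof -
    have "(h has_derivative (\<lambda>v. v \<bullet> D z)) (at z)" using assms(1) by (simp add: C2_function_def gderiv_def)
    moreover have "(h has_derivative (\<lambda>v. 0)) (at z)"
      by (rule has_derivative_transform_within_open[OF has_derivative_const, where s = "- K"]) (use assms z in auto)
    ultimately have "(\<lambda>v. v \<bullet> D z) = (\<lambda>v. 0)" by (rule has_derivative_unique)
    then have "D z \<bullet> D z = 0" by meson
    then show ?thesis by simp
  qed
  show "D x = 0" by (rule D0[OF x])
  have "(D has_derivative (\<lambda>v. E x *v v)) (at x)" using assms(1) by (simp add: C2_function_def)
  moreover have "(D has_derivative (\<lambda>v. 0)) (at x)"
    by (rule has_derivative_transform_within_open[OF has_derivative_const, where s = "- K"]) (use assms(2) D0 x in auto)
  ultimately have "(\<lambda>v. E x *v v) = (\<lambda>v. 0)" by (rule has_derivative_unique)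
  then show "E x = 0" by (rule has_derivative_matrix_zero)
qed

text \<open>The products of \<open>I\<close> with \<open>Xs\<close> and with the complement of
  \<open>K\<close> are relatively open and cover everything; on the second one the function is
  0.\<close>

lemma continuous_on_extended_by_zero:
  fixes G :: "'y::real_normed_vector \<Rightarrow> real \<Rightarrow> 'e::real_normed_vector"
  assumes "open Xs" "compact K" "K \<subseteq> Xs"
    and G: "continuous_on (Xs \<times> I) (\<lambda>(x, t). G x t)" "\<And>x t. x \<notin> K \<Longrightarrow> G x t = 0"
  shows "continuous_on (UNIV \<times> I) (\<lambda>(x, t). G x t)"
proof -
  have "continuous_on (Xs \<times> I \<union> (- K) \<times> I) (\<lambda>(x, t). G x t)"
  proof (rule continuous_on_Un_local_open)
    show "openin (top_of_set (Xs \<times> I \<union> (- K) \<times> I)) (Xs \<times> I)"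
      using assms(1) by (auto simp: openin_open intro!: exI[of _ "Xs \<times> UNIV"] open_Times)
    show "openin (top_of_set (Xs \<times> I \<union> (- K) \<times> I)) ((- K) \<times> I)"
      using compact_imp_closed[OF assms(2)] by (auto simp: openin_open intro!: exI[of _ "(- K) \<times> UNIV"] open_Times)
    have "continuous_on ((- K) \<times> I) (\<lambda>_. 0 :: 'e)" by (rule continuous_on_const)
    then show "continuous_on ((- K) \<times> I) (\<lambda>(x, t). G x t)"
      by (rule continuous_on_eq) (use G(2) in auto)
  qed (rule G(1))
  moreover have "Xs \<times> I \<union> (- K) \<times> I = UNIV \<times> I" using assms(3) by auto
  ultimately show ?thesis by simp
qed

text \<open>Uniform continuity handles nearby arguments. For distant ones the trivial bound is
  absorbed by the linear term, whose constant is dictated by the radius of uniform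
  continuity.\<close>

lemma compactly_supported_modulus:
  fixes G :: "'y::euclidean_space \<Rightarrow> real \<Rightarrow> 'e::real_normed_vector"
  assumes c: "continuous_on (UNIV \<times> {a..b}) (\<lambda>(x, t). G x t)" and K: "compact K" "\<And>x t. x \<notin> K \<Longrightarrow> G x t = 0"
  shows "\<exists>B. \<forall>x. \<forall>t\<in>{a..b}. norm (G x t) \<le> B"
    and "e > 0 \<Longrightarrow> \<exists>C\<ge>0. \<forall>x y. \<forall>r\<in>{a..b}. \<forall>s\<in>{a..b}. norm (G x r - G y s) \<le> e + C * ((norm (x - y))\<^sup>2 + \<bar>r - s\<bar>)"
proof -
  obtain R where "\<And>x. x \<in> K \<Longrightarrow> norm x \<le> R" using compact_imp_bounded[OF K(1)] unfolding bounded_iff by blast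
  then have R: "K \<subseteq> cball 0 R" by auto
  \<comment> \<open>The margin 1 ensures that two points less than 1 apart, one of them outside this
    ball, both avoid \<open>K\<close>.\<close>
  define Q where "Q = cball (0::'y) (R + 1) \<times> {a..b}"
  have Q: "compact Q" unfolding Q_def by (intro compact_Times compact_cball compact_Icc)
  have cQ: "continuous_on Q (\<lambda>(x, t). G x t)" by (rule continuous_on_subset[OF c]) (auto simp: Q_def)
  obtain B where B: "\<And>z. z \<in> Q \<Longrightarrow> norm (case z of (x, t) \<Rightarrow> G x t) \<le> B"
    using compact_imp_bounded[OF compact_continuous_image[OF cQ Q]] unfolding bounded_iff by blast
  have bd: "norm (G x t) \<le> max 0 B" if "t \<in> {a..b}" for x t
  proof (cases "x \<in> K")
    case True
    then have "norm x \<le> R" using R by auto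
    then have "(x, t) \<in> Q" using that by (auto simp: Q_def)
    from B[OF this] show ?thesis by simp
  qed (simp add: K(2))
  then show "\<exists>B. \<forall>x. \<forall>t\<in>{a..b}. norm (G x t) \<le> B" by blast
  assume e: "e > 0"
  obtain d where d: "d > 0" "\<And>z z'. z \<in> Q \<Longrightarrow> z' \<in> Q \<Longrightarrow> dist z' z < d \<Longrightarrow> dist (case z' of (x, t) \<Rightarrow> G x t) (case z of (x, t) \<Rightarrow> G x t) < e"
    using compact_uniformly_continuous[OF cQ Q] e unfolding uniformly_continuous_on_def by metis
  define d' where "d' = min 1 (d / 2)"
  have d': "0 < d'" "d' \<le> 1" "d' + d' \<le> d" using d(1) by (auto simp: d'_def)
  define B' where "B' = max 0 B"
  \<comment> \<open>The first summand serves arguments apart in space, whose squared distance is at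
    least \<open>d'\<^sup>2\<close>, the second serves arguments apart in time.\<close>
  define C where "C = 2 * B' / d'\<^sup>2 + 2 * B' / d'"
  have C0: "0 \<le> C" using d' by (simp add: C_def B'_def)
  have "norm (G x r - G y s) \<le> e + C * ((norm (x - y))\<^sup>2 + \<bar>r - s\<bar>)" if rs: "r \<in> {a..b}" "s \<in> {a..b}" for x y r s
  proof (cases "norm (x - y) < d' \<and> \<bar>r - s\<bar> < d'")
    case True
    have "norm (G x r - G y s) \<le> e"
    proof (cases "norm x \<le> R + 1 \<and> norm y \<le> R + 1")
      case T2: True
      have "dist (x, r) (y, s) \<le> dist x y + dist r s" unfolding dist_Pair_Pair by (rule sqrt_sum_squares_le_sum) auto
      also have "\<dots> < d" using True d'(3) by (auto simp: dist_norm)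
      finally have "dist (G x r) (G y s) < e" using d(2)[of "(y, s)" "(x, r)"] T2 rs by (auto simp: Q_def)
      then show ?thesis by (simp add: dist_norm)
    next
      case False
      have "norm x \<le> norm y + norm (x - y)" "norm y \<le> norm x + norm (x - y)"
        using norm_triangle_sub[of x y] norm_triangle_sub[of y x] by (simp_all add: norm_minus_commute)
      then have "R < norm x" "R < norm y" using False True d'(2) by auto
      then have "x \<notin> K" "y \<notin> K" using R by auto
      then show ?thesis using K(2) e by simp
    qed
    moreover have "0 \<le> C * ((norm (x - y))\<^sup>2 + \<bar>r - s\<bar>)" using C0 by simp
    ultimately show ?thesis by linarith
  next
    case False
    have "norm (G x r - G y s) \<le> 2 * B'"
      using norm_triangle_ineq4[of "G x r" "G y s"] bd[OF rs(1), of x] bd[OF rs(2), of y] by (simp add: B'_def)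
    also have "2 * B' \<le> C * ((norm (x - y))\<^sup>2 + \<bar>r - s\<bar>)"
    proof -
      have B0: "0 \<le> 2 * B'" by (simp add: B'_def)
      consider "d' \<le> norm (x - y)" | "d' \<le> \<bar>r - s\<bar>" using False by linarith
      then show ?thesis
      proof cases
        case 1
        have "2 * B' = 2 * B' / d'\<^sup>2 * d'\<^sup>2" using d' by simp
        also have "\<dots> \<le> C * ((norm (x - y))\<^sup>2 + \<bar>r - s\<bar>)"
        proof (rule mult_mono)
          show "2 * B' / d'\<^sup>2 \<le> C" using B0 d' by (simp add: C_def)
          have "d'\<^sup>2 \<le> (norm (x - y))\<^sup>2" using 1 d' by (intro power_mono) auto
          then show "d'\<^sup>2 \<le> (norm (x - y))\<^sup>2 + \<bar>r - s\<bar>" by simp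
        qed (use C0 in auto)
        finally show ?thesis .
      next
        case 2
        have "2 * B' = 2 * B' / d' * d'" using d' by simp
        also have "\<dots> \<le> C * ((norm (x - y))\<^sup>2 + \<bar>r - s\<bar>)"
        proof (rule mult_mono)
          show "2 * B' / d' \<le> C" using B0 d' by (simp add: C_def)
          show "d' \<le> (norm (x - y))\<^sup>2 + \<bar>r - s\<bar>" using 2 by (simp add: add_increasing)
        qed (use C0 d' in auto)
        finally show ?thesis .
      qed
    qed
    finally show ?thesis using e by simp
  qed
  then show "\<exists>C\<ge>0. \<forall>x y. \<forall>r\<in>{a..b}. \<forall>s\<in>{a..b}. norm (G x r - G y s) \<le> e + C * ((norm (x - y))\<^sup>2 + \<bar>r - s\<bar>)"
    using C0 by blast
qed

text \<open>The product rule for \<open>h * J\<close>, extended by zero. Derivatives of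
  \<open>J\<close> are only known on \<open>Xs\<close> and before \<open>T\<close>; the compact
  support of \<open>h\<close> and the earlier horizon keep away from both limits, so that bounds and
  moduli follow by compactness.\<close>

lemma cutoff_test_function:
  fixes J :: "(real ^ 'n) \<times> real \<Rightarrow> real"
  assumes Xs: "open Xs" and T1: "T1 < T"
    and J: "C21_on_cylinder Xs t0 T J J_t J_x J_xx" "continuous_on (cylinder Xs t0 T) J"
    and C2: "C2_function h D E" and K: "compact K" "K \<subseteq> Xs" "\<And>x. x \<notin> K \<Longrightarrow> h x = 0"
  defines "F \<equiv> \<lambda>x t. if x \<in> Xs then h x * J (x, t) else 0"
    and "Ft \<equiv> \<lambda>x t. if x \<in> Xs then h x * J_t (x, t) else 0"
    and "Fx \<equiv> \<lambda>x t. if x \<in> Xs then h x *\<^sub>R J_x (x, t) + J (x, t) *\<^sub>R D x else 0"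
    and "Fxx \<equiv> \<lambda>x t. if x \<in> Xs then h x *\<^sub>R J_xx (x, t) + outer_product (J_x (x, t)) (D x) + outer_product (D x) (J_x (x, t)) + J (x, t) *\<^sub>R E x else 0"
  shows "\<exists>B. test_function t0 T1 F Ft Fx Fxx B"
proof -
  have sub: "Xs \<times> {t0..T1} \<subseteq> cylinder Xs t0 T" using T1 by (auto simp: cylinder_def)
  have h_deriv: "\<And>x. GDERIV h x :> D x" "\<And>x. (D has_derivative (\<lambda>v. E x *v v)) (at x)"
    and h_cont: "continuous_on UNIV h" "continuous_on UNIV D" "continuous_on UNIV E"
    using C2 by (auto simp: C2_function_def)
  have K0: "D x = 0" "E x = 0" if "x \<notin> K" for x
    using C2_function_zero_outside[OF C2 compact_imp_closed[OF K(1)] K(3) that] by auto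
  have Jd: "((\<lambda>s. J (x, s)) has_real_derivative J_t (x, t)) (at t within {t0..<T})"
    "GDERIV (\<lambda>y. J (y, t)) x :> J_x (x, t)" "((\<lambda>y. J_x (y, t)) has_derivative (\<lambda>h. J_xx (x, t) *v h)) (at x)"
    if "x \<in> Xs" "t \<in> {t0..T1}" for x t
  proof -
    have c: "(x, t) \<in> cylinder Xs t0 T" using sub that by blast
    from J(1) have "\<forall>(x, t) \<in> cylinder Xs t0 T.
        ((\<lambda>s. J (x, s)) has_real_derivative J_t (x, t)) (at t within {t0..<T}) \<and>
        GDERIV (\<lambda>y. J (y, t)) x :> J_x (x, t) \<and>
        ((\<lambda>y. J_x (y, t)) has_derivative (\<lambda>h. J_xx (x, t) *v h)) (at x)"
      unfolding C21_on_cylinder_def by (rule conjunct1)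
    from bspec[OF this c] show "((\<lambda>s. J (x, s)) has_real_derivative J_t (x, t)) (at t within {t0..<T})"
      "GDERIV (\<lambda>y. J (y, t)) x :> J_x (x, t)" "((\<lambda>y. J_x (y, t)) has_derivative (\<lambda>h. J_xx (x, t) *v h)) (at x)"
      by auto
  qed
  have Jc: "continuous_on (Xs \<times> {t0..T1}) J" "continuous_on (Xs \<times> {t0..T1}) J_t" "continuous_on (Xs \<times> {t0..T1}) J_x" "continuous_on (Xs \<times> {t0..T1}) J_xx"
    using J(1) J(2) continuous_on_subset[OF _ sub] unfolding C21_on_cylinder_def by blast+
  define jet where "jet x t = (Ft x t, Fx x t, Fxx x t, F x t)" for x t
  have jet0: "jet x t = 0" if "x \<notin> K" for x t
    using that K(3) K0 by (simp add: jet_def Ft_def Fx_def Fxx_def F_def zero_prod_def)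
  have "continuous_on (Xs \<times> {t0..T1}) (\<lambda>z. (h (fst z) * J_t z, h (fst z) *\<^sub>R J_x z + J z *\<^sub>R D (fst z),
      h (fst z) *\<^sub>R J_xx z + outer_product (J_x z) (D (fst z)) + outer_product (D (fst z)) (J_x z) + J z *\<^sub>R E (fst z), h (fst z) * J z))"
    by (intro continuous_intros Jc continuous_on_compose2[OF h_cont(1)] continuous_on_compose2[OF h_cont(2)] continuous_on_compose2[OF h_cont(3)]) auto
  then have "continuous_on (Xs \<times> {t0..T1}) (\<lambda>(x, t). jet x t)"
    by (rule continuous_on_eq) (auto simp: jet_def Ft_def Fx_def Fxx_def F_def)
  from continuous_on_extended_by_zero[OF Xs K(1,2) this jet0]
  have jc: "continuous_on (UNIV \<times> {t0..T1}) (\<lambda>(x, t). jet x t)" .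
  note md = compactly_supported_modulus[OF jc K(1) jet0]
  obtain B where B: "\<And>x t. t \<in> {t0..T1} \<Longrightarrow> norm (jet x t) \<le> B" using md(1) by blast
  \<comment> \<open>A point outside \<open>Xs\<close> has a whole neighbourhood that avoids
    \<open>K\<close>, on which \<open>f\<close> is 0.\<close>
  have off: "((\<lambda>z. f z t) has_derivative (\<lambda>v. 0)) (at x)" if "x \<notin> Xs" "\<And>z. z \<notin> K \<Longrightarrow> f z t = 0" for f :: "real ^ 'n \<Rightarrow> real \<Rightarrow> 'z::real_normed_vector" and x t
    by (rule has_derivative_transform_within_open[OF has_derivative_const, where s = "- K"]) (use that K compact_imp_closed[OF K(1)] in auto)
  have FK: "F z t = 0" "Fx z t = 0" if "z \<notin> K" for z t using that K(3) K0 by (auto simp: F_def Fx_def)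
  have "test_function t0 T1 F Ft Fx Fxx B"
  proof
    fix t y assume t: "t \<in> {t0..T1}"
    show "((\<lambda>r. F y r) has_real_derivative Ft y t) (at t within {t0..T1})"
    proof (cases "y \<in> Xs")
      case True
      have "((\<lambda>s. J (y, s)) has_real_derivative J_t (y, t)) (at t within {t0..T1})"
        by (rule DERIV_subset[OF Jd(1)[OF True t]]) (use T1 in auto)
      from DERIV_cmult[OF this, of "h y"] show ?thesis using True by (simp add: F_def Ft_def)
    qed (simp add: F_def Ft_def)
    show "GDERIV (\<lambda>z. F z t) y :> Fx y t"
    proof (cases "y \<in> Xs")
      case True
      have "GDERIV (\<lambda>z. h z * J (z, t)) y :> h y *\<^sub>R J_x (y, t) + J (y, t) *\<^sub>R D y"
        by (rule GDERIV_mult[OF h_deriv(1) Jd(2)[OF True t]])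
      then show ?thesis unfolding gderiv_def
        by (rule has_derivative_transform_within_open[OF _ Xs True, THEN has_derivative_eq_rhs]) (use True in \<open>auto simp: F_def Fx_def\<close>)
    next
      case False
      then show ?thesis using off[OF False, of F t] FK by (simp add: gderiv_def Fx_def)
    qed
    show "((\<lambda>z. Fx z t) has_derivative (\<lambda>v. Fxx y t *v v)) (at y)"
    proof (cases "y \<in> Xs")
      case True
      have 1: "((\<lambda>z. h z *\<^sub>R J_x (z, t)) has_derivative (\<lambda>v. h y *\<^sub>R (J_xx (y, t) *v v) + (v \<bullet> D y) *\<^sub>R J_x (y, t))) (at y)"
        by (rule has_derivative_scaleR[OF h_deriv(1)[unfolded gderiv_def] Jd(3)[OF True t]])
      have 2: "((\<lambda>z. J (z, t) *\<^sub>R D z) has_derivative (\<lambda>v. J (y, t) *\<^sub>R (E y *v v) + (v \<bullet> J_x (y, t)) *\<^sub>R D y)) (at y)"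
        by (rule has_derivative_scaleR[OF Jd(2)[OF True t, unfolded gderiv_def] h_deriv(2)])
      have 3: "((\<lambda>z. Fx z t) has_derivative (\<lambda>v. (h y *\<^sub>R (J_xx (y, t) *v v) + (v \<bullet> D y) *\<^sub>R J_x (y, t)) + (J (y, t) *\<^sub>R (E y *v v) + (v \<bullet> J_x (y, t)) *\<^sub>R D y))) (at y)"
        by (rule has_derivative_transform_within_open[OF has_derivative_add[OF 1 2] Xs True]) (simp add: Fx_def)
      then show ?thesis
        by (rule has_derivative_eq_rhs)
           (use True in \<open>simp add: Fxx_def fun_eq_iff matrix_vector_mult_add_rdistrib scaleR_matrix_vector_assoc[symmetric] outer_product_mult inner_commute\<close>)
    next
      case False
      then show ?thesis using off[OF False, of Fx t] FK by (simp add: Fxx_def)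
    qed
    show "norm (Ft y t, Fx y t, Fxx y t, F y t) \<le> B" using B[OF t, of y] by (simp add: jet_def)
  next
    fix e :: real assume "e > 0"
    then show "\<exists>C\<ge>0. \<forall>y z. \<forall>r\<in>{t0..T1}. \<forall>s\<in>{t0..T1}. norm ((Ft y r, Fx y r, Fxx y r, F y r) - (Ft z s, Fx z s, Fxx z s, F z s)) \<le> e + C * ((norm (y - z))\<^sup>2 + \<bar>r - s\<bar>)"
      using md(2) by (simp add: jet_def)
  qed
  then show ?thesis by blast
qed

section \<open>The completed filtration of a standard Wiener process\<close>

lemma space_natural_filtration [simp]: "space (natural_filtration M t0 X t) = space M"
  by (auto simp: natural_filtration_def space_measure_of_conv)

lemma space_augmented_filtration [simp]: "space (augmented_filtration M t0 X t) = space M"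
  by (auto simp: augmented_filtration_def space_measure_of_conv)

lemma sets_natural_filtration:
  "sets (natural_filtration M t0 X t) = sigma_sets (space M) {X s -` A \<inter> space M | s A. s \<in> {t0..t} \<and> A \<in> sets borel}"
  unfolding natural_filtration_def by (rule sets_measure_of) auto

lemma sets_augmented_filtration:
  "sets (augmented_filtration M t0 X t) = sigma_sets (space M) (sets (natural_filtration M t0 X t) \<union> null_sets M)"
  unfolding augmented_filtration_def
  by (rule sets_measure_of) (use sets.sets_into_space[of _ "natural_filtration M t0 X t"] sets.sets_into_space[of _ M] in \<open>auto simp: null_sets_def\<close>)

lemma natural_subset_augmented: "sets (natural_filtration M t0 X t) \<subseteq> sets (augmented_filtration M t0 X t)"
  unfolding sets_augmented_filtration by auto

lemma null_sets_subset_augmented: "null_sets M \<subseteq> sets (augmented_filtration M t0 X t)"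
  unfolding sets_augmented_filtration by auto

lemma augmented_filtration_mono:
  assumes "s \<le> t" shows "sets (augmented_filtration M t0 X s) \<subseteq> sets (augmented_filtration M t0 X t)"
proof -
  have "sets (natural_filtration M t0 X s) \<subseteq> sets (natural_filtration M t0 X t)"
    unfolding sets_natural_filtration by (rule sigma_sets_mono') (use assms in force)
  then show ?thesis unfolding sets_augmented_filtration by (intro sigma_sets_mono') auto
qed

lemma natural_filtration_subset:
  assumes "\<And>s. s \<in> {t0..t} \<Longrightarrow> X s \<in> borel_measurable M"
  shows "sets (natural_filtration M t0 X t) \<subseteq> sets M"
  unfolding sets_natural_filtration
  by (rule sets.sigma_sets_subset) (use assms in \<open>auto intro: measurable_sets\<close>)

lemma augmented_filtration_subalgebra:
  assumes "\<And>s. s \<in> {t0..t} \<Longrightarrow> X s \<in> borel_measurable M"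
  shows "subalgebra M (augmented_filtration M t0 X t)"
proof -
  have "sets (augmented_filtration M t0 X t) \<subseteq> sets M"
    unfolding sets_augmented_filtration
    by (rule sets.sigma_sets_subset) (use natural_filtration_subset[OF assms] in auto)
  then show ?thesis by (simp add: subalgebra_def)
qed

lemma measurable_augmented_filtration:
  assumes "s \<in> {t0..t}" shows "X s \<in> borel_measurable (augmented_filtration M t0 X t)"
proof (rule measurableI)
  fix A :: "'b set" assume "A \<in> sets borel"
  then have "X s -` A \<inter> space M \<in> sets (natural_filtration M t0 X t)"
    unfolding sets_natural_filtration using assms by (intro sigma_sets.Basic) blast
  then show "X s -` A \<inter> space (augmented_filtration M t0 X t) \<in> sets (augmented_filtration M t0 X t)"
    using natural_subset_augmented[of M t0 X t] by auto
qed simp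

text \<open>Induction over the generated sigma-algebra: a complement keeps the exceptional null set,
  a countable union collects them. Probabilities therefore cannot distinguish the completed past
  from the natural one.\<close>

lemma augmented_filtration_approx:
  assumes nat: "sets (natural_filtration M t0 X t) \<subseteq> sets M" and A: "A \<in> sets (augmented_filtration M t0 X t)"
  shows "\<exists>A'\<in>sets (natural_filtration M t0 X t). \<exists>N\<in>null_sets M. A - N = A' - N"
  using A unfolding sets_augmented_filtration
proof (induction rule: sigma_sets.induct)
  case (Basic a)
  then show ?case
  proof
    assume "a \<in> sets (natural_filtration M t0 X t)" then show ?thesis by (intro bexI[of _ a] bexI[of _ "{}"]) auto
  next
    assume "a \<in> null_sets M" then show ?thesis by (intro bexI[of _ "{}"] bexI[of _ a]) auto
  qed
next
  case Empty then show ?case by (intro bexI[of _ "{}"] bexI[of _ "{}"]) auto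
next
  case (Compl a)
  then obtain A' N where *: "A' \<in> sets (natural_filtration M t0 X t)" "N \<in> null_sets M" "a - N = A' - N" by blast
  then have "space M - A' \<in> sets (natural_filtration M t0 X t)"
    using sets.compl_sets[of A' "natural_filtration M t0 X t"] by simp
  moreover have "space M - a - N = space M - A' - N" using *(3) by blast
  ultimately show ?case using *(2) by blast
next
  case (Union a)
  then obtain A' N where *: "\<And>i. A' i \<in> sets (natural_filtration M t0 X t)" "\<And>i. N i \<in> null_sets M" "\<And>i::nat. a i - N i = A' i - N i" by metis
  have "(\<Union>i. A' i) \<in> sets (natural_filtration M t0 X t)" using *(1) by (intro sets.countable_UN) auto
  moreover have "(\<Union>i. N i) \<in> null_sets M" using *(2) by (intro null_sets_UN') auto
  moreover have "(\<Union>i. a i) - (\<Union>i. N i) = (\<Union>i. A' i) - (\<Union>i. N i)" using *(3) by blast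
  ultimately show ?case by blast
qed

text \<open>Product formulas see events only up to null sets, so independence of \<open>V\<close>
  from the natural past carries over to the completed one, and from \<open>V\<close> to functions of
  it.\<close>

lemma (in prob_space) indep_augmented_filtration:
  fixes V :: "'a \<Rightarrow> 'b::topological_space" and Y :: "'a \<Rightarrow> 'c::topological_space"
  assumes nat: "sets (natural_filtration M t0 X t) \<subseteq> events"
    and indep: "indep_set (sets (natural_filtration M t0 X t)) (sets (vimage_algebra (space M) V borel))"
    and V: "V \<in> borel_measurable M"
    and Y: "Y \<in> borel_measurable (augmented_filtration M t0 X t)"
    and sub: "sets (augmented_filtration M t0 X t) \<subseteq> events"
    and q: "q \<in> borel_measurable borel"
  shows "indep_var borel Y borel (\<lambda>\<omega>. q (V \<omega>))"
proof -
  have qV: "(\<lambda>\<omega>. q (V \<omega>)) \<in> borel_measurable M" using measurable_compose[OF V q] .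
  have YM: "Y \<in> borel_measurable M" by (rule measurable_from_subalg[OF _ Y]) (use sub in \<open>simp add: subalgebra_def\<close>)
  have Ysets: "sigma_sets (space M) {Y -` A \<inter> space M |A. A \<in> sets borel} \<subseteq> sets (augmented_filtration M t0 X t)"
    using sets.sigma_sets_subset[of "{Y -` A \<inter> space M |A. A \<in> sets borel}" "augmented_filtration M t0 X t"] measurable_sets[OF Y] by auto
  have "{(\<lambda>\<omega>. q (V \<omega>)) -` A \<inter> space M |A. A \<in> sets borel} \<subseteq> {V -` A \<inter> space M |A. A \<in> sets borel}"
  proof safe
    fix A :: "'c set" assume "A \<in> sets borel"
    then have "q -` A \<in> sets borel" using measurable_sets_borel[OF q] by simp
    then show "\<exists>A'. (\<lambda>\<omega>. q (V \<omega>)) -` A \<inter> space M = V -` A' \<inter> space M \<and> A' \<in> sets borel"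
      by (intro exI[of _ "q -` A"]) auto
  qed
  then have Vsets: "sigma_sets (space M) {(\<lambda>\<omega>. q (V \<omega>)) -` A \<inter> space M |A. A \<in> sets borel} \<subseteq> sets (vimage_algebra (space M) V borel)"
    unfolding sets_vimage_algebra by (rule sigma_sets_mono')
  have prod: "prob (a \<inter> b) = prob a * prob b"
    if a: "a \<in> sets (augmented_filtration M t0 X t)" and b: "b \<in> sets (vimage_algebra (space M) V borel)" for a b
  proof -
    obtain A' N where *: "A' \<in> sets (natural_filtration M t0 X t)" "N \<in> null_sets M" "a - N = A' - N"
      using augmented_filtration_approx[OF nat a] by blast
    have bM: "b \<in> events" using indep b by (auto simp: indep_sets2_eq)
    have aM: "a \<in> events" "A' \<in> events" using a sub nat *(1) by auto
    have N: "AE \<omega> in M. \<omega> \<notin> N" by (rule AE_not_in[OF *(2)])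
    have iff: "\<omega> \<in> a \<longleftrightarrow> \<omega> \<in> A'" if "\<omega> \<notin> N" for \<omega> using *(3) that by blast
    have "prob a = prob A'"
      by (rule measure_eq_AE[OF _ aM]) (use N iff in \<open>auto elim: eventually_mono\<close>)
    moreover have "prob (a \<inter> b) = prob (A' \<inter> b)"
      by (rule measure_eq_AE) (use N iff aM bM in \<open>auto elim!: eventually_mono\<close>)
    moreover have "prob (A' \<inter> b) = prob A' * prob b" using indep *(1) b by (auto simp: indep_sets2_eq)
    ultimately show ?thesis by simp
  qed
  show ?thesis unfolding indep_var_eq
  proof (intro conjI YM qV)
    show "indep_set (sigma_sets (space M) {Y -` A \<inter> space M |A. A \<in> sets borel}) (sigma_sets (space M) {(\<lambda>\<omega>. q (V \<omega>)) -` A \<inter> space M |A. A \<in> sets borel})"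
      unfolding indep_sets2_eq
    proof (intro conjI ballI)
      show "sigma_sets (space M) {Y -` A \<inter> space M |A. A \<in> sets borel} \<subseteq> events" using Ysets sub by blast
      show "sigma_sets (space M) {(\<lambda>\<omega>. q (V \<omega>)) -` A \<inter> space M |A. A \<in> sets borel} \<subseteq> events"
        using Vsets indep by (auto simp: indep_sets2_eq)
    qed (use prod Ysets Vsets in blast)
  qed
qed

section \<open>Moments of Gaussian increments\<close>

lemma (in prob_space) centered_normal_moments:
  assumes s: "0 < s" and D: "distributed M lborel X (normal_density 0 s)"
  shows "integrable M (\<lambda>\<omega>. X \<omega> ^ k)" "expectation X = 0" "expectation (\<lambda>\<omega>. (X \<omega>)\<^sup>2) = s\<^sup>2" "expectation (\<lambda>\<omega>. (X \<omega>) ^ 4) = 3 * s ^ 4"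
proof -
  have "integrable lborel (\<lambda>x. normal_density 0 s x * x ^ k)" using integrable_normal_moment[OF s, of 0 k] by simp
  then show "integrable M (\<lambda>\<omega>. X \<omega> ^ k)"
    using distributed_integrable[OF D, of "\<lambda>x. x ^ k"] by simp
  show E: "expectation X = 0" by (rule normal_distributed_expectation[OF s D])
  show "expectation (\<lambda>\<omega>. (X \<omega>)\<^sup>2) = s\<^sup>2" using normal_distributed_variance[OF s D] E by simp
  have "expectation (\<lambda>\<omega>. X \<omega> ^ 4) = (\<integral>x. normal_density 0 s x * x ^ 4 \<partial>lborel)"
    by (rule distributed_integral[OF D, symmetric]) auto
  \<comment> \<open>The general even moment at order 4, that is
    \<open>24 / (8 / s ^ 4)\<close>.\<close>
  also have "\<dots> = fact (2 * 2) / ((2 / s\<^sup>2) ^ 2 * fact 2)"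
    using has_bochner_integral_integral_eq[OF normal_moment_even[OF s, of 0 2]] by simp
  also have "\<dots> = 3 * s ^ 4" using s by (simp add: fact_numeral power_divide field_simps)
  finally show "expectation (\<lambda>\<omega>. (X \<omega>) ^ 4) = 3 * s ^ 4" .
qed

lemma (in prob_space) gaussian_increment:
  fixes V :: "'a \<Rightarrow> real ^ 'k"
  assumes h: "0 < h" and V: "V \<in> borel_measurable M"
    and D: "\<And>i. distributed M lborel (\<lambda>\<omega>. V \<omega> $ i) (normal_density 0 (sqrt h))"
    and ind: "indep_vars (\<lambda>_. borel) (\<lambda>i \<omega>. V \<omega> $ i) UNIV"
    and indf: "\<And>q :: real ^ 'k \<Rightarrow> real. q \<in> borel_measurable borel \<Longrightarrow> indep_var borel Y borel (\<lambda>\<omega>. q (V \<omega>))"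
    and Y: "Y \<in> borel_measurable M" "\<And>\<omega>. \<omega> \<in> space M \<Longrightarrow> \<bar>Y \<omega>\<bar> \<le> (B::real)"
  shows "expectation (\<lambda>\<omega>. Y \<omega> * V \<omega> $ i) = 0"
    and "expectation (\<lambda>\<omega>. Y \<omega> * (V \<omega> $ i * V \<omega> $ j)) = (if i = j then h * expectation Y else 0)"
    and "integrable M (\<lambda>\<omega>. ((norm (V \<omega>))\<^sup>2)\<^sup>2)"
    and "expectation (\<lambda>\<omega>. ((norm (V \<omega>))\<^sup>2)\<^sup>2) \<le> 3 * (real CARD('k))\<^sup>2 * h\<^sup>2"
proof -
  have sh: "0 < sqrt h" using h by simp
  note mom = centered_normal_moments[OF sh D]
  have iV: "integrable M (\<lambda>\<omega>. V \<omega> $ i)" for i using mom(1)[of i 1] by simp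
  have iY: "integrable M Y" by (rule integrable_const_bound[of _ B]) (use Y in auto)
  have iVV: "integrable M (\<lambda>\<omega>. V \<omega> $ i * V \<omega> $ j)" and eVV: "expectation (\<lambda>\<omega>. V \<omega> $ i * V \<omega> $ j) = (if i = j then h else 0)" for i j
  proof -
    have "integrable M (\<lambda>\<omega>. V \<omega> $ i * V \<omega> $ j) \<and> expectation (\<lambda>\<omega>. V \<omega> $ i * V \<omega> $ j) = (if i = j then h else 0)"
    proof (cases "i = j")
      case True
      then show ?thesis using mom(1)[of i 2] mom(3)[of i] h by (simp add: power2_eq_square)
    next
      case False
      have ij: "indep_vars (\<lambda>_. borel) (\<lambda>i \<omega>. V \<omega> $ i) {i, j}" by (rule indep_vars_subset[OF ind]) simp
      show ?thesis
        using indep_vars_lebesgue_integral[OF _ ij] indep_vars_integrable[OF _ ij] iV mom(2) False by simp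
    qed
    then show "integrable M (\<lambda>\<omega>. V \<omega> $ i * V \<omega> $ j)" "expectation (\<lambda>\<omega>. V \<omega> $ i * V \<omega> $ j) = (if i = j then h else 0)" by auto
  qed
  have comp: "(\<lambda>v :: real ^ 'k. v $ i) \<in> borel_measurable borel" for i by (rule borel_measurable_vec_component) simp
  show "expectation (\<lambda>\<omega>. Y \<omega> * V \<omega> $ i) = 0"
    using indep_var_lebesgue_integral[OF indf[OF comp] iY iV] mom(2) by simp
  have "indep_var borel Y borel (\<lambda>\<omega>. V \<omega> $ i * V \<omega> $ j)"
    by (rule indf[of "\<lambda>v. v $ i * v $ j"]) (intro borel_measurable_times comp)
  from indep_var_lebesgue_integral[OF this iY iVV]
  show "expectation (\<lambda>\<omega>. Y \<omega> * (V \<omega> $ i * V \<omega> $ j)) = (if i = j then h * expectation Y else 0)"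
    by (simp add: eVV)
  \<comment> \<open>Cauchy-Schwarz over the coordinates. Its factor \<open>CARD('k)\<close>, times
    as many fourth moments \<open>3 * h\<^sup>2\<close>, is the constant of the final bound.\<close>
  have sq: "((norm v)\<^sup>2)\<^sup>2 \<le> (\<Sum>i\<in>UNIV. (v $ i) ^ 4) * real CARD('k)" for v :: "real ^ 'k"
    using sum_squared_le_sum_of_squares[of "\<lambda>i. (v $ i)\<^sup>2" UNIV]
    by (simp add: power2_norm_eq_inner inner_vec_def power2_eq_square[of "v $ _", symmetric])
  have i4: "integrable M (\<lambda>\<omega>. (\<Sum>i\<in>UNIV. (V \<omega> $ i) ^ 4) * real CARD('k))"
    by (intro integrable_mult_left Bochner_Integration.integrable_sum mom(1))
  show int: "integrable M (\<lambda>\<omega>. ((norm (V \<omega>))\<^sup>2)\<^sup>2)"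
  proof (rule Bochner_Integration.integrable_bound[OF i4])
    show "(\<lambda>\<omega>. ((norm (V \<omega>))\<^sup>2)\<^sup>2) \<in> borel_measurable M" using V by measurable
    show "AE \<omega> in M. norm (((norm (V \<omega>))\<^sup>2)\<^sup>2) \<le> norm ((\<Sum>i\<in>UNIV. (V \<omega> $ i) ^ 4) * real CARD('k))"
    proof (rule AE_I2)
      fix \<omega>
      show "norm (((norm (V \<omega>))\<^sup>2)\<^sup>2) \<le> norm ((\<Sum>i\<in>UNIV. (V \<omega> $ i) ^ 4) * real CARD('k))"
        using order_trans[OF sq[of "V \<omega>"] abs_ge_self] by simp
    qed
  qed
  have "expectation (\<lambda>\<omega>. ((norm (V \<omega>))\<^sup>2)\<^sup>2) \<le> expectation (\<lambda>\<omega>. (\<Sum>i\<in>UNIV. (V \<omega> $ i) ^ 4) * real CARD('k))"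
    by (rule integral_mono[OF int i4 sq])
  also have "\<dots> = (\<Sum>i\<in>(UNIV :: 'k set). 3 * sqrt h ^ 4) * real CARD('k)"
    using mom(1,4) by (simp add: Bochner_Integration.integral_sum)
  also have "\<dots> = 3 * (real CARD('k))\<^sup>2 * h\<^sup>2"
  proof -
    have "sqrt h ^ 4 = h\<^sup>2" using h by (simp add: power4_eq_xxxx power2_eq_square)
    then show ?thesis by (simp add: power2_eq_square)
  qed
  finally show "expectation (\<lambda>\<omega>. ((norm (V \<omega>))\<^sup>2)\<^sup>2) \<le> 3 * (real CARD('k))\<^sup>2 * h\<^sup>2" .
qed

text \<open>Completing the filtration makes the continuous modification of the Wiener process adapted.\<close>

lemma standard_wiener_modification:
  fixes w :: "real \<Rightarrow> 'a \<Rightarrow> real ^ 'k"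
  assumes "t0 < T" "prob_space M" and W: "standard_wiener M t0 T w"
  obtains w' Cw N where "wiener_filtration M (augmented_filtration M t0 w) t0 T w' Cw" "N \<in> null_sets M"
    "\<And>t \<omega>. t \<in> {t0..T} \<Longrightarrow> \<omega> \<in> space M - N \<Longrightarrow> w' t \<omega> = w t \<omega>"
proof -
  interpret prob_space M by fact
  define Fl where "Fl = augmented_filtration M t0 w"
  have wM: "w t \<in> borel_measurable M" if "t \<in> {t0..T}" for t using W that by (auto simp: standard_wiener_def)
  obtain N where N: "N \<in> null_sets M" "{\<omega> \<in> space M. \<not> continuous_on {t0..T} (\<lambda>t. w t \<omega>)} \<subseteq> N"
    using W unfolding standard_wiener_def eventually_ae_filter by blast
  define cl where "cl r = max t0 (min T r)" for r
  have cl: "cl r \<in> {t0..T}" and cl_id: "r \<in> {t0..T} \<Longrightarrow> cl r = r" for r using assms(1) by (auto simp: cl_def)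
  \<comment> \<open>Zero on the exceptional null set and constant in time on either side of the
    interval, so that every path is continuous on the whole line.\<close>
  define w' where "w' r \<omega> = (if \<omega> \<in> N then 0 else w (cl r) \<omega>)" for r \<omega>
  have sub: "subalgebra M (Fl t)" if "t \<le> T" for t
    unfolding Fl_def by (rule augmented_filtration_subalgebra) (use wM that in auto)
  have N_in: "N \<in> sets (Fl t)" for t unfolding Fl_def using null_sets_subset_augmented N(1) by blast
  have NM: "N \<in> sets M" using N(1) by auto
  have nat: "sets (natural_filtration M t0 w t) \<subseteq> sets M" if "t \<le> T" for t
    by (rule natural_filtration_subset) (use wM that in auto)
  have w'_adapted: "w' t \<in> borel_measurable (Fl t)" if "t \<in> {t0..T}" for t
  proof -
    have "w (cl t) \<in> borel_measurable (Fl t)"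
      unfolding Fl_def cl_id[OF that] by (rule measurable_augmented_filtration) (use that in auto)
    then show ?thesis unfolding w'_def[abs_def]
      by (intro measurable_If_set) (use N_in[of t] sets.sets_into_space[OF N_in[of t]] in \<open>auto simp: Int_absorb2\<close>)
  qed
  have w'_M: "w' r \<in> borel_measurable M" for r
    unfolding w'_def[abs_def]
    by (intro measurable_If_set wM cl) (use NM sets.sets_into_space[OF NM] in \<open>auto simp: Int_absorb2\<close>)
  have AE_N: "AE \<omega> in M. \<omega> \<notin> N" by (rule AE_not_in[OF N(1)])
  have eq: "AE \<omega> in M. w' t \<omega> - w' s \<omega> = w t \<omega> - w s \<omega>" if "s \<in> {t0..T}" "t \<in> {t0..T}" for s t
    using AE_N by eventually_elim (use that in \<open>simp add: w'_def cl_id\<close>)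
  define Cw where "Cw = 3 * (real CARD('k))\<^sup>2"
  have key: "expectation (\<lambda>\<omega>. Y \<omega> * (w' t \<omega> - w' s \<omega>) $ i) = 0"
    "expectation (\<lambda>\<omega>. Y \<omega> * ((w' t \<omega> - w' s \<omega>) $ i * (w' t \<omega> - w' s \<omega>) $ j)) = (if i = j then (t - s) * expectation Y else 0)"
    "integrable M (\<lambda>\<omega>. ((norm (w' t \<omega> - w' s \<omega>))\<^sup>2)\<^sup>2)"
    "expectation (\<lambda>\<omega>. ((norm (w' t \<omega> - w' s \<omega>))\<^sup>2)\<^sup>2) \<le> Cw * (t - s)\<^sup>2"
    if st: "t0 \<le> s" "s < t" "t \<le> T" and Y: "Y \<in> borel_measurable (Fl s)" "\<And>\<omega>. \<omega> \<in> space M \<Longrightarrow> \<bar>Y \<omega>\<bar> \<le> B" for s t Y B i j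
  proof -
    have sT: "s \<in> {t0..T}" "t \<in> {t0..T}" using st by auto
    define V where "V \<omega> = w t \<omega> - w s \<omega>" for \<omega>
    define V' where "V' \<omega> = w' t \<omega> - w' s \<omega>" for \<omega>
    have V: "V \<in> borel_measurable M" unfolding V_def[abs_def] using wM[OF sT(1)] wM[OF sT(2)] by measurable
    have V': "V' \<in> borel_measurable M" unfolding V'_def[abs_def] using w'_M[of s] w'_M[of t] by measurable
    have VV: "AE \<omega> in M. V' \<omega> = V \<omega>" unfolding V_def V'_def by (rule eq[OF sT])
    have YM: "Y \<in> borel_measurable M" by (rule measurable_from_subalg[OF sub Y(1)]) (use st in simp)
    have ind: "indep_var borel Y borel (\<lambda>\<omega>. q (V \<omega>))" if "q \<in> borel_measurable borel" for q :: "real ^ 'k \<Rightarrow> real"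
    proof (rule indep_augmented_filtration[where t = s and V = V and q = q])
      show "indep_set (sets (natural_filtration M t0 w s)) (sets (vimage_algebra (space M) V borel))"
        using W st unfolding standard_wiener_def V_def[abs_def] by blast
      show "sets (augmented_filtration M t0 w s) \<subseteq> events" using sub[of s] st by (auto simp: Fl_def subalgebra_def)
    qed (use nat[of s] st V Y that in \<open>auto simp: Fl_def\<close>)
    have h: "0 < t - s" using st by simp
    have d: "distributed M lborel (\<lambda>\<omega>. V \<omega> $ i) (normal_density 0 (sqrt (t - s)))" for i
      using W st unfolding standard_wiener_def V_def by simp
    have iv: "indep_vars (\<lambda>_. borel) (\<lambda>i \<omega>. V \<omega> $ i) UNIV"
      using W st unfolding standard_wiener_def V_def by simp
    note g = gaussian_increment[OF h V d iv ind YM Y(2)]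
    have c: "(\<lambda>\<omega>. V \<omega> $ i) \<in> borel_measurable M" "(\<lambda>\<omega>. V' \<omega> $ i) \<in> borel_measurable M" for i
      using V V' by (auto intro: borel_measurable_vec_component)
    have "expectation (\<lambda>\<omega>. Y \<omega> * V' \<omega> $ i) = expectation (\<lambda>\<omega>. Y \<omega> * V \<omega> $ i)"
      by (rule integral_cong_AE) (use VV c YM in \<open>auto elim: eventually_mono\<close>)
    then show "expectation (\<lambda>\<omega>. Y \<omega> * (w' t \<omega> - w' s \<omega>) $ i) = 0" using g(1) by (simp add: V'_def)
    have "expectation (\<lambda>\<omega>. Y \<omega> * (V' \<omega> $ i * V' \<omega> $ j)) = expectation (\<lambda>\<omega>. Y \<omega> * (V \<omega> $ i * V \<omega> $ j))"
      by (rule integral_cong_AE) (use VV c YM in \<open>auto elim: eventually_mono\<close>)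
    then show "expectation (\<lambda>\<omega>. Y \<omega> * ((w' t \<omega> - w' s \<omega>) $ i * (w' t \<omega> - w' s \<omega>) $ j)) = (if i = j then (t - s) * expectation Y else 0)"
      using g(2) by (simp add: V'_def)
    have m4: "(\<lambda>\<omega>. ((norm (V \<omega>))\<^sup>2)\<^sup>2) \<in> borel_measurable M" "(\<lambda>\<omega>. ((norm (V' \<omega>))\<^sup>2)\<^sup>2) \<in> borel_measurable M"
      using V V' by measurable
    have ae4: "AE \<omega> in M. ((norm (V \<omega>))\<^sup>2)\<^sup>2 = ((norm (V' \<omega>))\<^sup>2)\<^sup>2" using VV by eventually_elim simp
    show "integrable M (\<lambda>\<omega>. ((norm (w' t \<omega> - w' s \<omega>))\<^sup>2)\<^sup>2)"
      using integrable_cong_AE_imp[OF g(3) m4(2)] ae4 by (simp add: V'_def)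
    have "expectation (\<lambda>\<omega>. ((norm (V' \<omega>))\<^sup>2)\<^sup>2) = expectation (\<lambda>\<omega>. ((norm (V \<omega>))\<^sup>2)\<^sup>2)"
      by (rule integral_cong_AE[OF m4(2,1)]) (use ae4 in \<open>auto elim: eventually_mono\<close>)
    then show "expectation (\<lambda>\<omega>. ((norm (w' t \<omega> - w' s \<omega>))\<^sup>2)\<^sup>2) \<le> Cw * (t - s)\<^sup>2"
      using g(4) by (simp add: V'_def Cw_def)
  qed
  have "wiener_filtration M Fl t0 T w' Cw"
  proof
    show "continuous_on UNIV (\<lambda>r. w' r \<omega>)" if w: "\<omega> \<in> space M" for \<omega>
    proof (cases "\<omega> \<in> N")
      case True then show ?thesis by (simp add: w'_def)
    next
      case False
      then have "continuous_on {t0..T} (\<lambda>t. w t \<omega>)" using N(2) w by blast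
      then have "continuous_on UNIV (\<lambda>r. w (cl r) \<omega>)"
        by (rule continuous_on_compose2) (use cl in \<open>auto simp: cl_def intro!: continuous_intros\<close>)
      then show ?thesis using False by (simp add: w'_def)
    qed
    show "integrable M (\<lambda>\<omega>. ((norm (w' t \<omega> - w' s \<omega>))\<^sup>2)\<^sup>2)" "expectation (\<lambda>\<omega>. ((norm (w' t \<omega> - w' s \<omega>))\<^sup>2)\<^sup>2) \<le> Cw * (t - s)\<^sup>2"
      if "t0 \<le> s" "s < t" "t \<le> T" for s t
      \<comment> \<open>The moment facts do not mention the weight, which is instantiated with
        0.\<close>
      using key(3,4)[OF that, of "\<lambda>_. 0" 0] by auto
    show "sets (Fl s) \<subseteq> sets (Fl t)" if "s \<le> t" for s t unfolding Fl_def by (rule augmented_filtration_mono[OF that])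
    show "subalgebra M (Fl t)" if "t \<in> {t0..T}" for t using sub that by auto
  qed (use assms(1) w'_M w'_adapted key in blast)+
  then show thesis
    by (rule that[unfolded Fl_def[symmetric], OF _ N(1)]) (auto simp: w'_def cl_id)
qed

section \<open>Strong solutions\<close>

lemma jointly_measurable_stopped:
  assumes "progressively_measurable Fl t0 T X" "t \<in> {t0..T}"
  shows "jointly_measurable (Fl t) (\<lambda>q \<omega>. X (max t0 (min t q)) \<omega>)"
  unfolding jointly_measurable_def
proof -
  have "(\<lambda>z. (max t0 (min t (snd z)), fst z)) \<in> measurable (Fl t \<Otimes>\<^sub>M borel) (restrict_space borel {t0..t} \<Otimes>\<^sub>M Fl t)"
  proof (rule measurable_Pair)
    show "(\<lambda>z. max t0 (min t (snd z))) \<in> measurable (Fl t \<Otimes>\<^sub>M borel) (restrict_space borel {t0..t})"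
      by (rule measurable_restrict_space2) (use assms(2) in auto)
  qed simp
  moreover have "(\<lambda>(s, \<omega>). X s \<omega>) \<in> borel_measurable (restrict_space borel {t0..t} \<Otimes>\<^sub>M Fl t)"
    using assms by (auto simp: progressively_measurable_def)
  ultimately show "(\<lambda>z. X (max t0 (min t (snd z))) (fst z)) \<in> borel_measurable (Fl t \<Otimes>\<^sub>M borel)"
    using measurable_compose by fastforce
qed

lemma (in wiener_filtration) progressive_stopped:
  assumes "progressively_measurable Fl t0 T X"
  shows "progressive (\<lambda>r \<omega>. X (max t0 (min T r)) \<omega>)"
  unfolding progressive_def
proof (intro conjI ballI)
  have T: "T \<in> {t0..T}" using t0_less_T by simp
  show "jointly_measurable M (\<lambda>r \<omega>. X (max t0 (min T r)) \<omega>)"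
    by (rule jointly_measurable_subalgebra[OF subalg[OF T] jointly_measurable_stopped[OF assms T]])
  fix r assume r: "r \<in> {t0..T}"
  then have "max t0 (min T (max t0 (min r q))) = max t0 (min r q)" for q by auto
  then show "jointly_measurable (Fl r) (\<lambda>q \<omega>. X (max t0 (min T (max t0 (min r q)))) \<omega>)"
    using jointly_measurable_stopped[OF assms r] by simp
qed

lemma exit_time_cong:
  assumes "\<And>t. t \<in> {t0..T1} \<Longrightarrow> x t \<omega> = y t \<omega>" shows "exit_time U t0 T1 x \<omega> = exit_time U t0 T1 y \<omega>"
proof -
  have "{t \<in> {t0..T1}. x t \<omega> \<notin> U} = {t \<in> {t0..T1}. y t \<omega> \<notin> U}" using assms by auto
  then show ?thesis unfolding exit_time_def using assms by auto
qed

text \<open>The solution and its coefficients are clamped in time, and the Wiener process is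
  replaced by its continuous modification. The Ito integral stays the same process, since the simple
  integrals of both versions agree off a null set.\<close>

lemma strong_solution_dynkin:
  fixes w :: "real \<Rightarrow> 'a \<Rightarrow> real ^ 'k" and b :: "real ^ 'n \<Rightarrow> real \<Rightarrow> real ^ 'n"
  assumes "t0 < T" "prob_space M" "standard_wiener M t0 T w" and sol: "strong_solution M w t0 T b \<sigma> x0 x"
    and tf: "test_function t0 T1 F Ft Fx Fxx B" and T1: "t0 \<le> T1" "T1 \<le> T" and U: "open U"
    and pde: "\<And>y r. y \<in> U \<Longrightarrow> r \<in> {t0..T1} \<Longrightarrow>
        Ft y r + b y r \<bullet> Fx y r + 1/2 * ((\<sigma> y r ** transpose (\<sigma> y r)) \<bullet> Fxx y r) = 0"
  shows "prob_space.expectation M (\<lambda>\<omega>. F (x (exit_time U t0 T1 x \<omega>) \<omega>) (exit_time U t0 T1 x \<omega>)) = F x0 t0"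
proof -
  obtain w' Cw Nn where mod: "wiener_filtration M (augmented_filtration M t0 w) t0 T w' Cw" and Nn: "Nn \<in> null_sets M"
    and w': "\<And>t \<omega>. t \<in> {t0..T} \<Longrightarrow> \<omega> \<in> space M - Nn \<Longrightarrow> w' t \<omega> = w t \<omega>"
    using standard_wiener_modification[OF assms(1-3)] by blast
  define Fl where "Fl = augmented_filtration M t0 w"
  interpret wiener_filtration M Fl t0 T w' Cw unfolding Fl_def by (rule mod)
  interpret ito_setting t0 T1 T F Ft Fx Fxx B "\<lambda>y r. (Ft y r, Fx y r, Fxx y r, F y r)" M Fl w' Cw
    by (intro ito_setting.intro tf wiener_filtration_axioms ito_setting_axioms.intro T1)
  define cl where "cl r = max t0 (min T r)" for r
  have cl: "cl r \<in> {t0..T}" and cl_id: "r \<in> {t0..T} \<Longrightarrow> cl r = r" for r using assms(1) by (auto simp: cl_def)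
  define xc where "xc r \<omega> = x (cl r) \<omega>" for r \<omega>
  define bc where "bc r \<omega> = b (x (cl r) \<omega>) (cl r)" for r \<omega>
  define H where "H r \<omega> = \<sigma> (x (cl r) \<omega>) (cl r)" for r \<omega>
  from sol have x_ad: "\<And>t. t \<in> {t0..T} \<Longrightarrow> x t \<in> borel_measurable (Fl t)"
    and x_c: "\<And>\<omega>. \<omega> \<in> space M \<Longrightarrow> continuous_on {t0..T} (\<lambda>t. x t \<omega>)"
    and x_0: "AE \<omega> in M. x t0 \<omega> = x0"
    and pb: "progressively_measurable Fl t0 T (\<lambda>t \<omega>. b (x t \<omega>) t)"
    and ib: "AE \<omega> in M. set_integrable lborel {t0..T} (\<lambda>t. b (x t \<omega>) t)"
    unfolding strong_solution_def Let_def Fl_def by auto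
  from sol obtain I where I: "has_ito_integral M Fl w t0 T (\<lambda>t \<omega>. \<sigma> (x t \<omega>) t) I"
    and x_eq: "AE \<omega> in M. \<forall>t\<in>{t0..T}. x t \<omega> = x0 + (LINT s:{t0..t}|lborel. b (x s \<omega>) s) + I t \<omega>"
    unfolding strong_solution_def Let_def Fl_def by auto
  from I have pH: "progressively_measurable Fl t0 T (\<lambda>t \<omega>. \<sigma> (x t \<omega>) t)"
    and iH: "AE \<omega> in M. (\<integral>\<^sup>+t\<in>{t0..T}. ennreal ((norm (\<sigma> (x t \<omega>) t))\<^sup>2) \<partial>lborel) < \<infinity>"
    and I_ad: "\<And>t. t \<in> {t0..T} \<Longrightarrow> I t \<in> borel_measurable (Fl t)"
    unfolding has_ito_integral_def by auto
  from I obtain N p \<xi> where sp: "\<And>j. simple_process Fl t0 T (N j) (p j) (\<xi> j)"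
    and H_lim: "vanishes_in_probability M (\<lambda>j \<omega>.
          \<integral>\<^sup>+t\<in>{t0..T}. ennreal ((norm (simple_value (N j) (p j) (\<xi> j) t \<omega> - \<sigma> (x t \<omega>) t))\<^sup>2) \<partial>lborel)"
    and I_lim: "\<And>t. t \<in> {t0..T} \<Longrightarrow> vanishes_in_probability M (\<lambda>j \<omega>.
          ennreal (norm (simple_integral w (N j) (p j) (\<xi> j) t \<omega> - I t \<omega>)))"
    unfolding has_ito_integral_def by blast
  have wM: "w t \<in> borel_measurable M" if "t \<in> {t0..T}" for t using assms(3) that by (auto simp: standard_wiener_def)
  have IM: "I t \<in> borel_measurable M" if "t \<in> {t0..T}" for t by (rule measurable_filtration_M[OF that I_ad[OF that]])
  have progH: "progressive H" unfolding H_def cl_def by (rule progressive_stopped[OF pH])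
  have "expectation (\<lambda>\<omega>. F (xc (exit_time U t0 T1 xc \<omega>) \<omega>) (exit_time U t0 T1 xc \<omega>)) = F x0 t0"
  proof (rule dynkin_exit_time[where b = bc and x = xc and U = U and H = H and I = I and N = N and p = p and \<xi> = \<xi>])
    show "progressive bc" unfolding bc_def cl_def by (rule progressive_stopped[OF pb])
    show "progressive H" by (rule progH)
    show "AE \<omega> in M. set_integrable lborel {t0..T} (\<lambda>r. bc r \<omega>)"
    proof -
      have "set_integrable lborel {t0..T} (\<lambda>r. bc r \<omega>) = set_integrable lborel {t0..T} (\<lambda>t. b (x t \<omega>) t)" for \<omega>
        by (rule set_integrable_cong) (auto simp: bc_def cl_id)
      then show ?thesis using ib by simp
    qed
    show "AE \<omega> in M. set_integrable lborel {t0..T} (\<lambda>r. (norm (H r \<omega>))\<^sup>2)"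
      using iH AE_space
    proof eventually_elim
      fix \<omega> assume fin: "(\<integral>\<^sup>+t\<in>{t0..T}. ennreal ((norm (\<sigma> (x t \<omega>) t))\<^sup>2) \<partial>lborel) < \<infinity>" and w: "\<omega> \<in> space M"
      have [measurable]: "(\<lambda>r. H r \<omega>) \<in> borel_measurable borel"
        by (rule jointly_measurable_section[OF progressive_jointly_measurable[OF progH] w])
      have "(\<integral>\<^sup>+ r. ennreal (norm (indicator {t0..T} r *\<^sub>R (norm (H r \<omega>))\<^sup>2)) \<partial>lborel)
          = (\<integral>\<^sup>+t\<in>{t0..T}. ennreal ((norm (\<sigma> (x t \<omega>) t))\<^sup>2) \<partial>lborel)"
        by (rule nn_integral_cong) (auto simp: indicator_def H_def cl_id)
      then show "set_integrable lborel {t0..T} (\<lambda>r. (norm (H r \<omega>))\<^sup>2)"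
        unfolding set_integrable_def by (intro integrableI_bounded) (use fin in auto)
    qed
    show "continuous_on UNIV (\<lambda>r. xc r \<omega>)" if "\<omega> \<in> space M" for \<omega>
      unfolding xc_def by (rule continuous_on_compose2[OF x_c[OF that]]) (use cl in \<open>auto simp: cl_def intro!: continuous_intros\<close>)
    show "xc r \<in> borel_measurable M" for r
      unfolding xc_def by (rule measurable_filtration_M[OF cl x_ad[OF cl]])
    show "xc r \<in> borel_measurable (Fl r)" if "r \<in> {t0..T}" for r
      using x_ad[OF that] by (simp add: xc_def[abs_def] cl_id[OF that])
    show "AE \<omega> in M. \<forall>t\<in>{t0..T}. xc t \<omega> = x0 + (LINT r:{t0..t}|lborel. bc r \<omega>) + I t \<omega>"
      using x_eq
    proof eventually_elim
      fix \<omega> assume eq: "\<forall>t\<in>{t0..T}. x t \<omega> = x0 + (LINT s:{t0..t}|lborel. b (x s \<omega>) s) + I t \<omega>"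
      show "\<forall>t\<in>{t0..T}. xc t \<omega> = x0 + (LINT r:{t0..t}|lborel. bc r \<omega>) + I t \<omega>"
      proof
        fix t assume t: "t \<in> {t0..T}"
        have "(LINT r:{t0..t}|lborel. bc r \<omega>) = (LINT s:{t0..t}|lborel. b (x s \<omega>) s)"
          by (rule set_lebesgue_integral_cong) (use t in \<open>auto simp: bc_def cl_id\<close>)
        then show "xc t \<omega> = x0 + (LINT r:{t0..t}|lborel. bc r \<omega>) + I t \<omega>"
          using eq t by (simp add: xc_def cl_id)
      qed
    qed
    show "I t \<in> borel_measurable M" if "t \<in> {t0..T}" for t by (rule IM[OF that])
    show "simple_process Fl t0 T (N j) (p j) (\<xi> j)" for j by (rule sp)
    have "(\<integral>\<^sup>+t\<in>{t0..T}. ennreal ((norm (simple_value (N j) (p j) (\<xi> j) t \<omega> - H t \<omega>))\<^sup>2) \<partial>lborel)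
        = (\<integral>\<^sup>+t\<in>{t0..T}. ennreal ((norm (simple_value (N j) (p j) (\<xi> j) t \<omega> - \<sigma> (x t \<omega>) t))\<^sup>2) \<partial>lborel)" for j \<omega>
      by (rule nn_integral_cong) (auto simp: indicator_def H_def cl_id)
    then show "vanishes_in_probability M (\<lambda>j \<omega>. \<integral>\<^sup>+t\<in>{t0..T}. ennreal ((norm (simple_value (N j) (p j) (\<xi> j) t \<omega> - H t \<omega>))\<^sup>2) \<partial>lborel)"
      using H_lim by simp
    show "vanishes_in_probability M (\<lambda>j \<omega>. ennreal (norm (simple_integral w' (N j) (p j) (\<xi> j) t \<omega> - I t \<omega>)))"
      if t: "t \<in> {t0..T}" for t
    proof -
      have m: "(\<lambda>\<omega>. ennreal (norm (simple_integral w' (N j) (p j) (\<xi> j) t \<omega> - I t \<omega>))) \<in> borel_measurable M" for j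
        using simple_integral_measurable(1)[OF sp[of j], of t] IM[OF t] by measurable
      have pt: "min t (p j i) \<in> {t0..T}" if "i \<le> N j" for i j using simple_process_cutpoint[OF sp[of j] that] t by auto
      have "simple_integral w (N j) (p j) (\<xi> j) t \<in> borel_measurable M" for j
        unfolding simple_integral_def[abs_def]
        by (intro borel_measurable_sum borel_measurable_matrix_vector borel_measurable_diff wM pt simple_process_measurable[OF sp]) auto
      then have m2: "(\<lambda>\<omega>. ennreal (norm (simple_integral w (N j) (p j) (\<xi> j) t \<omega> - I t \<omega>))) \<in> borel_measurable M" for j
        using IM[OF t] by measurable
      have eq: "simple_integral w' (N j) (p j) (\<xi> j) t \<omega> = simple_integral w (N j) (p j) (\<xi> j) t \<omega>" if "\<omega> \<in> space M - Nn" for \<omega> j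
        unfolding simple_integral_def by (rule sum.cong) (use w'[OF pt that] in auto)
      have "measure M {\<omega> \<in> space M. e < ennreal (norm (simple_integral w' (N j) (p j) (\<xi> j) t \<omega> - I t \<omega>))}
          = measure M {\<omega> \<in> space M. e < ennreal (norm (simple_integral w (N j) (p j) (\<xi> j) t \<omega> - I t \<omega>))}" for e j
      proof (rule measure_eq_AE)
        show "AE \<omega> in M. (\<omega> \<in> {\<omega> \<in> space M. e < ennreal (norm (simple_integral w' (N j) (p j) (\<xi> j) t \<omega> - I t \<omega>))})
          = (\<omega> \<in> {\<omega> \<in> space M. e < ennreal (norm (simple_integral w (N j) (p j) (\<xi> j) t \<omega> - I t \<omega>))})"
          using AE_not_in[OF Nn] AE_space by eventually_elim (simp add: eq)
      qed (rule borel_measurable_less[OF borel_measurable_const m] borel_measurable_less[OF borel_measurable_const m2])+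
      then show ?thesis using I_lim[OF t] by (simp add: vanishes_in_probability_def)
    qed
    show "AE \<omega> in M. xc t0 \<omega> = x0" using x_0 assms(1) by (simp add: xc_def cl_id)
    show "open U" by (rule U)
    show "Ft (xc r \<omega>) r + bc r \<omega> \<bullet> Fx (xc r \<omega>) r + 1/2 * ((H r \<omega> ** transpose (H r \<omega>)) \<bullet> Fxx (xc r \<omega>) r) = 0"
      if "r \<in> {t0..T1}" "xc r \<omega> \<in> U" for \<omega> r
    proof -
      have "cl r = r" using that(1) T1 by (intro cl_id) auto
      then show ?thesis using pde[OF that(2,1)] by (simp add: xc_def bc_def H_def)
    qed
  qed
  moreover have "exit_time U t0 T1 xc \<omega> = exit_time U t0 T1 x \<omega>" for \<omega>
    by (rule exit_time_cong) (use T1 in \<open>auto simp: xc_def cl_id\<close>)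
  moreover have "xc (exit_time U t0 T1 x \<omega>) \<omega> = x (exit_time U t0 T1 x \<omega>) \<omega>" for \<omega>
    using exit_time_bounds[OF T1(1), of U x \<omega>] T1 by (simp add: xc_def cl_id)
  ultimately show ?thesis by simp
qed

lemma strong_solution_exit_measurable:
  fixes w :: "real \<Rightarrow> 'a \<Rightarrow> real ^ 'k"
  assumes "t0 < T" "prob_space M" "standard_wiener M t0 T w" and sol: "strong_solution M w t0 T b \<sigma> x0 x"
    and T1: "t0 \<le> T1" "T1 \<le> T" and U: "open U"
  shows "exit_time U t0 T1 x \<in> borel_measurable M"
    and "(\<lambda>\<omega>. x (exit_time U t0 T1 x \<omega>) \<omega>) \<in> borel_measurable M"
    and "{\<omega> \<in> space M. \<forall>r\<in>{t0..T}. x r \<omega> \<in> U} \<in> sets M"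
proof -
  obtain w' Cw Nn where mod: "wiener_filtration M (augmented_filtration M t0 w) t0 T w' Cw" and "Nn \<in> null_sets M"
    and "\<And>t \<omega>. t \<in> {t0..T} \<Longrightarrow> \<omega> \<in> space M - Nn \<Longrightarrow> w' t \<omega> = w t \<omega>"
    using standard_wiener_modification[OF assms(1-3)] by blast
  define Fl where "Fl = augmented_filtration M t0 w"
  interpret wiener_filtration M Fl t0 T w' Cw unfolding Fl_def by (rule mod)
  define cl where "cl r = max t0 (min T r)" for r
  have cl: "cl r \<in> {t0..T}" and cl_id: "r \<in> {t0..T} \<Longrightarrow> cl r = r" for r using assms(1) by (auto simp: cl_def)
  define xc where "xc r \<omega> = x (cl r) \<omega>" for r \<omega>
  from sol have x_ad: "\<And>t. t \<in> {t0..T} \<Longrightarrow> x t \<in> borel_measurable (Fl t)"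
    and x_c: "\<And>\<omega>. \<omega> \<in> space M \<Longrightarrow> continuous_on {t0..T} (\<lambda>t. x t \<omega>)"
    unfolding strong_solution_def Let_def Fl_def by auto
  have xcM: "xc r \<in> borel_measurable M" for r unfolding xc_def by (rule measurable_filtration_M[OF cl x_ad[OF cl]])
  have xcad: "xc r \<in> borel_measurable (Fl r)" if "r \<in> {t0..T}" for r
    using x_ad[OF that] by (simp add: xc_def[abs_def] cl_id[OF that])
  have xcc: "continuous_on UNIV (\<lambda>r. xc r \<omega>)" if "\<omega> \<in> space M" for \<omega>
    unfolding xc_def by (rule continuous_on_compose2[OF x_c[OF that]]) (use cl in \<open>auto simp: cl_def intro!: continuous_intros\<close>)
  have e1: "exit_time U t0 T1 xc = exit_time U t0 T1 x"
    by (rule ext, rule exit_time_cong) (use T1 in \<open>auto simp: xc_def cl_id\<close>)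
  have e2: "xc (exit_time U t0 T1 x \<omega>) \<omega> = x (exit_time U t0 T1 x \<omega>) \<omega>" for \<omega>
    using exit_time_bounds[OF T1(1), of U x \<omega>] T1 by (simp add: xc_def cl_id)
  show "exit_time U t0 T1 x \<in> borel_measurable M"
    using exit_time_measurable[OF U T1 xcad xcc] by (simp add: e1)
  show "(\<lambda>\<omega>. x (exit_time U t0 T1 x \<omega>) \<omega>) \<in> borel_measurable M"
    using exit_value_measurable[OF U T1 xcad xcc jointly_measurable_continuous[OF xcM xcc]] by (simp add: e1 e2)
  show "{\<omega> \<in> space M. \<forall>r\<in>{t0..T}. x r \<omega> \<in> U} \<in> sets M"
  proof (rule stays_in_open_measurable[OF U])
    show "x r \<in> borel_measurable M" if "r \<in> {t0..T}" for r by (rule measurable_filtration_M[OF that x_ad[OF that]])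
  qed (use assms(1) x_c in auto)
qed

section \<open>The boundary value problem\<close>

text \<open>The path lies in \<open>U\<close> on the half-open interval before the exit time, whose
  closure contains the exit time unless exit is immediate.\<close>

lemma exit_value_closed:
  assumes "t0 \<le> T" "continuous_on {t0..T} (\<lambda>t. x t \<omega>)" "closed C" "x t0 \<omega> \<in> C" "U \<subseteq> C"
  shows "x (exit_time U t0 T x \<omega>) \<omega> \<in> C"
proof (cases "exit_time U t0 T x \<omega> = t0")
  case False
  define \<tau> where "\<tau> = exit_time U t0 T x \<omega>"
  have \<tau>: "t0 < \<tau>" "\<tau> \<le> T" using exit_time_bounds[OF assms(1), of U x \<omega>] False by (auto simp: \<tau>_def)
  have "(\<lambda>t. x t \<omega>) ` closure {t0..<\<tau>} \<subseteq> C"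
  proof (rule image_closure_subset)
    show "continuous_on (closure {t0..<\<tau>}) (\<lambda>t. x t \<omega>)"
      using \<tau> by (auto intro: continuous_on_subset[OF assms(2)])
    show "(\<lambda>t. x t \<omega>) ` {t0..<\<tau>} \<subseteq> C"
      using before_exit_time[of t0 _ U T x \<omega>] assms(1,5) by (auto simp: \<tau>_def)
  qed (rule assms(3))
  then show ?thesis using \<tau> by (auto simp: \<tau>_def[symmetric])
qed (use assms in simp)

text \<open>Smaller sets and earlier horizons are left no later. Conversely, the path up to a time
  before the exit traces a compact subset of \<open>Xs\<close>, which is contained in one of the
  increasing open sets.\<close>

lemma exit_times_converge:
  assumes t0T: "t0 < T" and xc: "continuous_on {t0..T} (\<lambda>t. x t \<omega>)" and Xs: "open Xs"
    and U: "\<And>n. open (U n)" "\<And>n. U n \<subseteq> U (Suc n)" "(\<Union>n. U n) = Xs"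
    and S: "\<And>n. t0 \<le> S n" "\<And>n. S n < T" "S \<longlonglongrightarrow> T"
  shows "(\<lambda>n. exit_time (U n) t0 (S n) x \<omega>) \<longlonglongrightarrow> exit_time Xs t0 T x \<omega>"
proof -
  define \<tau> where "\<tau> = exit_time Xs t0 T x \<omega>"
  define \<tau>n where "\<tau>n n = exit_time (U n) t0 (S n) x \<omega>" for n
  have \<tau>: "t0 \<le> \<tau>" "\<tau> \<le> T" using exit_time_bounds[of t0 T Xs x \<omega>] t0T by (auto simp: \<tau>_def)
  have \<tau>n: "t0 \<le> \<tau>n n" "\<tau>n n \<le> S n" for n using exit_time_bounds[OF S(1)] by (auto simp: \<tau>n_def)
  have le: "\<tau>n n \<le> \<tau>" for n
  \<comment> \<open>If the path has left \<open>Xs\<close> by \<open>S n\<close>, it has left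
    \<open>U n\<close> too; otherwise \<open>\<tau>\<close> exceeds \<open>S n\<close>, which bounds
    the approximating exit time.\<close>
  proof (cases "(\<exists>t\<in>{t0..T}. x t \<omega> \<notin> Xs) \<and> \<tau> \<le> S n")
    case True
    then have "x \<tau> \<omega> \<notin> Xs" using exit_time_attained[where x = x and \<omega> = \<omega>, OF Xs xc] by (simp add: \<tau>_def)
    then have "x \<tau> \<omega> \<notin> U n" using U(3) by blast
    then show ?thesis unfolding \<tau>n_def using True \<tau> by (intro exit_time_le) auto
  next
    case False
    then have "\<tau> = T \<or> S n < \<tau>" by (cases "\<forall>t\<in>{t0..T}. x t \<omega> \<in> Xs") (auto simp: \<tau>_def exit_time_def)
    then show ?thesis using \<tau>n(2)[of n] S(2)[of n] by auto
  qed
  have mono: "U n \<subseteq> U m" if "n \<le> m" for n m using lift_Suc_mono_le[of U, OF U(2) that] .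
  have ge: "\<forall>\<^sub>F n in sequentially. r < \<tau>n n" if r: "r < \<tau>" for r
  proof (cases "r < t0")
    case True then show ?thesis using \<tau>n(1) by (intro always_eventually allI) (auto intro: less_le_trans)
  next
    case False
    define q where "q = (r + \<tau>) / 2"
    have q: "r < q" "q < \<tau>" "t0 \<le> q" using r False by (auto simp: q_def field_simps)
    define P where "P = (\<lambda>t. x t \<omega>) ` {t0..q}"
    have "compact P" unfolding P_def
      by (rule compact_continuous_image[OF continuous_on_subset[OF xc]]) (use q \<tau> in auto)
    moreover have "P \<subseteq> \<Union> (range U)"
      unfolding P_def using before_exit_time[of t0 _ Xs T x \<omega>] q t0T by (auto simp: U(3) \<tau>_def[symmetric])
    ultimately obtain D where D: "D \<subseteq> range U" "finite D" "P \<subseteq> \<Union> D"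
      using U(1) by (elim compactE[of P "range U"]) auto
    then obtain I where I: "finite I" "D = U ` I" using finite_subset_image by metis
    obtain n0 where n0: "I \<subseteq> {..n0}" using finite_nat_iff_bounded_le I(1) by blast
    have PU: "P \<subseteq> U n" if "n \<ge> n0" for n
    proof
      fix y assume "y \<in> P"
      then obtain i where "i \<in> I" "y \<in> U i" using D(3) I by auto
      moreover have "i \<le> n" using n0 that \<open>i \<in> I\<close> by auto
      ultimately show "y \<in> U n" using mono[of i n] by blast
    qed
    have "\<forall>\<^sub>F n in sequentially. q < S n" using order_tendstoD(1)[OF S(3)] q \<tau> by auto
    then show ?thesis using eventually_ge_at_top[of n0]
    proof eventually_elim
      fix n assume n: "q < S n" "n0 \<le> n"
      have "q \<le> \<tau>n n" unfolding \<tau>n_def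
        by (rule exit_time_ge) (use PU[OF n(2)] n in \<open>auto simp: P_def\<close>)
      then show "r < \<tau>n n" using q by simp
    qed
  qed
  have "\<tau>n \<longlonglongrightarrow> \<tau>"
  proof (rule order_tendstoI)
    show "\<forall>\<^sub>F n in sequentially. \<tau>n n < a" if "\<tau> < a" for a
      by (rule always_eventually) (use le that in \<open>auto intro: le_less_trans\<close>)
  qed (rule ge)
  then show ?thesis by (simp add: \<tau>n_def[abs_def] \<tau>_def)
qed

text \<open>Dynkin's formula for a cutoff of \<open>J\<close> up to the exit from \<open>U n\<close>
  or a horizon before \<open>T\<close>, then a limit in \<open>n\<close> by continuity of
  \<open>J\<close> on the compact closed cylinder. The bump functions serve here to exhaust
  \<open>Xs\<close>, whatever the datum \<open>\<phi>\<close>.\<close>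

lemma bvp_representation:
  fixes w :: "real \<Rightarrow> 'a \<Rightarrow> real ^ 'k" and g :: "real ^ 'n \<Rightarrow> real \<Rightarrow> real ^ 'm ^ 'n"
  assumes t0T: "t0 < T" and pM: "prob_space M" and W: "standard_wiener M t0 T w"
    and sol: "strong_solution M w t0 T (closed_loop_drift f g u) \<sigma> x0 x"
    and Xs: "open Xs" "bounded Xs" and x0: "x0 \<in> Xs" and B: "bump_approximation Xs B"
    and bvp: "solves_bvp f g u \<sigma> Xs t0 T \<phi> J"
    and Y: "Y \<in> borel_measurable M" "AE \<omega> in M. Y \<omega> = J (x (exit_time Xs t0 T x \<omega>) \<omega>, exit_time Xs t0 T x \<omega>)"
  shows "prob_space.expectation M Y = J (x0, t0)"
proof -
  interpret prob_space M by (rule pM)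
  from sol have x_c: "\<And>\<omega>. \<omega> \<in> space M \<Longrightarrow> continuous_on {t0..T} (\<lambda>t. x t \<omega>)"
    and x_0: "AE \<omega> in M. x t0 \<omega> = x0"
    unfolding strong_solution_def Let_def by auto
  from bvp obtain J_t J_x J_xx where Jc: "continuous_on (closed_cylinder Xs t0 T) J"
    and J: "C21_on_cylinder Xs t0 T J J_t J_x J_xx"
    and pde: "\<And>y t. (y, t) \<in> cylinder Xs t0 T \<Longrightarrow> - J_t (y, t) = (f y t + g y t *v u y t) \<bullet> J_x (y, t)
             + 1 / 2 * trace (\<sigma> y t ** transpose (\<sigma> y t) ** J_xx (y, t))"
    unfolding solves_bvp_def by blast
  have bump: "bump_function Xs (B i)" for i using B by (simp add: bump_approximation_def)
  have "\<exists>D E. C2_function (B i) D E" for i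
  proof -
    have "C_times (Suc (Suc 0)) (B i)" using bump[of i] unfolding bump_function_def by blast
    then show ?thesis using C_times_imp_C2_function by blast
  qed
  then obtain D E where C2: "\<And>i. C2_function (B i) (D i) (E i)" by metis
  \<comment> \<open>Partial sums are increasing even if the bump functions themselves are not, and
    so are their superlevel sets.\<close>
  define S where "S n y = (\<Sum>i<n. B i y)" for n y
  define DS where "DS n y = (\<Sum>i<n. D i y)" for n y
  define ES where "ES n y = (\<Sum>i<n. E i y)" for n y
  have C2S: "C2_function (S n) (DS n) (ES n)" for n
    unfolding S_def[abs_def] DS_def[abs_def] ES_def[abs_def] by (rule C2_function_sum) (rule C2)
  have Sc: "continuous_on UNIV (S n)" for n using C2S[of n] by (simp add: C2_function_def)
  have B01: "0 \<le> B i y" "B i y \<le> 1" for i y using bump[of i] by (auto simp: bump_function_def)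
  have S0: "0 \<le> S n y" for n y unfolding S_def by (rule sum_nonneg) (rule B01)
  \<comment> \<open>At the value 1 the plateau profile becomes constant: on \<open>U n\<close> the
    cutoff is 1 and its derivatives vanish, so the PDE for \<open>J\<close> holds for the
    product.\<close>
  define U where "U n = {y. 1 < S n y}" for n
  define K where "K n = (\<Union>i<n. closure {y. B i y \<noteq> 0})" for n
  have K: "compact (K n)" "K n \<subseteq> Xs" for n
    using bump by (auto simp: K_def bump_function_def intro!: compact_UN)
  have SK: "S n y = 0" if "y \<notin> K n" for n y
    unfolding S_def
  proof (rule sum.neutral, rule ballI)
    fix i assume "i \<in> {..<n}"
    then have "y \<notin> closure {y. B i y \<noteq> 0}" using that by (auto simp: K_def)
    then show "B i y = 0" using closure_subset[of "{y. B i y \<noteq> 0}"] by auto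
  qed
  have S_Xs: "y \<in> Xs" if "S n y \<noteq> 0" for n y using SK[of y n] K(2)[of n] that by blast
  have U_open: "open (U n)" for n
    unfolding U_def by (rule open_Collect_less) (use Sc in auto)
  have U_mono: "U n \<subseteq> U (Suc n)" for n
    using B01(1) by (auto simp: U_def S_def intro: less_le_trans)
  have U_Un: "(\<Union>n. U n) = Xs"
  proof
    show "(\<Union>n. U n) \<subseteq> Xs"
    proof safe
      fix y n assume "y \<in> U n" then show "y \<in> Xs" using S_Xs[of n y] by (simp add: U_def)
    qed
    show "Xs \<subseteq> (\<Union>n. U n)"
    proof
      fix y assume y: "y \<in> Xs"
      then have "(\<lambda>j. B j y) \<longlonglongrightarrow> 1" using B by (simp add: bump_approximation_def)
      then have "\<forall>\<^sub>F j in sequentially. 1/2 < B j y" by (rule order_tendstoD(1)) simp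
      then obtain n0 where n0: "\<And>n. n \<ge> n0 \<Longrightarrow> 1/2 < B n y" unfolding eventually_sequentially by blast
      \<comment> \<open>From some index on each bump function exceeds 1/2 at \<open>y\<close>, so a
        few summands push the sum above 1.\<close>
      have "1 < B n0 y + B (Suc n0) y + B (Suc (Suc n0)) y" using n0[of n0] n0[of "Suc n0"] n0[of "Suc (Suc n0)"] by simp
      also have "\<dots> \<le> S (Suc (Suc (Suc n0))) y" using S0[of n0 y] by (simp add: S_def)
      finally show "y \<in> (\<Union>n. U n)" by (auto simp: U_def)
    qed
  qed
  define h where "h n y = 1 - (max 0 (1 - S n y)) ^ 3" for n y
  define Dh where "Dh n y = (3 * (max 0 (1 - S n y))\<^sup>2) *\<^sub>R DS n y" for n y
  define Eh where "Eh n y = (3 * (max 0 (1 - S n y))\<^sup>2) *\<^sub>R ES n y - (6 * max 0 (1 - S n y)) *\<^sub>R outer_product (DS n y) (DS n y)" for n y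
  have C2h: "C2_function (h n) (Dh n) (Eh n)" for n
    unfolding h_def[abs_def] Dh_def[abs_def] Eh_def[abs_def] by (rule C2_function_plateau[OF C2S])
  have hK: "h n y = 0" if "y \<notin> K n" for n y using SK[OF that] by (simp add: h_def)
  have h1: "h n y = 1" if "1 \<le> S n y" for n y using that by (simp add: h_def max_def)
  have h01: "0 \<le> h n y" "h n y \<le> 1" for n y
    using S0[of n y] power_le_one[of "max 0 (1 - S n y)" 3] by (auto simp: h_def)
  define T1 where "T1 n = T - (T - t0) / real (Suc (Suc n))" for n
  have T1: "t0 \<le> T1 n" "T1 n < T" for n
  proof -
    have "(T - t0) / real (Suc (Suc n)) \<le> (T - t0) / 1" by (rule divide_left_mono) (use t0T in auto)
    then show "t0 \<le> T1 n" "T1 n < T" using t0T by (auto simp: T1_def)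
  qed
  have T1_lim: "T1 \<longlonglongrightarrow> T"
  proof -
    have "(\<lambda>n. (T - t0) / real (Suc (Suc n))) \<longlonglongrightarrow> 0"
      by (intro LIMSEQ_Suc lim_const_over_n)
    from tendsto_diff[OF tendsto_const[of T] this] show ?thesis by (simp add: T1_def[abs_def])
  qed
  define F where "F n y t = (if y \<in> Xs then h n y * J (y, t) else 0)" for n y t
  define \<tau> where "\<tau> = exit_time Xs t0 T x"
  define \<tau>n where "\<tau>n n = exit_time (U n) t0 (T1 n) x" for n
  have \<tau>: "\<tau> \<omega> \<in> {t0..T}" for \<omega> using exit_time_bounds[of t0 T Xs x \<omega>] t0T by (auto simp: \<tau>_def)
  have \<tau>n: "\<tau>n n \<omega> \<in> {t0..T1 n}" for n \<omega> using exit_time_bounds[OF T1(1)] by (auto simp: \<tau>n_def)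
  have \<tau>nT: "\<tau>n n \<omega> \<in> {t0..T}" for n \<omega> using \<tau>n[of n \<omega>] T1(2)[of n] by auto
  have sub: "cylinder Xs t0 T \<subseteq> closed_cylinder Xs t0 T"
    using closure_subset[of Xs] by (auto simp: cylinder_def closed_cylinder_def)
  have dynkin: "expectation (\<lambda>\<omega>. F n (x (\<tau>n n \<omega>) \<omega>) (\<tau>n n \<omega>)) = F n x0 t0" for n
  proof -
    define Ft where "Ft y t = (if y \<in> Xs then h n y * J_t (y, t) else 0)" for y t
    define Fx where "Fx y t = (if y \<in> Xs then h n y *\<^sub>R J_x (y, t) + J (y, t) *\<^sub>R Dh n y else 0)" for y t
    define Fxx where "Fxx y t = (if y \<in> Xs then h n y *\<^sub>R J_xx (y, t) + outer_product (J_x (y, t)) (Dh n y)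
      + outer_product (Dh n y) (J_x (y, t)) + J (y, t) *\<^sub>R Eh n y else 0)" for y t
    obtain Bd where tf: "test_function t0 (T1 n) (F n) Ft Fx Fxx Bd"
      using cutoff_test_function[OF Xs(1) T1(2) J continuous_on_subset[OF Jc sub] C2h K hK, of n]
      unfolding F_def[abs_def] Ft_def[abs_def] Fx_def[abs_def] Fxx_def[abs_def] by blast
    show ?thesis unfolding \<tau>n_def
    proof (rule strong_solution_dynkin[OF t0T pM W sol tf T1(1) less_imp_le[OF T1(2)] U_open])
      fix y r assume y: "y \<in> U n" and r: "r \<in> {t0..T1 n}"
      have S1: "1 < S n y" using y by (simp add: U_def)
      then have yX: "y \<in> Xs" using S_Xs[of n y] by simp
      have "(y, r) \<in> cylinder Xs t0 T" using yX r T1(2)[of n] by (auto simp: cylinder_def)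
      from pde[OF this]
      have "J_t (y, r) + (f y r + g y r *v u y r) \<bullet> J_x (y, r) + 1/2 * ((\<sigma> y r ** transpose (\<sigma> y r)) \<bullet> J_xx (y, r)) = 0"
        by (simp add: trace_mult_eq_inner)
      moreover have "Ft y r = J_t (y, r)" "Fx y r = J_x (y, r)" "Fxx y r = J_xx (y, r)"
        using S1 yX by (simp_all add: Ft_def Fx_def Fxx_def h_def Dh_def Eh_def)
      ultimately show "Ft y r + closed_loop_drift f g u y r \<bullet> Fx y r + 1/2 * ((\<sigma> y r ** transpose (\<sigma> y r)) \<bullet> Fxx y r) = 0"
        by (simp add: closed_loop_drift_def)
    qed
  qed
  obtain n0 where n0: "x0 \<in> U n0" using x0 U_Un by blast
  have x0U: "x0 \<in> U n" if "n \<ge> n0" for n using lift_Suc_mono_le[of U, OF U_mono that] n0 by blast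
  have cc: "compact (closed_cylinder Xs t0 T)"
    unfolding closed_cylinder_def using Xs(2) by (intro compact_Times) auto
  obtain C where C: "\<And>z. z \<in> closed_cylinder Xs t0 T \<Longrightarrow> \<bar>J z\<bar> \<le> C"
    using compact_imp_bounded[OF compact_continuous_image[OF Jc cc]] unfolding bounded_iff by auto
  \<comment> \<open>A Borel function on the whole space; outcomes that violate the initial condition
    may stop outside the closed cylinder.\<close>
  define JJ where "JJ z = indicator (closed_cylinder Xs t0 T) z *\<^sub>R J z" for z
  have JJ: "JJ \<in> borel_measurable borel"
    unfolding JJ_def[abs_def]
    by (rule borel_measurable_continuous_on_indicator[OF _ Jc]) (use compact_imp_closed[OF cc] in auto)
  have m\<tau>: "(\<lambda>\<omega>. (x (\<tau> \<omega>) \<omega>, \<tau> \<omega>)) \<in> borel_measurable M"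
    unfolding \<tau>_def using strong_solution_exit_measurable[OF t0T pM W sol less_imp_le[OF t0T] order_refl Xs(1)]
    by (intro borel_measurable_Pair)
  have m\<tau>n: "(\<lambda>\<omega>. (x (\<tau>n n \<omega>) \<omega>, \<tau>n n \<omega>)) \<in> borel_measurable M" for n
    unfolding \<tau>n_def using strong_solution_exit_measurable[OF t0T pM W sol T1(1) less_imp_le[OF T1(2)] U_open]
    by (intro borel_measurable_Pair)
  have in_cl: "(x (\<tau> \<omega>) \<omega>, \<tau> \<omega>) \<in> closed_cylinder Xs t0 T" if "\<omega> \<in> space M" "x t0 \<omega> = x0" for \<omega>
  proof -
    have "x (exit_time Xs t0 T x \<omega>) \<omega> \<in> closure Xs"
      by (rule exit_value_closed) (use t0T x_c that x0 closure_subset[of Xs] in auto)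
    then show ?thesis using \<tau>[of \<omega>] by (simp add: closed_cylinder_def \<tau>_def)
  qed
  \<comment> \<open>At the exit the path may have left \<open>U n\<close>, but by closedness the sum
    is still at least 1, so the cutoff is still 1 and the position still in
    \<open>Xs\<close>.\<close>
  have S_\<tau>n: "1 \<le> S n (x (\<tau>n n \<omega>) \<omega>)" if "\<omega> \<in> space M" "x t0 \<omega> = x0" "n \<ge> n0" for n \<omega>
  proof -
    have "x (exit_time (U n) t0 (T1 n) x \<omega>) \<omega> \<in> {y. 1 \<le> S n y}"
    proof (rule exit_value_closed[where x = x and \<omega> = \<omega>, OF T1(1)])
      show "continuous_on {t0..T1 n} (\<lambda>t. x t \<omega>)"
        by (rule continuous_on_subset[OF x_c[OF that(1)]]) (use T1(2)[of n] in auto)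
      show "closed {y. 1 \<le> S n y}" by (rule closed_Collect_le) (use Sc in auto)
      show "x t0 \<omega> \<in> {y. 1 \<le> S n y}" using x0U[OF that(3)] that(2) by (simp add: U_def)
    qed (auto simp: U_def)
    then show ?thesis by (simp add: \<tau>n_def)
  qed
  have F_eq: "F n (x (\<tau>n n \<omega>) \<omega>) (\<tau>n n \<omega>) = J (x (\<tau>n n \<omega>) \<omega>, \<tau>n n \<omega>)"
    and Xs_\<tau>n: "x (\<tau>n n \<omega>) \<omega> \<in> Xs" if "\<omega> \<in> space M" "x t0 \<omega> = x0" "n \<ge> n0" for n \<omega>
  proof -
    show "x (\<tau>n n \<omega>) \<omega> \<in> Xs" using S_\<tau>n[OF that] by (intro S_Xs[of n]) auto
    then show "F n (x (\<tau>n n \<omega>) \<omega>) (\<tau>n n \<omega>) = J (x (\<tau>n n \<omega>) \<omega>, \<tau>n n \<omega>)"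
      using h1[OF S_\<tau>n[OF that]] by (simp add: F_def)
  qed
  have "(\<lambda>n. expectation (\<lambda>\<omega>. F n (x (\<tau>n n \<omega>) \<omega>) (\<tau>n n \<omega>))) \<longlonglongrightarrow> expectation (\<lambda>\<omega>. JJ (x (\<tau> \<omega>) \<omega>, \<tau> \<omega>))"
  proof (rule integral_dominated_convergence[where w = "\<lambda>_. C"])
    show "(\<lambda>\<omega>. JJ (x (\<tau> \<omega>) \<omega>, \<tau> \<omega>)) \<in> borel_measurable M" by (rule measurable_compose[OF m\<tau> JJ])
    show "integrable M (\<lambda>_. C)" by simp
    show "(\<lambda>\<omega>. F n (x (\<tau>n n \<omega>) \<omega>) (\<tau>n n \<omega>)) \<in> borel_measurable M" for n
    proof -
      define G where "G z = indicator Xs (fst z) * (h n (fst z) * JJ z)" for z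
      have hb: "h n \<in> borel_measurable borel"
        using C2h[of n] by (intro borel_measurable_continuous_onI) (simp add: C2_function_def)
      have f: "fst \<in> measurable borel (borel :: (real ^ 'n) measure)"
        by (intro borel_measurable_continuous_onI continuous_intros)
      have i: "(\<lambda>y. indicator Xs y :: real) \<in> borel_measurable borel" using Xs(1) by simp
      have "G \<in> borel_measurable borel"
        unfolding G_def[abs_def]
        by (intro borel_measurable_times JJ measurable_compose[OF f hb] measurable_compose[OF f i])
      from measurable_compose[OF m\<tau>n this]
      have "(\<lambda>\<omega>. G (x (\<tau>n n \<omega>) \<omega>, \<tau>n n \<omega>)) \<in> borel_measurable M" .
      moreover have "G (x (\<tau>n n \<omega>) \<omega>, \<tau>n n \<omega>) = F n (x (\<tau>n n \<omega>) \<omega>) (\<tau>n n \<omega>)" for \<omega>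
        using \<tau>nT[of n \<omega>] closure_subset[of Xs] by (auto simp: G_def F_def JJ_def closed_cylinder_def indicator_def)
      ultimately show ?thesis by simp
    qed
    show "AE \<omega> in M. (\<lambda>n. F n (x (\<tau>n n \<omega>) \<omega>) (\<tau>n n \<omega>)) \<longlonglongrightarrow> JJ (x (\<tau> \<omega>) \<omega>, \<tau> \<omega>)"
      using x_0 AE_space
    proof eventually_elim
      fix \<omega> assume w: "x t0 \<omega> = x0" "\<omega> \<in> space M"
      have lim: "(\<lambda>n. \<tau>n n \<omega>) \<longlonglongrightarrow> \<tau> \<omega>"
        unfolding \<tau>n_def \<tau>_def by (rule exit_times_converge[where x = x and \<omega> = \<omega>, OF t0T x_c[OF w(2)] Xs(1) U_open U_mono U_Un T1 T1_lim])
      have "(\<lambda>n. x (\<tau>n n \<omega>) \<omega>) \<longlonglongrightarrow> x (\<tau> \<omega>) \<omega>"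
        by (rule continuous_on_tendsto_compose[OF x_c[OF w(2)] lim \<tau>]) (intro always_eventually allI \<tau>nT)
      from tendsto_Pair[OF this lim]
      have "(\<lambda>n. J (x (\<tau>n n \<omega>) \<omega>, \<tau>n n \<omega>)) \<longlonglongrightarrow> J (x (\<tau> \<omega>) \<omega>, \<tau> \<omega>)"
      proof (rule continuous_on_tendsto_compose[OF Jc _ in_cl[OF w(2,1)]])
        show "\<forall>\<^sub>F n in sequentially. (x (\<tau>n n \<omega>) \<omega>, \<tau>n n \<omega>) \<in> closed_cylinder Xs t0 T"
          using eventually_ge_at_top[of n0]
          by eventually_elim (use Xs_\<tau>n[OF w(2,1)] \<tau>nT closure_subset[of Xs] in \<open>auto simp: closed_cylinder_def\<close>)
      qed
      moreover have "\<forall>\<^sub>F n in sequentially. J (x (\<tau>n n \<omega>) \<omega>, \<tau>n n \<omega>) = F n (x (\<tau>n n \<omega>) \<omega>) (\<tau>n n \<omega>)"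
        using eventually_ge_at_top[of n0] by eventually_elim (simp add: F_eq[OF w(2,1)])
      ultimately have "(\<lambda>n. F n (x (\<tau>n n \<omega>) \<omega>) (\<tau>n n \<omega>)) \<longlonglongrightarrow> J (x (\<tau> \<omega>) \<omega>, \<tau> \<omega>)"
        by (rule Lim_transform_eventually)
      then show "(\<lambda>n. F n (x (\<tau>n n \<omega>) \<omega>) (\<tau>n n \<omega>)) \<longlonglongrightarrow> JJ (x (\<tau> \<omega>) \<omega>, \<tau> \<omega>)"
        using in_cl[OF w(2,1)] by (simp add: JJ_def)
    qed
    show "AE \<omega> in M. norm (F n (x (\<tau>n n \<omega>) \<omega>) (\<tau>n n \<omega>)) \<le> C" for n
    proof (rule AE_I2)
      fix \<omega>
      have C0: "0 \<le> C" using C[of "(x0, t0)"] x0 t0T closure_subset[of Xs] by (force simp: closed_cylinder_def)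
      show "norm (F n (x (\<tau>n n \<omega>) \<omega>) (\<tau>n n \<omega>)) \<le> C"
      proof (cases "x (\<tau>n n \<omega>) \<omega> \<in> Xs")
        case True
        then have "(x (\<tau>n n \<omega>) \<omega>, \<tau>n n \<omega>) \<in> closed_cylinder Xs t0 T"
          using \<tau>nT[of n \<omega>] closure_subset[of Xs] by (auto simp: closed_cylinder_def)
        from C[OF this] have "h n (x (\<tau>n n \<omega>) \<omega>) * \<bar>J (x (\<tau>n n \<omega>) \<omega>, \<tau>n n \<omega>)\<bar> \<le> 1 * C"
          using h01 by (intro mult_mono) auto
        then show ?thesis using True h01(1) by (simp add: F_def abs_mult)
      qed (simp add: F_def C0)
    qed
  qed
  moreover have "\<forall>\<^sub>F n in sequentially. J (x0, t0) = expectation (\<lambda>\<omega>. F n (x (\<tau>n n \<omega>) \<omega>) (\<tau>n n \<omega>))"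
    using eventually_ge_at_top[of n0]
  proof eventually_elim
    fix n assume "n0 \<le> n"
    then have "1 < S n x0" using x0U by (simp add: U_def)
    then show "J (x0, t0) = expectation (\<lambda>\<omega>. F n (x (\<tau>n n \<omega>) \<omega>) (\<tau>n n \<omega>))"
      using h1[of n x0] x0 unfolding dynkin by (simp add: F_def)
  qed
  then have "(\<lambda>n. expectation (\<lambda>\<omega>. F n (x (\<tau>n n \<omega>) \<omega>) (\<tau>n n \<omega>))) \<longlonglongrightarrow> J (x0, t0)"
    by (rule Lim_transform_eventually[OF tendsto_const])
  ultimately have "expectation (\<lambda>\<omega>. JJ (x (\<tau> \<omega>) \<omega>, \<tau> \<omega>)) = J (x0, t0)" by (rule LIMSEQ_unique)
  moreover have "expectation Y = expectation (\<lambda>\<omega>. JJ (x (\<tau> \<omega>) \<omega>, \<tau> \<omega>))"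
  proof (rule integral_cong_AE[OF Y(1) measurable_compose[OF m\<tau> JJ]])
    show "AE \<omega> in M. Y \<omega> = JJ (x (\<tau> \<omega>) \<omega>, \<tau> \<omega>)"
      using Y(2) x_0 AE_space
    proof eventually_elim
      fix \<omega> assume "Y \<omega> = J (x (exit_time Xs t0 T x \<omega>) \<omega>, exit_time Xs t0 T x \<omega>)" "x t0 \<omega> = x0" "\<omega> \<in> space M"
      then show "Y \<omega> = JJ (x (\<tau> \<omega>) \<omega>, \<tau> \<omega>)" using in_cl[of \<omega>] by (simp add: JJ_def \<tau>_def)
    qed
  qed
  ultimately show ?thesis by simp
qed

text \<open>The datum jumps from 1 to 0 at \<open>frontier Xs \<times> {T}\<close>, so no continuous function attains it.\<close>

lemma no_exact_boundary_solution:
  assumes "t0 < T" "open Xs" "bounded Xs" "Xs \<noteq> {}"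
  shows "\<not> solves_bvp f g u \<sigma> Xs t0 T (boundary_data Xs) J"
proof
  assume bvp: "solves_bvp f g u \<sigma> Xs t0 T (boundary_data Xs) J"
  then have Jc: "continuous_on (closed_cylinder Xs t0 T) J"
    and Jb: "\<And>y t. (y, t) \<in> cylinder_boundary Xs t0 T \<Longrightarrow> J (y, t) = boundary_data Xs y"
    unfolding solves_bvp_def by auto
  have "frontier Xs \<noteq> {}" using assms(3,4) not_bounded_UNIV by (auto simp: frontier_eq_empty)
  then obtain z where z: "z \<in> frontier Xs" by blast
  then have zc: "z \<in> closure Xs" by (auto simp: frontier_def)
  \<comment> \<open>Approached in time along the lateral boundary.\<close>
  have "J (z, T) = 1"
  proof (rule continuous_constant_on_closure[where S = "{t0..<T}" and f = "\<lambda>t. J (z, t)"])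
    show "continuous_on (closure {t0..<T}) (\<lambda>t. J (z, t))"
      by (rule continuous_on_compose2[OF Jc]) (use assms(1) zc in \<open>auto simp: closed_cylinder_def intro!: continuous_intros\<close>)
    show "J (z, t) = 1" if "t \<in> {t0..<T}" for t
      using Jb[of z t] z that by (auto simp: cylinder_boundary_def boundary_data_def)
  qed (use assms(1) in auto)
  \<comment> \<open>The same point approached within the top \<open>Xs \<times> {T}\<close>.\<close>
  moreover have "J (z, T) = 0"
  proof (rule continuous_constant_on_closure[where S = Xs and f = "\<lambda>y. J (y, T)"])
    show "continuous_on (closure Xs) (\<lambda>y. J (y, T))"
      by (rule continuous_on_compose2[OF Jc]) (use assms(1) in \<open>auto simp: closed_cylinder_def intro!: continuous_intros\<close>)
    show "J (y, T) = 0" if "y \<in> Xs" for y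
      using Jb[of y T] that assms(2) by (auto simp: cylinder_boundary_def boundary_data_def frontier_def interior_open)
  qed (rule zc)
  ultimately show False by simp
qed

text \<open>The corner \<open>frontier Xs \<times> {T}\<close> is not part of
  \<open>cylinder_boundary\<close>; there the value follows from the lateral boundary by continuity
  in time. It is the value met by a path that reaches the frontier exactly at
  \<open>T\<close>.\<close>

lemma bump_boundary_value:
  assumes "t0 < T" and B: "bump_function Xs B" and bvp: "solves_bvp f g u \<sigma> Xs t0 T (\<lambda>y. 1 - B y) J"
    and y: "y \<in> closure Xs" "t \<in> {t0..T}" "y \<in> Xs \<Longrightarrow> t = T"
  shows "J (y, t) = 1 - B y"
proof -
  from bvp have Jc: "continuous_on (closed_cylinder Xs t0 T) J"
    and Jb: "\<And>y t. (y, t) \<in> cylinder_boundary Xs t0 T \<Longrightarrow> J (y, t) = 1 - B y"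
    unfolding solves_bvp_def by auto
  show ?thesis
  proof (cases "y \<in> Xs")
    case True then show ?thesis using Jb[of y t] y(3) by (simp add: cylinder_boundary_def)
  next
    case False
    then have yf: "y \<in> frontier Xs" using y(1) interior_subset[of Xs] by (auto simp: frontier_def)
    show ?thesis
    proof (rule continuous_constant_on_closure[where S = "{t0..<T}" and f = "\<lambda>t. J (y, t)"])
      show "continuous_on (closure {t0..<T}) (\<lambda>t. J (y, t))"
        by (rule continuous_on_compose2[OF Jc]) (use assms(1) y(1) in \<open>auto simp: closed_cylinder_def intro!: continuous_intros\<close>)
      show "J (y, s) = 1 - B y" if "s \<in> {t0..<T}" for s
        using Jb[of y s] yf that by (simp add: cylinder_boundary_def)
    qed (use assms(1) y(2) in auto)
  qed
qed

theorem corollary1: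
  fixes M :: "'a measure"
    and w :: "real \<Rightarrow> 'a \<Rightarrow> real ^ 'k"
    and x :: "real \<Rightarrow> 'a \<Rightarrow> real ^ 'n"
    and f :: "real ^ 'n \<Rightarrow> real \<Rightarrow> real ^ 'n"
    and g :: "real ^ 'n \<Rightarrow> real \<Rightarrow> real ^ 'm ^ 'n"
    and u :: "real ^ 'n \<Rightarrow> real \<Rightarrow> real ^ 'm"
    and \<sigma> :: "real ^ 'n \<Rightarrow> real \<Rightarrow> real ^ 'k ^ 'n"
    and Xs :: "(real ^ 'n) set"
    and x0 :: "real ^ 'n"
    and t0 T :: real
  assumes "t0 < T"
    and "prob_space M"
    and "standard_wiener M t0 T w"
    and "open Xs" and "bounded Xs"
    and "(x0, t0) \<in> closed_cylinder Xs t0 T"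
    and "unique_strong_solution M w t0 T (closed_loop_drift f g u) \<sigma> x0 x"
    and "admissible M t0 T x u"
  shows "failure_probability M Xs t0 T x
           = prob_space.expectation M (\<lambda>\<omega>. indicator (frontier Xs) (x (exit_time Xs t0 T x \<omega>) \<omega>))
       \<and> (\<forall>J. solves_bvp f g u \<sigma> Xs t0 T (boundary_data Xs) J
             \<longrightarrow> failure_probability M Xs t0 T x = J (x0, t0))
       \<and> (\<forall>B J. bump_approximation Xs B
             \<and> (\<forall>j. solves_bvp f g u \<sigma> Xs t0 T (\<lambda>y. 1 - B j y) (J j))
             \<longrightarrow> (\<lambda>j. J j (x0, t0)) \<longlonglongrightarrow> failure_probability M Xs t0 T x)"
proof -
  define \<tau> where "\<tau> = exit_time Xs t0 T x"
  define fail where "fail = {\<omega> \<in> space M. \<exists>t\<in>{t0..T}. x t \<omega> \<notin> Xs}"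
  note t0T = assms(1) and pM = assms(2) and W = assms(3) and Xs = assms(4,5)
  interpret prob_space M by (rule pM)
  have x0: "x0 \<in> closure Xs" using assms(6) by (simp add: closed_cylinder_def)
  have sol: "strong_solution M w t0 T (closed_loop_drift f g u) \<sigma> x0 x"
    using assms(7) by (simp add: unique_strong_solution_def)
  from sol have x_c: "\<And>\<omega>. \<omega> \<in> space M \<Longrightarrow> continuous_on {t0..T} (\<lambda>t. x t \<omega>)"
    and x_0: "AE \<omega> in M. x t0 \<omega> = x0"
    unfolding strong_solution_def Let_def by auto
  note meas = strong_solution_exit_measurable[OF t0T pM W sol less_imp_le[OF t0T] order_refl Xs(1)]
  have m\<tau>: "(\<lambda>\<omega>. x (\<tau> \<omega>) \<omega>) \<in> borel_measurable M" unfolding \<tau>_def by (rule meas(2))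
  have \<tau>: "\<tau> \<omega> \<in> {t0..T}" for \<omega> using exit_time_bounds[of t0 T Xs x \<omega>] t0T by (auto simp: \<tau>_def)
  have "fail = space M - {\<omega> \<in> space M. \<forall>t\<in>{t0..T}. x t \<omega> \<in> Xs}" by (auto simp: fail_def)
  then have failM: "fail \<in> sets M" using meas(3) by auto
  have P: "failure_probability M Xs t0 T x = expectation (indicator fail)"
    using failM by (simp add: failure_probability_def fail_def)
  have x_cl: "x (\<tau> \<omega>) \<omega> \<in> closure Xs" if "\<omega> \<in> space M" "x t0 \<omega> = x0" for \<omega>
    unfolding \<tau>_def by (rule exit_value_closed) (use t0T x_c that x0 closure_subset[of Xs] in auto)
  \<comment> \<open>Failure can be read off at the exit time, because for an open set the first time
    outside is attained.\<close>
  have out: "x (\<tau> \<omega>) \<omega> \<notin> Xs \<longleftrightarrow> \<omega> \<in> fail" if "\<omega> \<in> space M" for \<omega>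
  proof
    show "x (\<tau> \<omega>) \<omega> \<notin> Xs \<Longrightarrow> \<omega> \<in> fail" using \<tau>[of \<omega>] that by (auto simp: fail_def)
    show "\<omega> \<in> fail \<Longrightarrow> x (\<tau> \<omega>) \<omega> \<notin> Xs"
      unfolding \<tau>_def by (rule exit_time_attained[where x = x and \<omega> = \<omega>, OF Xs(1) x_c[OF that]]) (auto simp: fail_def)
  qed
  have stay: "\<tau> \<omega> = T" if "\<omega> \<in> space M" "\<omega> \<notin> fail" for \<omega>
    using that by (auto simp: fail_def \<tau>_def exit_time_def)
  have part1: "failure_probability M Xs t0 T x = expectation (\<lambda>\<omega>. indicator (frontier Xs) (x (\<tau> \<omega>) \<omega>))"
    unfolding P
  proof (rule integral_cong_AE)
    have "(\<lambda>y. indicator (frontier Xs) y :: real) \<in> borel_measurable borel"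
      using frontier_closed[of Xs] by (intro borel_measurable_indicator borel_closed)
    from measurable_compose[OF m\<tau> this]
    show "(\<lambda>\<omega>. indicator (frontier Xs) (x (\<tau> \<omega>) \<omega>) :: real) \<in> borel_measurable M" .
    show "AE \<omega> in M. indicator fail \<omega> = (indicator (frontier Xs) (x (\<tau> \<omega>) \<omega>) :: real)"
      using x_0 AE_space
    proof eventually_elim
      fix \<omega> assume w: "x t0 \<omega> = x0" "\<omega> \<in> space M"
      then show "indicator fail \<omega> = (indicator (frontier Xs) (x (\<tau> \<omega>) \<omega>) :: real)"
        using out[OF w(2)] x_cl[OF w(2,1)] Xs(1) by (auto simp: frontier_def interior_open indicator_def)
    qed
  qed (use failM in simp)
  have part3: "(\<lambda>j. J j (x0, t0)) \<longlonglongrightarrow> failure_probability M Xs t0 T x"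
    if B: "bump_approximation Xs B" and J: "\<And>j. solves_bvp f g u \<sigma> Xs t0 T (\<lambda>y. 1 - B j y) (J j)" for B J
  proof -
    have bump: "bump_function Xs (B j)" for j using B by (simp add: bump_approximation_def)
    have B0: "B j y = 0" if "y \<notin> Xs" for j y
      using bump[of j] that closure_subset[of "{y. B j y \<noteq> 0}"] unfolding bump_function_def by blast
    have B01: "0 \<le> B j y" "B j y \<le> 1" for j y using bump[of j] by (auto simp: bump_function_def)
    have Bm: "B j \<in> borel_measurable borel" for j
    proof -
      have "C_times 0 (B j)" using bump[of j] unfolding bump_function_def by blast
      then show ?thesis by (intro borel_measurable_continuous_onI) simp
    qed
    have m: "(\<lambda>\<omega>. 1 - B j (x (\<tau> \<omega>) \<omega>)) \<in> borel_measurable M" for j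
      using measurable_compose[OF m\<tau> Bm] by measurable
    \<comment> \<open>On failure every bump function vanishes at the exit point; otherwise the exit
      point lies in \<open>Xs\<close>, where they tend to 1.\<close>
    have lim: "(\<lambda>j. expectation (\<lambda>\<omega>. 1 - B j (x (\<tau> \<omega>) \<omega>))) \<longlonglongrightarrow> expectation (indicator fail)"
    proof (rule integral_dominated_convergence[where w = "\<lambda>_. 1"])
      show "AE \<omega> in M. (\<lambda>j. 1 - B j (x (\<tau> \<omega>) \<omega>)) \<longlonglongrightarrow> indicator fail \<omega>"
      proof (rule AE_I2)
        fix \<omega> assume w: "\<omega> \<in> space M"
        show "(\<lambda>j. 1 - B j (x (\<tau> \<omega>) \<omega>)) \<longlonglongrightarrow> indicator fail \<omega>"
        proof (cases "\<omega> \<in> fail")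
          case True then show ?thesis using out[OF w] B0 by simp
        next
          case False
          then have "(\<lambda>j. B j (x (\<tau> \<omega>) \<omega>)) \<longlonglongrightarrow> 1" using out[OF w] B by (simp add: bump_approximation_def)
          from tendsto_diff[OF tendsto_const[of 1] this] show ?thesis using False by simp
        qed
      qed
      show "AE \<omega> in M. norm (1 - B j (x (\<tau> \<omega>) \<omega>)) \<le> 1" for j
        using B01 by (intro AE_I2) (simp add: abs_le_iff add_increasing)
    qed (use m failM in auto)
    have "J j (x0, t0) = expectation (\<lambda>\<omega>. 1 - B j (x (\<tau> \<omega>) \<omega>))" for j
    proof (cases "x0 \<in> Xs")
      case True
      have "AE \<omega> in M. 1 - B j (x (\<tau> \<omega>) \<omega>) = J j (x (\<tau> \<omega>) \<omega>, \<tau> \<omega>)"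
        using x_0 AE_space
      proof eventually_elim
        fix \<omega> assume w: "x t0 \<omega> = x0" "\<omega> \<in> space M"
        show "1 - B j (x (\<tau> \<omega>) \<omega>) = J j (x (\<tau> \<omega>) \<omega>, \<tau> \<omega>)"
          \<comment> \<open>An exit point inside \<open>Xs\<close> means no failure, and then the
            exit time is \<open>T\<close>.\<close>
          by (rule bump_boundary_value[OF t0T bump J x_cl[OF w(2,1)] \<tau>, symmetric]) (use out[OF w(2)] stay[OF w(2)] in blast)
      qed
      from bvp_representation[OF t0T pM W sol Xs True B J[of j] m[of j, unfolded \<tau>_def] this[unfolded \<tau>_def]] show ?thesis by (simp add: \<tau>_def)
    next
      \<comment> \<open>The initial point lies on the frontier: failure is immediate almost surely,
        and the initial point already carries the boundary value 1.\<close>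
      case False
      have "AE \<omega> in M. 1 - B j (x (\<tau> \<omega>) \<omega>) = 1"
        using x_0 AE_space
      proof eventually_elim
        fix \<omega> assume w: "x t0 \<omega> = x0" "\<omega> \<in> space M"
        then have "\<omega> \<in> fail" using False t0T by (auto simp: fail_def intro!: bexI[of _ t0])
        then show "1 - B j (x (\<tau> \<omega>) \<omega>) = 1" using out[OF w(2)] B0 by simp
      qed
      then have "expectation (\<lambda>\<omega>. 1 - B j (x (\<tau> \<omega>) \<omega>)) = expectation (\<lambda>_. 1)"
        by (intro integral_cong_AE m) auto
      moreover have "J j (x0, t0) = 1 - B j x0"
        by (rule bump_boundary_value[OF t0T bump J x0]) (use False t0T in auto)
      ultimately show ?thesis using B0[OF False] by (simp add: prob_space)
    qed
    then show ?thesis using lim by (simp add: P)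
  qed
  have "Xs \<noteq> {}" using x0 by auto
  then have part2: "\<not> solves_bvp f g u \<sigma> Xs t0 T (boundary_data Xs) J" for J
    by (rule no_exact_boundary_solution[OF t0T Xs])
  show ?thesis using part1 part2 part3 unfolding \<tau>_def by blast
qed

end
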